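(* Let $E$ be a complex Banach space, let $I,J\subseteq\{1,\dots,d\}$ be non-empty sets, $n=\#J$, $m=\#I$, and consider $\boldsymbol{\alpha}_J\in(\mathbb{N}^+)^n$, $\boldsymbol{\alpha}'_I\in(\mathbb{N}^+)^m$, and $k,k'>0$. Then (with $R>0$) $$\mathcal{O}_b(D_R^{d-n},E)\{\boldsymbol{x}_J\}^{\boldsymbol{\alpha}_J}_{1/k}\cap\mathcal{O}_b(D_R^{d-m},E)\{\boldsymbol{x}_I\}^{\boldsymbol{\alpha}'_I}_{1/k'}=E\{\boldsymbol{x}\},$$ except in the case $J=I$ and $k\boldsymbol{\alpha}_J=k'\boldsymbol{\alpha}'_I$, where the two spaces being intersected coincide.
   Context: Notation: $\mathbb{N}=\{0,1,2,\dots\}$, $\mathbb{N}^+=\mathbb{N}\setminus\{0\}$, $d\in\mathbb{N}^+$, $D_r\subset\mathbb{C}$ is the disc of radius $r$ at $0$; $\boldsymbol{x}=(x_1,\dots,x_d)$; for $J\subseteq\{1,\dots,d\}$, $J^c$ is its complement, $\boldsymbol{x}_J=(x_j)_{j\in J}$, and tuples $\boldsymbol{\beta}_J=(\beta_j)_{j\in J}$ are indexed by $J$, with $\boldsymbol{x}_J^{\boldsymbol{\beta}_J}=\prod_{j\in J}x_j^{\beta_j}$. $\mathcal{O}_b(U,E)$ is the Banach space (sup norm) of bounded holomorphic $E$-valued maps on $U$; in $\mathcal{O}_b(D_R^{d-n},E)\{\boldsymbol{x}_J\}^{\boldsymbol{\alpha}_J}_{1/k}$, $D_R^{d-n}$ is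 the polydisc in the variables $\boldsymbol{x}_{J^c}$ (the coefficient space is $E$ if $n=d$), and similarly for $I$. $E\{\boldsymbol{x}\}$ is the space of convergent power series in $\boldsymbol{x}$ with coefficients in $E$. A series in $\boldsymbol{x}_J$ with coefficients in $\mathcal{O}_b(D_R^{d-n},E)$ is regarded as an element of $E[[\boldsymbol{x}]]$ by Taylor expanding its coefficients. For a complex Banach space $F$, variables $\boldsymbol{z}=(z_1,\dots,z_p)$, $\boldsymbol{\gamma}\in(\mathbb{N}^+)^p$ and $k>0$, the space $F\{\boldsymbol{z}\}^{\boldsymbol{\gamma}}_{1/k}$ is defined as follows (it is used with $F=\mathcal{O}_b(D_R^{d-n},E)$, $\boldsymbol{z}=\boldsymbol{x}_J$, $\boldsymbol{\gamma}=\boldsymbol{\alpha}_J$, and similarly for $I$). $\boldsymbol{\gamma}\le\boldsymbol{\beta}$ is componentwise and $\not\le$ is its negation. $\hat{\mathcal{O}}'_p(F)=\bigcup_{r>0}\bigcap_{j=1}^p\mathcal{O}_b(D_r^{p-1},F)[[z_j]]\subset F[[\boldsymbol{z}]]$. Every $\hat f=\sum a_{\boldsymbol{\beta}}\boldsymbol{z}^{\boldsymbol{\beta}}$ is written uniquely as $\hat f=\sum_{l\ge0}\hat f_{\boldsymbol{\gamma},l}(\boldsymbol{z})\boldsymbol{z}^{l\boldsymbol{\gamma}}$, $\hat f_{\boldsymbol{\gamma},l}=\sum_{\boldsymbol{\gamma}\not\le\boldsymbol{\beta}}a_{l\boldsymbol{\gamma}+\boldsymbol{\beta}}\boldsymbol{z}^{\boldsymbol{\beta}}$;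 for $\hat f\in\hat{\mathcal{O}}'_p(F)$ all $\hat f_{\boldsymbol{\gamma},l}=f_{\boldsymbol{\gamma},l}$ are holomorphic on a common polydisc at the origin. Monomial sectors: $S_{\boldsymbol{\gamma}}(\theta,b-a,r)=\Pi_{\boldsymbol{\gamma}}(a,b,r)=\{\boldsymbol{z}\in\mathbb{C}^p: a<\arg(\boldsymbol{z}^{\boldsymbol{\gamma}})<b,\ 0<|z_j|^{\gamma_j}<r,\ j=1,\dots,p\}$, $\theta=(a+b)/2$, with any convenient branch of $\arg$. For $f$ holomorphic ($F$-valued) on $\Pi_{\boldsymbol{\gamma}}(a,b,r)$ and $\hat f\in\hat{\mathcal{O}}'_p(F)$, $f\sim^{\boldsymbol{\gamma}}_s\hat f$ on $\Pi_{\boldsymbol{\gamma}}(a,b,r)$ means: there is $0<r'\le r$ such that all $f_{\boldsymbol{\gamma},l}$ are bounded holomorphic on $\{|z_j|^{\gamma_j}<r',\ j=1,\dots,p\}$ and for every $\Pi'=\Pi_{\boldsymbol{\gamma}}(a',b',\rho)$ with $a<a'<b'<b$, $0<\rho<r'$, there are $C,A>0$ with $\|f(\boldsymbol{z})-\sum_{l=0}^{N-1}f_{\boldsymbol{\gamma},l}(\boldsymbol{z})\boldsymbol{z}^{l\boldsymbol{\gamma}}\|_F\le CA^NN!^s|\boldsymbol{z}^{N\boldsymbol{\gamma}}|$ on $\Pi'$ for all $N\in\mathbb{N}$. A series $\hat f\in\hat{\mathcal{O}}'_p(F)$ is $\boldsymbol{z}^{\boldsymbol{\gamma}}$-$k$-summable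 in the direction $\theta$ if there is a holomorphic $f$ with $f\sim^{\boldsymbol{\gamma}}_{1/k}\hat f$ on some $S_{\boldsymbol{\gamma}}(\theta,b-a,r)$ with $b-a>\pi/k$; $F\{\boldsymbol{z}\}^{\boldsymbol{\gamma}}_{1/k}$ is the space of series that are $\boldsymbol{z}^{\boldsymbol{\gamma}}$-$k$-summable in all directions, up to a finite number of them mod. $2\pi$.
   Formalization: For fixed R the displayed equality fails if J or I is a proper subset (1/(1-2x_2/R) converges but has a coefficient unbounded on D_R); proved instead: the union over all R>0 of the intersections equals E{x}. The exceptional case is proved for each R>0. *)

theory Defs
  imports "HOL-Analysis.Analysis" "HOL-Library.Function_Algebras"
begin

section \<open>Complex Banach spaces\<close>

class scaleC =
  fixes scaleC :: "complex \<Rightarrow> 'a \<Rightarrow> 'a"  (infixr "*\<^sub>C" 75)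

class complex_vector = scaleC + ab_group_add +
  assumes scaleC_add_right: "c *\<^sub>C (x + y) = c *\<^sub>C x + c *\<^sub>C y"
    and scaleC_add_left: "(b + c) *\<^sub>C x = b *\<^sub>C x + c *\<^sub>C x"
    and scaleC_scaleC: "b *\<^sub>C c *\<^sub>C x = (b * c) *\<^sub>C x"
    and scaleC_one: "1 *\<^sub>C x = x"

class complex_banach = complex_vector + banach +
  assumes scaleR_scaleC: "r *\<^sub>R x = complex_of_real r *\<^sub>C x"
    and norm_scaleC: "norm (c *\<^sub>C x) = cmod c * norm x"

instantiation complex :: complex_banach
begin
definition "c *\<^sub>C (x :: complex) = c * x"
instance
  by standard (simp_all add: scaleC_complex_def algebra_simps norm_mult scaleR_conv_of_real)
end

instantiation "fun" :: (type, complex_vector) complex_vector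
begin
definition "c *\<^sub>C f = (\<lambda>x. c *\<^sub>C f x)"
instance
  by standard (simp_all add: fun_eq_iff scaleC_fun_def scaleC_add_right scaleC_add_left
      scaleC_scaleC scaleC_one)
end

text \<open>The space of bounded holomorphic maps on a polydisc depends on the radius, so it cannot be a
  type. A complex normed space is therefore given by a linear subspace of an ambient complex vector
  space together with a norm, of which only the values on the subspace matter.\<close>

record 'v nspace =
  vecs :: "'v set"
  nrm :: "'v \<Rightarrow> real"

definition whole_space :: "'e::complex_banach nspace" where
  "whole_space = \<lparr>vecs = UNIV, nrm = norm\<rparr>"


section \<open>Tuples indexed by a finite set, monomials, formal series\<close>

text \<open>A tuple indexed by \<open>J\<close> is a function that vanishes outside \<open>J\<close>. With the product topology on
  functions, \<open>tuples J\<close> over the complex numbers is the usual finite-dimensional space.\<close>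

definition tuples :: "'i set \<Rightarrow> ('i \<Rightarrow> 'b::zero) set" where
  "tuples J = {x. \<forall>i. i \<notin> J \<longrightarrow> x i = 0}"

definition mono_val :: "'i set \<Rightarrow> ('i \<Rightarrow> complex) \<Rightarrow> ('i \<Rightarrow> nat) \<Rightarrow> complex" where
  "mono_val J z \<beta> = (\<Prod>j\<in>J. z j ^ \<beta> j)"

definition polydisc :: "'i set \<Rightarrow> real \<Rightarrow> ('i \<Rightarrow> complex) set" where
  "polydisc J r = {z \<in> tuples J. \<forall>j\<in>J. cmod (z j) < r}"

definition weighted_polydisc :: "'i set \<Rightarrow> ('i \<Rightarrow> nat) \<Rightarrow> real \<Rightarrow> ('i \<Rightarrow> complex) set" where
  "weighted_polydisc J \<gamma> r = {z \<in> tuples J. \<forall>j\<in>J. cmod (z j) ^ \<gamma> j < r}"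

text \<open>\<open>F[[z\<^sub>J]]\<close>, each series being its family of coefficients.\<close>

definition formal_series ::
  "'i set \<Rightarrow> 'v::complex_vector nspace \<Rightarrow> (('i \<Rightarrow> nat) \<Rightarrow> 'v) set" where
  "formal_series J F =
     {a. (\<forall>\<beta>\<in>tuples J. a \<beta> \<in> vecs F) \<and> (\<forall>\<beta>. \<beta> \<notin> tuples J \<longrightarrow> a \<beta> = 0)}"

text \<open>\<open>E{x\<^sub>J}\<close>\<close>

definition convergent_series :: "'i set \<Rightarrow> (('i \<Rightarrow> nat) \<Rightarrow> 'e::complex_banach) set" where
  "convergent_series J =
     {a \<in> formal_series J whole_space.
        \<exists>r>0. \<forall>z\<in>polydisc J r. (\<lambda>\<beta>. mono_val J z \<beta> *\<^sub>C a \<beta>) summable_on tuples J}"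


section \<open>Holomorphic maps with values in a normed space\<close>

text \<open>Complex Frechet differentiability at every point of \<open>S\<close>. The map \<open>\<pi>\<close> gives the coordinates of
  the points of \<open>S\<close> in the variables indexed by \<open>J\<close>: the identity if \<open>S\<close> is an open set of
  \<open>tuples J\<close>, and the projection if \<open>S\<close> is spread over such an open set (see \<open>sector\<close>).\<close>

definition holomorphic_map ::
  "'i set \<Rightarrow> 'v::complex_vector nspace \<Rightarrow> ('x::topological_space \<Rightarrow> 'i \<Rightarrow> complex) \<Rightarrow> 'x set
     \<Rightarrow> ('x \<Rightarrow> 'v) \<Rightarrow> bool" where
  "holomorphic_map J F \<pi> S f \<longleftrightarrow>
     (\<forall>x\<in>S. f x \<in> vecs F) \<and>
     (\<forall>x\<in>S. \<exists>v. (\<forall>j\<in>J. v j \<in> vecs F) \<and>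
        (\<forall>\<epsilon>>0. \<forall>\<^sub>F y in at x within S.
           nrm F (f y - f x - (\<Sum>j\<in>J. (\<pi> y j - \<pi> x j) *\<^sub>C v j))
             \<le> \<epsilon> * (\<Sum>j\<in>J. cmod (\<pi> y j - \<pi> x j))))"

text \<open>\<open>O\<^sub>b(U, F)\<close> with the sup norm. Maps are extended by zero outside \<open>U\<close>, so that equality of
  functions is equality on \<open>U\<close>. For \<open>J = {}\<close> and \<open>U = polydisc {} r\<close>, a single point, this is a
  copy of \<open>F\<close>.\<close>

definition bdd_holomorphic ::
  "'i set \<Rightarrow> ('i \<Rightarrow> complex) set \<Rightarrow> 'v::complex_vector nspace \<Rightarrow> (('i \<Rightarrow> complex) \<Rightarrow> 'v) nspace" where
  "bdd_holomorphic J U F =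
     \<lparr>vecs = {f. holomorphic_map J F (\<lambda>z. z) U f \<and> (\<exists>M. \<forall>z\<in>U. nrm F (f z) \<le> M) \<and>
                 (\<forall>z. z \<notin> U \<longrightarrow> f z = 0)},
      nrm = (\<lambda>f. SUP z\<in>U. nrm F (f z))\<rparr>"

text \<open>\<open>c\<close> is the family of Taylor coefficients at the origin of \<open>g\<close>, whose domain \<open>U\<close> is a polydisc
  centred at the origin (the series then converges unconditionally to \<open>g\<close> on all of \<open>U\<close>).\<close>

definition has_taylor ::
  "'i set \<Rightarrow> 'v::complex_vector nspace \<Rightarrow> ('i \<Rightarrow> complex) set \<Rightarrow> (('i \<Rightarrow> complex) \<Rightarrow> 'v)
     \<Rightarrow> (('i \<Rightarrow> nat) \<Rightarrow> 'v) \<Rightarrow> bool" where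
  "has_taylor J F U g c \<longleftrightarrow>
     (\<forall>z\<in>U. ((\<lambda>B. nrm F (g z - (\<Sum>\<beta>\<in>B. mono_val J z \<beta> *\<^sub>C c \<beta>))) \<longlongrightarrow> 0)
               (finite_subsets_at_top (tuples J)))"

text \<open>The series \<open>a\<close> in the variables \<open>L\<close> arises from the series \<open>b\<close> in the variables \<open>K \<subseteq> L\<close> with
  coefficients in \<open>O\<^sub>b\<close> of the polydisc of radius \<open>r\<close> in the remaining variables, by Taylor expanding
  these coefficients.\<close>

definition taylor_expansion ::
  "'i set \<Rightarrow> 'i set \<Rightarrow> real \<Rightarrow> 'v::complex_vector nspace
     \<Rightarrow> (('i \<Rightarrow> nat) \<Rightarrow> ('i \<Rightarrow> complex) \<Rightarrow> 'v) \<Rightarrow> (('i \<Rightarrow> nat) \<Rightarrow> 'v) \<Rightarrow> bool" where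
  "taylor_expansion L K r F b a \<longleftrightarrow>
     (\<forall>\<kappa>\<in>tuples K. has_taylor (L - K) F (polydisc (L - K) r) (b \<kappa>) (\<lambda>\<beta>. a (\<lambda>i. \<kappa> i + \<beta> i)))"

text \<open>\<open>O\<^sub>b(D\<^sub>r\<^sup>p\<^sup>-\<^sup>1, F)[[z\<^sub>j]]\<close> as a subset of \<open>F[[z\<^sub>J]]\<close>, and the union over \<open>r\<close> of the intersection
  over \<open>j\<close> of these spaces.\<close>

definition one_var_series ::
  "'i set \<Rightarrow> 'v::complex_vector nspace \<Rightarrow> real \<Rightarrow> 'i \<Rightarrow> (('i \<Rightarrow> nat) \<Rightarrow> 'v) set" where
  "one_var_series J F r j =
     {a \<in> formal_series J F.
        \<exists>b\<in>formal_series {j} (bdd_holomorphic (J - {j}) (polydisc (J - {j}) r) F).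
          taylor_expansion J {j} r F b a}"

definition Ohat :: "'i set \<Rightarrow> 'v::complex_vector nspace \<Rightarrow> (('i \<Rightarrow> nat) \<Rightarrow> 'v) set" where
  "Ohat J F = (\<Union>r\<in>{0<..}. \<Inter>j\<in>J. one_var_series J F r j)"


section \<open>Monomial asymptotics and monomial summability\<close>

text \<open>The coefficients of \<open>f\<^bsub>\<gamma>,l\<^esub>\<close>. Exponents \<open>\<gamma>\<close> are always elements of \<open>tuples J\<close>.\<close>

definition mono_component ::
  "'i set \<Rightarrow> ('i \<Rightarrow> nat) \<Rightarrow> nat \<Rightarrow> (('i \<Rightarrow> nat) \<Rightarrow> 'v::zero) \<Rightarrow> ('i \<Rightarrow> nat) \<Rightarrow> 'v" where
  "mono_component J \<gamma> l a =
     (\<lambda>\<beta>. if \<beta> \<in> tuples J \<and> \<not> (\<forall>j\<in>J. \<gamma> j \<le> \<beta> j) then a (\<lambda>i. l * \<gamma> i + \<beta> i) else 0)"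

text \<open>Monomial sectors. A point carries, besides \<open>z\<close>, the value \<open>t\<close> of the argument of the monomial
  that lies in the interval from \<open>a\<close> to \<open>b\<close>. If \<open>b - a \<le> 2\<pi>\<close>, then \<open>t\<close> is determined by \<open>z\<close> and
  this is the subset of the complex space cut out by the inequalities. For larger openings, which
  are needed as soon as \<open>k \<le> 1/2\<close> and \<open>b - a > \<pi>/k\<close>, points with the same \<open>z\<close> and different \<open>t\<close> lie on
  different sheets: the monomial takes its values in the Riemann surface of the logarithm, as it
  does for ordinary \<open>k\<close>-summability.\<close>

definition sector ::
  "'i set \<Rightarrow> ('i \<Rightarrow> nat) \<Rightarrow> real \<Rightarrow> real \<Rightarrow> real \<Rightarrow> (('i \<Rightarrow> complex) \<times> real) set" where
  "sector J \<gamma> a b r =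
     {(z, t). z \<in> tuples J \<and> is_Arg (mono_val J z \<gamma>) t \<and> a < t \<and> t < b \<and>
              (\<forall>j\<in>J. 0 < cmod (z j) ^ \<gamma> j \<and> cmod (z j) ^ \<gamma> j < r)}"

text \<open>The asymptotic relation of Gevrey order \<open>s\<close> between \<open>f\<close> and the formal series \<open>fh\<close>. The function
  \<open>g l\<close> is the sum of the component with index \<open>l\<close> of \<open>fh\<close>.\<close>

definition gevrey_asymp ::
  "'i set \<Rightarrow> 'v::complex_vector nspace \<Rightarrow> ('i \<Rightarrow> nat) \<Rightarrow> real \<Rightarrow> real \<Rightarrow> real \<Rightarrow> real
     \<Rightarrow> (('i \<Rightarrow> complex) \<times> real \<Rightarrow> 'v) \<Rightarrow> (('i \<Rightarrow> nat) \<Rightarrow> 'v) \<Rightarrow> bool" where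
  "gevrey_asymp J F \<gamma> s a b r f fh \<longleftrightarrow>
     (\<exists>r' g. 0 < r' \<and> r' \<le> r \<and>
        (\<forall>l. g l \<in> vecs (bdd_holomorphic J (weighted_polydisc J \<gamma> r') F) \<and>
             has_taylor J F (weighted_polydisc J \<gamma> r') (g l) (mono_component J \<gamma> l fh)) \<and>
        (\<forall>a' b' \<rho>. a < a' \<and> a' < b' \<and> b' < b \<and> 0 < \<rho> \<and> \<rho> < r' \<longrightarrow>
           (\<exists>C>0. \<exists>A>0. \<forall>N. \<forall>(z, t)\<in>sector J \<gamma> a' b' \<rho>.
              nrm F (f (z, t) - (\<Sum>l<N. mono_val J z (\<lambda>i. l * \<gamma> i) *\<^sub>C g l z))
                \<le> C * A ^ N * fact N powr s * cmod (mono_val J z (\<lambda>i. N * \<gamma> i)))))"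

definition mono_summable_in_dir ::
  "'i set \<Rightarrow> 'v::complex_vector nspace \<Rightarrow> ('i \<Rightarrow> nat) \<Rightarrow> real \<Rightarrow> (('i \<Rightarrow> nat) \<Rightarrow> 'v) \<Rightarrow> real \<Rightarrow> bool" where
  "mono_summable_in_dir J F \<gamma> k fh \<theta> \<longleftrightarrow>
     (\<exists>a b r f. 0 < r \<and> \<theta> = (a + b) / 2 \<and> b - a > pi / k \<and>
        holomorphic_map J F fst (sector J \<gamma> a b r) f \<and>
        gevrey_asymp J F \<gamma> (1 / k) a b r f fh)"

text \<open>The space of monomially \<open>k\<close>-summable series: directions modulo \<open>2\<pi>\<close> are points of the unit circle.\<close>

definition mono_summable ::
  "'i set \<Rightarrow> 'v::complex_vector nspace \<Rightarrow> ('i \<Rightarrow> nat) \<Rightarrow> real \<Rightarrow> (('i \<Rightarrow> nat) \<Rightarrow> 'v) set" where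
  "mono_summable J F \<gamma> k =
     {fh \<in> Ohat J F. finite (cis ` {\<theta>. \<not> mono_summable_in_dir J F \<gamma> k fh \<theta>})}"

text \<open>The series in the variables \<open>K\<close> obtained by Taylor expansion from the monomially \<open>k\<close>-summable
  series in the variables \<open>J \<subseteq> K\<close> with coefficients in \<open>O\<^sub>b\<close> of the polydisc of radius \<open>R\<close> in the
  variables \<open>K - J\<close>. The spaces grow as \<open>R\<close> decreases, and a convergent series in the variables \<open>K\<close> has
  coefficients in \<open>O\<^sub>b\<close> of this polydisc only if \<open>R\<close> is small enough, unless \<open>J = K\<close>.\<close>

definition partial_mono_summable ::
  "'i set \<Rightarrow> 'i set \<Rightarrow> real \<Rightarrow> ('i \<Rightarrow> nat) \<Rightarrow> real \<Rightarrow> (('i \<Rightarrow> nat) \<Rightarrow> 'e::complex_banach) set" where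
  "partial_mono_summable K J R \<gamma> k =
     {a \<in> formal_series K whole_space.
        \<exists>b\<in>mono_summable J (bdd_holomorphic (K - J) (polydisc (K - J) R) whole_space) \<gamma> k.
          taylor_expansion K J R whole_space b a}"

end

theory Submission
  imports Defs "HOL-Complex_Analysis.Complex_Analysis" "HOL-Real_Asymp.Real_Asymp"
begin

text \<open>Give the variable with index \<open>j\<close> a positive weight \<open>w\<^sub>j\<close>. On a curve \<open>v \<mapsto> (y\<^sub>j q(v) ^ w\<^sub>j)\<close> with
  \<open>q(v)\<close> a rotation of \<open>v powr (-1 / K)\<close>, the part \<open>P\<^sub>n(y)\<close> of weighted degree \<open>n\<close> of the series becomes
  the coefficient of \<open>v powr (-n / K)\<close>. For \<open>K = k \<Sum>\<^sub>j w\<^sub>j \<alpha>\<^sub>j\<close> the monomial sums of the series become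
  ordinary sums in all but finitely many directions, while the other space gives
  \<open>P\<^sub>n(y) = O(A ^ n n! ^ (1 / K'))\<close> with \<open>K' = k' \<Sum>\<^sub>i w\<^sub>i \<alpha>'\<^sub>i\<close>. Unless \<open>k \<alpha> = k' \<alpha>'\<close> (both extended by
  zero), some choice of weights yields \<open>K \<noteq> K'\<close>, and by symmetry \<open>K < K'\<close>. As in the one-variable
  theorem that a \<open>K\<close>-summable series of Gevrey order \<open>1 / K'\<close> converges, the Borel transform is then
  entire of order at most \<open>1 / (1 / K - 1 / K')\<close> and bounded by \<open>exp (c |z| ^ K)\<close> in sectors around
  finitely many directions that lie close together, so that the Phragmen-Lindelof principle extends
  this bound to all \<open>z\<close>.
  The Post--Widder formula replaces contour integrals in the inversion of the Laplace transform.
  Norm-one functionals and Cauchy's estimate on the torus turn this into geometric bounds for all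
  coefficients.

  If \<open>k \<alpha> = k' \<alpha>'\<close>, then \<open>\<alpha>\<close> and \<open>\<alpha>'\<close> are multiples of a common tuple \<open>\<delta>\<close>, and it suffices to compare
  \<open>\<delta>\<close> with \<open>N \<delta>\<close>: the argument of the monomial is multiplied by \<open>N\<close>, so a sum in a direction \<open>\<theta>\<close> with
  respect to \<open>N \<delta>\<close> is glued from the \<open>N\<close> sums in the directions \<open>(\<theta> + 2 \<pi> i) / N\<close>.\<close>

section \<open>Post--Widder inversion\<close>

text \<open>The functional that detects the norm of a layer depends on the layer and on the point of
  the torus, and there are infinitely many of both. The Tauberian theorem is therefore uniform: its
  constants are fixed by numerical data alone, before the sequence and its sums are given, and these
  data come from finitely many directions. The obstacle in the inversion of the Laplace transform is
  to keep the approximations locally bounded in a cone. A decay of order -2 at infinity achieves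
  this, which is why finitely many terms are removed from the expansion; Montel's theorem and the
  identity theorem then carry what is known for small \<open>t\<close> to every \<open>t\<close>.
  Holomorphy means complex Frechet differentiability, and Taylor expansions are carried along as
  data: infinite sums of holomorphic maps are recognised as holomorphic by rearranging their Taylor
  series. Arguments of monomials along a curve are continuous real lifts, because the sectors may
  have openings beyond 2 pi.\<close>

lemma has_integral_circle_inverse_square:
  fixes x :: complex
  assumes "0 < r" "r < cmod x"
  shows "((\<lambda>\<theta>. 1 / (cmod (circlepath x r \<theta>))\<^sup>2) has_integral 1 / ((cmod x)\<^sup>2 - r\<^sup>2)) {0..1}"
proof -
  \<comment> \<open>The mirror image of the origin in the circle. On the circle \<open>cnj u\<close>
    is a rational function of \<open>u\<close> with its zero at \<open>w\<close>, so the integrand 1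
    / |u|^2 extends holomorphically apart from a simple pole at \<open>w\<close>, and Cauchy's
    formula evaluates it.\<close>
  define w where "w = x - of_real (r\<^sup>2) / cnj x"
  have x0: "x \<noteq> 0" and cx0: "cnj x \<noteq> 0" using assms by auto
  have cw: "cnj x * w = of_real ((cmod x)\<^sup>2 - r\<^sup>2)"
    using cx0 by (simp add: w_def field_simps complex_norm_square[symmetric] del: complex_cnj_zero_iff)
  have "cmod (x - w) = r\<^sup>2 / cmod x"
    by (simp add: w_def norm_divide norm_power)
  also have "\<dots> < r" using assms by (simp add: power2_eq_square divide_simps)
  finally have w_in: "w \<in> ball x r" by (simp add: dist_norm)
  have nz: "u \<noteq> 0" if "u \<in> cball x r" for u using that assms by (auto simp: dist_norm)
  have "((\<lambda>u. (1 / (cnj x * u)) / (u - w)) has_contour_integral (2 * of_real pi * \<i> * (1 / (cnj x * w))))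
      (circlepath x r)"
    by (rule Cauchy_integral_circlepath)
      (use nz w_in cx0 in \<open>auto intro!: continuous_intros holomorphic_intros simp: dist_norm norm_minus_commute\<close>)
  then have I: "((\<lambda>\<theta>. (1 / (cnj x * circlepath x r \<theta>)) / (circlepath x r \<theta> - w)
        * vector_derivative (circlepath x r) (at \<theta> within {0..1})) has_integral
        (2 * of_real pi * \<i> * (1 / (cnj x * w)))) {0..1}"
    by (simp add: has_contour_integral_def)
  have eq: "(1 / (cnj x * circlepath x r \<theta>)) / (circlepath x r \<theta> - w)
        * vector_derivative (circlepath x r) (at \<theta> within {0..1})
       = 2 * of_real pi * \<i> * of_real (1 / (cmod (circlepath x r \<theta>))\<^sup>2)" if "\<theta> \<in> {0..1}" for \<theta>
  proof -
    define e where "e = exp (2 * of_real pi * \<i> * \<theta>)"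
    define u where "u = circlepath x r \<theta>"
    have e: "e * cnj e = 1" "e \<noteq> 0"
      unfolding e_def by (simp_all add: exp_cnj exp_minus[symmetric] flip: exp_add)
    have u: "u = x + r * e" unfolding u_def e_def circlepath by simp
    have vd: "vector_derivative (circlepath x r) (at \<theta> within {0..1}) = 2 * pi * \<i> * r * e"
      using that by (simp add: vector_derivative_circlepath01 e_def)
    have u_nz: "u \<noteq> 0"
      by (rule nz) (use assms e_def in \<open>simp add: u dist_norm norm_mult\<close>)
    \<comment> \<open>On the circle \<open>of_real r * e\<close> is \<open>u - x\<close>, so this
      expresses \<open>cnj u\<close> as \<open>cnj x * (u - w) / (u - x)\<close>.\<close>
    have "cnj x * (u - w) = of_real r * e * (cnj x + r * cnj e)"
      using cx0 e by (simp add: u w_def field_simps power2_eq_square del: complex_cnj_zero_iff)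
    then have "cnj x * (u - w) = of_real r * e * cnj u" by (simp add: u)
    then have "(1 / (cnj x * u)) / (u - w) = 1 / (u * (of_real r * e * cnj u))"
      by (simp add: field_simps)
    moreover have "of_real ((cmod u)\<^sup>2) = u * cnj u" by (rule complex_norm_square)
    ultimately show ?thesis unfolding vd u_def[symmetric]
      using u_nz e assms by (simp add: field_simps power2_eq_square)
  qed
  have "((\<lambda>\<theta>. 2 * of_real pi * \<i> * complex_of_real (1 / (cmod (circlepath x r \<theta>))\<^sup>2)) has_integral
        (2 * of_real pi * \<i> * (1 / (cnj x * w)))) {0..1}"
    using I by (rule has_integral_eq[rotated]) (use eq in auto)
  from has_integral_mult_right[OF this, of "1 / (2 * of_real pi * \<i>)"]
  have "((\<lambda>\<theta>. complex_of_real (1 / (cmod (circlepath x r \<theta>))\<^sup>2)) has_integral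
        (1 / (cnj x * w))) {0..1}" by simp
  from has_integral_linear[OF this bounded_linear_Re]
  have "((\<lambda>\<theta>. 1 / (cmod (circlepath x r \<theta>))\<^sup>2) has_integral Re (1 / (cnj x * w))) {0..1}"
    by (simp only: o_def Re_complex_of_real)
  moreover have "1 / (cnj x * w) = of_real (1 / ((cmod x)\<^sup>2 - r\<^sup>2))"
    by (simp add: cw)
  ultimately show ?thesis by (simp only: Re_complex_of_real)
qed

text \<open>Cauchy's formula with the decay averaged over the circle instead of replaced by its
  maximum. The denominator is then |x|^2 - r^2 and not (|x| - r)^2, which for r close to |x| gains a
  factor of the size of |x|.\<close>

lemma higher_deriv_bound_inverse_square:
  fixes f :: "complex \<Rightarrow> complex"
  assumes S: "open S" "f holomorphic_on S" "cball x r \<subseteq> S" and r: "0 < r" "r < cmod x"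
    and bnd: "\<And>u. u \<in> cball x r \<Longrightarrow> cmod (f u) \<le> C / (cmod u)\<^sup>2"
  shows "cmod ((deriv ^^ N) f x) \<le> fact N * C / (r ^ N * ((cmod x)\<^sup>2 - r\<^sup>2))"
proof -
  have "((\<lambda>u. f u / (u - x) ^ Suc N) has_contour_integral (2 * pi * \<i> / fact N * (deriv ^^ N) f x)) (circlepath x r)"
    by (rule Cauchy_has_contour_integral_higher_derivative_circlepath)
      (use S r ball_subset_cball[of x r] in
        \<open>auto intro!: holomorphic_on_subset[OF S(2)] holomorphic_on_imp_continuous_on\<close>)
  then have I: "((\<lambda>\<theta>. f (circlepath x r \<theta>) / (circlepath x r \<theta> - x) ^ Suc N *
     vector_derivative (circlepath x r) (at \<theta> within {0..1})) has_integral
       (2 * pi * \<i> / fact N * (deriv ^^ N) f x)) {0..1}"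
    by (simp add: has_contour_integral_def)
  have J: "((\<lambda>\<theta>. 2 * pi * C / r ^ N * (1 / (cmod (circlepath x r \<theta>))\<^sup>2)) has_integral 
      (2 * pi * C / r ^ N * (1 / ((cmod x)\<^sup>2 - r\<^sup>2)))) {0..1}"
    by (intro has_integral_mult_right has_integral_circle_inverse_square r)
  have le: "cmod (f (circlepath x r \<theta>) / (circlepath x r \<theta> - x) ^ Suc N *
     vector_derivative (circlepath x r) (at \<theta> within {0..1}))
     \<le> 2 * pi * C / r ^ N * (1 / (cmod (circlepath x r \<theta>))\<^sup>2)" if "\<theta> \<in> {0..1}" for \<theta>
  proof -
    have mem: "circlepath x r \<theta> \<in> cball x r"
      using r by (simp add: circlepath dist_norm norm_mult)
    have "cmod (circlepath x r \<theta> - x) = r" using r by (simp add: circlepath norm_mult)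
    moreover have "cmod (vector_derivative (circlepath x r) (at \<theta> within {0..1})) = 2 * pi * r"
      using that r by (simp add: vector_derivative_circlepath01 norm_mult)
    ultimately have "cmod (f (circlepath x r \<theta>) / (circlepath x r \<theta> - x) ^ Suc N *
     vector_derivative (circlepath x r) (at \<theta> within {0..1})) = 2 * pi / r ^ N * cmod (f (circlepath x r \<theta>))"
      using r by (simp add: norm_mult norm_divide norm_power)
    also have "\<dots> \<le> 2 * pi / r ^ N * (C / (cmod (circlepath x r \<theta>))\<^sup>2)"
      by (intro mult_left_mono bnd mem) (use r in auto)
    finally show ?thesis by simp
  qed
  have "cmod (2 * pi * \<i> / fact N * (deriv ^^ N) f x) \<le> 2 * pi * C / r ^ N * (1 / ((cmod x)\<^sup>2 - r\<^sup>2))"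
    using has_integral_norm_bound_integral_component[OF I J] le I J
    by (metis (no_types, lifting) has_integral_integrable integral_norm_bound_integral has_integral_iff)
  moreover have "cmod (2 * pi * \<i> / fact N * (deriv ^^ N) f x) = 2 * pi * (cmod ((deriv ^^ N) f x) / fact N)"
    by (simp add: norm_mult norm_divide)
  moreover have "2 * pi * C / r ^ N * (1 / ((cmod x)\<^sup>2 - r\<^sup>2)) = 2 * pi * (C / (r ^ N * ((cmod x)\<^sup>2 - r\<^sup>2)))"
    by simp
  ultimately have "cmod ((deriv ^^ N) f x) / fact N \<le> C / (r ^ N * ((cmod x)\<^sup>2 - r\<^sup>2))"
    by (metis mult_le_cancel_left_pos pi_gt_zero zero_less_mult_iff zero_less_numeral)
  then show ?thesis by (simp add: field_simps)
qed

section \<open>Powers of v and their Post-Widder approximations\<close>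

lemma higher_deriv_powr:
  fixes z :: complex
  assumes "x \<notin> \<real>\<^sub>\<le>\<^sub>0"
  shows "(deriv ^^ N) (\<lambda>v. v powr (-z)) x = (-1) ^ N * pochhammer z N * x powr (- z - of_nat N)"
  using assms
proof (induction N arbitrary: x)
  case (Suc N)
  have op: "open (- \<real>\<^sub>\<le>\<^sub>0 :: complex set)" by (simp add: open_Compl)
  have "(deriv ^^ Suc N) (\<lambda>v. v powr (-z)) x = deriv ((deriv ^^ N) (\<lambda>v. v powr (-z))) x" by simp
  also have "\<dots> = deriv (\<lambda>x. (-1) ^ N * pochhammer z N * x powr (- z - of_nat N)) x"
    using Suc.prems eventually_nhds_in_open[OF op, of x]
    by (intro deriv_cong_ev) (auto elim!: eventually_mono simp: Suc.IH)
  also have "\<dots> = (-1) ^ N * pochhammer z N * ((- z - of_nat N) * x powr (- z - of_nat N - 1))"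
    using Suc.prems by (intro DERIV_imp_deriv) (auto intro!: derivative_eq_intros)
  also have "\<dots> = (-1) ^ Suc N * pochhammer z (Suc N) * x powr (- z - of_nat (Suc N))"
    by (simp add: pochhammer_Suc algebra_simps)
  finally show ?case .
qed simp

lemma power_self_le_exp_fact: "real n ^ n \<le> exp (real n) * fact n"
proof -
  have "real n ^ n /\<^sub>R fact n \<le> (\<Sum>k. real n ^ k /\<^sub>R fact k)"
    by (rule sum_le_suminf[of _ "{n}", simplified]) (auto intro: summable_exp_generic[of "real n", simplified])
  then show ?thesis by (simp add: exp_def field_simps)
qed

text \<open>Gamma is bounded on [1, 2] by compactness, and the functional equation carries the bound
  upwards in unit steps; the factor z - 1 of each step is absorbed by z powr z.\<close>

lemma Gamma_upper_bound: "\<exists>C>0. \<forall>z\<ge>1::real. Gamma z \<le> C * z powr z"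
proof -
  have "continuous_on {1..2::real} Gamma"
    by (intro continuous_intros) (auto simp: nonpos_Ints_def)
  then have "bounded (Gamma ` {1..2::real})"
    by (intro compact_imp_bounded compact_continuous_image) auto
  then obtain C where C: "C > 0" "\<And>z. z \<in> {1..2} \<Longrightarrow> norm (Gamma (z::real)) \<le> C"
    unfolding bounded_pos by auto
  have "Gamma z \<le> C * z powr z" if "1 \<le> z" "z \<le> real m + 2" for m and z :: real
    using that
  proof (induction m arbitrary: z)
    case 0
    then have "Gamma z \<le> C * 1" using C(2)[of z] by auto
    also have "\<dots> \<le> C * z powr z" using C(1) 0 by (intro mult_left_mono ge_one_powr_ge_zero) auto
    finally show ?case .
  next
    case (Suc m)
    show ?case
    proof (cases "z \<le> real m + 2")
      case True then show ?thesis using Suc by blast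
    next
      case False
      then have IH: "Gamma (z - 1) \<le> C * (z - 1) powr (z - 1)" and z: "z > 2" using Suc by auto
      have "Gamma z = (z - 1) * Gamma (z - 1)"
        using Gamma_plus1[of "z - 1"] z by (auto simp: nonpos_Ints_def)
      also have "\<dots> \<le> z * (C * z powr (z - 1))"
        using z C(1) by (intro mult_mono order_trans[OF IH] mult_left_mono powr_mono2 Gamma_real_nonneg) auto
      also have "\<dots> = C * z powr z" using z by (simp add: powr_diff)
      finally show ?thesis .
    qed
  qed
  moreover have "\<exists>m. z \<le> real m + 2" for z :: real
    using real_arch_simple[of z] by (metis add_increasing2 zero_le_numeral)
  ultimately show ?thesis using C(1) by blast
qed

text \<open>The value at \<open>t = 1\<close> of the \<open>N\<close>-th Post--Widder approximation of the inverse Laplace transform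
  of \<open>v powr (-z)\<close>.\<close>

definition post_widder :: "nat \<Rightarrow> real \<Rightarrow> real" where
  "post_widder N z = pochhammer z N / (fact N * real N powr (z - 1))"

lemma post_widder_nonneg: "z > 0 \<Longrightarrow> post_widder N z \<ge> 0"
  unfolding post_widder_def by (intro divide_nonneg_nonneg pochhammer_nonneg) auto

text \<open>Up to the factor N / (z + N), which tends to 1, this is Gauss's limit for the reciprocal
  Gamma function.\<close>

lemma post_widder_LIMSEQ:
  assumes "z > 0"
  shows "(\<lambda>N. post_widder N z) \<longlonglongrightarrow> rGamma z"
proof -
  have eq: "rGamma_series z N * (real N / (z + real N)) = post_widder N z" if "N > 0" for N
  proof -
    have "z + real N > 0" using assms by simp
    moreover have "exp (z * ln (real N)) = real N powr (z - 1) * real N"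
      using that by (simp add: powr_def left_diff_distrib exp_diff mult.commute)
    ultimately show ?thesis using that
      by (simp add: rGamma_series_def post_widder_def pochhammer_Suc)
  qed
  have "(\<lambda>N. rGamma_series z N * (real N / (z + real N))) \<longlonglongrightarrow> rGamma z * 1"
  proof (intro tendsto_mult rGamma_series_LIMSEQ)
    show "(\<lambda>N. real N / (z + real N)) \<longlonglongrightarrow> 1" by real_asymp
  qed
  moreover have "\<forall>\<^sub>F N in sequentially. rGamma_series z N * (real N / (z + real N)) = post_widder N z"
    using eventually_gt_at_top[of 0] by eventually_elim (use eq in auto)
  ultimately show ?thesis by (simp add: tendsto_cong)
qed

text \<open>With u = 1 / (N + 1) the quotient of consecutive terms is (1 - u) powr (z - 1) * (1 + (z
  - 1) u). The two factors are at most exp (- (z - 1) u) and exp ((z - 1) u).\<close>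

lemma post_widder_Suc_le:
  assumes "z \<ge> 1" "N > 0"
  shows "post_widder (Suc N) z \<le> post_widder N z"
proof -
  define u where "u = 1 / real (Suc N)"
  have u: "0 < u" "u < 1" using assms by (auto simp: u_def)
  have N: "real N = real (Suc N) * (1 - u)" by (simp add: u_def field_simps)
  have "(1 - u) powr (z - 1) * (1 + (z - 1) * u) \<le> exp (- u * (z - 1)) * exp ((z - 1) * u)"
  proof (intro mult_mono)
    have "ln (1 - u) \<le> - u" using ln_add_one_self_le_self2[of "-u"] u by simp
    then show "(1 - u) powr (z - 1) \<le> exp (- u * (z - 1))"
      using u assms mult_left_mono[of "ln (1 - u)" "- u" "z - 1"] by (simp add: powr_def mult.commute)
  qed (use u assms exp_ge_add_one_self[of "(z-1)*u"] in auto)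
  also have "\<dots> = 1" by (simp flip: exp_add)
  finally have key: "(1 - u) powr (z - 1) * (1 + (z - 1) * u) \<le> 1" .
  have "(z + real N) / real (Suc N) = 1 + (z - 1) * u" by (simp add: u_def field_simps)
  then have "pochhammer z N * ((z + real N) / real (Suc N)) / (fact N * real (Suc N) powr (z - 1))
      = pochhammer z N * (1 + (z - 1) * u) / (fact N * real (Suc N) powr (z - 1))" by simp
  then have "post_widder (Suc N) z = pochhammer z N * (1 + (z - 1) * u) / (fact N * real (Suc N) powr (z - 1))"
    by (simp add: post_widder_def pochhammer_Suc mult.assoc)
  also have "\<dots> = post_widder N z * ((1 - u) powr (z - 1) * (1 + (z - 1) * u))"
  proof -
    have "real N powr (z - 1) = real (Suc N) powr (z - 1) * (1 - u) powr (z - 1)"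
      unfolding N using u by (simp add: powr_mult)
    then show ?thesis using u assms by (simp add: post_widder_def del: of_nat_Suc)
  qed
  also have "\<dots> \<le> post_widder N z * 1"
    by (intro mult_left_mono key post_widder_nonneg) (use assms in auto)
  finally show ?thesis by simp
qed

lemma post_widder_antimono:
  assumes "z \<ge> 1" "0 < M" "M \<le> N"
  shows "post_widder N z \<le> post_widder M z"
  using assms(3)
proof (induction rule: dec_induct)
  case (step n)
  then show ?case using post_widder_Suc_le[of z n] assms by force
qed simp

text \<open>By monotonicity it suffices to estimate at M, the ceiling of z, which
  \<open>z \<le> real N\<close> allows. There the Pochhammer quotient is at most 6 ^ M: each factor
  is at most 2 M, and M ^ M is at most 3 ^ M * fact M.\<close>

lemma post_widder_bound:
  assumes "z \<ge> 1" "z \<le> real N"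
  shows "post_widder N z \<le> 6 powr (z + 1) * z powr (1 - z)"
proof -
  define M where "M = nat \<lceil>z\<rceil>"
  have M: "z \<le> real M" "real M \<le> z + 1" "0 < M" "M \<le> N" using assms unfolding M_def by linarith+
  have "post_widder N z \<le> post_widder M z"
    by (rule post_widder_antimono) (use M assms in auto)
  also have "\<dots> = pochhammer z M / fact M * real M powr (1 - z)"
    using M by (simp add: post_widder_def powr_diff field_simps)
  also have "\<dots> \<le> 6 ^ M * z powr (1 - z)"
  proof (intro mult_mono)
    have "pochhammer z M = (\<Prod>i<M. z + real i)" by (simp add: pochhammer_prod atLeast0LessThan)
    also have "\<dots> \<le> (\<Prod>i<M. 2 * real M)" by (intro prod_mono) (use M assms in auto)
    also have "\<dots> = 2 ^ M * real M ^ M" by (simp add: power_mult_distrib)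
    also have "\<dots> \<le> 2 ^ M * (exp (real M) * fact M)" by (intro mult_left_mono power_self_le_exp_fact) auto
    also have "\<dots> \<le> 2 ^ M * (3 ^ M * fact M)"
      using power_mono[OF exp_le, of M] by (intro mult_left_mono mult_right_mono) (auto simp flip: exp_of_nat_mult)
    finally show "pochhammer z M / fact M \<le> 6 ^ M" by (simp add: field_simps flip: power_mult_distrib)
    show "real M powr (1 - z) \<le> z powr (1 - z)" using M assms by (intro powr_mono2') auto
  qed auto
  also have "6 ^ M \<le> 6 powr (z + 1)" using M by (simp add: powr_mono flip: powr_realpow)
  finally show ?thesis by (simp add: mult_right_mono)
qed

text \<open>The preceding bound holds as soon as N \<ge> z, so it passes to the limit of the
  approximations.\<close>

lemma rGamma_bound:
  assumes "z \<ge> (1::real)"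
  shows "rGamma z \<le> 6 powr (z + 1) * z powr (1 - z)"
proof (rule LIMSEQ_le_const2[OF post_widder_LIMSEQ])
  show "\<exists>N0. \<forall>N\<ge>N0. post_widder N z \<le> 6 powr (z + 1) * z powr (1 - z)"
    using post_widder_bound[OF assms] real_arch_simple[of z] by (meson of_nat_mono order_trans)
qed (use assms in auto)

section \<open>Cones, wide sectors and local boundedness of the approximations\<close>

definition acone :: "real \<Rightarrow> complex set" where
  "acone c = {t. \<bar>Im t\<bar> < c * Re t}"

text \<open>A union of half-planes, cut off at the unit circle: for positive \<open>c\<close> a
  sector around the positive axis whose opening exceeds pi. In this form a disc around a point x of
  the cone with radius below |x| stays inside as long as it avoids the unit disc.\<close>

definition wide_sector :: "real \<Rightarrow> complex set" where
  "wide_sector c = {v. 1 < cmod v \<and> (\<exists>x\<in>acone c. 0 < Re (v * cnj x))}"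

lemma open_acone: "open (acone c)"
  unfolding acone_def by (intro open_Collect_less continuous_intros)

text \<open>Convexity provides the connected domain for the identity theorem.\<close>

lemma convex_acone: "convex (acone c)"
proof (rule convexI)
  fix x y :: complex and u v :: real
  assume *: "x \<in> acone c" "y \<in> acone c" "0 \<le> u" "0 \<le> v" "u + v = 1"
  then have "u * \<bar>Im x\<bar> \<le> u * (c * Re x)" "v * \<bar>Im y\<bar> \<le> v * (c * Re y)"
    by (auto simp: acone_def intro!: mult_left_mono)
  moreover have "u * \<bar>Im x\<bar> < u * (c * Re x) \<or> v * \<bar>Im y\<bar> < v * (c * Re y)"
    using * by (cases "u = 0") (auto simp: acone_def)
  moreover have "\<bar>u * Im x + v * Im y\<bar> \<le> u * \<bar>Im x\<bar> + v * \<bar>Im y\<bar>"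
    using * abs_triangle_ineq[of "u * Im x" "v * Im y"] by (simp add: abs_mult)
  ultimately show "u *\<^sub>R x + v *\<^sub>R y \<in> acone c"
    by (auto simp: acone_def algebra_simps)
qed

lemma of_real_in_acone: "c > 0 \<Longrightarrow> t > 0 \<Longrightarrow> of_real t \<in> acone c"
  by (simp add: acone_def)

lemma acone_Re_pos: "c > 0 \<Longrightarrow> t \<in> acone c \<Longrightarrow> Re t > 0"
  using le_less_trans[of 0 "\<bar>Im t\<bar>" "c * Re t"] zero_less_mult_pos[of c "Re t"] by (simp add: acone_def)

text \<open>Since 1 / t is a positive multiple of the conjugate of t, the nodes N / t of the
  Post-Widder formula lie in the same cone as t.\<close>

lemma acone_divide:
  assumes "t \<in> acone c" "r > 0" "c > 0"
  shows "of_real r / t \<in> acone c"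
proof -
  have "t \<noteq> 0" using acone_Re_pos[OF assms(3,1)] by auto
  then have n: "r / (cmod t)\<^sup>2 > 0" using assms by simp
  have "of_real r / t = of_real (r / (cmod t)\<^sup>2) * cnj t"
    using \<open>t \<noteq> 0\<close> by (simp add: complex_norm_square field_simps del: of_real_power)
  then have "Im (of_real r / t) = - (r / (cmod t)\<^sup>2) * Im t" "Re (of_real r / t) = r / (cmod t)\<^sup>2 * Re t"
    by simp_all
  moreover have "r / (cmod t)\<^sup>2 * \<bar>Im t\<bar> < r / (cmod t)\<^sup>2 * (c * Re t)"
    using assms n by (intro mult_strict_left_mono) (auto simp: acone_def)
  ultimately show ?thesis using n assms(2)
    by (simp add: acone_def abs_mult mult.left_commute)
qed

lemma open_wide_sector: "open (wide_sector c)"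
proof -
  have "wide_sector c = {v. 1 < cmod v} \<inter> (\<Union>x\<in>acone c. {v. 0 < Re (v * cnj x)})"
    by (auto simp: wide_sector_def)
  moreover have "open \<dots>"
    by (intro open_Int open_UN ballI open_Collect_less continuous_intros)
  ultimately show ?thesis by simp
qed

text \<open>A disc of radius below |x| around x does not leave the half-plane that faces x.\<close>

lemma wide_sector_cball:
  assumes "x \<in> acone c" "cball x r \<subseteq> {v. 1 < cmod v}" "r < cmod x"
  shows "cball x r \<subseteq> wide_sector c"
proof
  fix v assume v: "v \<in> cball x r"
  have "Re ((x - v) * cnj x) \<le> cmod (x - v) * cmod x"
    using complex_Re_le_cmod[of "(x - v) * cnj x"] by (simp add: norm_mult)
  also have "\<dots> < cmod x * cmod x"
    using v assms by (intro mult_strict_right_mono) (auto simp: dist_norm simp flip: zero_less_norm_iff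
      intro: le_less_trans[of 0 "cmod (x - v)"])
  finally have "0 < cmod x * cmod x - Re ((x - v) * cnj x)" by simp
  also have "cmod x * cmod x = Re (x * cnj x)" by (simp add: complex_norm_square[symmetric] flip: power2_eq_square)
  finally have "0 < Re (v * cnj x)" by (simp add: algebra_simps)
  then show "v \<in> wide_sector c" using assms v by (auto simp: wide_sector_def)
qed

text \<open>The sector avoids the branch cut, so that principal powers are holomorphic on
  it.\<close>

lemma wide_sector_nonpos:
  assumes "v \<in> wide_sector c" "c > 0"
  shows "v \<notin> \<real>\<^sub>\<le>\<^sub>0"
proof
  assume "v \<in> \<real>\<^sub>\<le>\<^sub>0"
  then obtain y where "v = of_real y" "y \<le> 0" by (auto elim: nonpos_Reals_cases)
  moreover obtain x where "x \<in> acone c" "0 < Re (v * cnj x)" using assms by (auto simp: wide_sector_def)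
  ultimately show False using acone_Re_pos[OF assms(2)] by (force simp: zero_less_mult_iff)
qed

text \<open>The estimate that makes the Post--Widder approximations locally bounded uniformly in \<open>N\<close>: the
  decay \<open>C / (cmod v)\<^sup>2\<close> compensates the factor \<open>N\<close> that is lost in Cauchy's inequality.\<close>

lemma post_widder_operator_bound:
  assumes h: "h holomorphic_on wide_sector c" and c: "c > 0"
    and bnd: "\<And>v. v \<in> wide_sector c \<Longrightarrow> cmod (h v) \<le> C / (cmod v)\<^sup>2"
    and t: "t \<in> acone c" "4 * cmod t \<le> real N"
  shows "cmod ((-1) ^ N * (deriv ^^ N) h (of_nat N / t) / fact N * (of_nat N / t) ^ Suc N) \<le> C * exp (4 * cmod t)"
proof -
  have t0: "cmod t > 0" using acone_Re_pos[OF c t(1)] by auto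
  define x where "x = of_nat N / t"
  \<comment> \<open>Radius |x| - 2 keeps the disc beyond |v| = 1 and is yet so large that (|x| / r)
    ^ N stays bounded when |x| = N / |t|.\<close>
  define r where "r = cmod x - 2"
  have N: "real N > 0" using t t0 by linarith
  have nx: "cmod x = real N / cmod t" by (simp add: x_def norm_divide)
  have x4: "cmod x \<ge> 4" using t t0 by (simp add: nx field_simps)
  have xc: "x \<in> acone c" using acone_divide[OF t(1) N c] by (simp add: x_def)
  have sub: "cball x r \<subseteq> wide_sector c"
  proof (rule wide_sector_cball[OF xc])
    show "cball x r \<subseteq> {v. 1 < cmod v}"
    proof
      fix v assume "v \<in> cball x r"
      then have "cmod (x - v) \<le> cmod x - 2" by (simp add: dist_norm r_def)
      then show "v \<in> {v. 1 < cmod v}" using norm_triangle_ineq2[of x v] norm_triangle_sub[of x v] by simp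
    qed
  qed (simp add: r_def)
  have C: "C \<ge> 0"
  proof -
    have "x \<in> wide_sector c" using sub x4 by (auto simp: r_def)
    from bnd[OF this] have "0 \<le> C / (cmod x)\<^sup>2" by (rule order_trans[OF norm_ge_zero])
    then show ?thesis using x4 by (auto simp: zero_le_divide_iff)
  qed
  have D: "cmod ((deriv ^^ N) h x) \<le> fact N * C / (r ^ N * ((cmod x)\<^sup>2 - r\<^sup>2))"
    by (rule higher_deriv_bound_inverse_square[OF open_wide_sector h sub])
      (use x4 sub bnd in \<open>auto simp: r_def\<close>)
  have "(cmod x)\<^sup>2 - r\<^sup>2 = 4 * (cmod x - 1)" by (simp add: r_def power2_eq_square algebra_simps)
  \<comment> \<open>Here the averaging pays: the denominator is at least |x|, which cancels the
    surplus factor |x| in \<open>x ^ Suc N\<close>.\<close>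
  then have sq: "(cmod x)\<^sup>2 - r\<^sup>2 \<ge> cmod x" using x4 by simp
  have r0: "r > 0" using x4 by (simp add: r_def)
  have "cmod ((-1) ^ N * (deriv ^^ N) h x / fact N * x ^ Suc N)
      = cmod ((deriv ^^ N) h x) / fact N * cmod x ^ Suc N"
    by (simp add: norm_mult norm_divide norm_power)
  also have "\<dots> \<le> (fact N * C / (r ^ N * ((cmod x)\<^sup>2 - r\<^sup>2))) / fact N * cmod x ^ Suc N"
    by (intro mult_right_mono divide_right_mono D) auto
  also have "\<dots> = C * (cmod x / r) ^ N * (cmod x / ((cmod x)\<^sup>2 - r\<^sup>2))"
    by (simp add: power_divide)
  also have "\<dots> \<le> C * exp (4 * cmod t) * 1"
  proof (intro mult_mono mult_left_mono)
    \<comment> \<open>The N-th power of the right-hand side is exp (4 |t|), because |x| = N /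
      |t|.\<close>
    have "cmod x / r \<le> exp (4 / cmod x)"
    proof -
      have "cmod x / r \<le> 1 + 4 / cmod x"
        using x4 r0 by (auto simp: r_def divide_simps) (simp add: algebra_simps)
      also have "\<dots> \<le> exp (4 / cmod x)" by (rule exp_ge_add_one_self)
      finally show ?thesis .
    qed
    then have "(cmod x / r) ^ N \<le> exp (4 / cmod x) ^ N" using r0 by (intro power_mono) auto
    also have "\<dots> = exp (4 * cmod t)" using N t0 by (simp add: nx flip: exp_of_nat_mult)
    finally show "(cmod x / r) ^ N \<le> exp (4 * cmod t)" .
    show "cmod x / ((cmod x)\<^sup>2 - r\<^sup>2) \<le> 1" using sq x4 by (simp add: divide_simps)
  qed (use C r0 sq x4 order_trans[OF _ sq, of 0] in \<open>auto intro!: mult_nonneg_nonneg divide_nonneg_nonneg\<close>)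
  finally show ?thesis by (simp add: x_def)
qed

section \<open>Powers of factorials against exponentials\<close>

lemma fact_powr_ge_1: "s \<ge> 0 \<Longrightarrow> (fact n :: real) powr s \<ge> 1"
  by (intro ge_one_powr_ge_zero) auto

text \<open>The inequality Y ^ n / fact n \<le> exp Y for Y = (2 X) powr \<kappa>, raised to the
  power 1 / \<kappa>. The 2 leaves a geometric factor, so that the sum over n has the same
  exponential bound up to a constant.\<close>

lemma power_div_fact_powr_le:
  fixes X \<kappa> :: real
  assumes "X \<ge> 0" "\<kappa> > 0"
  shows "X ^ n * fact n powr (- 1 / \<kappa>) \<le> (1 / 2) ^ n * exp ((2 * X) powr \<kappa> / \<kappa>)"
proof (cases "X = 0")
  case True
  then show ?thesis by (cases n) auto
next
  case False
  then have X: "X > 0" using assms by simp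
  define Y where "Y = (2 * X) powr \<kappa>"
  have Y: "Y > 0" using X by (simp add: Y_def)
  have "Y ^ n / fact n \<le> exp Y"
  proof -
    have "Y ^ n /\<^sub>R fact n \<le> (\<Sum>k. Y ^ k /\<^sub>R fact k)"
      using Y by (intro sum_le_suminf[of _ "{n}", simplified]) (auto intro: summable_exp_generic[of Y, simplified])
    then show ?thesis by (simp add: exp_def field_simps)
  qed
  then have "(Y ^ n / fact n) powr (1 / \<kappa>) \<le> exp Y powr (1 / \<kappa>)"
    using Y assms by (intro powr_mono2) auto
  also have "exp Y powr (1 / \<kappa>) = exp (Y / \<kappa>)" by (simp add: powr_def)
  also have "(Y ^ n / fact n) powr (1 / \<kappa>) = (2 * X) ^ n * fact n powr (- 1 / \<kappa>)"
  proof -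
    have "(Y ^ n) powr (1 / \<kappa>) = (2 * X) powr (\<kappa> * real n * (1 / \<kappa>))"
      using Y X by (simp add: Y_def powr_powr flip: powr_realpow)
    also have "\<dots> = (2 * X) ^ n" using assms X by (simp add: powr_realpow)
    finally show ?thesis using Y by (simp add: powr_divide powr_minus_divide)
  qed
  finally show ?thesis by (simp add: Y_def power_mult_distrib field_simps)
qed

lemma summable_power_fact_powr:
  fixes X \<kappa> :: real
  assumes "X \<ge> 0" "\<kappa> > 0"
  shows "summable (\<lambda>n. X ^ n * fact n powr (- 1 / \<kappa>))"
    and "(\<Sum>n. X ^ n * fact n powr (- 1 / \<kappa>)) \<le> 2 * exp ((2 * X) powr \<kappa> / \<kappa>)"
proof -
  have s: "(\<lambda>n. (1 / 2) ^ n * exp ((2 * X) powr \<kappa> / \<kappa>)) sums (2 * exp ((2 * X) powr \<kappa> / \<kappa>))"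
    using sums_mult2[OF geometric_sums[of "1/2::real"]] by simp
  show 1: "summable (\<lambda>n. X ^ n * fact n powr (- 1 / \<kappa>))"
    by (rule summable_comparison_test'[OF sums_summable[OF s], of 0])
      (use power_div_fact_powr_le[OF assms] assms in \<open>auto simp: abs_mult\<close>)
  show "(\<Sum>n. X ^ n * fact n powr (- 1 / \<kappa>)) \<le> 2 * exp ((2 * X) powr \<kappa> / \<kappa>)"
    using suminf_le[OF power_div_fact_powr_le[OF assms] 1 sums_summable[OF s]] sums_unique[OF s] by simp
qed

section \<open>A Tauberian theorem in one variable\<close>

text \<open>Gevrey growth of order 1 / K2 against the decay of the reciprocal Gamma function, which
  is of order 1 / K because n ^ n dominates fact n; everything else is geometric. The second factor
  on the left is the common bound for \<open>post_widder\<close> and \<open>rGamma\<close> at z = n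
  / K.\<close>

lemma coefficient_decay:
  fixes K K2 C A :: real
  assumes "0 < K" "K < K2" "0 < C" "0 < A"
  shows "\<exists>C1>0. \<exists>A1>0. \<forall>n>0. C * A ^ n * fact n powr (1 / K2) * (6 powr (n / K + 1) * (n / K) powr (1 - n / K))
    \<le> C1 * A1 ^ n * fact n powr (- (1 / K - 1 / K2))"
proof (intro exI conjI allI impI)
  show "6 * C / K > 0" "A * 2 * 6 powr (1 / K) * K powr (1 / K) > 0" using assms by auto
  fix n :: nat assume n: "n > 0"
  have "real n powr (- n / K) = (real n ^ n) powr (- 1 / K)"
    using n by (simp add: powr_powr flip: powr_realpow)
  also have "\<dots> \<le> fact n powr (- 1 / K)"
    using assms fact_le_power[of n, where 'a = real] by (intro powr_mono2') auto
  finally have 1: "real n powr (- n / K) \<le> fact n powr (- 1 / K)" .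
  have "(n / K) powr (1 - n / K) = (n / K) * (real n powr (- n / K) * K powr (n / K))"
    using n assms by (simp add: powr_diff powr_minus_divide powr_divide)
  also have "\<dots> \<le> (2 ^ n / K) * (fact n powr (- 1 / K) * K powr (n / K))"
    using assms of_nat_less_two_power[of n, where 'a = real]
    by (intro mult_mono 1 order_refl divide_right_mono) auto
  also have "K powr (n / K) = (K powr (1 / K)) ^ n"
    using assms by (simp add: powr_powr flip: powr_realpow)
  finally have 2: "(n / K) powr (1 - n / K) \<le> (2 ^ n / K) * (fact n powr (- 1 / K) * (K powr (1 / K)) ^ n)" .
  have 3: "6 powr (n / K + 1) = 6 * (6 powr (1 / K)) ^ n"
    by (simp add: powr_add powr_powr flip: powr_realpow)
  have "C * A ^ n * fact n powr (1 / K2) * (6 powr (n / K + 1) * (n / K) powr (1 - n / K))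
     \<le> C * A ^ n * fact n powr (1 / K2) * ((6 * (6 powr (1 / K)) ^ n) * ((2 ^ n / K) * (fact n powr (- 1 / K) * (K powr (1 / K)) ^ n)))"
    unfolding 3 using assms by (intro mult_left_mono 2) auto
  also have "\<dots> = 6 * C / K * (A * 2 * 6 powr (1 / K) * K powr (1 / K)) ^ n * (fact n powr (1 / K2) * fact n powr (- 1 / K))"
    by (simp add: power_mult_distrib field_simps)
  also have "fact n powr (1 / K2) * fact n powr (- 1 / K) = (fact n :: real) powr (- (1 / K - 1 / K2))"
    by (simp flip: powr_add)
  finally show "C * A ^ n * fact n powr (1 / K2) * (6 powr (n / K + 1) * (n / K) powr (1 - n / K))
    \<le> 6 * C / K * (A * 2 * 6 powr (1 / K) * K powr (1 / K)) ^ n * fact n powr (- (1 / K - 1 / K2))" .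
qed

text \<open>\<open>p\<close> has Gevrey order 1 / \<open>K2\<close>, and \<open>h\<close> is a sum
  at infinity of its Puiseux series on a sector wider than pi. Remainder estimates are available
  after blocks of \<open>L\<close> terms. The first \<open>M0\<close> blocks are set aside; all
  later exponents n / K are at least 2.\<close>

locale gevrey_pair =
  fixes K K2 C A c :: real and L M0 :: nat and p :: "nat \<Rightarrow> complex" and h :: "complex \<Rightarrow> complex"
  assumes K: "0 < K" "K < K2" and L: "0 < L" and c: "0 < c" and C: "0 < C" and A: "0 < A"
    and M0: "2 * K \<le> real (M0 * L)"
    and p: "cmod (p n) \<le> C * A ^ n * fact n powr (1 / K2)"
    and hol: "h holomorphic_on wide_sector c"
    and asym: "v \<in> wide_sector c \<Longrightarrow>
      cmod (h v - (\<Sum>n<M * L. p n * v powr - of_real (n / K)))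
        \<le> C * A ^ M * fact M powr (L / K) * cmod v powr - (M * L / K)"
begin

text \<open>Coefficients of the formal Borel transform, with 0 for the terms that are set
  aside.\<close>

definition "borel_coeff n = (if n < M0 * L then 0 else p n * of_real (rGamma (n / K)))"

text \<open>Without the first terms the function is O(|v| ^ -2), the decay on which the bound for
  the Post-Widder operator rests.\<close>

definition "h0 v = h v - (\<Sum>n<M0 * L. p n * v powr - of_real (n / K))"

text \<open>The \<open>N\<close>-th Post-Widder approximation at \<open>t\<close> of the inverse
  Laplace transform of \<open>h0\<close>.\<close>

definition "pw_approx N t = (-1) ^ N * (deriv ^^ N) h0 (of_nat N / t) / fact N * (of_nat N / t) ^ Suc N"

lemma M0_pos: "M0 * L > 0"
proof -
  have "real (M0 * L) > 0" using K(1) M0 by linarith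
  then show ?thesis by (simp only: of_nat_0_less_iff)
qed

lemma n0_K: "n \<ge> M0 * L \<Longrightarrow> n / K \<ge> 2"
proof -
  assume "n \<ge> M0 * L"
  then have "2 * K \<le> real n" using M0 of_nat_mono[of "M0 * L" n, where 'a = real] by linarith
  then show ?thesis using K by (simp add: field_simps)
qed

lemma holomorphic_powr_wide: "(\<lambda>v. v powr z) holomorphic_on wide_sector c"
  by (intro holomorphic_on_powr holomorphic_intros) (use wide_sector_nonpos c in auto)

lemma holomorphic_sum_wide: "(\<lambda>v. \<Sum>n\<in>X. p n * v powr - of_real (n / K)) holomorphic_on wide_sector c"
  by (intro holomorphic_intros holomorphic_powr_wide)

lemma hol_h0: "h0 holomorphic_on wide_sector c"
  unfolding h0_def by (intro holomorphic_intros hol holomorphic_sum_wide)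

definition "C0 = C * A ^ M0 * fact M0 powr (L / K)"

lemma C0_pos: "C0 > 0"
  using C A by (simp add: C0_def)

text \<open>The asymptotic estimate at M = M0, where M0 L / K \<ge> 2 and |v| > 1.\<close>

lemma h0_bound:
  assumes "v \<in> wide_sector c"
  shows "cmod (h0 v) \<le> C0 / (cmod v)\<^sup>2"
proof -
  have v: "cmod v > 1" using assms by (simp add: wide_sector_def)
  have "cmod (h0 v) \<le> C0 * cmod v powr - (M0 * L / K)"
    using asym[OF assms, of M0] by (simp add: h0_def C0_def)
  also have "\<dots> \<le> C0 * cmod v powr - 2"
    using v n0_K[of "M0 * L"] C0_pos by (intro mult_left_mono powr_mono) auto
  also have "cmod v powr - 2 = 1 / (cmod v)\<^sup>2" using v by (simp add: powr_minus divide_inverse powr_numeral)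
  finally show ?thesis by simp
qed

lemma pw_approx_bound:
  "t \<in> acone c \<Longrightarrow> 4 * cmod t \<le> real N \<Longrightarrow> cmod (pw_approx N t) \<le> C0 * exp (4 * cmod t)"
  unfolding pw_approx_def by (rule post_widder_operator_bound[OF hol_h0 c h0_bound])

lemma borel_coeff_bound:
  assumes "\<And>n::nat. n > 0 \<Longrightarrow> C * A ^ n * fact n powr (1 / K2) * (6 powr (n / K + 1) * (n / K) powr (1 - n / K))
    \<le> C1 * A1 ^ n * fact n powr (- (1 / K - 1 / K2))" "C1 > 0" "A1 > 0"
  shows "n \<ge> M0 * L \<Longrightarrow> cmod (p n) * (6 powr (n / K + 1) * (n / K) powr (1 - n / K))
       \<le> C1 * A1 ^ n * fact n powr (- (1 / K - 1 / K2))"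
    and "cmod (borel_coeff n) \<le> C1 * A1 ^ n * fact n powr (- (1 / K - 1 / K2))"
proof -
  show 1: "cmod (p n) * (6 powr (n / K + 1) * (n / K) powr (1 - n / K))
       \<le> C1 * A1 ^ n * fact n powr (- (1 / K - 1 / K2))" if "n \<ge> M0 * L" for n
    by (rule order_trans[OF mult_right_mono[OF p] assms(1)]) (use that less_le_trans[OF M0_pos that] in auto)
  show "cmod (borel_coeff n) \<le> C1 * A1 ^ n * fact n powr (- (1 / K - 1 / K2))"
  proof (cases "n < M0 * L")
    case False
    have z: "n / K \<ge> 1" using n0_K[of n] False by simp
    have "cmod (borel_coeff n) = cmod (p n) * rGamma (n / K)"
      using False z Gamma_real_pos[of "n / K"]
      by (simp add: borel_coeff_def norm_mult rGamma_inverse_Gamma norm_inverse del: of_real_divide)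
    also have "\<dots> \<le> cmod (p n) * (6 powr (n / K + 1) * (n / K) powr (1 - n / K))"
      by (intro mult_left_mono rGamma_bound z) auto
    also have "\<dots> \<le> C1 * A1 ^ n * fact n powr (- (1 / K - 1 / K2))" using False by (intro 1) auto
    finally show ?thesis .
  qed (use assms in \<open>simp add: borel_coeff_def\<close>)
qed

lemma coeff_bounds:
  obtains C1 A1 where "C1 > 0" "A1 > 0"
    "\<And>n. n \<ge> M0 * L \<Longrightarrow> cmod (p n) * (6 powr (n / K + 1) * (n / K) powr (1 - n / K))
       \<le> C1 * A1 ^ n * fact n powr (- (1 / K - 1 / K2))"
    "\<And>n. cmod (borel_coeff n) \<le> C1 * A1 ^ n * fact n powr (- (1 / K - 1 / K2))"
proof -
  obtain C1 A1 where C1: "C1 > 0" "A1 > 0" "\<And>n::nat. n > 0 \<Longrightarrow>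
     C * A ^ n * fact n powr (1 / K2) * (6 powr (n / K + 1) * (n / K) powr (1 - n / K))
    \<le> C1 * A1 ^ n * fact n powr (- (1 / K - 1 / K2))"
    using coefficient_decay[OF K C A] by blast
  show thesis using that[OF C1(1,2) borel_coeff_bound(1)[OF C1(3,1,2)] borel_coeff_bound(2)[OF C1(3,1,2)]] by blast
qed

text \<open>The order of truncation grows with N, so that M L / K is within L / K of N. Cauchy's
  inequality on a disc of radius |x| / 2 costs 2 ^ N, while the Gevrey remainder on that disc is of
  size (1 / 4) ^ N once t is small.\<close>

lemma tail_bound:
  assumes t: "0 < t" "8 * A powr (K / L) * t * K \<le> L" and N: "2 * t < real N"
    and M: "M = nat \<lfloor>N * K / L\<rfloor>"
  defines "R \<equiv> (\<lambda>v. h v - (\<Sum>n<M * L. p n * v powr - of_real (n / K)))"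
  defines "x \<equiv> complex_of_real (N / t)"
  shows "cmod ((deriv ^^ N) R x / fact N * x ^ Suc N) \<le> C * 4 powr (L / K) / t * (real N * (1 / 2) ^ N)"
proof -
  define s where "s = L / K"
  define X where "X = N / t"
  have s: "s > 0" using K L by (simp add: s_def)
  have N0: "real N > 0" using N t by linarith
  have X: "X > 2" "cmod x = X" using N t N0 by (auto simp: X_def x_def norm_divide field_simps simp del: of_real_divide)
  have M1: "real M * s \<le> N" "real M * s \<ge> N - s"
  proof -
    have "real M \<le> N * K / L" "real M \<ge> N * K / L - 1" using K L unfolding M by (auto intro: of_nat_floor)
    then have "real M * s \<le> N * K / L * s" "real M * s \<ge> (N * K / L - 1) * s"
      using s by (blast intro: mult_right_mono less_imp_le)+
    moreover have "N * K / L * s = N" using K L by (simp add: s_def)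
    ultimately show "real M * s \<le> N" "real M * s \<ge> N - s" by (auto simp: left_diff_distrib)
  qed
  \<comment> \<open>Half the distance from the origin: since X > 2, this disc still avoids the
    closed unit disc.\<close>
  have sub: "cball x (X / 2) \<subseteq> wide_sector c"
  proof (rule wide_sector_cball)
    show "x \<in> acone c" unfolding x_def using of_real_in_acone[OF c, of "N / t"] N0 t by simp
    show "cball x (X / 2) \<subseteq> {v. 1 < cmod v}"
    proof
      fix v assume "v \<in> cball x (X / 2)"
      then have "cmod (x - v) \<le> X / 2" by (simp add: dist_norm)
      then show "v \<in> {v. 1 < cmod v}" using norm_triangle_sub[of x v] X by simp
    qed
  qed (use X in simp)
  define B where "B = C * A ^ M * fact M powr s * (X / 2) powr - (M * s)"
  have Rb: "cmod (R v) \<le> B" if "cmod (x - v) = X / 2" for v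
  proof -
    have v: "v \<in> wide_sector c" using sub that by (auto simp: dist_norm)
    have "cmod (R v) \<le> C * A ^ M * fact M powr s * cmod v powr - (M * s)"
      using asym[OF v, of M] by (simp add: R_def s_def)
    also have "\<dots> \<le> B" unfolding B_def
    proof (intro mult_left_mono powr_mono2')
      show "X / 2 \<le> cmod v" using norm_triangle_sub[of x v] X that by simp
    qed (use s X C A in auto)
    finally show ?thesis .
  qed
  have holR: "R holomorphic_on wide_sector c" unfolding R_def
    by (intro holomorphic_intros hol holomorphic_sum_wide)
  have D: "cmod ((deriv ^^ N) R x) \<le> fact N * B / (X / 2) ^ N"
    by (rule Cauchy_inequality)
      (use sub X Rb ball_subset_cball[of x "X/2"] in
        \<open>auto intro!: holomorphic_on_subset[OF holR] holomorphic_on_imp_continuous_on\<close>)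
  have "cmod ((deriv ^^ N) R x / fact N * x ^ Suc N) = cmod ((deriv ^^ N) R x) / fact N * X ^ Suc N"
    using X by (simp add: norm_mult norm_divide norm_power)
  also have "\<dots> \<le> (fact N * B / (X / 2) ^ N) / fact N * X ^ Suc N"
    using X by (intro mult_right_mono divide_right_mono D) auto
  also have "\<dots> = B * X * 2 ^ N" using X by (simp add: power_divide)
  finally have 1: "cmod ((deriv ^^ N) R x / fact N * x ^ Suc N) \<le> B * X * 2 ^ N" .
  \<comment> \<open>As M s \<le> N, the factorial is at most (N / s) ^ M. Against |v| \<ge> N / (2
    t) the N cancels, and a power of a multiple of t remains.\<close>
  have F: "fact M powr s \<le> (N / s) powr (M * s)"
  proof (cases "M = 0")
    case True
    then show ?thesis using N0 s by simp
  next
    case False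
    have "(fact M :: real) \<le> real M ^ M" using fact_le_power[of M] by simp
    also have "\<dots> \<le> (N / s) ^ M" using M1 s by (intro power_mono) (auto simp: field_simps)
    finally have "fact M powr s \<le> ((N / s) ^ M) powr s" using s by (intro powr_mono2) auto
    also have "\<dots> = (N / s) powr (M * s)" using N0 s by (simp add: powr_powr flip: powr_realpow)
    finally show ?thesis .
  qed
  \<comment> \<open>Brings the geometric factor to the exponent M s of the other two
    factors.\<close>
  have A': "A ^ M = (A powr (1 / s)) powr (M * s)"
    using A s by (simp add: powr_powr powr_realpow)
  have "B \<le> C * (A powr (1 / s)) powr (M * s) * (N / s) powr (M * s) * (X / 2) powr - (M * s)"
    unfolding B_def A' by (intro mult_right_mono mult_left_mono F) (use C in auto)
  also have "\<dots> = C * (A powr (1 / s) * (N / s) / (X / 2)) powr (M * s)"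
  proof -
    have "a powr e * b powr e * d powr - e = (a * b / d) powr e" if "0 < a" "0 < b" "0 < d" for a b d e :: real
      using that by (simp add: powr_mult powr_divide powr_minus_divide)
    from this[of "A powr (1 / s)" "N / s" "X / 2" "M * s"] show ?thesis
      using N0 X(1) s A by simp
  qed
  also have "A powr (1 / s) * (N / s) / (X / 2) = A powr (K / L) * 2 * t * K / L"
    using N0 t(1) K L by (simp add: X_def s_def)
  \<comment> \<open>The assumed smallness of t says exactly that this base is at most 1 / 4.\<close>
  also have "C * (A powr (K / L) * 2 * t * K / L) powr (M * s) \<le> C * (1 / 4) powr (M * s)"
  proof (intro mult_left_mono powr_mono2)
    have "A powr (K / L) * 2 * t * K = 8 * A powr (K / L) * t * K / 4" by simp
    also have "\<dots> \<le> L / 4" using t(2) by (intro divide_right_mono) auto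
    finally show "A powr (K / L) * 2 * t * K / L \<le> 1 / 4" using L by (simp add: divide_simps)
  qed (use t K L s C in auto)
  \<comment> \<open>M s falls short of N by at most s, which costs the factor 4 powr s.\<close>
  also have "\<dots> \<le> C * (1 / 4) powr (N - s)"
    using C M1 by (intro mult_left_mono powr_mono') auto
  also have "\<dots> = C * 4 powr s * (1 / 4) ^ N"
    by (simp add: powr_diff powr_divide power_divide powr_realpow)
  finally have "B \<le> C * 4 powr s * (1 / 4) ^ N" .
  then have "B * X * 2 ^ N \<le> C * 4 powr s * (1 / 4) ^ N * X * 2 ^ N"
    using X by (intro mult_right_mono) auto
  also have "\<dots> = C * 4 powr s / t * (real N * ((1 / 4) ^ N * 2 ^ N))" by (simp add: X_def)
  also have "(1 / 4) ^ N * 2 ^ N = (1 / 2 :: real) ^ N" by (simp flip: power_mult_distrib)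
  finally show ?thesis using 1 by (simp add: s_def)
qed

text \<open>The powers v powr (- n / K) have explicit derivatives, so their Post-Widder
  approximations are exact Pochhammer quotients. What is left is the contribution of the Gevrey
  remainder \<open>R\<close>.\<close>

lemma pw_approx_split:
  assumes t: "0 < t" and N: "0 < N" and M: "M0 \<le> M"
  defines "R \<equiv> (\<lambda>v. h v - (\<Sum>n<M * L. p n * v powr - of_real (n / K)))"
  defines "x \<equiv> complex_of_real (N / t)"
  assumes x: "x \<in> wide_sector c"
  shows "pw_approx N (of_real t) = (\<Sum>n\<in>{M0 * L..<M * L}. p n * of_real (post_widder N (n / K) * t powr (n / K - 1)))
     + (-1) ^ N * ((deriv ^^ N) R x / fact N * x ^ Suc N)"
proof -
  define S where "S = {M0 * L..<M * L}"
  have eq: "h0 v = (\<Sum>n\<in>S. p n * v powr - of_real (n / K)) + R v" for v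
  proof -
    have "{..<M * L} = {..<M0 * L} \<union> S" "{..<M0 * L} \<inter> S = {}"
      using mult_le_mono1[OF M, of L] by (auto simp: S_def intro: less_le_trans)
    then show ?thesis unfolding h0_def R_def by (simp add: sum.union_disjoint S_def)
  qed
  have nonpos: "x \<notin> \<real>\<^sub>\<le>\<^sub>0" using wide_sector_nonpos[OF x c] .
  have holR: "R holomorphic_on wide_sector c" unfolding R_def
    by (intro holomorphic_intros hol holomorphic_sum_wide)
  have sum: "(deriv ^^ N) (\<lambda>v. \<Sum>n\<in>X. p n * v powr - of_real (n / K)) x
      = (\<Sum>n\<in>X. p n * (deriv ^^ N) (\<lambda>v. v powr - of_real (n / K)) x)" if "finite X" for X
    using that
  proof (induction X)
    case (insert a X)
    have "(deriv ^^ N) (\<lambda>v. \<Sum>n\<in>insert a X. p n * v powr - of_real (n / K)) x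
       = (deriv ^^ N) (\<lambda>v. p a * v powr - of_real (a / K) + (\<Sum>n\<in>X. p n * v powr - of_real (n / K))) x"
      using insert by simp
    also have "\<dots> = (deriv ^^ N) (\<lambda>v. p a * v powr - of_real (a / K)) x +
        (deriv ^^ N) (\<lambda>v. \<Sum>n\<in>X. p n * v powr - of_real (n / K)) x"
      by (intro higher_deriv_add[OF _ _ open_wide_sector x] holomorphic_intros holomorphic_powr_wide holomorphic_sum_wide)
    also have "(deriv ^^ N) (\<lambda>v. p a * v powr - of_real (a / K)) x = p a * (deriv ^^ N) (\<lambda>v. v powr - of_real (a / K)) x"
      by (intro higher_deriv_cmult[OF _ x open_wide_sector] holomorphic_powr_wide)
    finally show ?case using insert by simp
  qed simp
  have "(deriv ^^ N) h0 x = (deriv ^^ N) (\<lambda>v. (\<Sum>n\<in>S. p n * v powr - of_real (n / K)) + R v) x"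
    using eq by presburger
  also have "\<dots> = (deriv ^^ N) (\<lambda>v. \<Sum>n\<in>S. p n * v powr - of_real (n / K)) x + (deriv ^^ N) R x"
    by (intro higher_deriv_add[OF _ _ open_wide_sector x] holomorphic_sum_wide holR)
  also have "(deriv ^^ N) (\<lambda>v. \<Sum>n\<in>S. p n * v powr - of_real (n / K)) x
     = (\<Sum>n\<in>S. p n * ((-1) ^ N * pochhammer (of_real (n / K)) N * x powr (- of_real (n / K) - of_nat N)))"
    by (subst sum) (simp_all only: higher_deriv_powr[OF nonpos] S_def finite_atLeastLessThan)
  finally have D: "(deriv ^^ N) h0 x = (\<Sum>n\<in>S. p n * ((-1) ^ N * pochhammer (of_real (n / K)) N * x powr (- of_real (n / K) - of_nat N)))
     + (deriv ^^ N) R x" .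
  \<comment> \<open>At v = N / t the power of t separates as t powr (n / K - 1), the power of N goes
    into \<open>post_widder\<close>, and the two signs cancel.\<close>
  have summand: "(-1) ^ N * (p n * ((-1) ^ N * pochhammer (of_real (n / K)) N * x powr (- of_real (n / K) - of_nat N))) / fact N * x ^ Suc N
     = p n * of_real (post_widder N (n / K) * t powr (n / K - 1))" for n :: nat
  proof -
    have "x powr (- of_real (n / K) - of_nat N) * x ^ Suc N = of_real ((N / t) powr (- (n / K) - real N) * (N / t) ^ Suc N)"
      using t N unfolding x_def by (simp add: powr_of_real[symmetric] del: power_Suc)
    also have "(N / t) powr (- (n / K) - real N) * (N / t) ^ Suc N = (N / t) powr (- (n / K) - real N) * (N / t) powr (real (Suc N))"
      using t N by (subst powr_realpow) auto
    also have "\<dots> = (N / t) powr (1 - n / K)"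
      by (simp flip: powr_add)
    also have "\<dots> = t powr (n / K - 1) / real N powr (n / K - 1)"
      using t N by (simp add: powr_divide powr_diff)
    finally have *: "x powr (- of_real (n / K) - of_nat N) * x ^ Suc N = of_real (t powr (n / K - 1) / real N powr (n / K - 1))" .
    have m1: "(-1) ^ N * (-1) ^ N = (1 :: complex)" by (simp flip: power_mult_distrib)
    have "(-1) ^ N * (p n * ((-1) ^ N * pochhammer (of_real (n / K)) N * x powr (- of_real (n / K) - of_nat N))) / fact N * x ^ Suc N
      = ((-1) ^ N * (-1) ^ N) * (p n * (pochhammer (of_real (n / K)) N / fact N * (x powr (- of_real (n / K) - of_nat N) * x ^ Suc N)))"
      by (simp add: mult_ac)
    also have "\<dots> = p n * of_real (post_widder N (n / K) * t powr (n / K - 1))"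
      unfolding * m1 pochhammer_of_real by (simp add: post_widder_def)
    finally show ?thesis .
  qed
  have "pw_approx N (of_real t) = (-1) ^ N * (deriv ^^ N) h0 x / fact N * x ^ Suc N"
    by (simp add: pw_approx_def x_def)
  also have "\<dots> = (\<Sum>n\<in>S. (-1) ^ N * (p n * ((-1) ^ N * pochhammer (of_real (n / K)) N * x powr (- of_real (n / K) - of_nat N))) / fact N * x ^ Suc N)
    + (-1) ^ N * ((deriv ^^ N) R x / fact N * x ^ Suc N)"
    unfolding D by (simp add: distrib_left distrib_right add_divide_distrib sum_distrib_left sum_distrib_right sum_divide_distrib mult.assoc)
  finally show ?thesis unfolding summand S_def .
qed

end

text \<open>Termwise from \<open>summable_power_fact_powr\<close> with \<kappa> = 1 / \<sigma>:
  coefficients of negative Gevrey order - \<sigma> belong to an entire function of order at most 1 /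
  \<sigma>.\<close>

lemma entire_power_series:
  fixes a :: "nat \<Rightarrow> complex"
  assumes C: "\<And>n. cmod (a n) \<le> C * A ^ n * fact n powr (- \<sigma>)" and pos: "C \<ge> 0" "A \<ge> 0" "\<sigma> > 0"
  shows "summable (\<lambda>n. a n * z ^ n)"
    and "(\<lambda>z. \<Sum>n. a n * z ^ n) holomorphic_on S"
    and "cmod (\<Sum>n. a n * z ^ n) \<le> 2 * C * exp ((2 * A * cmod z) powr (1 / \<sigma>) * \<sigma>)"
proof -
  have le: "cmod (a n * z ^ n) \<le> C * ((A * cmod z) ^ n * fact n powr (- 1 / (1 / \<sigma>)))" for z n
    using mult_right_mono[OF C[of n], of "cmod z ^ n"] pos
    by (simp add: norm_mult norm_power power_mult_distrib mult_ac)
  have s: "summable (\<lambda>n. C * ((A * cmod z) ^ n * fact n powr (- 1 / (1 / \<sigma>))))" for z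
    by (intro summable_mult summable_power_fact_powr) (use pos in auto)
  have sa: "summable (\<lambda>n. norm (a n * z ^ n))" for z
    by (rule summable_comparison_test'[OF s, of 0]) (use le in auto)
  then show sum: "summable (\<lambda>n. a n * z ^ n)" for z by (rule summable_norm_cancel)
  show "(\<lambda>z. \<Sum>n. a n * z ^ n) holomorphic_on S"
    unfolding holomorphic_on_def field_differentiable_def
    using has_field_derivative_at_within[OF termdiffs_strong_converges_everywhere[OF sum]] by blast
  have "cmod (\<Sum>n. a n * z ^ n) \<le> (\<Sum>n. norm (a n * z ^ n))" by (rule summable_norm[OF sa])
  also have "\<dots> \<le> (\<Sum>n. C * ((A * cmod z) ^ n * fact n powr (- 1 / (1 / \<sigma>))))"
    by (intro suminf_le le sa s)
  also have "\<dots> = C * (\<Sum>n. (A * cmod z) ^ n * fact n powr (- 1 / (1 / \<sigma>)))"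
    by (intro suminf_mult summable_power_fact_powr) (use pos in auto)
  also have "\<dots> \<le> C * (2 * exp ((2 * (A * cmod z)) powr (1 / \<sigma>) / (1 / \<sigma>)))"
    by (intro mult_left_mono summable_power_fact_powr) (use pos in auto)
  finally show "cmod (\<Sum>n. a n * z ^ n) \<le> 2 * C * exp ((2 * A * cmod z) powr (1 / \<sigma>) * \<sigma>)"
    by (simp add: mult.assoc)
qed

context gevrey_pair
begin

text \<open>In the variable z = t powr (1 / K) the Borel transform is an ordinary power series; the
  inverse Laplace transform at t is \<open>borel_sum z / t\<close>.\<close>

definition "borel_sum z = (\<Sum>n. borel_coeff n * z ^ n)"

lemma sigma_pos: "1 / K - 1 / K2 > 0"
proof -
  have "1 / K2 < 1 / K" by (rule divide_strict_left_mono) (use K in auto)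
  then show ?thesis by (simp only: diff_gt_0_iff_gt)
qed

lemma holomorphic_borel: "borel_sum holomorphic_on S"
proof -
  obtain C1 A1 where C1: "C1 > 0" "A1 > 0"
    "\<And>n. n \<ge> M0 * L \<Longrightarrow> cmod (p n) * (6 powr (n / K + 1) * (n / K) powr (1 - n / K))
       \<le> C1 * A1 ^ n * fact n powr (- (1 / K - 1 / K2))"
    "\<And>n. cmod (borel_coeff n) \<le> C1 * A1 ^ n * fact n powr (- (1 / K - 1 / K2))"
    by (rule coeff_bounds, rule that)
  show ?thesis unfolding borel_sum_def[abs_def]
    by (rule entire_power_series(2)[OF C1(4) _ _ sigma_pos]) (use C1 in auto)
qed

lemma summable_borel: "summable (\<lambda>n. borel_coeff n * z ^ n)"
proof -
  obtain C1 A1 where C1: "C1 > 0" "A1 > 0"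
    "\<And>n. n \<ge> M0 * L \<Longrightarrow> cmod (p n) * (6 powr (n / K + 1) * (n / K) powr (1 - n / K))
       \<le> C1 * A1 ^ n * fact n powr (- (1 / K - 1 / K2))"
    "\<And>n. cmod (borel_coeff n) \<le> C1 * A1 ^ n * fact n powr (- (1 / K - 1 / K2))"
    by (rule coeff_bounds, rule that)
  show ?thesis by (rule entire_power_series(1)[OF C1(4) _ _ sigma_pos]) (use C1 in auto)
qed

text \<open>Tannery's theorem for the approximations of the single powers. A common summable bound
  exists because the sum for N stops at n / K \<le> N, the range of
  \<open>post_widder_bound\<close>; the rest is controlled by \<open>tail_bound\<close>, which is
  why t has to be small.\<close>

lemma pw_approx_LIMSEQ:
  assumes t: "0 < t" "8 * A powr (K / L) * t * K \<le> L"
  shows "(\<lambda>N. pw_approx N (of_real t)) \<longlonglongrightarrow> borel_sum (of_real (t powr (1 / K))) / of_real t"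
proof -
  obtain C1 A1 where C1: "C1 > 0" "A1 > 0"
    "\<And>n. n \<ge> M0 * L \<Longrightarrow> cmod (p n) * (6 powr (n / K + 1) * (n / K) powr (1 - n / K))
       \<le> C1 * A1 ^ n * fact n powr (- (1 / K - 1 / K2))"
    "\<And>n. cmod (borel_coeff n) \<le> C1 * A1 ^ n * fact n powr (- (1 / K - 1 / K2))"
    by (rule coeff_bounds, rule that)
  define M where "M N = nat \<lfloor>real N * K / L\<rfloor>" for N
  have M: "real (M N) * L \<le> N * K" "real (M N) * L > N * K - L" for N
  proof -
    have "real (M N) \<le> N * K / L" "real (M N) > N * K / L - 1"
      using K L of_nat_floor[of "real N * K / L"] unfolding M_def by auto
    then show "real (M N) * L \<le> N * K" "real (M N) * L > N * K - L"
      using L by (auto simp: field_simps)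
  qed
  have evM: "\<forall>\<^sub>F N in sequentially. n < M N * L" for n
  proof -
    have "\<forall>\<^sub>F N in sequentially. (real n + L) / K \<le> real N"
      using filterlim_real_sequentially unfolding filterlim_at_top by blast
    then show ?thesis
    proof eventually_elim
      case (elim N)
      then have "real n + L \<le> N * K" using K by (simp add: field_simps)
      then have "real n < real (M N * L)" using M(2)[of N] by simp
      then show ?case by (simp only: of_nat_less_iff)
    qed
  qed
  \<comment> \<open>The finite sums over a window that grows with N, written as series over all n by
    padding with zeros.\<close>
  define a where "a n N = (if M0 * L \<le> n \<and> n < M N * L then p n * of_real (post_widder N (n / K) * t powr (n / K - 1)) else 0)" for n N
  define b where "b n = borel_coeff n * of_real (t powr (n / K - 1))" for n
  define B where "B n = C1 * ((A1 * t powr (1 / K)) ^ n * fact n powr (- 1 / (1 / (1 / K - 1 / K2)))) / t" for n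
  have tn: "t powr (n / K - 1) = (t powr (1 / K)) ^ n / t" for n :: nat
    using t by (simp add: powr_diff powr_powr flip: powr_realpow)
  have lim: "(\<lambda>N. a n N) \<longlonglongrightarrow> b n" for n
  proof (cases "M0 * L \<le> n")
    case True
    then have z: "n / K > 0" using n0_K[of n] by simp
    have "\<forall>\<^sub>F N in sequentially. p n * of_real (post_widder N (n / K) * t powr (n / K - 1)) = a n N"
      using evM[of n] by eventually_elim (use True in \<open>simp add: a_def\<close>)
    moreover have "(\<lambda>N. p n * of_real (post_widder N (n / K) * t powr (n / K - 1))) \<longlonglongrightarrow>
       p n * of_real (rGamma (n / K) * t powr (n / K - 1))"
      by (intro tendsto_intros post_widder_LIMSEQ z)
    ultimately show ?thesis using True by (simp add: tendsto_cong b_def borel_coeff_def mult_ac)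
  qed (simp add: a_def b_def borel_coeff_def)
  have bound: "cmod (a n N) \<le> B n" for n N
  proof (cases "M0 * L \<le> n \<and> n < M N * L")
    case True
    have "real n \<le> real (M N * L)" using True by (intro of_nat_mono) auto
    \<comment> \<open>The coupling of M with N gives the second inequality, the range condition of
      \<open>post_widder_bound\<close>.\<close>
    then have z: "n / K \<ge> 1" "n / K \<le> real N" using n0_K[of n] True M(1)[of N] K by (auto simp: field_simps)
    have "cmod (a n N) = cmod (p n) * post_widder N (n / K) * t powr (n / K - 1)"
      using True z post_widder_nonneg[of "n / K" N] by (simp add: a_def norm_mult)
    also have "\<dots> \<le> cmod (p n) * (6 powr (n / K + 1) * (n / K) powr (1 - n / K)) * t powr (n / K - 1)"
      by (intro mult_right_mono mult_left_mono post_widder_bound z) auto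
    also have "\<dots> \<le> C1 * A1 ^ n * fact n powr (- (1 / K - 1 / K2)) * t powr (n / K - 1)"
      by (intro mult_right_mono C1) (use True in auto)
    also have "\<dots> = B n" unfolding tn B_def by (simp add: power_mult_distrib mult_ac)
    finally show ?thesis .
  next
    case False
    then have "a n N = 0" by (auto simp: a_def)
    then show ?thesis using C1(1,2) t(1) by (simp add: B_def)
  qed
  have sB: "summable B" unfolding B_def
    using C1 by (intro summable_divide summable_mult summable_power_fact_powr divide_pos_pos sigma_pos) auto
  have ev: "\<forall>\<^sub>F (k, N) in at_top \<times>\<^sub>F sequentially. norm (a k N) \<le> B k"
    by (rule always_eventually) (use bound in auto)
  have "(\<lambda>N. \<Sum>n. a n N) \<longlonglongrightarrow> suminf b"
    using tannerys_theorem[of a b sequentially B, OF lim ev sB] by simp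
  also have "suminf b = borel_sum (of_real (t powr (1 / K))) / of_real t"
  proof -
    have "b = (\<lambda>n. borel_coeff n * of_real (t powr (1 / K)) ^ n / of_real t)"
      by (simp add: fun_eq_iff b_def tn)
    then show ?thesis using suminf_divide[OF summable_borel] by (simp add: borel_sum_def)
  qed
  finally have main: "(\<lambda>N. \<Sum>n. a n N) \<longlonglongrightarrow> borel_sum (of_real (t powr (1 / K))) / of_real t" .
  \<comment> \<open>The contribution of the Gevrey remainder; it vanishes in the limit like N / 2 ^
    N.\<close>
  define T where "T N = pw_approx N (of_real t) - (\<Sum>n. a n N)" for N
  have evT: "\<forall>\<^sub>F N in sequentially. cmod (T N) \<le> C * 4 powr (L / K) / t * (real N * (1 / 2) ^ N)"
  proof -
    have "\<forall>\<^sub>F N in sequentially. 2 * t + 1 \<le> real N"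
      using filterlim_real_sequentially unfolding filterlim_at_top by blast
    then show ?thesis using evM[of "M0 * L"]
    proof eventually_elim
      case (elim N)
      then have N: "2 * t < real N" "N > 0" using t by (auto intro: Nat.gr0I)
      have MM: "M0 \<le> M N" using elim(2) by (metis less_imp_le mult_less_cancel2)
      have x1: "cmod (complex_of_real (N / t)) > 1" using N t by (simp add: norm_divide field_simps)
      have "0 < Re (complex_of_real (N / t) * cnj (of_real 1))" using N t by simp
      then have x: "complex_of_real (N / t) \<in> wide_sector c"
        using x1 of_real_in_acone[OF c zero_less_one] unfolding wide_sector_def by blast
      have "(\<Sum>n. a n N) = (\<Sum>n\<in>{M0 * L..<M N * L}. a n N)"
        by (rule suminf_finite) (auto simp: a_def)
      also have "\<dots> = (\<Sum>n\<in>{M0 * L..<M N * L}. p n * of_real (post_widder N (n / K) * t powr (n / K - 1)))"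
        by (intro sum.cong) (auto simp: a_def)
      finally have "T N = (-1) ^ N * ((deriv ^^ N) (\<lambda>v. h v - (\<Sum>n<M N * L. p n * v powr - of_real (n / K)))
          (of_real (N / t)) / fact N * of_real (N / t) ^ Suc N)"
        unfolding T_def pw_approx_split[OF t(1) N(2) MM x] by simp
      moreover have "cmod ((-1) ^ N * y) = cmod y" for y :: complex by (simp add: norm_mult norm_power)
      ultimately show ?case
        using tail_bound[OF t N(1) M_def] by (simp only:)
    qed
  qed
  have "(\<lambda>N. C * 4 powr (L / K) / t * (real N * (1 / 2) ^ N)) \<longlonglongrightarrow> C * 4 powr (L / K) / t * 0"
    by (intro tendsto_intros) real_asymp
  then have "T \<longlonglongrightarrow> 0"
    using evT by (intro Lim_null_comparison[OF evT]) simp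
  from tendsto_add[OF this main] show ?thesis by (simp add: T_def)
qed

text \<open>On each bounded part of the cone the approximations are bounded uniformly in N, so by
  Montel's theorem a subsequence converges to a holomorphic function. For small t the limit is
  known; by the identity theorem it is the Borel transform throughout, and the bound is
  inherited.\<close>

lemma borel_growth_cone:
  assumes "t > 0"
  shows "cmod (borel_sum (of_real (t powr (1 / K)))) \<le> C0 * t * exp (4 * t)"
proof -
  define T where "T = t + 1"
  define S where "S = acone c \<inter> ball 0 T"
  \<comment> \<open>The bound for \<open>pw_approx\<close> asks for 4 |u| \<le> N; the shift of the
    index secures this on all of \<open>S\<close>.\<close>
  define N0 where "N0 = nat \<lceil>4 * T\<rceil> + 1"
  define F where "F N = pw_approx (N + N0)" for N
  have opS: "open S" unfolding S_def by (intro open_Int open_acone) auto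
  have conS: "connected S" unfolding S_def by (intro convex_connected convex_Int convex_acone convex_ball)
  have N0: "4 * T \<le> real (N + N0)" "0 < N + N0" for N unfolding N0_def by (simp, linarith) (simp add: N0_def)
  have nz: "u \<noteq> 0" if "u \<in> acone c" for u using acone_Re_pos[OF c that] by auto
  have in_wide: "of_nat M / u \<in> wide_sector c" if "u \<in> S" "4 * T \<le> real M" for M u
  proof -
    have u: "u \<in> acone c" "cmod u < T" "cmod u > 0" using that nz by (auto simp: S_def)
    then have "real M > 0" using that by linarith
    then have x: "of_nat M / u \<in> acone c" using acone_divide[OF u(1) _ c, of "real M"] by simp
    have "1 < cmod (of_nat M / u)" using u that by (simp add: norm_divide field_simps)
    then show ?thesis unfolding wide_sector_def
      using x acone_Re_pos[OF c x] complex_norm_square[of "of_nat M / u"]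
      by (auto simp: complex_mult_cnj intro!: bexI[OF _ x] add_pos_nonneg)
  qed
  have holF: "F N holomorphic_on S" for N
    unfolding F_def pw_approx_def
    by (intro holomorphic_intros holomorphic_on_compose_gen[unfolded o_def, OF _ holomorphic_higher_deriv[OF hol_h0 open_wide_sector]])
      (use nz in_wide[OF _ N0(1)] in \<open>auto simp: S_def simp del: of_nat_add\<close>)
  have bF: "cmod (F N u) \<le> C0 * exp (4 * cmod u)" if "u \<in> S" for N u
    unfolding F_def by (rule pw_approx_bound) (use that N0(1)[of N] in \<open>auto simp: S_def\<close>)
  have bF': "cmod (F N u) \<le> C0 * exp (4 * T)" if "u \<in> S" for N u
    using bF[OF that, of N] that C0_pos by (force simp: S_def intro: order_trans)
  \<comment> \<open>A limit along a subsequence is enough, since for small arguments the whole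
    sequence converges.\<close>
  obtain g r where g: "g holomorphic_on S" "strict_mono (r :: nat \<Rightarrow> nat)" "\<And>u. u \<in> S \<Longrightarrow> (\<lambda>N. F (r N) u) \<longlonglongrightarrow> g u"
    by (rule Montel[OF opS, of "range F" F]) (use holF bF' in blast)+
  \<comment> \<open>The positive reals in the disc to which \<open>pw_approx_LIMSEQ\<close>
    applies.\<close>
  define U where "U = complex_of_real ` {0<..<min T (L / (8 * A powr (K / L) * K))}"
  define G where "G u = g u - borel_sum (u powr of_real (1 / K)) / u" for u
  have T0: "T > 0" using assms by (simp add: T_def)
  have t0: "min T (L / (8 * A powr (K / L) * K)) > 0" using T0 L A K by simp
  have gU: "G u = 0" if "u \<in> U" for u
  proof -
    obtain s where s: "u = of_real s" "0 < s" "s < T" "s < L / (8 * A powr (K / L) * K)"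
      using \<open>u \<in> U\<close> by (auto simp: U_def)
    have uS: "u \<in> S" using s of_real_in_acone[OF c] by (simp add: S_def)
    have "(\<lambda>N. pw_approx N u) \<longlonglongrightarrow> borel_sum (of_real (s powr (1 / K))) / of_real s"
      unfolding s(1) by (rule pw_approx_LIMSEQ) (use s K A in \<open>auto simp: field_simps\<close>)
    then have "(\<lambda>N. F N u) \<longlonglongrightarrow> borel_sum (of_real (s powr (1 / K))) / of_real s"
      unfolding F_def by (rule LIMSEQ_ignore_initial_segment)
    then have "(\<lambda>N. F (r N) u) \<longlonglongrightarrow> borel_sum (of_real (s powr (1 / K))) / of_real s"
      using LIMSEQ_subseq_LIMSEQ[OF _ g(2)] by (auto simp: o_def)
    then have "g u = borel_sum (of_real (s powr (1 / K))) / of_real s"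
      by (rule LIMSEQ_unique[OF g(3)[OF uS]])
    then show ?thesis using s powr_of_real[of s "1 / K"] by (simp add: G_def)
  qed
  have tS: "of_real t \<in> S" using of_real_in_acone[OF c assms] assms by (simp add: S_def T_def)
  have "G (of_real t) = 0"
  proof (rule analytic_continuation[OF _ opS conS _ _ _ gU tS])
    have "S \<inter> \<real>\<^sub>\<le>\<^sub>0 = {}"
      using acone_Re_pos[OF c] by (fastforce simp: S_def elim!: nonpos_Reals_cases)
    then show "G holomorphic_on S" unfolding G_def
      by (intro holomorphic_intros g holomorphic_on_compose_gen[unfolded o_def, OF _ holomorphic_borel[of UNIV]])
        (use nz in \<open>auto simp: S_def\<close>)
    \<comment> \<open>The midpoint of the interval, hence a limit point of \<open>U\<close>.\<close>
    define s where "s = min T (L / (8 * A powr (K / L) * K)) / 2"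
    show "U \<subseteq> S" using of_real_in_acone[OF c] by (auto simp: U_def S_def)
    have s: "0 < s" "s < T" using t0 T0 min.cobounded1[of T "L / (8 * A powr (K / L) * K)"] unfolding s_def by auto
    then show "of_real s \<in> S" using of_real_in_acone[OF c, of s] by (simp add: S_def)
    show "of_real s islimpt U"
    proof -
      have "s islimpt {0<..<min T (L / (8 * A powr (K / L) * K))}"
        using t0 half_gt_zero[OF t0] field_sum_of_halves[of "min T (L / (8 * A powr (K / L) * K))"]
        by (intro interior_limit_point, unfold s_def interior_open[OF open_greaterThanLessThan]) (simp only: greaterThanLessThan_iff, linarith)
      then show ?thesis unfolding U_def islimpt_sequential
        by (elim exE conjE, rename_tac f, rule_tac x = "of_real \<circ> f" in exI) (auto simp: o_def intro: tendsto_of_real)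
    qed
  qed
  then have "g (of_real t) = borel_sum (of_real (t powr (1 / K))) / of_real t"
    using assms powr_of_real[of t "1 / K"] by (simp add: G_def)
  moreover have "cmod (g (of_real t)) \<le> C0 * exp (4 * t)"
    by (rule LIMSEQ_le_const2[OF tendsto_norm[OF g(3)[OF tS]]]) (use bF[OF tS] assms in auto)
  ultimately have "cmod (borel_sum (of_real (t powr (1 / K)))) / t \<le> C0 * exp (4 * t)"
    using assms by (simp add: norm_divide)
  then show ?thesis using assms by (simp add: field_simps)
qed

text \<open>The previous bound at t = \<tau> powr K; the factor t is absorbed by exp t, so the
  constant 4 becomes 5.\<close>

lemma borel_growth:
  assumes "\<tau> > 0"
  shows "cmod (borel_sum (of_real \<tau>)) \<le> C0 * exp (5 * \<tau> powr K)"
proof -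
  define t where "t = \<tau> powr K"
  have t: "t > 0" "t powr (1 / K) = \<tau>" using assms K by (simp_all add: t_def powr_powr)
  have "cmod (borel_sum (of_real \<tau>)) \<le> C0 * t * exp (4 * t)" using borel_growth_cone[OF t(1)] t(2) by simp
  also have "\<dots> \<le> C0 * exp t * exp (4 * t)"
    using C0_pos exp_ge_add_one_self[of t] t(1) by (intro mult_left_mono mult_right_mono exp_ge_zero) linarith+
  finally show ?thesis by (simp add: t_def mult.assoc flip: exp_add)
qed

end

text \<open>In the coordinate u = log z the sector is a strip. A factor exp (- c2 e^(K u))
  compensates the growth on the two rays, and exp (- \<epsilon> e^(\<kappa>' u)) with \<kappa> <
  \<kappa>' < pi / \<eta> beats the global growth far out. The maximum principle on a rectangle and
  \<epsilon> \<rightarrow> 0 conclude. The rectangle begins at Re u = 0, hence the restriction to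
  modulus at least 1 and the constant C exp c.\<close>

lemma phragmen_lindelof_sector:
  fixes F :: "complex \<Rightarrow> complex"
  assumes hol: "F holomorphic_on UNIV"
    and pos: "0 < K" "0 < \<eta>" "0 \<le> C" "0 \<le> C1" "0 \<le> c" "0 \<le> c1"
    and kap: "K < \<kappa>" "\<kappa> * \<eta> < pi"
    and growth: "\<And>z. cmod (F z) \<le> C * exp (c * cmod z powr \<kappa>)"
    and rays: "\<And>\<tau>. \<tau> > 0 \<Longrightarrow> cmod (F (rcis \<tau> (\<theta> - \<eta> / 2))) \<le> C1 * exp (c1 * \<tau> powr K)"
      "\<And>\<tau>. \<tau> > 0 \<Longrightarrow> cmod (F (rcis \<tau> (\<theta> + \<eta> / 2))) \<le> C1 * exp (c1 * \<tau> powr K)"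
    and z: "\<tau> \<ge> 1" "\<bar>\<phi>\<bar> \<le> \<eta> / 2"
  shows "cmod (F (rcis \<tau> (\<theta> + \<phi>))) \<le> max C1 (C * exp c) * exp (c1 / cos (K * \<eta> / 2) * \<tau> powr K)"
proof -
  \<comment> \<open>Halfway between \<kappa> and pi / \<eta>.\<close>
  define \<kappa>' where "\<kappa>' = (\<kappa> + pi / \<eta>) / 2"
  have kap': "\<kappa> < \<kappa>'" "\<kappa>' * \<eta> < pi" "0 < \<kappa>'"
    using kap pos by (auto simp: \<kappa>'_def field_simps intro: add_pos_pos)
  define a where "a = cos (K * \<eta> / 2)"
  define b where "b = cos (\<kappa>' * \<eta> / 2)"
  have "K * \<eta> < \<kappa> * \<eta>" using kap pos by simp
  then have Keta: "K * \<eta> < pi" using kap(2) by linarith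
  have "0 < K * \<eta>" "0 < \<kappa>' * \<eta>" using pos kap'(3) by simp_all
  then have "- (pi / 2) < K * \<eta> / 2" "K * \<eta> / 2 < pi / 2" "- (pi / 2) < \<kappa>' * \<eta> / 2" "\<kappa>' * \<eta> / 2 < pi / 2"
    using Keta kap'(2) pi_gt_zero by linarith+
  note cos_pos = this
  have a: "0 < a" unfolding a_def by (rule cos_gt_zero_pi[OF cos_pos(1,2)])
  have b: "0 < b" unfolding b_def by (rule cos_gt_zero_pi[OF cos_pos(3,4)])
  define c2 where "c2 = c1 / a"
  have c2: "0 \<le> c2" using a pos(6) by (simp add: c2_def)
  define M where "M = max C1 (C * exp c)"
  have M: "0 \<le> M" using pos(4) by (simp add: M_def le_max_iff_disj)
  define u0 where "u0 = Complex (ln \<tau>) \<phi>"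
  define E where "E u = F (exp u * cis \<theta>)" for u
  have expE: "exp u * cis \<theta> = rcis (exp (Re u)) (\<theta> + Im u)" for u
    by (simp add: exp_eq_polar rcis_def cis_mult add.commute mult_ac)
  have eps: "cmod (E u0) * exp (- (c2 * exp (K * Re u0))) * exp (- (\<epsilon> * exp (\<kappa>' * Re u0))) \<le> M"
    if e: "\<epsilon> > 0" for \<epsilon>
  proof -
    \<comment> \<open>The right edge of the rectangle is moved so far out that the \<epsilon>-factor
      outweighs the global growth there.\<close>
    have "\<exists>X\<ge>ln \<tau>. c * exp (\<kappa> * X) \<le> \<epsilon> * b * exp (\<kappa>' * X)"
    proof -
      define X where "X = max (ln \<tau>) (ln (max 1 (c / (\<epsilon> * b))) / (\<kappa>' - \<kappa>))"
      have "c / (\<epsilon> * b) \<le> exp (ln (max 1 (c / (\<epsilon> * b))))" by simp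
      also have "ln (max 1 (c / (\<epsilon> * b))) / (\<kappa>' - \<kappa>) \<le> X" by (simp add: X_def)
      then have "ln (max 1 (c / (\<epsilon> * b))) \<le> (\<kappa>' - \<kappa>) * X"
        using kap'(1) by (simp add: pos_divide_le_eq mult.commute)
      finally have "c / (\<epsilon> * b) \<le> exp ((\<kappa>' - \<kappa>) * X)" by simp
      then have "c \<le> \<epsilon> * b * exp ((\<kappa>' - \<kappa>) * X)"
        using pos_divide_le_eq[OF mult_pos_pos[OF e b]] by (simp add: mult.commute)
      then have "c * exp (\<kappa> * X) \<le> \<epsilon> * b * exp ((\<kappa>' - \<kappa>) * X) * exp (\<kappa> * X)" by (intro mult_right_mono) auto
      also have "\<dots> = \<epsilon> * b * exp (\<kappa>' * X)" by (simp add: left_diff_distrib flip: exp_add)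
      finally show ?thesis by (intro exI[of _ X]) (simp add: X_def)
    qed
    then obtain X where X: "X \<ge> ln \<tau>" "c * exp (\<kappa> * X) \<le> \<epsilon> * b * exp (\<kappa>' * X)" by blast
    define G where "G u = E u * exp (- (of_real c2 * exp (of_real K * u))) * exp (- (of_real \<epsilon> * exp (of_real \<kappa>' * u)))" for u
    have holE: "E holomorphic_on UNIV" unfolding E_def
      by (intro holomorphic_on_compose_gen[unfolded o_def, OF _ hol] holomorphic_intros) auto
    have holG: "G holomorphic_on UNIV" unfolding G_def by (intro holomorphic_intros holE)
    define S where "S = cbox (Complex 0 (- \<eta> / 2)) (Complex X (\<eta> / 2))"
    have nG: "cmod (G u) = cmod (E u) * exp (- (c2 * exp (K * Re u) * cos (K * Im u)))
        * exp (- (\<epsilon> * exp (\<kappa>' * Re u) * cos (\<kappa>' * Im u)))" for u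
      by (simp add: G_def norm_mult Re_exp mult.assoc)
    \<comment> \<open>Over the strip the cosine is smallest on the two edges, because k \<eta> is
      below pi.\<close>
    have cosle: "cos (k * \<eta> / 2) \<le> cos (k * y)" if "\<bar>y\<bar> \<le> \<eta> / 2" "0 < k" "k * \<eta> < pi" for k y
    proof -
      have "k * \<bar>y\<bar> \<le> k * (\<eta> / 2)" "0 \<le> k * \<bar>y\<bar>" "k * \<eta> / 2 \<le> pi"
        using mult_left_mono[OF that(1), of k] that(2,3) pi_gt_zero by (simp_all, linarith?)
      then have "cos (k * \<eta> / 2) \<le> cos (k * \<bar>y\<bar>)" by (intro cos_monotone_0_pi_le) simp_all
      also have "cos (k * \<bar>y\<bar>) = cos (k * y)" by (cases "y \<ge> 0") simp_all
      finally show ?thesis .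
    qed
    have bnd: "cmod (G u) \<le> M" if "u \<in> frontier S" for u
    proof -
      have "u \<in> S - box (Complex 0 (- \<eta> / 2)) (Complex X (\<eta> / 2))"
        using that by (simp add: S_def frontier_cbox)
      then have u: "0 \<le> Re u" "Re u \<le> X" "\<bar>Im u\<bar> \<le> \<eta> / 2"
        "Re u = 0 \<or> Re u = X \<or> Im u = - \<eta> / 2 \<or> Im u = \<eta> / 2"
        unfolding S_def Diff_iff in_cbox_complex_iff in_box_complex_iff complex.sel atLeastAtMost_iff greaterThanLessThan_iff
        by - linarith+
      note c1 = cosle[OF u(3) pos(1) Keta] and c2' = cosle[OF u(3) kap'(3,2)]
      have e1: "exp (- (c2 * exp (K * Re u) * cos (K * Im u))) \<le> 1"
      proof -
        have "0 \<le> cos (K * Im u)" using order_trans[OF less_imp_le[OF a] c1[folded a_def]] .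
        then have "0 \<le> c2 * exp (K * Re u) * cos (K * Im u)" using c2 by (intro mult_nonneg_nonneg exp_ge_zero)
        then show ?thesis by (simp only: exp_le_one_iff neg_le_0_iff_le)
      qed
      have e2: "exp (- (\<epsilon> * exp (\<kappa>' * Re u) * cos (\<kappa>' * Im u))) \<le> exp (- (\<epsilon> * exp (\<kappa>' * Re u) * b))"
        using mult_left_mono[OF c2'[folded b_def], of "\<epsilon> * exp (\<kappa>' * Re u)"] e
        by (simp only: exp_le_cancel_iff neg_le_iff_le) simp
      have e2': "exp (- (\<epsilon> * exp (\<kappa>' * Re u) * b)) \<le> 1" using e b by simp
      have gE: "cmod (E u) \<le> C * exp (c * exp (\<kappa> * Re u))"
        using growth[of "exp u * cis \<theta>"] by (simp add: E_def norm_mult exp_powr_real mult.commute[of _ \<kappa>])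
      consider "Re u = 0" | "Re u = X" | "Im u = - \<eta> / 2 \<or> Im u = \<eta> / 2" using u by blast
      then show ?thesis
      proof cases
        case 1
        have "cmod (G u) \<le> cmod (E u) * 1 * 1"
          unfolding nG by (intro mult_mono e1 order_trans[OF e2 e2']) auto
        then show ?thesis using gE 1 by (simp add: M_def)
      next
        case 2
        have "cmod (G u) \<le> cmod (E u) * 1 * exp (- (\<epsilon> * exp (\<kappa>' * Re u) * b))"
          unfolding nG by (intro mult_mono e1 e2) auto
        also have "\<dots> \<le> C * exp (c * exp (\<kappa> * Re u)) * 1 * exp (- (\<epsilon> * exp (\<kappa>' * Re u) * b))"
          by (intro mult_right_mono gE) auto
        also have "\<dots> = C * exp (c * exp (\<kappa> * X) - \<epsilon> * b * exp (\<kappa>' * X))"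
          using 2 by (simp add: exp_diff exp_minus divide_inverse mult_ac)
        also have "\<dots> \<le> C * 1" using X(2) pos by (intro mult_left_mono) auto
        also have "\<dots> \<le> C * exp c" using pos by (intro mult_left_mono) auto
        finally show ?thesis by (simp add: M_def)
      next
        case 3
        have "cmod (E u) \<le> C1 * exp (c1 * exp (Re u) powr K)"
          using 3 rays[of "exp (Re u)"] by (auto simp: E_def expE)
        then have "cmod (E u) \<le> C1 * exp (c1 * exp (K * Re u))"
          by (simp add: exp_powr_real mult.commute)
        moreover have "cos (K * Im u) = a" using 3 by (auto simp: a_def)
        ultimately have "cmod (G u) \<le> C1 * exp (c1 * exp (K * Re u)) * exp (- (c2 * exp (K * Re u) * a)) * 1"
          unfolding nG using pos by (intro mult_mono order_trans[OF e2 e2']) (auto intro: mult_nonneg_nonneg)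
        also have "c2 * exp (K * Re u) * a = c1 * exp (K * Re u)" using a by (simp add: c2_def)
        finally show ?thesis by (simp add: M_def mult.assoc flip: exp_add)
      qed
    qed
    have "- \<eta> / 2 \<le> \<phi>" "\<phi> \<le> \<eta> / 2" using z(2) by linarith+
    then have u0S: "u0 \<in> S" using z(1) X(1) by (simp add: S_def u0_def in_cbox_complex_iff)
    have "cmod (G u0) \<le> M"
    proof (rule maximum_modulus_frontier[OF _ _ _ bnd u0S])
      show "G holomorphic_on interior S" by (rule holomorphic_on_subset[OF holG]) simp
      show "continuous_on (closure S) G"
        by (rule continuous_on_subset[OF holomorphic_on_imp_continuous_on[OF holG]]) simp
    qed (simp add: S_def)
    moreover have "exp (- (c2 * exp (K * Re u0))) \<le> exp (- (c2 * exp (K * Re u0) * cos (K * Im u0)))"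
      using mult_left_mono[OF cos_le_one, of "c2 * exp (K * Re u0)" "K * Im u0"] c2
      by (simp only: exp_le_cancel_iff neg_le_iff_le) simp
    moreover have "exp (- (\<epsilon> * exp (\<kappa>' * Re u0))) \<le> exp (- (\<epsilon> * exp (\<kappa>' * Re u0) * cos (\<kappa>' * Im u0)))"
      using mult_left_mono[OF cos_le_one, of "\<epsilon> * exp (\<kappa>' * Re u0)" "\<kappa>' * Im u0"] e
      by (simp only: exp_le_cancel_iff neg_le_iff_le) simp
    ultimately have "cmod (E u0) * exp (- (c2 * exp (K * Re u0))) * exp (- (\<epsilon> * exp (\<kappa>' * Re u0))) \<le> cmod (G u0)"
      unfolding nG by (intro mult_mono order_refl) (auto intro!: mult_nonneg_nonneg)
    with \<open>cmod (G u0) \<le> M\<close> show ?thesis by linarith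
  qed
  \<comment> \<open>The bound M does not depend on \<epsilon>, so the auxiliary factor disappears in
    the limit.\<close>
  have "((\<lambda>\<epsilon>. cmod (E u0) * exp (- (c2 * exp (K * Re u0))) * exp (- (\<epsilon> * exp (\<kappa>' * Re u0)))) \<longlongrightarrow>
     cmod (E u0) * exp (- (c2 * exp (K * Re u0))) * exp (- (0 * exp (\<kappa>' * Re u0)))) (at_right 0)"
    by (intro tendsto_intros)
  then have "cmod (E u0) * exp (- (c2 * exp (K * Re u0))) * exp (- (0 * exp (\<kappa>' * Re u0))) \<le> M"
    by (rule tendsto_upperbound) (use eps in \<open>auto simp: eventually_at_filter\<close>)
  then have "cmod (E u0) \<le> M * exp (c2 * exp (K * Re u0))"
    by (simp add: exp_minus field_simps)
  moreover have "E u0 = F (rcis \<tau> (\<theta> + \<phi>))" using z by (simp add: E_def expE u0_def)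
  moreover have "exp (K * Re u0) = \<tau> powr K" using z by (simp add: u0_def powr_def)
  ultimately show ?thesis by (simp add: M_def c2_def a_def)
qed

text \<open>Coefficients of the series are recovered from \<open>p n * rGamma (n / K)\<close>, since
  \<open>Gamma (n / K) \<le> C * (n / K) powr (n / K)\<close> compensates the Cauchy estimate on the circle of radius
  \<open>n powr (1 / K)\<close>.\<close>

lemma coefficient_bound_of_growth:
  fixes K C c :: real
  assumes pos: "0 < K" "0 < C" "0 \<le> c"
  shows "\<exists>C'>0. \<exists>A'>0. \<forall>p a F n. F holomorphic_on UNIV \<longrightarrow> (\<forall>z. (\<lambda>n. a n * z ^ n) sums F z) \<longrightarrow>
     (\<forall>z. cmod z \<ge> 1 \<longrightarrow> cmod (F z) \<le> C * exp (c * cmod z powr K)) \<longrightarrow>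
     real n \<ge> K \<longrightarrow> a n = p * of_real (rGamma (n / K)) \<longrightarrow> cmod p \<le> C' * A' ^ n"
proof -
  obtain G where G: "G > 0" "\<And>z. z \<ge> 1 \<Longrightarrow> Gamma z \<le> G * (z::real) powr z"
    using Gamma_upper_bound by blast
  show ?thesis
  proof (intro exI conjI allI impI)
    show "C * G > 0" "exp c / K powr (1 / K) > 0" using pos G by auto
    fix p :: complex and a F n
    assume F: "F holomorphic_on UNIV" "\<forall>z. (\<lambda>n. a n * z ^ n) sums F z"
      "\<forall>z. cmod z \<ge> 1 \<longrightarrow> cmod (F z) \<le> C * exp (c * cmod z powr K)"
      and n: "real n \<ge> K" and an: "a n = p * of_real (rGamma (n / K))"
    have n0: "real n > 0" "n \<ge> 1" using n pos by linarith+
    have z: "n / K \<ge> 1" using n pos by simp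
    define R where "R = real n powr (1 / K)"
    have R: "R \<ge> 1" "R powr K = n" "R ^ n = n powr (n / K)"
      using n0 pos by (auto simp: R_def powr_powr ge_one_powr_ge_zero simp flip: powr_realpow)
    have "norm (1::complex) \<le> conv_radius a"
      by (rule conv_radius_geI) (use F(2)[rule_format, of 1] in \<open>auto simp: sums_iff\<close>)
    then have "0 < fps_conv_radius (Abs_fps a)"
      using less_le_trans[of 0 "ereal 1" "conv_radius a"] by (simp add: fps_conv_radius_def)
    moreover have "eval_fps (Abs_fps a) = F"
      using F(2) by (auto simp: eval_fps_def sums_iff fun_eq_iff)
    ultimately have "(deriv ^^ n) F 0 = fact n * a n" using fps_nth_conv_deriv[of "Abs_fps a" n] by simp
    moreover have "cmod ((deriv ^^ n) F 0) \<le> fact n * (C * exp (c * n)) / R ^ n"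
    proof (rule Cauchy_inequality)
      show "cmod (F x) \<le> C * exp (c * n)" if "cmod (0 - x) = R" for x
        using F(3)[rule_format, of x] R that by simp
    qed (use R in \<open>auto intro: holomorphic_on_subset[OF F(1)]
          continuous_on_subset[OF holomorphic_on_imp_continuous_on[OF F(1)]]\<close>)
    ultimately have "cmod (a n) \<le> C * exp (c * n) / R ^ n"
      by (simp add: norm_mult mult.assoc flip: times_divide_eq_right)
    moreover have "cmod p = cmod (a n) * Gamma (n / K)"
    proof -
      have "Gamma (n / K) > 0" by (rule Gamma_real_pos) (use n0 pos in simp)
      then show ?thesis by (simp add: an norm_mult rGamma_inverse_Gamma norm_inverse del: of_real_divide)
    qed
    moreover have "0 \<le> Gamma (n / K)" by (rule Gamma_real_nonneg) (use n0 pos in simp)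
    ultimately have "cmod p \<le> C * exp (c * n) / R ^ n * (G * (n / K) powr (n / K))"
      using mult_mono[OF \<open>cmod (a n) \<le> _\<close> G(2)[OF z]] pos(2) R(1) by simp
    also have "\<dots> = C * G * exp (c * n) / K powr (n / K)"
      using n0 pos unfolding R by (simp add: powr_divide)
    also have "\<dots> = C * G * (exp c / K powr (1 / K)) ^ n"
    proof -
      have "exp (c * n) = exp c ^ n" by (rule exp_of_nat2_mult)
      moreover have "K powr (n / K) = (K powr (1 / K)) ^ n"
        using pos(1) by (simp add: powr_powr flip: powr_realpow)
      ultimately show ?thesis by (simp add: power_divide)
    qed
    finally show "cmod p \<le> C * G * (exp c / K powr (1 / K)) ^ n" .
  qed
qed

text \<open>Neighbouring rays are \<eta> apart, less than pi \<sigma> for \<sigma> = 1 / K - 1 / K2,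
  and since m \<eta> \<ge> 2 pi every z lies between two of them. There the Phragmen-Lindelof
  principle applies to the Borel transform, which is entire of order at most 1 / \<sigma>. The
  constants precede \<open>p\<close>, because one choice must serve a whole family of
  sequences.\<close>

theorem scalar_tauberian:
  fixes K K2 C A c \<theta>0 \<eta> :: real and L m :: nat
  assumes K: "0 < K" "K < K2" and L: "0 < L" and c: "0 < c" and C: "0 < C" and A: "0 < A"
    and \<eta>: "0 < \<eta>" "\<eta> / (1 / K - 1 / K2) < pi" "2 * pi \<le> m * \<eta>"
  shows "\<exists>C'>0. \<exists>A'>0. \<forall>p. (\<forall>n. cmod (p n) \<le> C * A ^ n * fact n powr (1 / K2)) \<longrightarrow>
    (\<forall>i\<le>m. \<exists>h. h holomorphic_on wide_sector c \<and> (\<forall>M. \<forall>v\<in>wide_sector c.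
      cmod (h v - (\<Sum>n<M * L. p n * cis (n * (\<theta>0 + i * \<eta>)) * v powr - of_real (n / K)))
        \<le> C * A ^ M * fact M powr (L / K) * cmod v powr - (M * L / K))) \<longrightarrow>
    (\<forall>n. cmod (p n) \<le> C' * A' ^ n)"
proof -
  define M0 where "M0 = nat \<lceil>2 * K\<rceil>"
  have M0: "2 * K \<le> real (M0 * L)"
  proof -
    have "2 * K \<le> real M0" unfolding M0_def by linarith
    also have "\<dots> \<le> real (M0 * L)" using L by (intro of_nat_mono) auto
    finally show ?thesis .
  qed
  define \<sigma> where "\<sigma> = 1 / K - 1 / K2"
  \<comment> \<open>The order 1 / \<sigma> exceeds K; this is the hypothesis K < \<kappa> of the
    principle.\<close>
  have \<sigma>: "\<sigma> > 0" "1 / \<sigma> > K"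
  proof -
    have "1 / K2 < 1 / K" by (rule divide_strict_left_mono) (use K in auto)
    then show "\<sigma> > 0" by (simp only: \<sigma>_def diff_gt_0_iff_gt)
    moreover have "\<sigma> < 1 / K" using K by (simp add: \<sigma>_def)
    ultimately show "1 / \<sigma> > K" using K by (simp add: field_simps)
  qed
  obtain C1 A1 where C1: "C1 > 0" "A1 > 0" "\<And>n::nat. n > 0 \<Longrightarrow>
     C * A ^ n * fact n powr (1 / K2) * (6 powr (n / K + 1) * (n / K) powr (1 - n / K))
    \<le> C1 * A1 ^ n * fact n powr (- (1 / K - 1 / K2))"
    using coefficient_decay[OF K C A] by blast
  define D0 where "D0 = C * A ^ M0 * fact M0 powr (L / K)"
  define c2 where "c2 = (2 * A1) powr (1 / \<sigma>) * \<sigma>"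
  define C2 where "C2 = max D0 (2 * C1 * exp c2)"
  define c3 where "c3 = 5 / cos (K * \<eta> / 2)"
  have keta: "1 / \<sigma> * \<eta> < pi" using \<eta> by (simp add: \<sigma>_def)
  have "K * \<eta> < 1 / \<sigma> * \<eta>" using \<sigma>(2) \<eta>(1) by (intro mult_strict_right_mono)
  then have "cos (K * \<eta> / 2) > 0" using keta mult_pos_pos[OF K(1) \<eta>(1)] by (intro cos_gt_zero_pi) linarith+
  then have c3: "c3 > 0" by (simp add: c3_def)
  have C2: "C2 > 0" using C1 by (simp add: C2_def less_max_iff_disj)
  from coefficient_bound_of_growth[OF K(1) C2 less_imp_le[OF c3]]
  obtain C3 A3 where C3: "C3 > 0" "A3 > 0" and coef: "\<forall>p a F n. F holomorphic_on UNIV \<longrightarrow> (\<forall>z. (\<lambda>n. a n * z ^ n) sums F z) \<longrightarrow>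
     (\<forall>z. cmod z \<ge> 1 \<longrightarrow> cmod (F z) \<le> C2 * exp (c3 * cmod z powr K)) \<longrightarrow>
     real n \<ge> K \<longrightarrow> a n = p * of_real (rGamma (n / K)) \<longrightarrow> cmod p \<le> C3 * A3 ^ n"
    by (elim exE conjE)
  \<comment> \<open>Covers the finitely many coefficients that are not seen by the truncated Borel
    transform.\<close>
  define C4 where "C4 = C * fact (M0 * L) powr (1 / K2)"
  have C4: "C4 > 0" using C by (simp add: C4_def)
  have main: "cmod (p n) \<le> (C3 + C4) * (A3 + A) ^ n"
    if p: "\<forall>n. cmod (p n) \<le> C * A ^ n * fact n powr (1 / K2)"
    and h: "\<forall>i\<le>m. \<exists>h. h holomorphic_on wide_sector c \<and> (\<forall>M. \<forall>v\<in>wide_sector c.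
      cmod (h v - (\<Sum>n<M * L. p n * cis (n * (\<theta>0 + i * \<eta>)) * v powr - of_real (n / K)))
        \<le> C * A ^ M * fact M powr (L / K) * cmod v powr - (M * L / K))" for p n
  proof (cases "n < M0 * L")
    case True
    have "cmod (p n) \<le> C * A ^ n * fact n powr (1 / K2)" using p by blast
    also have "\<dots> \<le> C * A ^ n * fact (M0 * L) powr (1 / K2)"
      using True C A K by (intro mult_left_mono powr_mono2) (auto intro: fact_mono)
    also have "\<dots> = C4 * A ^ n" by (simp add: C4_def)
    also have "\<dots> \<le> (C3 + C4) * (A3 + A) ^ n"
      using C4 C3 A by (intro mult_mono power_mono) auto
    finally show ?thesis .
  next
    case False
    define a where "a n = (if n < M0 * L then 0 else p n * of_real (rGamma (n / K)))" for n
    define F where "F z = (\<Sum>n. a n * z ^ n)" for z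
    have ray: "cmod (F (rcis \<tau> (\<theta>0 + i * \<eta>))) \<le> D0 * exp (5 * \<tau> powr K)" 
      and ab: "cmod (a n) \<le> C1 * A1 ^ n * fact n powr (- \<sigma>)" if im: "i \<le> m" and tau: "\<tau> > 0" for i \<tau> n
    proof -
      obtain h where h: "h holomorphic_on wide_sector c" "\<And>M v. v \<in> wide_sector c \<Longrightarrow>
      cmod (h v - (\<Sum>n<M * L. p n * cis (n * (\<theta>0 + i * \<eta>)) * v powr - of_real (n / K)))
        \<le> C * A ^ M * fact M powr (L / K) * cmod v powr - (M * L / K)"
        using h[rule_format, OF im] by blast
      interpret gevrey_pair K K2 C A c L M0 "\<lambda>n. p n * cis (n * (\<theta>0 + i * \<eta>))" h
        by unfold_locales (use K L c C A M0 p h in \<open>auto simp: norm_mult\<close>)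
      \<comment> \<open>On the ray with index i the coefficients are twisted by powers of one
        unimodular number, which amounts to rotating the argument of a fixed function
        \<open>F\<close>.\<close>
      have bc: "borel_coeff n = a n * cis (n * (\<theta>0 + i * \<eta>))" for n
        by (simp add: borel_coeff_def a_def)
      have "borel_sum (of_real \<tau>) = F (rcis \<tau> (\<theta>0 + i * \<eta>))"
        unfolding borel_sum_def F_def bc rcis_def power_mult_distrib
        by (simp only: Complex.DeMoivre mult_ac)
      then show "cmod (F (rcis \<tau> (\<theta>0 + i * \<eta>))) \<le> D0 * exp (5 * \<tau> powr K)"
        using borel_growth[OF tau] by (simp add: D0_def C0_def)
      show "cmod (a n) \<le> C1 * A1 ^ n * fact n powr (- \<sigma>)"
        using borel_coeff_bound(2)[OF C1(3,1,2), of n] by (simp add: bc norm_mult \<sigma>_def)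
    qed
    \<comment> \<open>The bound for the coefficients is the same for all rays, so it is read off at
      i = 0.\<close>
    note ab = ab[OF le0 zero_less_one]
    note F = entire_power_series[OF ab _ _ \<sigma>(1), folded F_def]
    have C1': "0 \<le> C1" "0 \<le> A1" using C1 by auto
    have growth: "cmod (F z) \<le> 2 * C1 * exp (c2 * cmod z powr (1 / \<sigma>))" for z
      using F(3)[OF C1'] C1 by (simp add: c2_def powr_mult mult_ac)
    have FC2: "cmod (F z) \<le> C2 * exp (c3 * cmod z powr K)" if z: "cmod z \<ge> 1" for z
    proof -
      define t where "t = Arg2pi (z / cis \<theta>0)"
      have t: "0 \<le> t" "t < 2 * pi" unfolding t_def by (auto simp: Arg2pi_lt_2pi Arg2pi_ge_0)
      have "z / cis \<theta>0 = rcis (cmod z) t"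
        using Arg2pi_eq[of "z / cis \<theta>0"] by (simp add: t_def norm_divide rcis_def cis_conv_exp)
      then have zt: "z = rcis (cmod z) (\<theta>0 + t)"
        by (simp add: rcis_def field_simps flip: cis_mult)
      \<comment> \<open>z lies between the rays with indices i and i + 1; the angle \<theta> below
        is that of their bisector.\<close>
      define i where "i = nat \<lfloor>t / \<eta>\<rfloor>"
      have i: "real i * \<eta> \<le> t" "t < (real i + 1) * \<eta>"
      proof -
        have "real i \<le> t / \<eta>" "t / \<eta> < real i + 1"
          using t \<eta> unfolding i_def by (auto intro: of_nat_floor)
        then show "real i * \<eta> \<le> t" "t < (real i + 1) * \<eta>" using \<eta> by (auto simp: field_simps)
      qed
      have "real i * \<eta> < real m * \<eta>" using i t \<eta>(3) by linarith
      then have im: "i < m" using \<eta>(1) by simp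
      define \<theta> where "\<theta> = \<theta>0 + i * \<eta> + \<eta> / 2"
      have "cmod (F (rcis (cmod z) (\<theta> + (\<theta>0 + t - \<theta>)))) \<le> max D0 (2 * C1 * exp c2) * exp (5 / cos (K * \<eta> / 2) * cmod z powr K)"
      proof (rule phragmen_lindelof_sector[OF F(2)[OF C1'] K(1) \<eta>(1) _ _ _ _ \<sigma>(2) keta growth _ _ z])
        fix \<tau> :: real assume "\<tau> > 0"
        show "cmod (F (rcis \<tau> (\<theta> - \<eta> / 2))) \<le> D0 * exp (5 * \<tau> powr K)"
          using ray[of i \<tau>] im \<open>\<tau> > 0\<close> by (simp add: \<theta>_def)
        show "cmod (F (rcis \<tau> (\<theta> + \<eta> / 2))) \<le> D0 * exp (5 * \<tau> powr K)"
          using ray[of "Suc i" \<tau>] im \<open>\<tau> > 0\<close> by (simp add: \<theta>_def algebra_simps)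
      next
        show "\<bar>\<theta>0 + t - \<theta>\<bar> \<le> \<eta> / 2" using i unfolding \<theta>_def distrib_right abs_le_iff by linarith
      qed (use C1 C A \<sigma> in \<open>auto simp: D0_def c2_def\<close>)
      then show ?thesis using zt by (simp add: C2_def c3_def)
    qed
    have "real (M0 * L) \<le> real n" using False by (intro of_nat_mono) auto
    then have nK: "real n \<ge> K" using M0 K by linarith
    have "cmod (p n) \<le> C3 * A3 ^ n"
    proof (rule coef[rule_format, OF F(2)[OF C1'] _ FC2 nK])
      show "(\<lambda>n. a n * z ^ n) sums F z" for z
        unfolding F_def by (rule summable_sums[OF F(1)[OF C1']])
    qed (use False in \<open>simp_all add: a_def\<close>)
    also have "\<dots> \<le> (C3 + C4) * (A3 + A) ^ n" using C4 C3 A by (intro mult_mono power_mono) auto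
    finally show ?thesis .
  qed
  show ?thesis
    by (intro exI[of _ "C3 + C4"] exI[of _ "A3 + A"] conjI allI impI main) (use C3 C4 A in auto)
qed

section \<open>Norming functionals\<close>

text \<open>Hahn-Banach by Zorn's lemma on graphs: subspaces of pairs (y, r) with r \<le> norm y.
  Such a subspace is automatically single-valued, since two values at one y would produce a pair (0,
  r) with r > 0.\<close>

lemma real_norming_functional:
  fixes x :: "'a::real_normed_vector"
  obtains f :: "'a \<Rightarrow> real" where "linear f" "\<And>y. f y \<le> norm y" "f x = norm x"
proof -
  define \<A> where "\<A> = {G :: ('a \<times> real) set. subspace G \<and> (x, norm x) \<in> G \<and> (\<forall>(y, r)\<in>G. r \<le> norm y)}"
  have "span {(x, norm x)} \<in> \<A>"
  proof -
    have "r \<le> norm y" if "(y, r) \<in> span {(x, norm x)}" for y r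
      using that by (auto simp: span_singleton mult_right_mono[OF abs_ge_self])
    then show ?thesis by (auto simp: \<A>_def subspace_span span_base)
  qed
  then have ne: "\<A> \<noteq> {}" by blast
  have "\<exists>M\<in>\<A>. \<forall>X\<in>\<A>. M \<subseteq> X \<longrightarrow> X = M"
  proof (rule subset_Zorn_nonempty[OF ne])
    fix \<C> assume C: "\<C> \<noteq> {}" "subset.chain \<A> \<C>"
    then have sub: "\<C> \<subseteq> \<A>" and ch: "\<And>X Y. X \<in> \<C> \<Longrightarrow> Y \<in> \<C> \<Longrightarrow> X \<subseteq> Y \<or> Y \<subseteq> X"
      by (auto simp: subset_chain_def)
    have "subspace (\<Union>\<C>)"
      unfolding subspace_def
    proof (intro conjI ballI allI)
      obtain X where "X \<in> \<C>" using C(1) by blast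
      moreover from this have "0 \<in> X" using sub subspace_0 unfolding \<A>_def by blast
      ultimately show "0 \<in> \<Union>\<C>" by blast
    next
      fix u v assume "u \<in> \<Union>\<C>" "v \<in> \<Union>\<C>"
      then obtain X Y where XY: "X \<in> \<C>" "u \<in> X" "Y \<in> \<C>" "v \<in> Y" by blast
      then obtain Z where "Z \<in> \<C>" "u \<in> Z" "v \<in> Z" using ch[OF XY(1,3)] by blast
      then show "u + v \<in> \<Union>\<C>" using sub by (auto simp: \<A>_def intro: subspace_add)
    next
      fix u and c :: real assume "u \<in> \<Union>\<C>"
      then obtain X where "X \<in> \<C>" "u \<in> X" by blast
      moreover from this have "c *\<^sub>R u \<in> X" using sub subspace_mul unfolding \<A>_def by blast
      ultimately show "c *\<^sub>R u \<in> \<Union>\<C>" by blast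
    qed
    moreover have "(x, norm x) \<in> \<Union>\<C>" using C(1) sub unfolding \<A>_def by blast
    moreover have "\<forall>(y, r)\<in>\<Union>\<C>. r \<le> norm y" using sub unfolding \<A>_def by blast
    ultimately show "\<Union>\<C> \<in> \<A>" unfolding \<A>_def by blast
  qed
  then obtain M where M: "M \<in> \<A>" and max: "\<And>X. X \<in> \<A> \<Longrightarrow> M \<subseteq> X \<Longrightarrow> X = M" by blast
  have sM: "subspace M" and xM: "(x, norm x) \<in> M" and leM: "\<And>y r. (y, r) \<in> M \<Longrightarrow> r \<le> norm y"
    using M by (auto simp: \<A>_def)
  have addM: "(u + v, r + q) \<in> M" if "(u, r) \<in> M" "(v, q) \<in> M" for u v r q
    using subspace_add[OF sM that] by simp
  have mulM: "(c *\<^sub>R u, c * r) \<in> M" if "(u, r) \<in> M" for u r c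
    using subspace_mul[OF sM that, of c] by simp
  have uniq: "r = q" if "(y, r) \<in> M" "(y, q) \<in> M" for y r q
    using leM[OF addM[OF that(1) mulM[OF that(2), of "-1"]]] leM[OF addM[OF that(2) mulM[OF that(1), of "-1"]]] by simp
  have total: "\<exists>r. (y, r) \<in> M" for y
  proof (rule ccontr)
    assume y: "\<nexists>r. (y, r) \<in> M"
    \<comment> \<open>Every lower bound for the new value at y is below every upper bound, so a
      value s fits in between.\<close>
    have key: "r - norm (u - y) \<le> norm (v + y) - q" if "(u, r) \<in> M" "(v, q) \<in> M" for u r v q
      using leM[OF addM[OF that]] norm_triangle_ineq[of "u - y" "v + y"] by simp
    define s where "s = (SUP (u, r)\<in>M. r - norm (u - y))"
    have bdd: "bdd_above ((\<lambda>(u, r). r - norm (u - y)) ` M)"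
      using key[OF _ xM] by (auto intro!: bdd_aboveI)
    have s1: "r - norm (u - y) \<le> s" if "(u, r) \<in> M" for u r
      unfolding s_def using cSUP_upper[OF that bdd] by simp
    have s2: "s \<le> norm (v + y) - q" if "(v, q) \<in> M" for v q
      unfolding s_def using xM key[OF _ that] by (intro cSUP_least) auto
    \<comment> \<open>The graph extended by the value s at y. Scaling by 1 / |c| reduces the norm
      condition to the two bounds for s, one for each sign of c.\<close>
    define M' where "M' = {(u + c *\<^sub>R y, r + c * s) | u r c. (u, r) \<in> M}"
    have "subspace M'"
      unfolding subspace_def
    proof (intro conjI ballI allI)
      show "0 \<in> M'" using subspace_0[OF sM] by (auto simp: M'_def zero_prod_def intro!: exI[of _ 0])
    next
      fix a b assume "a \<in> M'" "b \<in> M'"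
      then obtain u r c u' r' c' where "(u, r) \<in> M" "(u', r') \<in> M"
        "a = (u + c *\<^sub>R y, r + c * s)" "b = (u' + c' *\<^sub>R y, r' + c' * s)"
        unfolding M'_def by blast
      then show "a + b \<in> M'" unfolding M'_def mem_Collect_eq
        by (intro exI[of _ "u + u'"] exI[of _ "r + r'"] exI[of _ "c + c'"]) (auto simp: algebra_simps addM)
    next
      fix a and d :: real assume "a \<in> M'"
      then obtain u r c where "(u, r) \<in> M" "a = (u + c *\<^sub>R y, r + c * s)" by (auto simp: M'_def)
      then show "d *\<^sub>R a \<in> M'" unfolding M'_def mem_Collect_eq
        by (intro exI[of _ "d *\<^sub>R u"] exI[of _ "d * r"] exI[of _ "d * c"]) (auto simp: algebra_simps mulM)
    qed
    moreover have MM: "M \<subseteq> M'"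
    proof
      fix a assume "a \<in> M"
      then have "(fst a, snd a) \<in> M" "a = (fst a + 0 *\<^sub>R y, snd a + 0 * s)" by simp_all
      then show "a \<in> M'" unfolding M'_def by blast
    qed
    moreover have "r + c * s \<le> norm (u + c *\<^sub>R y)" if "(u, r) \<in> M" for u r c
    proof -
      consider "c = 0" | "c > 0" | "c < 0" by linarith
      then show ?thesis
      proof cases
        case 1 then show ?thesis using leM[OF that] by simp
      next
        case 2
        have "c * s \<le> c * (norm ((1 / c) *\<^sub>R u + y) - (1 / c) * r)"
          using s2[OF mulM[OF that, of "1 / c"]] 2 by (intro mult_left_mono) auto
        also have "\<dots> = norm (c *\<^sub>R ((1 / c) *\<^sub>R u + y)) - r" using 2 by (simp add: right_diff_distrib)
        also have "c *\<^sub>R ((1 / c) *\<^sub>R u + y) = u + c *\<^sub>R y" using 2 by (simp add: scaleR_add_right)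
        finally show ?thesis by simp
      next
        case 3
        define d where "d = - c"
        have d: "d > 0" using 3 by (simp add: d_def)
        have "d * ((1 / d) * r - norm ((1 / d) *\<^sub>R u - y)) \<le> d * s"
          using s1[OF mulM[OF that, of "1 / d"]] d by (intro mult_left_mono) auto
        also have "d * ((1 / d) * r - norm ((1 / d) *\<^sub>R u - y)) = r - norm (d *\<^sub>R ((1 / d) *\<^sub>R u - y))"
          using d by (simp add: right_diff_distrib)
        also have "d *\<^sub>R ((1 / d) *\<^sub>R u - y) = u + c *\<^sub>R y" using d by (simp add: scaleR_diff_right d_def)
        finally show ?thesis by (simp add: d_def)
      qed
    qed
    ultimately have "M' \<in> \<A>" using xM unfolding \<A>_def M'_def by blast
    then have "M' = M" using max MM by blast
    moreover have "(0 + 1 *\<^sub>R y, 0 + 1 * s) \<in> M'"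
      using subspace_0[OF sM] unfolding M'_def zero_prod_def by blast
    ultimately show False using y by auto
  qed
  define f where "f y = (THE r. (y, r) \<in> M)" for y
  have f: "(y, f y) \<in> M" for y
    using total[of y] uniq unfolding f_def by (metis theI)
  have "linear f"
  proof (rule linearI)
    show "f (u + v) = f u + f v" for u v by (rule uniq[OF f addM[OF f f]])
    show "f (c *\<^sub>R u) = c *\<^sub>R f u" for c u using uniq[OF f mulM[OF f]] by simp
  qed
  then show thesis using that leM[OF f] uniq[OF f xM] by blast
qed

definition linear_contraction :: "('e::complex_banach \<Rightarrow> complex) \<Rightarrow> bool" where
  "linear_contraction \<Lambda> \<longleftrightarrow> (\<forall>x y. \<Lambda> (x + y) = \<Lambda> x + \<Lambda> y) \<and> (\<forall>c x. \<Lambda> (c *\<^sub>C x) = c * \<Lambda> x) \<and>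
     (\<forall>x. cmod (\<Lambda> x) \<le> norm x)"

section \<open>Complex scalar multiplication and complex functionals\<close>

lemma scaleC_zero_left [simp]: "0 *\<^sub>C (x :: 'a::complex_vector) = 0"
  using scaleC_add_left[of 0 0 x] by simp

lemma scaleC_zero_right [simp]: "c *\<^sub>C (0 :: 'a::complex_vector) = 0"
  using scaleC_add_right[of c 0 "0::'a"] by simp

lemma scaleC_minus_left: "(- c) *\<^sub>C (x :: 'a::complex_vector) = - (c *\<^sub>C x)"
  using scaleC_add_left[of c "-c" x] by (simp add: eq_neg_iff_add_eq_0 add.commute)

lemma scaleC_minus_right: "c *\<^sub>C (- x :: 'a::complex_vector) = - (c *\<^sub>C x)"
  using scaleC_add_right[of c x "-x"] by (simp add: eq_neg_iff_add_eq_0 add.commute)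

lemma scaleC_diff_right: "c *\<^sub>C (x - y :: 'a::complex_vector) = c *\<^sub>C x - c *\<^sub>C y"
  using scaleC_add_right[of c x "-y"] by (simp add: scaleC_minus_right)

lemma scaleC_diff_left: "(b - c) *\<^sub>C (x :: 'a::complex_vector) = b *\<^sub>C x - c *\<^sub>C x"
  using scaleC_add_left[of b "-c" x] by (simp add: scaleC_minus_left)

lemma scaleC_sum_right: "c *\<^sub>C (\<Sum>i\<in>A. f i) = (\<Sum>i\<in>A. c *\<^sub>C (f i :: 'a::complex_vector))"
  by (induction A rule: infinite_finite_induct) (simp_all add: scaleC_add_right)

lemma scaleC_sum_left: "(\<Sum>i\<in>A. f i) *\<^sub>C (x :: 'a::complex_vector) = (\<Sum>i\<in>A. f i *\<^sub>C x)"
  by (induction A rule: infinite_finite_induct) (simp_all add: scaleC_add_left)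

lemma bounded_linear_scaleC: "bounded_linear (\<lambda>x :: 'a::complex_banach. c *\<^sub>C x)"
proof (rule bounded_linear_intro[where K = "cmod c"])
  show "c *\<^sub>C (r *\<^sub>R x) = r *\<^sub>R (c *\<^sub>C x)" for r and x :: 'a
    by (simp add: scaleR_scaleC scaleC_scaleC mult.commute)
qed (simp_all add: scaleC_add_right norm_scaleC mult.commute)

text \<open>The usual complexification f y - i f (i y). Rotating y until its value is real yields
  the norm bound; at x the real part already has modulus norm x, which leaves no room for an
  imaginary part.\<close>

lemma norming_functional:
  fixes x :: "'e::complex_banach"
  obtains \<Lambda> where "linear_contraction \<Lambda>" "\<Lambda> x = of_real (norm x)"
proof -
  obtain f :: "'e \<Rightarrow> real" where f: "linear f" "\<And>y. f y \<le> norm y" "f x = norm x"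
    using real_norming_functional by blast
  define \<Lambda> where "\<Lambda> y = Complex (f y) (- f (\<i> *\<^sub>C y))" for y
  have add: "\<Lambda> (y + z) = \<Lambda> y + \<Lambda> z" for y z
    by (simp add: \<Lambda>_def scaleC_add_right linear_add[OF f(1)] complex_eq_iff)
  have fr: "f (of_real r *\<^sub>C y) = r * f y" for r y
    using linear_scale[OF f(1), of r y] by (simp add: scaleR_scaleC)
  have r: "\<Lambda> (of_real r *\<^sub>C y) = of_real r * \<Lambda> y" for r y
  proof -
    have "\<i> *\<^sub>C of_real r *\<^sub>C y = of_real r *\<^sub>C \<i> *\<^sub>C y" by (simp add: scaleC_scaleC mult.commute)
    then show ?thesis by (simp add: \<Lambda>_def fr complex_eq_iff)
  qed
  have i: "\<Lambda> (\<i> *\<^sub>C y) = \<i> * \<Lambda> y" for y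
    by (simp add: \<Lambda>_def scaleC_scaleC complex_eq_iff scaleC_minus_left scaleC_one linear_neg[OF f(1)])
  have scale: "\<Lambda> (c *\<^sub>C y) = c * \<Lambda> y" for c y
  proof -
    have "c *\<^sub>C y = of_real (Re c) *\<^sub>C y + of_real (Im c) *\<^sub>C \<i> *\<^sub>C y"
      unfolding scaleC_scaleC scaleC_add_left[symmetric] by (simp add: mult.commute[of _ \<i>] flip: complex_eq)
    then show ?thesis by (simp add: add r i complex_eq_iff)
  qed
  have le: "cmod (\<Lambda> y) \<le> norm y" for y
  proof (cases "\<Lambda> y = 0")
    case False
    define u where "u = cnj (\<Lambda> y) / cmod (\<Lambda> y)"
    have "cmod u = 1" using False by (simp add: u_def norm_divide)
    have "\<Lambda> (u *\<^sub>C y) = of_real (cmod (\<Lambda> y))"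
      using False by (simp add: scale u_def complex_norm_square[symmetric] power2_eq_square mult.commute[of "cnj _"])
    then have "cmod (\<Lambda> y) = f (u *\<^sub>C y)" by (simp add: \<Lambda>_def complex_eq_iff)
    also have "\<dots> \<le> norm y" using f(2)[of "u *\<^sub>C y"] \<open>cmod u = 1\<close> by (simp add: norm_scaleC)
    finally show ?thesis .
  qed simp
  have "Re (\<Lambda> x) = norm x" by (simp add: \<Lambda>_def f)
  moreover have "(Im (\<Lambda> x))\<^sup>2 \<le> 0"
    using power_mono[OF le[of x], of 2] \<open>Re (\<Lambda> x) = norm x\<close> by (simp add: cmod_power2)
  ultimately have "\<Lambda> x = of_real (norm x)" by (simp add: complex_eq_iff)
  then show thesis using that add scale le unfolding linear_contraction_def by blast
qed

section \<open>Power series in several variables\<close>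

definition mdeg :: "'i set \<Rightarrow> ('i \<Rightarrow> nat) \<Rightarrow> nat" where
  "mdeg J \<beta> = (\<Sum>j\<in>J. \<beta> j)"

lemma norm_mono_val: "cmod (mono_val J z \<beta>) = (\<Prod>j\<in>J. cmod (z j) ^ \<beta> j)"
  by (simp only: mono_val_def prod_norm[symmetric] norm_power)

lemma norm_mono_val_le:
  assumes "\<And>j. j \<in> J \<Longrightarrow> cmod (z j) \<le> r"
  shows "cmod (mono_val J z \<beta>) \<le> r ^ mdeg J \<beta>"
  unfolding norm_mono_val mdeg_def power_sum
  by (intro prod_mono conjI power_mono assms) auto

lemma norm_mono_val_eq:
  assumes "\<And>j. j \<in> J \<Longrightarrow> cmod (z j) = r"
  shows "cmod (mono_val J z \<beta>) = r ^ mdeg J \<beta>"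
  unfolding norm_mono_val mdeg_def power_sum using assms by simp

lemma mono_val_cong: "(\<And>j. j \<in> J \<Longrightarrow> z j = z' j) \<Longrightarrow> (\<And>j. j \<in> J \<Longrightarrow> \<beta> j = \<beta>' j) \<Longrightarrow> mono_val J z \<beta> = mono_val J z' \<beta>'"
  unfolding mono_val_def by (intro prod.cong) auto

lemma mono_val_add: "mono_val J z (\<lambda>i. \<beta> i + \<beta>' i) = mono_val J z \<beta> * mono_val J z \<beta>'"
  by (simp add: mono_val_def power_add prod.distrib)

lemma mono_val_mult: "mono_val J z (\<lambda>i. l * \<gamma> i) = mono_val J z \<gamma> ^ l"
  by (simp add: mono_val_def power_mult mult.commute[of l] prod_power_distrib)

lemma mdeg_add: "mdeg J (\<lambda>i. \<beta> i + \<beta>' i) = mdeg J \<beta> + mdeg J \<beta>'"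
  by (simp add: mdeg_def sum.distrib)

lemma mdeg_mult: "mdeg J (\<lambda>i. l * \<gamma> i) = l * mdeg J \<gamma>"
  by (simp add: mdeg_def sum_distrib_left)

lemma tuples_eqI: "\<beta> \<in> tuples J \<Longrightarrow> \<beta>' \<in> tuples J \<Longrightarrow> (\<And>j. j \<in> J \<Longrightarrow> \<beta> j = \<beta>' j) \<Longrightarrow> \<beta> = \<beta>'"
  unfolding tuples_def fun_eq_iff by (metis (mono_tags, lifting) mem_Collect_eq)

lemma tuples_bounded:
  fixes F :: "('i \<Rightarrow> nat) set"
  assumes "finite F" "finite J"
  obtains B where "0 < B" "\<And>\<beta> j. \<beta> \<in> F \<Longrightarrow> j \<in> J \<Longrightarrow> \<beta> j < B"
proof -
  define B where "B = Suc (Max (insert 0 ((\<lambda>(\<beta>, j). \<beta> j) ` (F \<times> J))))"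
  have "\<beta> j < B" if "\<beta> \<in> F" "j \<in> J" for \<beta> j
    unfolding B_def less_Suc_eq_le using assms that by (intro Max_ge) auto
  then show thesis using that[of B] by (auto simp: B_def)
qed

text \<open>A finite set of tuples lies in a box, and over a box the sum is a product of finite
  geometric sums.\<close>

lemma summable_on_geometric_tuples:
  fixes q :: real
  assumes J: "finite J" and q: "0 \<le> q" "q < 1"
  shows "(\<lambda>\<beta>. q ^ mdeg J \<beta>) summable_on tuples J"
proof (rule nonneg_bdd_above_summable_on)
  show "bdd_above (sum (\<lambda>\<beta>. q ^ mdeg J \<beta>) ` {F. F \<subseteq> tuples J \<and> finite F})"
  proof (rule bdd_aboveI2)
    fix F :: "('a \<Rightarrow> nat) set" assume "F \<in> {F. F \<subseteq> tuples J \<and> finite F}"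
    then have F: "F \<subseteq> tuples J" "finite F" by auto
    obtain B where B0: "0 < B" and B: "\<And>\<beta> j. \<beta> \<in> F \<Longrightarrow> j \<in> J \<Longrightarrow> \<beta> j < B"
      by (rule tuples_bounded[OF F(2) J], rule that)
    have inj: "inj_on (\<lambda>\<beta>. restrict \<beta> J) F"
    proof (intro inj_onI tuples_eqI[of _ J])
      fix \<beta> \<beta>' j assume "restrict \<beta> J = restrict \<beta>' J" "j \<in> J"
      then show "\<beta> j = \<beta>' j" by (metis restrict_apply')
    qed (use F in auto)
    have "(\<Sum>\<beta>\<in>F. q ^ mdeg J \<beta>) = (\<Sum>\<beta>\<in>F. \<Prod>j\<in>J. q ^ (restrict \<beta> J) j)"
      by (simp add: mdeg_def power_sum)
    also have "\<dots> = (\<Sum>g\<in>(\<lambda>\<beta>. restrict \<beta> J) ` F. \<Prod>j\<in>J. q ^ g j)"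
      by (simp add: sum.reindex[OF inj])
    also have "\<dots> \<le> (\<Sum>g\<in>PiE J (\<lambda>_. {..<B}). \<Prod>j\<in>J. q ^ g j)"
      using B q J by (intro sum_mono2) (auto intro!: finite_PiE prod_nonneg)
    also have "\<dots> = (\<Prod>j\<in>J. \<Sum>i<B. q ^ i)" by (rule prod_sum_PiE[symmetric]) (use J in auto)
    also have "\<dots> \<le> (\<Prod>j\<in>J. 1 / (1 - q))"
    proof (intro prod_mono conjI sum_nonneg)
      have "(\<Sum>i<B. q ^ i) \<le> (\<Sum>i. q ^ i)" by (intro sum_le_suminf summable_geometric) (use q in auto)
      then show "(\<Sum>i<B. q ^ i) \<le> 1 / (1 - q)" using q by (simp add: suminf_geometric)
    qed (use q in auto)
    finally show "(\<Sum>\<beta>\<in>F. q ^ mdeg J \<beta>) \<le> (\<Prod>j\<in>J. 1 / (1 - q))" .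
  qed
qed (use q in auto)

text \<open>Outside a finite set, each single term is the difference of two partial sums that are
  both within 1 of the limit.\<close>

lemma summable_on_imp_bounded:
  fixes f :: "'a \<Rightarrow> 'b::real_normed_vector"
  assumes "f summable_on A"
  obtains M where "\<And>x. x \<in> A \<Longrightarrow> norm (f x) \<le> M"
proof -
  obtain S where "(f has_sum S) A" using assms by (auto simp: summable_on_def)
  then have "\<forall>\<^sub>F X in finite_subsets_at_top A. dist (sum f X) S < 1"
    unfolding has_sum_def by (rule tendstoD) simp
  then obtain X where X: "finite X" "X \<subseteq> A" "\<forall>Y. finite Y \<and> X \<subseteq> Y \<and> Y \<subseteq> A \<longrightarrow> dist (sum f Y) S < 1"
    unfolding eventually_finite_subsets_at_top by (elim exE conjE)
  have "norm (f x) \<le> 2 + (\<Sum>x\<in>X. norm (f x))" if "x \<in> A" for x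
  proof (cases "x \<in> X")
    case True
    then have "norm (f x) \<le> (\<Sum>x\<in>X. norm (f x))" using X(1) by (intro member_le_sum) auto
    then show ?thesis by simp
  next
    case False
    have "norm (f x) = dist (sum f (insert x X)) (sum f X)" using False X by (simp add: dist_norm)
    also have "\<dots> \<le> dist (sum f (insert x X)) S + dist (sum f X) S" by (rule dist_triangle2)
    also have "\<dots> \<le> 1 + 1" using X that by (intro add_mono less_imp_le) auto
    finally show ?thesis using sum_nonneg[of X "\<lambda>x. norm (f x)"] by simp
  qed
  then show thesis by (rule that)
qed

text \<open>Abel's lemma: the terms are bounded at polyradius R, which leaves the geometric factor
  (r / R) ^ |\<beta>| at polyradius r.\<close>

lemma power_series_abs_summable:
  fixes c :: "('i \<Rightarrow> nat) \<Rightarrow> 'e::complex_banach"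
  assumes J: "finite J" and s: "(\<lambda>\<beta>. mono_val J z \<beta> *\<^sub>C c \<beta>) summable_on tuples J"
    and z: "\<And>j. j \<in> J \<Longrightarrow> cmod (z j) = R" and r: "0 \<le> r" "r < R"
  shows "(\<lambda>\<beta>. norm (c \<beta>) * r ^ mdeg J \<beta>) summable_on tuples J"
proof -
  obtain M where M: "\<And>\<beta>. \<beta> \<in> tuples J \<Longrightarrow> norm (mono_val J z \<beta> *\<^sub>C c \<beta>) \<le> M"
    by (rule summable_on_imp_bounded[OF s], rule that)
  have "(\<lambda>\<beta>. M * (r / R) ^ mdeg J \<beta>) summable_on tuples J"
    by (intro summable_on_cmult_right summable_on_geometric_tuples J) (use r in auto)
  then show ?thesis
  proof (rule summable_on_comparison_test)
    fix \<beta> :: "'i \<Rightarrow> nat" assume "\<beta> \<in> tuples J"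
    from M[OF this] have "norm (c \<beta>) * R ^ mdeg J \<beta> \<le> M"
      using norm_mono_val_eq[OF z, where \<beta> = \<beta>] by (simp add: norm_scaleC mult.commute)
    then have "norm (c \<beta>) * R ^ mdeg J \<beta> * (r / R) ^ mdeg J \<beta> \<le> M * (r / R) ^ mdeg J \<beta>"
      using r by (intro mult_right_mono) auto
    then show "norm (c \<beta>) * r ^ mdeg J \<beta> \<le> M * (r / R) ^ mdeg J \<beta>"
      using r by (simp add: power_divide)
  qed (use r in auto)
qed

text \<open>The summands are the powers of a B-th root of unity, and this root is not 1 because B
  does not divide d.\<close>

lemma sum_cis_root:
  fixes d :: int
  assumes "\<bar>d\<bar> < int B" "d \<noteq> 0"
  shows "(\<Sum>i<B. cis (2 * pi * real i * real_of_int d / real B)) = 0"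
proof -
  have B: "B > 0" using assms by (cases B) auto
  define \<zeta> where "\<zeta> = cis (2 * pi * real_of_int d / real B)"
  have pow: "cis (2 * pi * real i * real_of_int d / real B) = \<zeta> ^ i" for i
    by (simp add: \<zeta>_def Complex.DeMoivre mult_ac)
  have "\<zeta> \<noteq> 1"
  proof
    assume "\<zeta> = 1"
    then have "cos (2 * pi * real_of_int d / real B) = 1" by (simp add: \<zeta>_def complex_eq_iff)
    then have "\<exists>n::int. 2 * pi * real_of_int d / real B = real_of_int n * 2 * pi" by (simp only: cos_one_2pi_int)
    then obtain n :: int where "2 * pi * real_of_int d / real B = real_of_int n * 2 * pi" by (elim exE)
    then have "real_of_int d = real_of_int (n * int B)" using B by (simp add: field_simps)
    then have "d = n * int B" by (simp only: of_int_eq_iff)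
    then have "int B dvd d" by simp
    then show False using assms zdvd_imp_le[of "int B" "\<bar>d\<bar>"] by auto
  qed
  moreover have "\<zeta> ^ B = 1"
  proof -
    have "\<zeta> ^ B = cis (2 * pi * real_of_int d)" using B by (simp add: \<zeta>_def Complex.DeMoivre)
    then show ?thesis by simp
  qed
  ultimately show ?thesis unfolding pow by (simp add: geometric_sum)
qed

text \<open>Averages over a finite subgroup of the torus replace the integral of Cauchy's formula.\<close>

lemma polynomial_coefficient_bound:
  fixes c :: "('i \<Rightarrow> nat) \<Rightarrow> 'e::complex_banach"
  assumes J: "finite J" and X: "finite X" "X \<subseteq> tuples J" "\<beta>0 \<in> X" and r: "0 \<le> r"
    and bnd: "\<And>z. z \<in> tuples J \<Longrightarrow> (\<And>j. j \<in> J \<Longrightarrow> cmod (z j) = r) \<Longrightarrow> norm (\<Sum>\<beta>\<in>X. mono_val J z \<beta> *\<^sub>C c \<beta>) \<le> M"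
  shows "norm (c \<beta>0) * r ^ mdeg J \<beta>0 \<le> M"
proof -
  \<comment> \<open>B exceeds all exponents in \<open>X\<close>, so that B-th roots of unity tell
    any two of them apart.\<close>
  obtain B where B: "0 < B" "\<And>\<beta> j. \<beta> \<in> X \<Longrightarrow> j \<in> J \<Longrightarrow> \<beta> j < B"
    by (rule tuples_bounded[OF X(1) J], rule that)
  define S where "S = PiE J (\<lambda>_. {..<B})"
  define z where "z s = (\<lambda>j. if j \<in> J then rcis r (2 * pi * real (s j) / real B) else 0)" for s :: "'i \<Rightarrow> nat"
  \<comment> \<open>The inverse of the character that belongs to \<beta>0; averaging against it
    leaves only the term of \<beta>0.\<close>
  define u where "u s = (\<Prod>j\<in>J. cis (- (2 * pi * real (s j) * real (\<beta>0 j) / real B)))" for s :: "'i \<Rightarrow> nat"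
  have z: "z s \<in> tuples J" "\<And>j. j \<in> J \<Longrightarrow> cmod (z s j) = r" for s
    using r by (auto simp: z_def tuples_def)
  have finS: "finite S" and cS: "card S = B ^ card J"
    unfolding S_def using J by (auto intro: finite_PiE simp: card_PiE)
  \<comment> \<open>Orthogonality of characters, one variable at a time.\<close>
  have char: "(\<Sum>s\<in>S. u s * mono_val J (z s) \<beta>) = (if \<beta> = \<beta>0 then of_real (r ^ mdeg J \<beta>) * of_nat (B ^ card J) else 0)"
    if "\<beta> \<in> X" for \<beta>
  proof -
    have "(\<Sum>s\<in>S. u s * mono_val J (z s) \<beta>)
      = (\<Sum>s\<in>S. \<Prod>j\<in>J. of_real (r ^ \<beta> j) * cis (2 * pi * real (s j) * real_of_int (int (\<beta> j) - int (\<beta>0 j)) / real B))"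
      unfolding u_def mono_val_def prod.distrib[symmetric]
    proof (intro sum.cong prod.cong refl)
      fix s j assume "j \<in> J"
      have "real (\<beta> j) * (2 * pi * real (s j) / real B) + - (2 * pi * real (s j) * real (\<beta>0 j) / real B)
        = 2 * pi * real (s j) * real_of_int (int (\<beta> j) - int (\<beta>0 j)) / real B"
        by (simp add: algebra_simps diff_divide_distrib)
      then have "cis (2 * pi * real (s j) / real B) ^ \<beta> j * cis (- (2 * pi * real (s j) * real (\<beta>0 j) / real B))
        = cis (2 * pi * real (s j) * real_of_int (int (\<beta> j) - int (\<beta>0 j)) / real B)"
        unfolding Complex.DeMoivre cis_mult by (rule arg_cong)
      then show "cis (- (2 * pi * real (s j) * real (\<beta>0 j) / real B)) * z s j ^ \<beta> j
        = of_real (r ^ \<beta> j) * cis (2 * pi * real (s j) * real_of_int (int (\<beta> j) - int (\<beta>0 j)) / real B)"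
        using \<open>j \<in> J\<close> by (simp only: z_def rcis_def if_True power_mult_distrib of_real_power mult_ac)
    qed
    also have "\<dots> = (\<Prod>j\<in>J. \<Sum>i<B. of_real (r ^ \<beta> j) * cis (2 * pi * real i * real_of_int (int (\<beta> j) - int (\<beta>0 j)) / real B))"
      unfolding S_def by (rule prod_sum_PiE[symmetric]) (use J in auto)
    also have "\<dots> = (\<Prod>j\<in>J. of_real (r ^ \<beta> j) * (if \<beta> j = \<beta>0 j then of_nat B else 0))"
    proof (intro prod.cong refl)
      fix j assume j: "j \<in> J"
      have "(\<Sum>i<B. cis (2 * pi * real i * real_of_int (int (\<beta> j) - int (\<beta>0 j)) / real B)) = (if \<beta> j = \<beta>0 j then of_nat B else 0)"
      proof (cases "\<beta> j = \<beta>0 j")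
        case False
        then show ?thesis using B(2)[OF that j] B(2)[OF X(3) j] by (subst sum_cis_root) auto
      qed simp
      then show "(\<Sum>i<B. of_real (r ^ \<beta> j) * cis (2 * pi * real i * real_of_int (int (\<beta> j) - int (\<beta>0 j)) / real B))
         = of_real (r ^ \<beta> j) * (if \<beta> j = \<beta>0 j then of_nat B else 0)"
        by (simp only: sum_distrib_left[symmetric])
    qed
    also have "\<dots> = (if \<beta> = \<beta>0 then of_real (r ^ mdeg J \<beta>) * of_nat (B ^ card J) else 0)"
    proof (cases "\<beta> = \<beta>0")
      case True
      then show ?thesis by (simp add: prod.distrib mdeg_def power_sum)
    next
      case False
      then have "\<exists>j\<in>J. \<beta> j \<noteq> \<beta>0 j" using tuples_eqI[of \<beta> J \<beta>0] X that by blast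
      then show ?thesis using False J by (auto simp: prod_zero_iff)
    qed
    finally show ?thesis .
  qed
  have "(\<Sum>s\<in>S. u s *\<^sub>C (\<Sum>\<beta>\<in>X. mono_val J (z s) \<beta> *\<^sub>C c \<beta>)) = (\<Sum>s\<in>S. \<Sum>\<beta>\<in>X. (u s * mono_val J (z s) \<beta>) *\<^sub>C c \<beta>)"
    by (simp add: scaleC_sum_right scaleC_scaleC)
  also have "\<dots> = (\<Sum>\<beta>\<in>X. (\<Sum>s\<in>S. u s * mono_val J (z s) \<beta>) *\<^sub>C c \<beta>)"
    by (subst sum.swap) (simp add: scaleC_sum_left)
  also have "\<dots> = (\<Sum>\<beta>\<in>X. if \<beta> = \<beta>0 then (of_real (r ^ mdeg J \<beta>0) * of_nat (B ^ card J)) *\<^sub>C c \<beta>0 else 0)"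
    by (intro sum.cong refl) (simp add: char)
  also have "\<dots> = (of_real (r ^ mdeg J \<beta>0) * of_nat (B ^ card J)) *\<^sub>C c \<beta>0"
    using X by simp
  finally have "real (B ^ card J) * (norm (c \<beta>0) * r ^ mdeg J \<beta>0)
      = norm (\<Sum>s\<in>S. u s *\<^sub>C (\<Sum>\<beta>\<in>X. mono_val J (z s) \<beta> *\<^sub>C c \<beta>))"
    using r by (simp add: norm_scaleC norm_mult norm_power mult_ac)
  also have "\<dots> \<le> (\<Sum>s\<in>S. M)"
  proof (rule sum_norm_le)
    fix s
    have "cmod (u s) = 1" by (simp only: u_def prod_norm[symmetric] norm_cis) simp
    then show "norm (u s *\<^sub>C (\<Sum>\<beta>\<in>X. mono_val J (z s) \<beta> *\<^sub>C c \<beta>)) \<le> M"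
      using bnd[OF z] by (simp add: norm_scaleC)
  qed
  also have "\<dots> = real (B ^ card J) * M" using cS by simp
  finally show ?thesis using B by simp
qed

text \<open>A finite set that contains \<beta>0 and carries all but \<epsilon> of the absolute sum
  changes the values on the torus by at most \<epsilon>, so the estimate for polynomials applies
  with M + \<epsilon>.\<close>

lemma cauchy_coefficient_bound:
  fixes c :: "('i \<Rightarrow> nat) \<Rightarrow> 'e::complex_banach"
  assumes J: "finite J" and \<beta>0: "\<beta>0 \<in> tuples J" and r: "0 \<le> r"
    and s: "(\<lambda>\<beta>. norm (c \<beta>) * r ^ mdeg J \<beta>) summable_on tuples J"
    and bnd: "\<And>z. z \<in> tuples J \<Longrightarrow> (\<And>j. j \<in> J \<Longrightarrow> cmod (z j) = r) \<Longrightarrow>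
       norm (\<Sum>\<^sub>\<infinity>\<beta>\<in>tuples J. mono_val J z \<beta> *\<^sub>C c \<beta>) \<le> M"
  shows "norm (c \<beta>0) * r ^ mdeg J \<beta>0 \<le> M"
proof (rule field_le_epsilon)
  fix \<epsilon> :: real assume \<epsilon>: "\<epsilon> > 0"
  define g where "g \<beta> = norm (c \<beta>) * r ^ mdeg J \<beta>" for \<beta>
  have "(sum g \<longlongrightarrow> infsum g (tuples J)) (finite_subsets_at_top (tuples J))"
    using s unfolding g_def[abs_def] by (rule infsum_tendsto)
  then have "\<forall>\<^sub>F X in finite_subsets_at_top (tuples J). sum g X > infsum g (tuples J) - \<epsilon>"
    using \<epsilon> by (intro order_tendstoD) auto
  then obtain X0 where X0: "finite X0" "X0 \<subseteq> tuples J"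
    "\<forall>Y. finite Y \<and> X0 \<subseteq> Y \<and> Y \<subseteq> tuples J \<longrightarrow> sum g Y > infsum g (tuples J) - \<epsilon>"
    unfolding eventually_finite_subsets_at_top by (elim exE conjE)
  define X where "X = insert \<beta>0 X0"
  have X: "finite X" "X \<subseteq> tuples J" "\<beta>0 \<in> X" "sum g X > infsum g (tuples J) - \<epsilon>"
    using X0 \<beta>0 by (auto simp: X_def)
  show "norm (c \<beta>0) * r ^ mdeg J \<beta>0 \<le> M + \<epsilon>"
  proof (rule polynomial_coefficient_bound[OF J X(1-3) r])
    fix z :: "'i \<Rightarrow> complex" assume z: "z \<in> tuples J" "\<And>j. j \<in> J \<Longrightarrow> cmod (z j) = r"
    define f where "f \<beta> = mono_val J z \<beta> *\<^sub>C c \<beta>" for \<beta>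
    have nf: "norm (f \<beta>) = g \<beta>" for \<beta>
      using norm_mono_val_eq[OF z(2), where \<beta> = \<beta>] by (simp add: f_def g_def norm_scaleC)
    have sf: "(\<lambda>\<beta>. norm (f \<beta>)) summable_on tuples J" using s by (simp add: nf g_def)
    then have sf': "(\<lambda>\<beta>. norm (f \<beta>)) summable_on tuples J - X" by (rule summable_on_subset_banach) auto
    have "infsum f (tuples J - X) = infsum f (tuples J) - sum f X"
      using X sf abs_summable_summable[OF sf] by (subst infsum_Diff) auto
    then have "norm (sum f X) \<le> norm (infsum f (tuples J)) + norm (infsum f (tuples J - X))"
      using norm_triangle_ineq4[of "infsum f (tuples J)" "infsum f (tuples J - X)"] by simp
    also have "norm (infsum f (tuples J)) \<le> M" using bnd[OF z] by (simp add: f_def[abs_def])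
    also have "norm (infsum f (tuples J - X)) \<le> infsum g (tuples J - X)"
      using norm_infsum_bound[OF sf'] by (simp add: nf)
    also have "infsum g (tuples J - X) = infsum g (tuples J) - sum g X"
      using X s by (subst infsum_Diff) (auto simp: g_def[abs_def])
    also have "\<dots> \<le> \<epsilon>" using X(4) by simp
    finally show "norm (\<Sum>\<beta>\<in>X. mono_val J z \<beta> *\<^sub>C c \<beta>) \<le> M + \<epsilon>" by (simp add: f_def)
  qed
qed

section \<open>Holomorphic maps with values in normed spaces\<close>

text \<open>The record \<open>nspace\<close> carries no axioms; these are the laws of a linear
  subspace with a seminorm.\<close>

definition seminormed :: "'v::complex_vector nspace \<Rightarrow> bool" where
  "seminormed F \<longleftrightarrow> 0 \<in> vecs F \<and>
     (\<forall>x\<in>vecs F. \<forall>y\<in>vecs F. x + y \<in> vecs F \<and> nrm F (x + y) \<le> nrm F x + nrm F y) \<and>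
     (\<forall>c. \<forall>x\<in>vecs F. c *\<^sub>C x \<in> vecs F \<and> nrm F (c *\<^sub>C x) = cmod c * nrm F x)"

lemma seminormed_add: "seminormed F \<Longrightarrow> x \<in> vecs F \<Longrightarrow> y \<in> vecs F \<Longrightarrow> x + y \<in> vecs F"
  and seminormed_triangle: "seminormed F \<Longrightarrow> x \<in> vecs F \<Longrightarrow> y \<in> vecs F \<Longrightarrow> nrm F (x + y) \<le> nrm F x + nrm F y"
  and seminormed_scaleC: "seminormed F \<Longrightarrow> x \<in> vecs F \<Longrightarrow> c *\<^sub>C x \<in> vecs F"
  and seminormed_nrm_scaleC: "seminormed F \<Longrightarrow> x \<in> vecs F \<Longrightarrow> nrm F (c *\<^sub>C x) = cmod c * nrm F x"
  and seminormed_zero: "seminormed F \<Longrightarrow> 0 \<in> vecs F"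
  unfolding seminormed_def by blast+

lemma seminormed_nrm_zero: "seminormed F \<Longrightarrow> nrm F 0 = 0"
  using seminormed_nrm_scaleC[of F 0 0] seminormed_zero[of F] by simp

lemma seminormed_minus:
  assumes "seminormed F" "x \<in> vecs F"
  shows "- x \<in> vecs F" "nrm F (- x) = nrm F x"
  using seminormed_scaleC[OF assms, of "-1"] seminormed_nrm_scaleC[OF assms, of "-1"]
  by (simp_all add: scaleC_minus_left scaleC_one)

lemma seminormed_diff:
  assumes "seminormed F" "x \<in> vecs F" "y \<in> vecs F"
  shows "x - y \<in> vecs F" "nrm F (x - y) \<le> nrm F x + nrm F y"
  using seminormed_add[OF assms(1,2) seminormed_minus(1)[OF assms(1,3)]]
    seminormed_triangle[OF assms(1,2) seminormed_minus(1)[OF assms(1,3)]]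
    seminormed_minus(2)[OF assms(1,3)] by simp_all

lemma seminormed_nonneg:
  assumes "seminormed F" "x \<in> vecs F"
  shows "nrm F x \<ge> 0"
  using seminormed_diff(2)[OF assms assms(2)] seminormed_nrm_zero[OF assms(1)] by simp

lemma seminormed_sum:
  assumes "seminormed F" "\<And>i. i \<in> A \<Longrightarrow> f i \<in> vecs F"
  shows "sum f A \<in> vecs F \<and> nrm F (sum f A) \<le> (\<Sum>i\<in>A. nrm F (f i))"
  using assms(2)
proof (induction A rule: infinite_finite_induct)
  case (insert a A)
  then have "f a \<in> vecs F" "sum f A \<in> vecs F" by auto
  then show ?case using insert seminormed_add[OF assms(1)] seminormed_triangle[OF assms(1), of "f a" "sum f A"] by auto
qed (simp_all add: seminormed_zero[OF assms(1)] seminormed_nrm_zero[OF assms(1)])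

text \<open>Unconditional summation in the norm of \<open>F\<close>. On a type of maps
  \<open>has_sum\<close> would refer to the pointwise topology instead of the sup norm.\<close>

definition nsum :: "'v::complex_vector nspace \<Rightarrow> 'k set \<Rightarrow> ('k \<Rightarrow> 'v) \<Rightarrow> 'v \<Rightarrow> bool" where
  "nsum F A c s \<longleftrightarrow> s \<in> vecs F \<and> ((\<lambda>B. nrm F (s - sum c B)) \<longlongrightarrow> 0) (finite_subsets_at_top A)"

lemma eventually_subset: "\<forall>\<^sub>F B in finite_subsets_at_top A. finite B \<and> B \<subseteq> A"
  by (rule eventually_finite_subsets_at_top_weakI) auto

lemma nsum_bound:
  assumes F: "seminormed F" and c: "\<And>k. k \<in> A \<Longrightarrow> c k \<in> vecs F"
    and s: "(\<lambda>k. nrm F (c k)) summable_on A" and n: "nsum F A c x"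
  shows "nrm F x \<le> (\<Sum>\<^sub>\<infinity>k\<in>A. nrm F (c k))"
proof -
  have x: "x \<in> vecs F" and lim: "((\<lambda>B. nrm F (x - sum c B)) \<longlongrightarrow> 0) (finite_subsets_at_top A)"
    using n by (auto simp: nsum_def)
  have "((\<lambda>B. nrm F (x - sum c B) + (\<Sum>\<^sub>\<infinity>k\<in>A. nrm F (c k))) \<longlongrightarrow> 0 + (\<Sum>\<^sub>\<infinity>k\<in>A. nrm F (c k))) (finite_subsets_at_top A)"
    by (intro tendsto_intros lim)
  moreover have "\<forall>\<^sub>F B in finite_subsets_at_top A. nrm F x \<le> nrm F (x - sum c B) + (\<Sum>\<^sub>\<infinity>k\<in>A. nrm F (c k))"
    using eventually_subset[of A]
  proof eventually_elim
    case (elim B)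
    have sB: "sum c B \<in> vecs F" "nrm F (sum c B) \<le> (\<Sum>k\<in>B. nrm F (c k))"
      using seminormed_sum[OF F, of B c] c elim by auto
    have "nrm F x \<le> nrm F (x - sum c B) + nrm F (sum c B)"
      using seminormed_triangle[OF F seminormed_diff(1)[OF F x sB(1)] sB(1)] by simp
    also have "nrm F (sum c B) \<le> (\<Sum>\<^sub>\<infinity>k\<in>A. nrm F (c k))"
      using elim by (intro order_trans[OF sB(2)] finite_sum_le_infsum s seminormed_nonneg F c) auto
    finally show ?case by simp
  qed
  ultimately show ?thesis by (metis add_0 tendsto_lowerbound finite_subsets_at_top_neq_bot)
qed

lemma nsum_add:
  assumes F: "seminormed F" and c: "\<And>k. k \<in> A \<Longrightarrow> c k \<in> vecs F" "\<And>k. k \<in> A \<Longrightarrow> d k \<in> vecs F"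
    and n: "nsum F A c x" "nsum F A d y"
  shows "nsum F A (\<lambda>k. c k + d k) (x + y)"
  unfolding nsum_def
proof
  have x: "x \<in> vecs F" "y \<in> vecs F" using n by (auto simp: nsum_def)
  then show "x + y \<in> vecs F" by (rule seminormed_add[OF F])
  have "((\<lambda>B. nrm F (x - sum c B) + nrm F (y - sum d B)) \<longlongrightarrow> 0) (finite_subsets_at_top A)"
    using tendsto_add[of _ 0 _ _ 0] n by (auto simp: nsum_def)
  then show "((\<lambda>B. nrm F (x + y - (\<Sum>k\<in>B. c k + d k))) \<longlongrightarrow> 0) (finite_subsets_at_top A)"
  proof (rule Lim_null_comparison[rotated])
    show "\<forall>\<^sub>F B in finite_subsets_at_top A. norm (nrm F (x + y - (\<Sum>k\<in>B. c k + d k)))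
        \<le> nrm F (x - sum c B) + nrm F (y - sum d B)"
      using eventually_subset[of A]
    proof eventually_elim
      case (elim B)
      have v: "x - sum c B \<in> vecs F" "y - sum d B \<in> vecs F"
        using seminormed_sum[OF F, of B c] seminormed_sum[OF F, of B d] c elim x
        by (auto intro!: seminormed_diff(1)[OF F])
      have eq: "x + y - (\<Sum>k\<in>B. c k + d k) = (x - sum c B) + (y - sum d B)"
        by (simp add: sum.distrib algebra_simps)
      show ?case unfolding eq using seminormed_triangle[OF F v] seminormed_nonneg[OF F seminormed_add[OF F v]] by simp
    qed
  qed
qed

lemma nsum_scaleC:
  assumes F: "seminormed F" and c: "\<And>k. k \<in> A \<Longrightarrow> c k \<in> vecs F" and n: "nsum F A c x"
  shows "nsum F A (\<lambda>k. a *\<^sub>C c k) (a *\<^sub>C x)"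
  unfolding nsum_def
proof
  have x: "x \<in> vecs F" using n by (auto simp: nsum_def)
  then show "a *\<^sub>C x \<in> vecs F" by (rule seminormed_scaleC[OF F])
  have "((\<lambda>B. cmod a * nrm F (x - sum c B)) \<longlongrightarrow> 0) (finite_subsets_at_top A)"
    using tendsto_mult_right_zero n by (auto simp: nsum_def)
  moreover have "\<forall>\<^sub>F B in finite_subsets_at_top A. cmod a * nrm F (x - sum c B) = nrm F (a *\<^sub>C x - (\<Sum>k\<in>B. a *\<^sub>C c k))"
    using eventually_subset[of A]
  proof eventually_elim
    case (elim B)
    have "x - sum c B \<in> vecs F"
      using seminormed_sum[OF F, of B c] c elim x by (auto intro!: seminormed_diff(1)[OF F])
    then show ?case
      using seminormed_nrm_scaleC[OF F, of "x - sum c B" a] by (simp add: scaleC_diff_right scaleC_sum_right)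
  qed
  ultimately show "((\<lambda>B. nrm F (a *\<^sub>C x - (\<Sum>k\<in>B. a *\<^sub>C c k))) \<longlongrightarrow> 0) (finite_subsets_at_top A)"
    using tendsto_cong by fastforce
qed

lemma nsum_diff:
  assumes F: "seminormed F" and c: "\<And>k. k \<in> A \<Longrightarrow> c k \<in> vecs F" "\<And>k. k \<in> A \<Longrightarrow> d k \<in> vecs F"
    and n: "nsum F A c x" "nsum F A d y"
  shows "nsum F A (\<lambda>k. c k - d k) (x - y)"
proof -
  have "nsum F A (\<lambda>k. - d k) (- y)"
    using nsum_scaleC[OF F c(2) n(2), of "-1"] by (simp add: scaleC_minus_left scaleC_one)
  from nsum_add[OF F c(1) seminormed_minus(1)[OF F c(2)] n(1) this] show ?thesis by simp
qed

lemma nsum_sum: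
  assumes F: "seminormed F" and "finite J" and c: "\<And>j k. j \<in> J \<Longrightarrow> k \<in> A \<Longrightarrow> c j k \<in> vecs F"
    and n: "\<And>j. j \<in> J \<Longrightarrow> nsum F A (c j) (x j)"
  shows "nsum F A (\<lambda>k. \<Sum>j\<in>J. c j k) (\<Sum>j\<in>J. x j)"
  using assms(2) c n
proof (induction J rule: finite_induct)
  case empty
  then show ?case by (simp add: nsum_def seminormed_zero[OF F] seminormed_nrm_zero[OF F])
next
  case (insert a J)
  have "nsum F A (\<lambda>k. c a k + (\<Sum>j\<in>J. c j k)) (x a + (\<Sum>j\<in>J. x j))"
  proof (rule nsum_add[OF F])
    show "(\<Sum>j\<in>J. c j k) \<in> vecs F" if "k \<in> A" for k
      using seminormed_sum[OF F, of J "\<lambda>j. c j k"] insert.prems(1) that by blast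
    show "nsum F A (\<lambda>k. \<Sum>j\<in>J. c j k) (\<Sum>j\<in>J. x j)" using insert by blast
  qed (use insert.prems in auto)
  then show ?case using insert.hyps by simp
qed

text \<open>The instance of completeness that power series call for: every absolutely convergent
  family of scalar multiples of a fixed family has a sum. For maps on a polydisc it is established
  for families that come with Taylor series.\<close>

definition summing :: "'v::complex_vector nspace \<Rightarrow> 'k set \<Rightarrow> ('k \<Rightarrow> 'v) \<Rightarrow> bool" where
  "summing F A c \<longleftrightarrow> (\<forall>k\<in>A. c k \<in> vecs F) \<and>
     (\<forall>m. (\<lambda>k. cmod (m k) * nrm F (c k)) summable_on A \<longrightarrow> (\<exists>s. nsum F A (\<lambda>k. m k *\<^sub>C c k) s))"

lemma seminormed_whole_space: "seminormed whole_space"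
  by (simp add: seminormed_def whole_space_def norm_triangle_ineq norm_scaleC)

lemma nsum_whole_space: "nsum whole_space A c x \<longleftrightarrow> (c has_sum x) A"
proof -
  have "((\<lambda>B. norm (x - sum c B)) \<longlongrightarrow> 0) (finite_subsets_at_top A) \<longleftrightarrow> (sum c \<longlongrightarrow> x) (finite_subsets_at_top A)"
    unfolding tendsto_iff by (simp add: dist_norm norm_minus_commute)
  then show ?thesis by (simp add: nsum_def whole_space_def has_sum_def)
qed

lemma summing_whole_space: "summing whole_space A (c :: 'k \<Rightarrow> 'e::complex_banach)"
  unfolding summing_def nsum_whole_space
proof (intro conjI ballI allI impI)
  fix m assume "(\<lambda>k. cmod (m k) * nrm whole_space (c k)) summable_on A"
  then have "(\<lambda>k. norm (m k *\<^sub>C c k)) summable_on A" by (simp add: whole_space_def norm_scaleC)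
  then have "(\<lambda>k. m k *\<^sub>C c k) summable_on A" by (rule abs_summable_summable)
  then show "\<exists>s. ((\<lambda>k. m k *\<^sub>C c k) has_sum s) A" by (simp add: summable_on_def)
qed (simp add: whole_space_def)

lemma has_taylor_iff_nsum:
  assumes "\<And>z. z \<in> U \<Longrightarrow> g z \<in> vecs F"
  shows "has_taylor J F U g c \<longleftrightarrow> (\<forall>z\<in>U. nsum F (tuples J) (\<lambda>\<beta>. mono_val J z \<beta> *\<^sub>C c \<beta>) (g z))"
  using assms by (auto simp: has_taylor_def nsum_def)

text \<open>First and second order differences of powers, multiplied by r for each order so that the
  exponent on the right is n throughout. The constants are polynomial in n.\<close>

lemma power_diff_bounds:
  fixes x y :: complex and r :: real
  assumes r: "0 \<le> r" "cmod x \<le> r" "cmod y \<le> r"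
  shows "r * cmod (y ^ n - x ^ n) \<le> n * r ^ n * cmod (y - x)"
    and "r\<^sup>2 * cmod (y ^ n - x ^ n - of_nat n * x ^ (n - 1) * (y - x)) \<le> (real n)\<^sup>2 * r ^ n * (cmod (y - x))\<^sup>2"
    and "r * cmod (of_nat n * x ^ (n - 1) * (y - x)) \<le> n * r ^ n * cmod (y - x)"
proof -
  show 3: "r * cmod (of_nat n * x ^ (n - 1) * (y - x)) \<le> n * r ^ n * cmod (y - x)" for n
  proof (cases n)
    case (Suc m)
    have "cmod x ^ m \<le> r ^ m" using r by (intro power_mono) auto
    then have "real n * (r * cmod x ^ m) * cmod (y - x) \<le> real n * (r * r ^ m) * cmod (y - x)"
      using r by (intro mult_right_mono mult_left_mono) auto
    then show ?thesis using Suc by (simp add: norm_mult norm_power mult_ac del: of_nat_Suc)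
  qed simp
  show "r * cmod (y ^ n - x ^ n) \<le> n * r ^ n * cmod (y - x)"
  proof (induction n)
    case (Suc n)
    have "y ^ Suc n - x ^ Suc n = y * (y ^ n - x ^ n) + x ^ n * (y - x)" by (simp add: algebra_simps)
    then have "cmod (y ^ Suc n - x ^ Suc n) \<le> cmod y * cmod (y ^ n - x ^ n) + cmod x ^ n * cmod (y - x)"
      by (metis norm_mult norm_power norm_triangle_ineq)
    also have "\<dots> \<le> r * cmod (y ^ n - x ^ n) + r ^ n * cmod (y - x)"
      using r by (intro add_mono mult_right_mono power_mono) auto
    also have "\<dots> \<le> n * r ^ n * cmod (y - x) + r ^ n * cmod (y - x)" using Suc by simp
    finally have "r * cmod (y ^ Suc n - x ^ Suc n) \<le> r * (n * r ^ n * cmod (y - x) + r ^ n * cmod (y - x))"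
      using r by (intro mult_left_mono) auto
    then show ?case by (simp add: algebra_simps)
  qed simp
  show "r\<^sup>2 * cmod (y ^ n - x ^ n - of_nat n * x ^ (n - 1) * (y - x)) \<le> (real n)\<^sup>2 * r ^ n * (cmod (y - x))\<^sup>2"
  proof (induction n)
    case (Suc n)
    let ?R = "y ^ n - x ^ n - of_nat n * x ^ (n - 1) * (y - x)"
    have "y ^ Suc n - x ^ Suc n - of_nat (Suc n) * x ^ (Suc n - 1) * (y - x)
      = y * ?R + of_nat n * x ^ (n - 1) * (y - x) * (y - x)"
      by (cases n) (simp_all add: algebra_simps)
    then have "cmod (y ^ Suc n - x ^ Suc n - of_nat (Suc n) * x ^ (Suc n - 1) * (y - x))
       \<le> cmod y * cmod ?R + cmod (of_nat n * x ^ (n - 1) * (y - x)) * cmod (y - x)"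
      by (metis norm_mult norm_triangle_ineq)
    also have "\<dots> \<le> r * cmod ?R + cmod (of_nat n * x ^ (n - 1) * (y - x)) * cmod (y - x)"
      using r by (intro add_mono mult_right_mono) auto
    finally have "r\<^sup>2 * cmod (y ^ Suc n - x ^ Suc n - of_nat (Suc n) * x ^ (Suc n - 1) * (y - x))
       \<le> r\<^sup>2 * (r * cmod ?R + cmod (of_nat n * x ^ (n - 1) * (y - x)) * cmod (y - x))"
      by (intro mult_left_mono) auto
    also have "\<dots> = r * (r\<^sup>2 * cmod ?R) + r * (r * cmod (of_nat n * x ^ (n - 1) * (y - x))) * cmod (y - x)"
      by (simp add: algebra_simps power2_eq_square)
    also have "\<dots> \<le> r * ((real n)\<^sup>2 * r ^ n * (cmod (y - x))\<^sup>2) + r * (n * r ^ n * cmod (y - x)) * cmod (y - x)"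
      using r 3 Suc by (intro add_mono mult_right_mono mult_left_mono) auto
    also have "\<dots> = ((real n)\<^sup>2 + n) * (r ^ Suc n * (cmod (y - x))\<^sup>2)"
      by (simp add: algebra_simps power2_eq_square)
    also have "\<dots> \<le> (real (Suc n))\<^sup>2 * (r ^ Suc n * (cmod (y - x))\<^sup>2)"
      using r by (intro mult_right_mono) (auto simp: power2_eq_square algebra_simps)
    finally show ?case by (simp add: mult.assoc)
  qed simp
qed

text \<open>The partial derivative, in the variable with index \<open>j\<close>, of the monomial
  with exponent \<kappa>.\<close>

definition dmono :: "'i set \<Rightarrow> ('i \<Rightarrow> complex) \<Rightarrow> ('i \<Rightarrow> nat) \<Rightarrow> 'i \<Rightarrow> complex" where
  "dmono J x \<kappa> j = of_nat (\<kappa> j) * x j ^ (\<kappa> j - 1) * mono_val (J - {j}) x \<kappa>"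

text \<open>Induction on the number of variables by the product rule. The constants are polynomial
  in the degree, so the remainders stay summable after a slight loss of radius.\<close>

lemma mono_val_diff_bounds:
  fixes x y :: "'i \<Rightarrow> complex" and \<eta> :: "'i set \<Rightarrow> real" and r :: real
  assumes "finite J" "0 \<le> r" "\<And>j. j \<in> J \<Longrightarrow> cmod (x j) \<le> r" "\<And>j. j \<in> J \<Longrightarrow> cmod (y j) \<le> r"
  defines "\<eta> \<equiv> (\<lambda>T. \<Sum>j\<in>T. cmod (y j - x j))"
  shows "r * cmod (mono_val J y \<kappa> - mono_val J x \<kappa>) \<le> mdeg J \<kappa> * r ^ mdeg J \<kappa> * \<eta> J \<and>
    r\<^sup>2 * cmod (mono_val J y \<kappa> - mono_val J x \<kappa> - (\<Sum>j\<in>J. (y j - x j) * dmono J x \<kappa> j))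
      \<le> (real (mdeg J \<kappa>))\<^sup>2 * r ^ mdeg J \<kappa> * (\<eta> J)\<^sup>2"
  using assms(1,3,4)
proof (induction J rule: finite_induct)
  case empty
  then show ?case by (simp add: mono_val_def mdeg_def)
next
  case (insert a J)
  define n where "n = \<kappa> a"
  define N where "N = mdeg J \<kappa>"
  define p where "p = x a ^ n"
  define p' where "p' = y a ^ n"
  define P where "P = mono_val J x \<kappa>"
  define P' where "P' = mono_val J y \<kappa>"
  define h where "h = y a - x a"
  define dp where "dp = of_nat n * x a ^ (n - 1) * h"
  define dP where "dP = (\<Sum>j\<in>J. (y j - x j) * dmono J x \<kappa> j)"
  define e where "e = cmod h"
  have xa: "cmod (x a) \<le> r" "cmod (y a) \<le> r" using insert by auto
  note pb = power_diff_bounds[OF assms(2) xa, of n, folded p_def p'_def h_def, folded dp_def e_def]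
  have IH: "r * cmod (P' - P) \<le> N * r ^ N * \<eta> J" "r\<^sup>2 * cmod (P' - P - dP) \<le> (real N)\<^sup>2 * r ^ N * (\<eta> J)\<^sup>2"
    using insert by (auto simp: P_def P'_def dP_def N_def)
  have eta: "\<eta> (insert a J) = e + \<eta> J" "0 \<le> e" "0 \<le> \<eta> J"
    using insert by (auto simp: \<eta>_def e_def h_def sum_nonneg)
  have m: "mdeg (insert a J) \<kappa> = n + N" using insert by (simp add: mdeg_def n_def N_def)
  have mv: "mono_val (insert a J) x \<kappa> = p * P" "mono_val (insert a J) y \<kappa> = p' * P'"
    using insert by (simp_all add: mono_val_def p_def p'_def P_def P'_def n_def)
  have D: "(\<Sum>j\<in>insert a J. (y j - x j) * dmono (insert a J) x \<kappa> j) = dp * P + p * dP"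
  proof -
    have "dmono (insert a J) x \<kappa> j = p * dmono J x \<kappa> j" if "j \<in> J" for j
    proof -
      have "insert a J - {j} = insert a (J - {j})" "a \<notin> J - {j}" "finite (J - {j})" using insert that by auto
      then show ?thesis by (simp add: dmono_def mono_val_def p_def n_def)
    qed
    moreover have "dmono (insert a J) x \<kappa> a * (y a - x a) = dp * P"
      using insert by (simp add: dmono_def dp_def P_def h_def n_def)
    ultimately show ?thesis using insert
      by (simp add: dP_def sum_distrib_left mult.left_commute mult.commute[of "y a - x a"])
  qed
  have pr: "cmod p \<le> r ^ n" unfolding p_def norm_power using xa by (intro power_mono) auto
  have Pr: "cmod P' \<le> r ^ N" unfolding P'_def N_def using insert by (intro norm_mono_val_le) auto
  have rn: "0 \<le> r ^ n" "0 \<le> r ^ N" using assms(2) by auto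
  have "p' * P' - p * P = (p' - p) * P' + p * (P' - P)" by (simp add: algebra_simps)
  then have "cmod (p' * P' - p * P) \<le> cmod (p' - p) * cmod P' + cmod p * cmod (P' - P)"
    by (metis norm_mult norm_triangle_ineq)
  then have "r * cmod (p' * P' - p * P) \<le> r * (cmod (p' - p) * cmod P' + cmod p * cmod (P' - P))"
    using assms(2) by (rule mult_left_mono)
  also have "\<dots> = (r * cmod (p' - p)) * cmod P' + cmod p * (r * cmod (P' - P))" by (simp add: algebra_simps)
  also have "\<dots> \<le> (n * r ^ n * e) * r ^ N + r ^ n * (N * r ^ N * \<eta> J)"
    by (rule add_mono[OF mult_mono[OF pb(1) Pr] mult_mono[OF pr IH(1)]]) (use rn eta assms(2) in simp_all)
  also have "\<dots> = r ^ (n + N) * (n * e + N * \<eta> J)" by (simp add: power_add algebra_simps)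
  also have "\<dots> \<le> r ^ (n + N) * (real (n + N) * (e + \<eta> J))"
    using assms(2) eta by (intro mult_left_mono) (auto simp: algebra_simps)
  finally have A: "r * cmod (p' * P' - p * P) \<le> real (n + N) * r ^ (n + N) * (e + \<eta> J)" by (simp add: mult_ac)
  \<comment> \<open>The second order remainder of a product: remainder times value, derivative times
    difference, value times remainder.\<close>
  have "p' * P' - p * P - (dp * P + p * dP) = (p' - p - dp) * P' + dp * (P' - P) + p * (P' - P - dP)"
    by (simp add: algebra_simps)
  then have "cmod (p' * P' - p * P - (dp * P + p * dP))
     \<le> cmod (p' - p - dp) * cmod P' + cmod dp * cmod (P' - P) + cmod p * cmod (P' - P - dP)"
    by (metis norm_mult norm_triangle_mono norm_triangle_ineq order_refl)
  then have "r\<^sup>2 * cmod (p' * P' - p * P - (dp * P + p * dP))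
     \<le> r\<^sup>2 * (cmod (p' - p - dp) * cmod P' + cmod dp * cmod (P' - P) + cmod p * cmod (P' - P - dP))"
    by (intro mult_left_mono) auto
  also have "\<dots> = (r\<^sup>2 * cmod (p' - p - dp)) * cmod P' + (r * cmod dp) * (r * cmod (P' - P)) + cmod p * (r\<^sup>2 * cmod (P' - P - dP))"
    by (simp add: algebra_simps power2_eq_square)
  also have "\<dots> \<le> ((real n)\<^sup>2 * r ^ n * e\<^sup>2) * r ^ N + (n * r ^ n * e) * (N * r ^ N * \<eta> J) + r ^ n * ((real N)\<^sup>2 * r ^ N * (\<eta> J)\<^sup>2)"
    by (rule add_mono[OF add_mono[OF mult_mono[OF pb(2) Pr] mult_mono[OF pb(3) IH(1)]] mult_mono[OF pr IH(2)]])
      (use rn eta assms(2) in simp_all)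
  also have "\<dots> = r ^ (n + N) * ((n * e)\<^sup>2 + (n * e) * (N * \<eta> J) + (N * \<eta> J)\<^sup>2)"
    by (simp add: power_add algebra_simps power2_eq_square)
  also have "\<dots> \<le> r ^ (n + N) * (real (n + N) * (e + \<eta> J))\<^sup>2"
  proof (intro mult_left_mono)
    have "(n * e)\<^sup>2 + (n * e) * (N * \<eta> J) + (N * \<eta> J)\<^sup>2 \<le> (n * e + N * \<eta> J)\<^sup>2"
      using eta by (simp add: power2_eq_square algebra_simps)
    also have "\<dots> \<le> (real (n + N) * (e + \<eta> J))\<^sup>2"
      using eta by (intro power_mono) (auto simp: algebra_simps)
    finally show "(n * e)\<^sup>2 + (n * e) * (N * \<eta> J) + (N * \<eta> J)\<^sup>2 \<le> (real (n + N) * (e + \<eta> J))\<^sup>2" .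
  qed (use assms(2) in auto)
  finally have B: "r\<^sup>2 * cmod (p' * P' - p * P - (dp * P + p * dP)) \<le> (real (n + N))\<^sup>2 * r ^ (n + N) * (e + \<eta> J)\<^sup>2"
    by (simp add: power_mult_distrib mult_ac)
  show ?case unfolding mv m eta(1) D using A B by (simp only:)
qed

lemma dmono_bound:
  fixes r :: real
  assumes "finite J" "j \<in> J" "0 \<le> r" "\<And>i. i \<in> J \<Longrightarrow> cmod (x i) \<le> r"
  shows "r * cmod (dmono J x \<kappa> j) \<le> mdeg J \<kappa> * r ^ mdeg J \<kappa>"
proof -
  have m: "mdeg J \<kappa> = \<kappa> j + mdeg (J - {j}) \<kappa>" using assms by (simp add: mdeg_def sum.remove)
  have "cmod (mono_val (J - {j}) x \<kappa>) \<le> r ^ mdeg (J - {j}) \<kappa>"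
    using assms by (intro norm_mono_val_le) auto
  moreover have "r * cmod (of_nat (\<kappa> j) * x j ^ (\<kappa> j - 1)) \<le> \<kappa> j * r ^ \<kappa> j"
  proof (cases "\<kappa> j")
    case (Suc n)
    have "cmod (x j) ^ n \<le> r ^ n" using assms by (intro power_mono) auto
    then have "real (Suc n) * (r * cmod (x j) ^ n) \<le> real (Suc n) * (r * r ^ n)"
      using assms by (intro mult_left_mono) auto
    then show ?thesis using Suc by (simp add: norm_mult norm_power mult_ac del: of_nat_Suc)
  qed simp
  ultimately have "(r * cmod (of_nat (\<kappa> j) * x j ^ (\<kappa> j - 1))) * cmod (mono_val (J - {j}) x \<kappa>)
    \<le> (\<kappa> j * r ^ \<kappa> j) * r ^ mdeg (J - {j}) \<kappa>"
    using assms(3) by (rule_tac mult_mono[rotated]) simp_all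
  also have "\<dots> = \<kappa> j * r ^ mdeg J \<kappa>" by (simp add: m power_add)
  also have "\<dots> \<le> mdeg J \<kappa> * r ^ mdeg J \<kappa>" using assms by (intro mult_right_mono) (auto simp: m)
  finally show ?thesis by (simp add: dmono_def norm_mult mult.assoc)
qed

text \<open>Pays for the factors n and n^2 produced by differentiation when the radius shrinks in
  the ratio q.\<close>

lemma square_times_geometric_bounded:
  fixes q :: real
  assumes "0 < q" "q < 1"
  obtains C where "C \<ge> 0" "\<And>n. (real n)\<^sup>2 * q ^ n \<le> C" "\<And>n. real n * q ^ n \<le> C"
proof -
  have "(\<lambda>n. (real n)\<^sup>2 * q ^ n) \<longlonglongrightarrow> 0" using assms by real_asymp
  then have "Bseq (\<lambda>n. (real n)\<^sup>2 * q ^ n)" by (rule convergent_imp_Bseq[OF convergentI])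
  then obtain C where C: "C > 0" "\<And>n. norm ((real n)\<^sup>2 * q ^ n) \<le> C" by (auto simp: Bseq_def)
  have 1: "(real n)\<^sup>2 * q ^ n \<le> C" for n using C(2)[of n] by simp
  have "real n \<le> (real n)\<^sup>2" for n by (cases n) (simp_all add: power2_eq_square)
  then have "real n * q ^ n \<le> (real n)\<^sup>2 * q ^ n" for n using assms by (intro mult_right_mono) auto
  then have "real n * q ^ n \<le> C" for n using 1 order_trans by blast
  then show thesis using that[of C] C(1) 1 by simp
qed

lemma nsum_weighted_bound:
  assumes F: "seminormed F" and c: "\<And>k. k \<in> A \<Longrightarrow> c k \<in> vecs F"
    and w: "(\<lambda>k. w k * nrm F (c k)) summable_on A" and m: "\<And>k. k \<in> A \<Longrightarrow> cmod (m k) \<le> a * w k" 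
    and n: "nsum F A (\<lambda>k. m k *\<^sub>C c k) x"
  shows "nrm F x \<le> a * (\<Sum>\<^sub>\<infinity>k\<in>A. w k * nrm F (c k))"
proof -
  have le: "nrm F (m k *\<^sub>C c k) \<le> a * (w k * nrm F (c k))" if "k \<in> A" for k
    using mult_right_mono[OF m[OF that] seminormed_nonneg[OF F c[OF that]]] seminormed_nrm_scaleC[OF F c[OF that]]
    by (simp add: mult.assoc)
  have sa: "(\<lambda>k. a * (w k * nrm F (c k))) summable_on A" by (rule summable_on_cmult_right[OF w])
  have s: "(\<lambda>k. nrm F (m k *\<^sub>C c k)) summable_on A"
    using sa by (rule summable_on_comparison_test) (use le seminormed_nonneg[OF F seminormed_scaleC[OF F c]] in auto)
  have "nrm F x \<le> (\<Sum>\<^sub>\<infinity>k\<in>A. nrm F (m k *\<^sub>C c k))"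
    by (rule nsum_bound[OF F seminormed_scaleC[OF F c] s n])
  also have "\<dots> \<le> (\<Sum>\<^sub>\<infinity>k\<in>A. a * (w k * nrm F (c k)))" by (rule infsum_mono[OF s sa le])
  also have "\<dots> = a * (\<Sum>\<^sub>\<infinity>k\<in>A. w k * nrm F (c k))" by (rule infsum_cmult_right'[OF ])
  finally show ?thesis .
qed

lemma summing_obtain:
  assumes F: "seminormed F" and sc: "summing F A c"
    and w: "(\<lambda>k. w k * nrm F (c k)) summable_on A" and m: "\<And>k. k \<in> A \<Longrightarrow> cmod (m k) \<le> a * w k"
  shows "\<exists>s. nsum F A (\<lambda>k. m k *\<^sub>C c k) s"
proof -
  have c: "\<And>k. k \<in> A \<Longrightarrow> c k \<in> vecs F" using sc by (simp add: summing_def)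
  have "(\<lambda>k. a * (w k * nrm F (c k))) summable_on A" by (rule summable_on_cmult_right[OF w])
  then have "(\<lambda>k. cmod (m k) * nrm F (c k)) summable_on A"
  proof (rule summable_on_comparison_test)
    show "cmod (m k) * nrm F (c k) \<le> a * (w k * nrm F (c k))" if "k \<in> A" for k
      using mult_right_mono[OF m[OF that] seminormed_nonneg[OF F c[OF that]]] by (simp add: mult.assoc)
  qed (use seminormed_nonneg[OF F c] in auto)
  then show ?thesis using sc by (simp add: summing_def)
qed

text \<open>A Taylor estimate of second order, uniform on a polydisc and formulated for functions of
  the coordinates alone. It can therefore be pulled back along any continuous coordinate map, also
  to sectors spread over the polydisc.\<close>

definition quadratic_approx :: "'i set \<Rightarrow> 'v::complex_vector nspace \<Rightarrow> real \<Rightarrow> (('i \<Rightarrow> complex) \<Rightarrow> 'v) \<Rightarrow> bool" where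
  "quadratic_approx J F r G \<longleftrightarrow> (\<exists>C. \<forall>x. (\<forall>j\<in>J. cmod (x j) \<le> r) \<longrightarrow>
     (\<exists>v. (\<forall>j\<in>J. v j \<in> vecs F) \<and> (\<forall>y. (\<forall>j\<in>J. cmod (y j) \<le> r) \<longrightarrow>
       nrm F (G y - G x - (\<Sum>j\<in>J. (y j - x j) *\<^sub>C v j)) \<le> C * (\<Sum>j\<in>J. cmod (y j - x j))\<^sup>2)))"

text \<open>Termwise differentiation. The existence of the derivative and the quadratic remainder
  both follow from bounds of the scalar factors by multiples of \<rho> ^ |\<kappa>|, which the gap
  between r and \<rho> provides.\<close>

theorem power_series_nspace:
  fixes c :: "('i \<Rightarrow> nat) \<Rightarrow> 'v::complex_vector"
  assumes F: "seminormed F" and J: "finite J" and sc: "summing F (tuples J) c" and \<rho>: "0 < \<rho>"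
    and s: "(\<lambda>\<kappa>. \<rho> ^ mdeg J \<kappa> * nrm F (c \<kappa>)) summable_on tuples J"
  shows "\<exists>G. (\<forall>z. (\<forall>j\<in>J. cmod (z j) \<le> \<rho>) \<longrightarrow> nsum F (tuples J) (\<lambda>\<kappa>. mono_val J z \<kappa> *\<^sub>C c \<kappa>) (G z)) \<and>
    (\<forall>r. 0 < r \<longrightarrow> r < \<rho> \<longrightarrow> quadratic_approx J F r G)"
proof -
  have c: "\<And>k. k \<in> tuples J \<Longrightarrow> c k \<in> vecs F" using sc by (simp add: summing_def)
  \<comment> \<open>The sum exists on the closed polydisc of radius \<rho>; elsewhere the value may
    be arbitrary.\<close>
  define G where "G z = (SOME s. nsum F (tuples J) (\<lambda>\<kappa>. mono_val J z \<kappa> *\<^sub>C c \<kappa>) s)" for z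
  have G: "nsum F (tuples J) (\<lambda>\<kappa>. mono_val J z \<kappa> *\<^sub>C c \<kappa>) (G z)" if "\<forall>j\<in>J. cmod (z j) \<le> \<rho>" for z
    unfolding G_def
  proof (rule someI_ex, rule summing_obtain[OF F sc s, of _ 1])
    fix k show "cmod (mono_val J z k) \<le> 1 * \<rho> ^ mdeg J k" using norm_mono_val_le[of J z \<rho> k] that by simp
  qed
  have "quadratic_approx J F r G" if r: "0 < r" "r < \<rho>" for r
  proof -
    \<comment> \<open>Passing from r to \<rho> leaves a factor q ^ n that absorbs both n and
      n^2.\<close>
    define q where "q = r / \<rho>"
    have q: "0 < q" "q < 1" using r \<rho> by (auto simp: q_def)
    obtain C where C: "C \<ge> 0" "\<And>n. (real n)\<^sup>2 * q ^ n \<le> C" "\<And>n. real n * q ^ n \<le> C"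
      by (rule square_times_geometric_bounded[OF q], rule that)
    have rq: "r ^ n = q ^ n * \<rho> ^ n" for n using \<rho> by (simp add: q_def power_divide)
    have C1: "n * r ^ n \<le> C * \<rho> ^ n" for n
      unfolding rq using mult_right_mono[OF C(3)[of n], of "\<rho> ^ n"] \<rho> by (simp add: mult.assoc)
    have C2: "(real n)\<^sup>2 * r ^ n \<le> C * \<rho> ^ n" for n
      unfolding rq using mult_right_mono[OF C(2)[of n], of "\<rho> ^ n"] \<rho> by (simp add: mult.assoc)
    define T where "T = (\<Sum>\<^sub>\<infinity>\<kappa>\<in>tuples J. \<rho> ^ mdeg J \<kappa> * nrm F (c \<kappa>))"
    show ?thesis unfolding quadratic_approx_def
    proof (intro exI[of _ "C / r\<^sup>2 * T"] allI impI)
      fix x :: "'i \<Rightarrow> complex" assume x: "\<forall>j\<in>J. cmod (x j) \<le> r"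
      have "\<forall>j\<in>J. \<exists>v. nsum F (tuples J) (\<lambda>\<kappa>. dmono J x \<kappa> j *\<^sub>C c \<kappa>) v"
      proof
        fix j assume j: "j \<in> J"
        show "\<exists>v. nsum F (tuples J) (\<lambda>\<kappa>. dmono J x \<kappa> j *\<^sub>C c \<kappa>) v"
        proof (rule summing_obtain[OF F sc s, of _ "C / r"])
          fix \<kappa>
          have "r * cmod (dmono J x \<kappa> j) \<le> C * \<rho> ^ mdeg J \<kappa>"
            using order_trans[OF dmono_bound[OF J j] C1] x r by auto
          then show "cmod (dmono J x \<kappa> j) \<le> C / r * \<rho> ^ mdeg J \<kappa>" using r by (simp add: field_simps)
        qed
      qed
      then obtain v where v: "\<forall>j\<in>J. nsum F (tuples J) (\<lambda>\<kappa>. dmono J x \<kappa> j *\<^sub>C c \<kappa>) (v j)" by metis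
      show "\<exists>v. (\<forall>j\<in>J. v j \<in> vecs F) \<and> (\<forall>y. (\<forall>j\<in>J. cmod (y j) \<le> r) \<longrightarrow>
       nrm F (G y - G x - (\<Sum>j\<in>J. (y j - x j) *\<^sub>C v j)) \<le> C / r\<^sup>2 * T * (\<Sum>j\<in>J. cmod (y j - x j))\<^sup>2)"
      proof (intro exI[of _ v] conjI allI impI ballI)
        show "v j \<in> vecs F" if "j \<in> J" for j using v that by (auto simp: nsum_def)
        fix y :: "'i \<Rightarrow> complex" assume y: "\<forall>j\<in>J. cmod (y j) \<le> r"
        let ?\<eta> = "\<Sum>j\<in>J. cmod (y j - x j)"
        define m where "m \<kappa> = mono_val J y \<kappa> - mono_val J x \<kappa> - (\<Sum>j\<in>J. (y j - x j) * dmono J x \<kappa> j)" for \<kappa>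
        note cs = seminormed_scaleC[OF F c]
        have xr: "\<forall>j\<in>J. cmod (x j) \<le> \<rho>" "\<forall>j\<in>J. cmod (y j) \<le> \<rho>" using x y r by fastforce+
        have n1: "nsum F (tuples J) (\<lambda>\<kappa>. \<Sum>j\<in>J. (y j - x j) *\<^sub>C dmono J x \<kappa> j *\<^sub>C c \<kappa>) (\<Sum>j\<in>J. (y j - x j) *\<^sub>C v j)"
          using v by (intro nsum_sum[OF F J] nsum_scaleC[OF F] seminormed_scaleC[OF F] c) auto
        have n2: "nsum F (tuples J) (\<lambda>\<kappa>. mono_val J y \<kappa> *\<^sub>C c \<kappa> - mono_val J x \<kappa> *\<^sub>C c \<kappa>) (G y - G x)"
          by (intro nsum_diff[OF F] cs G xr)
        have n3: "nsum F (tuples J) (\<lambda>\<kappa>. (mono_val J y \<kappa> *\<^sub>C c \<kappa> - mono_val J x \<kappa> *\<^sub>C c \<kappa>)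
           - (\<Sum>j\<in>J. (y j - x j) *\<^sub>C dmono J x \<kappa> j *\<^sub>C c \<kappa>)) (G y - G x - (\<Sum>j\<in>J. (y j - x j) *\<^sub>C v j))"
        proof (rule nsum_diff[OF F _ _ n2 n1])
          fix k :: "'i \<Rightarrow> nat" assume k: "k \<in> tuples J"
          show "mono_val J y k *\<^sub>C c k - mono_val J x k *\<^sub>C c k \<in> vecs F"
            by (intro seminormed_diff(1)[OF F] cs k)
          show "(\<Sum>j\<in>J. (y j - x j) *\<^sub>C dmono J x k j *\<^sub>C c k) \<in> vecs F"
            by (intro conjunct1[OF seminormed_sum[OF F]] seminormed_scaleC[OF F] c k)
        qed
        have "(mono_val J y \<kappa> *\<^sub>C c \<kappa> - mono_val J x \<kappa> *\<^sub>C c \<kappa>)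
           - (\<Sum>j\<in>J. (y j - x j) *\<^sub>C dmono J x \<kappa> j *\<^sub>C c \<kappa>) = m \<kappa> *\<^sub>C c \<kappa>" for \<kappa>
          by (simp add: m_def scaleC_diff_left scaleC_sum_left scaleC_scaleC)
        then have n4: "nsum F (tuples J) (\<lambda>\<kappa>. m \<kappa> *\<^sub>C c \<kappa>) (G y - G x - (\<Sum>j\<in>J. (y j - x j) *\<^sub>C v j))"
          using n3 by simp
        have "nrm F (G y - G x - (\<Sum>j\<in>J. (y j - x j) *\<^sub>C v j)) \<le> (C / r\<^sup>2 * ?\<eta>\<^sup>2) * T"
          unfolding T_def
        proof (rule nsum_weighted_bound[OF F c s _ n4])
          fix \<kappa>
          have "r\<^sup>2 * cmod (m \<kappa>) \<le> ((real (mdeg J \<kappa>))\<^sup>2 * r ^ mdeg J \<kappa>) * ?\<eta>\<^sup>2"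
            unfolding m_def using mono_val_diff_bounds[OF J, of r x y \<kappa>] x y r by auto
          also have "\<dots> \<le> (C * \<rho> ^ mdeg J \<kappa>) * ?\<eta>\<^sup>2" by (intro mult_right_mono C2) auto
          finally show "cmod (m \<kappa>) \<le> C / r\<^sup>2 * ?\<eta>\<^sup>2 * \<rho> ^ mdeg J \<kappa>"
            using r by (simp add: field_simps)
        qed
        then show "nrm F (G y - G x - (\<Sum>j\<in>J. (y j - x j) *\<^sub>C v j)) \<le> C / r\<^sup>2 * T * ?\<eta>\<^sup>2"
          by (simp add: mult_ac)
      qed
    qed
  qed
  then show ?thesis using G by blast
qed

section \<open>Criteria for holomorphy and linear combinations\<close>

lemma quadratic_approxD:
  "quadratic_approx J F r G \<Longrightarrow> \<exists>C. \<forall>x. (\<forall>j\<in>J. cmod (x j) \<le> r) \<longrightarrow>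
     (\<exists>v. (\<forall>j\<in>J. v j \<in> vecs F) \<and> (\<forall>y. (\<forall>j\<in>J. cmod (y j) \<le> r) \<longrightarrow>
       nrm F (G y - G x - (\<Sum>j\<in>J. (y j - x j) *\<^sub>C v j)) \<le> C * (\<Sum>j\<in>J. cmod (y j - x j))\<^sup>2))"
  by (simp only: quadratic_approx_def)

lemma holomorphic_mapD:
  "holomorphic_map J F \<pi> S f \<Longrightarrow> x \<in> S \<Longrightarrow> \<exists>v. (\<forall>j\<in>J. v j \<in> vecs F) \<and>
     (\<forall>\<epsilon>>0. \<forall>\<^sub>F y in at x within S. nrm F (f y - f x - (\<Sum>j\<in>J. (\<pi> y j - \<pi> x j) *\<^sub>C v j)) \<le> \<epsilon> * (\<Sum>j\<in>J. cmod (\<pi> y j - \<pi> x j)))"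
  unfolding holomorphic_map_def by (rule bspec[OF conjunct2])

text \<open>By continuity the increments of the coordinates tend to 0, so a quadratic remainder is
  eventually below \<epsilon> times the increment.\<close>

lemma holomorphic_map_quadratic:
  assumes F: "seminormed F" and J: "finite J" and q: "quadratic_approx J F r G"
    and \<pi>: "\<And>j. j \<in> J \<Longrightarrow> continuous_on S (\<lambda>x. \<pi> x j)" "\<And>x j. x \<in> S \<Longrightarrow> j \<in> J \<Longrightarrow> cmod (\<pi> x j) \<le> r"
    and f: "\<And>x. x \<in> S \<Longrightarrow> f x = G (\<pi> x)" "\<And>x. x \<in> S \<Longrightarrow> f x \<in> vecs F"
  shows "holomorphic_map J F \<pi> S f"
  unfolding holomorphic_map_def
proof (intro conjI ballI)
  fix x assume x: "x \<in> S"
  from quadratic_approxD[OF q] obtain C where C: "\<forall>x. (\<forall>j\<in>J. cmod (x j) \<le> r) \<longrightarrow>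
     (\<exists>v. (\<forall>j\<in>J. v j \<in> vecs F) \<and> (\<forall>y. (\<forall>j\<in>J. cmod (y j) \<le> r) \<longrightarrow>
       nrm F (G y - G x - (\<Sum>j\<in>J. (y j - x j) *\<^sub>C v j)) \<le> C * (\<Sum>j\<in>J. cmod (y j - x j))\<^sup>2))"
    by (elim exE)
  have "\<forall>j\<in>J. cmod (\<pi> x j) \<le> r" using \<pi>(2)[OF x] by (rule ballI)
  from mp[OF spec[OF C] this] obtain v where v: "\<forall>j\<in>J. v j \<in> vecs F" "\<forall>y. (\<forall>j\<in>J. cmod (y j) \<le> r) \<longrightarrow>
       nrm F (G y - G (\<pi> x) - (\<Sum>j\<in>J. (y j - \<pi> x j) *\<^sub>C v j)) \<le> C * (\<Sum>j\<in>J. cmod (y j - \<pi> x j))\<^sup>2"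
    by (elim exE conjE)
  show "\<exists>v. (\<forall>j\<in>J. v j \<in> vecs F) \<and>
     (\<forall>\<epsilon>>0. \<forall>\<^sub>F y in at x within S. nrm F (f y - f x - (\<Sum>j\<in>J. (\<pi> y j - \<pi> x j) *\<^sub>C v j)) \<le> \<epsilon> * (\<Sum>j\<in>J. cmod (\<pi> y j - \<pi> x j)))"
  proof (intro exI[of _ v] conjI v(1) allI impI)
    fix \<epsilon> :: real assume \<epsilon>: "\<epsilon> > 0"
    \<comment> \<open>A positive majorant of \<open>C\<close>, whose sign is unknown.\<close>
    define D where "D = \<bar>C\<bar> + 1"
    have D: "D > 0" "C \<le> D" by (auto simp: D_def)
    have "((\<lambda>y. \<Sum>j\<in>J. cmod (\<pi> y j - \<pi> x j)) \<longlongrightarrow> (\<Sum>j\<in>J. cmod (\<pi> x j - \<pi> x j))) (at x within S)"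
      using \<pi>(1) x by (intro tendsto_intros) (auto simp: continuous_on_def)
    then have "\<forall>\<^sub>F y in at x within S. (\<Sum>j\<in>J. cmod (\<pi> y j - \<pi> x j)) < \<epsilon> / D"
      using \<epsilon> D by (intro order_tendstoD) auto
    moreover have "\<forall>\<^sub>F y in at x within S. y \<in> S" by (simp add: eventually_at_filter)
    ultimately show "\<forall>\<^sub>F y in at x within S. nrm F (f y - f x - (\<Sum>j\<in>J. (\<pi> y j - \<pi> x j) *\<^sub>C v j)) \<le> \<epsilon> * (\<Sum>j\<in>J. cmod (\<pi> y j - \<pi> x j))"
    proof eventually_elim
      case (elim y)
      define e where "e = (\<Sum>j\<in>J. cmod (\<pi> y j - \<pi> x j))"
      have e: "0 \<le> e" "e < \<epsilon> / D" using elim by (auto simp: e_def sum_nonneg)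
      have "nrm F (f y - f x - (\<Sum>j\<in>J. (\<pi> y j - \<pi> x j) *\<^sub>C v j)) \<le> C * e\<^sup>2"
        using v(2)[rule_format, of "\<pi> y"] \<pi>(2)[OF elim(2)] f(1)[OF elim(2)] f(1)[OF x] by (simp add: e_def)
      also have "\<dots> \<le> D * e\<^sup>2" using D by (intro mult_right_mono) auto
      also have "\<dots> = (D * e) * e" by (simp add: power2_eq_square)
      also have "\<dots> \<le> \<epsilon> * e" using e D by (intro mult_right_mono) (auto simp: field_simps)
      finally show ?case by (simp add: e_def)
    qed
  qed
qed (use f in auto)

lemma holomorphic_map_add:
  assumes F: "seminormed F" and J: "finite J" and fg: "holomorphic_map J F \<pi> S f" "holomorphic_map J F \<pi> S g"
  shows "holomorphic_map J F \<pi> S (\<lambda>x. f x + g x)"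
  unfolding holomorphic_map_def
proof (intro conjI ballI)
  have vf: "\<And>x. x \<in> S \<Longrightarrow> f x \<in> vecs F" and vg: "\<And>x. x \<in> S \<Longrightarrow> g x \<in> vecs F"
    using fg by (auto simp: holomorphic_map_def)
  then show "f x + g x \<in> vecs F" if "x \<in> S" for x using that by (intro seminormed_add[OF F])
  fix x assume x: "x \<in> S"
  obtain v where v: "\<forall>j\<in>J. v j \<in> vecs F" "\<forall>\<epsilon>>0. \<forall>\<^sub>F y in at x within S. nrm F (f y - f x - (\<Sum>j\<in>J. (\<pi> y j - \<pi> x j) *\<^sub>C v j)) \<le> \<epsilon> * (\<Sum>j\<in>J. cmod (\<pi> y j - \<pi> x j))"
    using holomorphic_mapD[OF fg(1) x] by (elim exE conjE)
  obtain u where u: "\<forall>j\<in>J. u j \<in> vecs F" "\<forall>\<epsilon>>0. \<forall>\<^sub>F y in at x within S. nrm F (g y - g x - (\<Sum>j\<in>J. (\<pi> y j - \<pi> x j) *\<^sub>C u j)) \<le> \<epsilon> * (\<Sum>j\<in>J. cmod (\<pi> y j - \<pi> x j))"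
    using holomorphic_mapD[OF fg(2) x] by (elim exE conjE)
  show "\<exists>v. (\<forall>j\<in>J. v j \<in> vecs F) \<and>
     (\<forall>\<epsilon>>0. \<forall>\<^sub>F y in at x within S. nrm F (f y + g y - (f x + g x) - (\<Sum>j\<in>J. (\<pi> y j - \<pi> x j) *\<^sub>C v j)) \<le> \<epsilon> * (\<Sum>j\<in>J. cmod (\<pi> y j - \<pi> x j)))"
  proof (intro exI[of _ "\<lambda>j. v j + u j"] conjI allI impI ballI)
    show "v j + u j \<in> vecs F" if "j \<in> J" for j using v u that by (intro seminormed_add[OF F]) auto
    fix \<epsilon> :: real assume \<epsilon>: "\<epsilon> > 0"
    have "\<forall>\<^sub>F y in at x within S. y \<in> S" by (simp add: eventually_at_filter)
    with v(2)[rule_format, of "\<epsilon> / 2"] u(2)[rule_format, of "\<epsilon> / 2"]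
    have "\<forall>\<^sub>F y in at x within S. y \<in> S \<and> nrm F (f y - f x - (\<Sum>j\<in>J. (\<pi> y j - \<pi> x j) *\<^sub>C v j)) \<le> \<epsilon> / 2 * (\<Sum>j\<in>J. cmod (\<pi> y j - \<pi> x j)) \<and>
      nrm F (g y - g x - (\<Sum>j\<in>J. (\<pi> y j - \<pi> x j) *\<^sub>C u j)) \<le> \<epsilon> / 2 * (\<Sum>j\<in>J. cmod (\<pi> y j - \<pi> x j))"
      using \<epsilon> by (auto simp: eventually_conj_iff)
    then show "\<forall>\<^sub>F y in at x within S. nrm F (f y + g y - (f x + g x) - (\<Sum>j\<in>J. (\<pi> y j - \<pi> x j) *\<^sub>C (v j + u j))) \<le> \<epsilon> * (\<Sum>j\<in>J. cmod (\<pi> y j - \<pi> x j))"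
    proof eventually_elim
      case (elim y)
      let ?a = "f y - f x - (\<Sum>j\<in>J. (\<pi> y j - \<pi> x j) *\<^sub>C v j)"
      let ?b = "g y - g x - (\<Sum>j\<in>J. (\<pi> y j - \<pi> x j) *\<^sub>C u j)"
      have mem: "?a \<in> vecs F" "?b \<in> vecs F"
        using elim x vf vg v(1) u(1)
        by (auto intro!: seminormed_diff(1)[OF F] conjunct1[OF seminormed_sum[OF F]] seminormed_scaleC[OF F])
      have eq: "f y + g y - (f x + g x) - (\<Sum>j\<in>J. (\<pi> y j - \<pi> x j) *\<^sub>C (v j + u j)) = ?a + ?b"
        by (simp add: scaleC_add_right sum.distrib)
      show ?case unfolding eq using seminormed_triangle[OF F mem] elim by linarith
    qed
  qed
qed

lemma holomorphic_map_scaleC: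
  assumes F: "seminormed F" and f: "holomorphic_map J F \<pi> S f"
  shows "holomorphic_map J F \<pi> S (\<lambda>x. a *\<^sub>C f x)"
  unfolding holomorphic_map_def
proof (intro conjI ballI)
  have vf: "\<And>x. x \<in> S \<Longrightarrow> f x \<in> vecs F" using f by (auto simp: holomorphic_map_def)
  then show "a *\<^sub>C f x \<in> vecs F" if "x \<in> S" for x using that by (intro seminormed_scaleC[OF F])
  fix x assume x: "x \<in> S"
  obtain v where v: "\<forall>j\<in>J. v j \<in> vecs F" "\<forall>\<epsilon>>0. \<forall>\<^sub>F y in at x within S. nrm F (f y - f x - (\<Sum>j\<in>J. (\<pi> y j - \<pi> x j) *\<^sub>C v j)) \<le> \<epsilon> * (\<Sum>j\<in>J. cmod (\<pi> y j - \<pi> x j))"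
    using holomorphic_mapD[OF f x] by (elim exE conjE)
  show "\<exists>v. (\<forall>j\<in>J. v j \<in> vecs F) \<and>
     (\<forall>\<epsilon>>0. \<forall>\<^sub>F y in at x within S. nrm F (a *\<^sub>C f y - a *\<^sub>C f x - (\<Sum>j\<in>J. (\<pi> y j - \<pi> x j) *\<^sub>C v j)) \<le> \<epsilon> * (\<Sum>j\<in>J. cmod (\<pi> y j - \<pi> x j)))"
  proof (intro exI[of _ "\<lambda>j. a *\<^sub>C v j"] conjI allI impI ballI)
    show "a *\<^sub>C v j \<in> vecs F" if "j \<in> J" for j using v that by (intro seminormed_scaleC[OF F]) auto
    fix \<epsilon> :: real assume \<epsilon>: "\<epsilon> > 0"
    \<comment> \<open>Positive also for a = 0, so that \<epsilon> / D can be taken as the new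
      tolerance.\<close>
    define D where "D = cmod a + 1"
    have D: "D > 0" "cmod a \<le> D" by (auto simp: D_def intro: add_nonneg_pos)
    have "\<forall>\<^sub>F y in at x within S. y \<in> S" by (simp add: eventually_at_filter)
    moreover have "\<forall>\<^sub>F y in at x within S. nrm F (f y - f x - (\<Sum>j\<in>J. (\<pi> y j - \<pi> x j) *\<^sub>C v j)) \<le> \<epsilon> / D * (\<Sum>j\<in>J. cmod (\<pi> y j - \<pi> x j))"
      by (rule v(2)[rule_format]) (use \<epsilon> D in simp)
    ultimately show "\<forall>\<^sub>F y in at x within S. nrm F (a *\<^sub>C f y - a *\<^sub>C f x - (\<Sum>j\<in>J. (\<pi> y j - \<pi> x j) *\<^sub>C (a *\<^sub>C v j))) \<le> \<epsilon> * (\<Sum>j\<in>J. cmod (\<pi> y j - \<pi> x j))"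
    proof eventually_elim
      case (elim y)
      let ?a = "f y - f x - (\<Sum>j\<in>J. (\<pi> y j - \<pi> x j) *\<^sub>C v j)"
      have mem: "?a \<in> vecs F"
        using elim x vf v(1)
        by (auto intro!: seminormed_diff(1)[OF F] conjunct1[OF seminormed_sum[OF F]] seminormed_scaleC[OF F])
      have eq: "a *\<^sub>C f y - a *\<^sub>C f x - (\<Sum>j\<in>J. (\<pi> y j - \<pi> x j) *\<^sub>C (a *\<^sub>C v j)) = a *\<^sub>C ?a"
        by (simp add: scaleC_diff_right scaleC_sum_right scaleC_scaleC mult.commute)
      have "nrm F (a *\<^sub>C ?a) \<le> D * nrm F ?a"
        unfolding seminormed_nrm_scaleC[OF F mem] by (intro mult_right_mono D seminormed_nonneg[OF F mem])
      also have "\<dots> \<le> D * (\<epsilon> / D * (\<Sum>j\<in>J. cmod (\<pi> y j - \<pi> x j)))"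
        using elim D by (intro mult_left_mono) auto
      finally show ?case unfolding eq using D by simp
    qed
  qed
qed

section \<open>Bounded holomorphic maps as a normed space\<close>

lemma bdd_holomorphic_nrm_le:
  assumes "U \<noteq> {}" "\<And>z. z \<in> U \<Longrightarrow> nrm F (f z) \<le> M"
  shows "nrm (bdd_holomorphic J U F) f \<le> M"
  unfolding bdd_holomorphic_def using assms by (auto intro!: cSUP_least)

lemma bdd_holomorphic_le_nrm:
  assumes "f \<in> vecs (bdd_holomorphic J U F)" "z \<in> U"
  shows "nrm F (f z) \<le> nrm (bdd_holomorphic J U F) f"
  using assms unfolding bdd_holomorphic_def by (auto intro!: cSUP_upper bdd_aboveI2)

lemma bdd_holomorphic_vecs:
  "f \<in> vecs (bdd_holomorphic J U F) \<longleftrightarrow> holomorphic_map J F (\<lambda>z. z) U f \<and> (\<exists>M. \<forall>z\<in>U. nrm F (f z) \<le> M) \<and>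
                 (\<forall>z. z \<notin> U \<longrightarrow> f z = 0)"
  by (simp add: bdd_holomorphic_def)

lemma bdd_holomorphic_value:
  "f \<in> vecs (bdd_holomorphic J U F) \<Longrightarrow> z \<in> U \<Longrightarrow> f z \<in> vecs F"
  by (auto simp: bdd_holomorphic_def holomorphic_map_def)

lemma seminormed_bdd_holomorphic:
  assumes F: "seminormed F" and J: "finite J" and U: "U \<noteq> {}"
  shows "seminormed (bdd_holomorphic J U F)"
  unfolding seminormed_def
proof (intro conjI ballI allI)
  let ?O = "bdd_holomorphic J U F"
  have "holomorphic_map J F (\<lambda>z. z) U 0"
    unfolding holomorphic_map_def
    by (auto simp: seminormed_zero[OF F] seminormed_nrm_zero[OF F] intro!: exI[of _ "\<lambda>_. 0"] always_eventually mult_nonneg_nonneg sum_nonneg)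
  then show zero: "0 \<in> vecs ?O"
    by (auto simp: bdd_holomorphic_vecs seminormed_nrm_zero[OF F])
  fix f assume f: "f \<in> vecs ?O"
  then obtain M where M: "\<And>z. z \<in> U \<Longrightarrow> nrm F (f z) \<le> M" by (auto simp: bdd_holomorphic_vecs)
  {
    fix g assume g: "g \<in> vecs ?O"
    have le: "nrm F ((f + g) z) \<le> nrm ?O f + nrm ?O g" if "z \<in> U" for z
      using seminormed_triangle[OF F bdd_holomorphic_value[OF f that] bdd_holomorphic_value[OF g that]]
        bdd_holomorphic_le_nrm[OF f that] bdd_holomorphic_le_nrm[OF g that] by simp
    have "f + g = (\<lambda>x. f x + g x)" by (simp add: fun_eq_iff)
    then show "f + g \<in> vecs ?O"
      using f g holomorphic_map_add[OF F J, of "\<lambda>z. z" U f g] le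
      unfolding bdd_holomorphic_vecs by (auto intro!: exI[of _ "nrm ?O f + nrm ?O g"])
    show "nrm ?O (f + g) \<le> nrm ?O f + nrm ?O g"
      by (intro bdd_holomorphic_nrm_le U le)
  }
  fix a :: complex
  have eq: "nrm F ((a *\<^sub>C f) z) = cmod a * nrm F (f z)" if "z \<in> U" for z
    using seminormed_nrm_scaleC[OF F bdd_holomorphic_value[OF f that]] by (simp add: scaleC_fun_def)
  have le: "nrm F ((a *\<^sub>C f) z) \<le> cmod a * nrm ?O f" if "z \<in> U" for z
    unfolding eq[OF that] by (intro mult_left_mono bdd_holomorphic_le_nrm f that) auto
  show af: "a *\<^sub>C f \<in> vecs ?O"
    using f holomorphic_map_scaleC[OF F, of J "\<lambda>z. z" U f a] le
    unfolding bdd_holomorphic_vecs by (auto simp: scaleC_fun_def intro!: exI[of _ "cmod a * nrm ?O f"])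
  \<comment> \<open>The reverse inequality by scaling back with 1 / a; for a = 0 only nonnegativity
    of the norm is at stake.\<close>
  have "cmod a * nrm ?O f \<le> nrm ?O (a *\<^sub>C f)"
  proof (cases "a = 0")
    case True
    obtain z where "z \<in> U" using U by blast
    then show ?thesis using bdd_holomorphic_le_nrm[OF af, of z] eq[of z] True by simp
  next
    case False
    have "nrm ?O f \<le> nrm ?O (a *\<^sub>C f) / cmod a"
    proof (rule bdd_holomorphic_nrm_le[OF U])
      fix z assume z: "z \<in> U"
      show "nrm F (f z) \<le> nrm ?O (a *\<^sub>C f) / cmod a"
        using bdd_holomorphic_le_nrm[OF af z] eq[OF z] False by (simp add: field_simps)
    qed
    then show ?thesis using False by (simp add: field_simps)
  qed
  then show "nrm ?O (a *\<^sub>C f) = cmod a * nrm ?O f"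
    using bdd_holomorphic_nrm_le[OF U le] by (intro antisym) auto
qed

lemma scaleC_left_commute: "a *\<^sub>C b *\<^sub>C x = b *\<^sub>C a *\<^sub>C (x :: 'a::complex_vector)"
  by (simp add: scaleC_scaleC mult.commute)

lemma sum_fun_apply: "(\<Sum>k\<in>B. f k) z = (\<Sum>k\<in>B. f k z)"
  by (induction B rule: infinite_finite_induct) auto

lemma vecs_whole_space [simp]: "x \<in> vecs whole_space"
  and nrm_whole_space [simp]: "nrm whole_space = norm"
  by (simp_all add: whole_space_def)

lemma has_taylor_whole_space:
  "has_taylor J whole_space U g c \<longleftrightarrow> (\<forall>z\<in>U. ((\<lambda>\<beta>. mono_val J z \<beta> *\<^sub>C c \<beta>) has_sum g z) (tuples J))"
  using has_taylor_iff_nsum[of U g whole_space J c] by (simp add: nsum_whole_space)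

lemma polydisc_nonempty: "0 < R \<Longrightarrow> polydisc L R \<noteq> {}"
  by (auto simp: polydisc_def tuples_def intro!: exI[of _ "\<lambda>_. 0"])

text \<open>Evaluation at a point does not increase the norm, so it commutes with sums in the sup
  norm.\<close>

lemma nsum_bdd_holomorphic_pointwise:
  assumes n: "nsum (bdd_holomorphic J U F) A c s" and z: "z \<in> U" and F: "seminormed F"
    and J: "finite J" and c: "\<And>k. k \<in> A \<Longrightarrow> c k \<in> vecs (bdd_holomorphic J U F)"
  shows "nsum F A (\<lambda>k. c k z) (s z)"
  unfolding nsum_def
proof
  have U: "U \<noteq> {}" using z by blast
  note S = seminormed_bdd_holomorphic[OF F J U]
  have s: "s \<in> vecs (bdd_holomorphic J U F)" using n by (simp add: nsum_def)
  then show "s z \<in> vecs F" by (rule bdd_holomorphic_value[OF _ z])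
  show "((\<lambda>B. nrm F (s z - (\<Sum>k\<in>B. c k z))) \<longlongrightarrow> 0) (finite_subsets_at_top A)"
  proof (rule Lim_null_comparison)
    show "((\<lambda>B. nrm (bdd_holomorphic J U F) (s - sum c B)) \<longlongrightarrow> 0) (finite_subsets_at_top A)"
      using n by (simp add: nsum_def)
    show "\<forall>\<^sub>F B in finite_subsets_at_top A. norm (nrm F (s z - (\<Sum>k\<in>B. c k z))) \<le> nrm (bdd_holomorphic J U F) (s - sum c B)"
      using eventually_subset[of A]
    proof eventually_elim
      case (elim B)
      have m: "s - sum c B \<in> vecs (bdd_holomorphic J U F)"
        using elim c by (intro seminormed_diff(1)[OF S] s conjunct1[OF seminormed_sum[OF S]]) auto
      have "nrm F ((s - sum c B) z) \<le> nrm (bdd_holomorphic J U F) (s - sum c B)"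
        by (rule bdd_holomorphic_le_nrm[OF m z])
      moreover have "0 \<le> nrm F ((s - sum c B) z)" by (rule seminormed_nonneg[OF F bdd_holomorphic_value[OF m z]])
      ultimately show ?case by (simp add: sum_fun_apply)
    qed
  qed
qed

text \<open>Cauchy's estimate on the tori of radius r < R, then r \<rightarrow> R, since the series
  is given only on the open polydisc.\<close>

lemma taylor_coefficient_bound:
  fixes f :: "('i \<Rightarrow> complex) \<Rightarrow> 'e::complex_banach"
  assumes L: "finite L" and R: "0 < R" and t: "has_taylor L whole_space (polydisc L R) f d"
    and bnd: "\<And>z. z \<in> polydisc L R \<Longrightarrow> norm (f z) \<le> M" and \<beta>: "\<beta> \<in> tuples L"
  shows "norm (d \<beta>) * R ^ mdeg L \<beta> \<le> M"
proof -
  have *: "norm (d \<beta>) * r ^ mdeg L \<beta> \<le> M" if r: "0 < r" "r < R" for r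
  proof (rule cauchy_coefficient_bound[OF L \<beta>])
    \<comment> \<open>Convergence at this larger polyradius gives absolute convergence on the torus
      of radius r by Abel's lemma.\<close>
    define R' where "R' = (r + R) / 2"
    have R': "r < R'" "R' < R" using r by (auto simp: R'_def)
    define z where "z = (\<lambda>j. if j \<in> L then complex_of_real R' else 0)"
    have "z \<in> polydisc L R" using R' r by (auto simp: z_def polydisc_def tuples_def)
    then have "(\<lambda>\<beta>. mono_val L z \<beta> *\<^sub>C d \<beta>) summable_on tuples L"
      using t unfolding has_taylor_whole_space summable_on_def by blast
    then show "(\<lambda>\<beta>. norm (d \<beta>) * r ^ mdeg L \<beta>) summable_on tuples L"
      by (rule power_series_abs_summable[OF L]) (use R' r in \<open>auto simp: z_def\<close>)
    fix z assume z: "z \<in> tuples L" "\<And>j. j \<in> L \<Longrightarrow> cmod (z j) = r"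
    then have zU: "z \<in> polydisc L R" using r by (auto simp: polydisc_def)
    then have "(\<Sum>\<^sub>\<infinity>\<beta>\<in>tuples L. mono_val L z \<beta> *\<^sub>C d \<beta>) = f z"
      using t unfolding has_taylor_whole_space by (intro infsumI) blast
    then show "norm (\<Sum>\<^sub>\<infinity>\<beta>\<in>tuples L. mono_val L z \<beta> *\<^sub>C d \<beta>) \<le> M" using bnd[OF zU] by simp
  qed (use r in auto)
  have "((\<lambda>r. norm (d \<beta>) * r ^ mdeg L \<beta>) \<longlongrightarrow> norm (d \<beta>) * R ^ mdeg L \<beta>) (at_left R)"
    by (intro tendsto_intros)
  then show ?thesis
  proof (rule tendsto_upperbound)
    show "\<forall>\<^sub>F r in at_left R. norm (d \<beta>) * r ^ mdeg L \<beta> \<le> M"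
      unfolding eventually_at_left[OF R] using * R by blast
  qed simp
qed

text \<open>On an open neighbourhood the punctured filters agree, so differentiability may be
  checked locally.\<close>

lemma holomorphic_map_local:
  assumes v: "\<And>x. x \<in> S \<Longrightarrow> f x \<in> vecs F"
    and loc: "\<And>x. x \<in> S \<Longrightarrow> \<exists>T. open T \<and> x \<in> T \<and> holomorphic_map J F \<pi> (S \<inter> T) f"
  shows "holomorphic_map J F \<pi> S f"
  unfolding holomorphic_map_def
proof (intro conjI ballI v)
  fix x assume x: "x \<in> S"
  from loc[OF this] obtain T where T: "open T" "x \<in> T" "holomorphic_map J F \<pi> (S \<inter> T) f" by (elim exE conjE)
  have "at x within (S \<inter> T) = at x within S"
    by (rule at_within_nhd[OF T(2,1)]) auto
  then show "\<exists>v. (\<forall>j\<in>J. v j \<in> vecs F) \<and>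
     (\<forall>\<epsilon>>0. \<forall>\<^sub>F y in at x within S. nrm F (f y - f x - (\<Sum>j\<in>J. (\<pi> y j - \<pi> x j) *\<^sub>C v j)) \<le> \<epsilon> * (\<Sum>j\<in>J. cmod (\<pi> y j - \<pi> x j)))"
    using holomorphic_mapD[OF T(3), of x] T(2) x by simp
qed

lemma open_coordinate_box:
  "finite L \<Longrightarrow> open {z :: 'i \<Rightarrow> complex. \<forall>j\<in>L. cmod (z j) < r}"
proof -
  assume L: "finite L"
  have "{z :: 'i \<Rightarrow> complex. \<forall>j\<in>L. cmod (z j) < r} = (\<Inter>j\<in>L. {z. cmod (z j) < r})" by auto
  moreover have "open \<dots>"
    by (intro open_INT L ballI open_Collect_less continuous_intros continuous_on_product_coordinates)
  ultimately show ?thesis by simp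
qed

text \<open>The sup norms make the sum uniform; that it is holomorphic comes from interchanging it
  with the Taylor series. The new coefficients \<open>D\<close> inherit the Cauchy bounds of the
  summands, so the sum is locally given by a convergent power series.\<close>

lemma summing_bdd_holomorphic:
  fixes c :: "'k \<Rightarrow> ('i \<Rightarrow> complex) \<Rightarrow> 'e::complex_banach"
  assumes L: "finite L" and R: "0 < R"
    and c: "\<And>k. k \<in> A \<Longrightarrow> c k \<in> vecs (bdd_holomorphic L (polydisc L R) whole_space)"
    and t: "\<And>k. k \<in> A \<Longrightarrow> has_taylor L whole_space (polydisc L R) (c k) (d k)"
  shows "summing (bdd_holomorphic L (polydisc L R) whole_space) A c"
  unfolding summing_def
proof (intro conjI ballI allI impI c)
  let ?F = "bdd_holomorphic L (polydisc L R) whole_space :: (('i \<Rightarrow> complex) \<Rightarrow> 'e) nspace"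
  let ?U = "polydisc L R"
  fix m :: "'k \<Rightarrow> complex"
  define w where "w k = cmod (m k) * nrm ?F (c k)" for k
  assume "(\<lambda>k. cmod (m k) * nrm ?F (c k)) summable_on A"
  then have w: "w summable_on A" by (simp add: w_def[abs_def])
  have U: "?U \<noteq> {}" by (rule polydisc_nonempty[OF R])
  have S: "seminormed ?F" by (rule seminormed_bdd_holomorphic[OF seminormed_whole_space L U])
  have c_le: "norm (c k z) \<le> nrm ?F (c k)" if "k \<in> A" "z \<in> ?U" for k z
    using bdd_holomorphic_le_nrm[OF c[OF that(1)] that(2)] by (simp add: whole_space_def)
  have le: "norm (m k *\<^sub>C c k z) \<le> w k" if "k \<in> A" "z \<in> ?U" for k z
    using c_le[OF that] by (simp add: norm_scaleC w_def mult_left_mono)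
  have w0: "0 \<le> w k" if "k \<in> A" for k
    unfolding w_def by (intro mult_nonneg_nonneg seminormed_nonneg[OF S] c that) auto
  have abs: "(\<lambda>k. norm (m k *\<^sub>C c k z)) summable_on A" if "z \<in> ?U" for z
    using w by (rule summable_on_comparison_test) (use le that in auto)
  note sm = abs_summable_summable[OF abs]
  define s where "s z = (if z \<in> ?U then \<Sum>\<^sub>\<infinity>k\<in>A. m k *\<^sub>C c k z else 0)" for z
  define T where "T = infsum w A"
  have d_le: "norm (d k \<beta>) * R ^ mdeg L \<beta> \<le> nrm ?F (c k)" if "k \<in> A" "\<beta> \<in> tuples L" for k \<beta>
    by (rule taylor_coefficient_bound[OF L R t[OF that(1)] c_le[OF that(1)] that(2)])
  have md_le: "norm (m k *\<^sub>C d k \<beta>) * R ^ mdeg L \<beta> \<le> w k" if "k \<in> A" "\<beta> \<in> tuples L" for k \<beta>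
    using mult_left_mono[OF d_le[OF that], of "cmod (m k)"] by (simp add: norm_scaleC w_def mult.assoc)
  define D where "D \<beta> = (\<Sum>\<^sub>\<infinity>k\<in>A. m k *\<^sub>C d k \<beta>)" for \<beta>
  have md_sum: "(\<lambda>k. norm (m k *\<^sub>C d k \<beta>)) summable_on A" if "\<beta> \<in> tuples L" for \<beta>
  proof (rule summable_on_comparison_test)
    show "(\<lambda>k. w k * (1 / R ^ mdeg L \<beta>)) summable_on A" by (rule summable_on_cmult_left[OF w])
    show "norm (m k *\<^sub>C d k \<beta>) \<le> w k * (1 / R ^ mdeg L \<beta>)" if "k \<in> A" for k
      using md_le[OF that \<open>\<beta> \<in> tuples L\<close>] R by (simp add: field_simps)
  qed auto
  have D_le: "norm (D \<beta>) * R ^ mdeg L \<beta> \<le> T" if "\<beta> \<in> tuples L" for \<beta>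
  proof -
    have "norm (D \<beta>) \<le> (\<Sum>\<^sub>\<infinity>k\<in>A. norm (m k *\<^sub>C d k \<beta>))" unfolding D_def by (rule norm_infsum_bound[OF md_sum[OF that]])
    also have "\<dots> \<le> (\<Sum>\<^sub>\<infinity>k\<in>A. w k * (1 / R ^ mdeg L \<beta>))"
      using md_le[OF _ that] R by (intro infsum_mono md_sum that summable_on_cmult_left w) (auto simp: field_simps)
    also have "\<dots> = T * (1 / R ^ mdeg L \<beta>)" unfolding T_def by (rule infsum_cmult_left')
    finally show ?thesis using R by (simp add: field_simps)
  qed
  have s_series: "s z = (\<Sum>\<^sub>\<infinity>\<beta>\<in>tuples L. mono_val L z \<beta> *\<^sub>C D \<beta>)"
    if z: "z \<in> tuples L" "\<And>j. j \<in> L \<Longrightarrow> cmod (z j) \<le> r" and r: "0 < r" "r < R" for z r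
  proof -
    have zU: "z \<in> ?U" using z r by (force simp: polydisc_def)
    define q where "q = r / R"
    have q: "0 \<le> q" "q < 1" using r R by (auto simp: q_def)
    define Q where "Q = (\<Sum>\<^sub>\<infinity>\<beta>\<in>tuples L. q ^ mdeg L \<beta>)"
    have qs: "((\<lambda>\<beta>. q ^ mdeg L \<beta>) has_sum Q) (tuples L)"
      unfolding Q_def by (rule has_sum_infsum[OF summable_on_geometric_tuples[OF L q]])
    \<comment> \<open>Absolute convergence of the double series on a smaller polydisc: the weights
      \<open>w\<close> times a geometric family.\<close>
    have "(\<lambda>(k, \<beta>). w k * q ^ mdeg L \<beta>) summable_on A \<times> tuples L"
    proof (rule summable_on_SigmaI)
      show "((\<lambda>\<beta>. case (k, \<beta>) of (k, \<beta>) \<Rightarrow> w k * q ^ mdeg L \<beta>) has_sum w k * Q) (tuples L)" for k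
        using has_sum_cmult_right[OF qs, of "w k"] by simp
      show "(\<lambda>k. w k * Q) summable_on A" by (rule summable_on_cmult_left[OF w])
    qed (use w0 q in auto)
    then have "(\<lambda>(k, \<beta>). norm (mono_val L z \<beta> *\<^sub>C m k *\<^sub>C d k \<beta>)) summable_on A \<times> tuples L"
    proof (rule summable_on_comparison_test)
      fix x :: "'k \<times> ('i \<Rightarrow> nat)" assume "x \<in> A \<times> tuples L"
      then obtain k \<beta> where x: "x = (k, \<beta>)" "k \<in> A" "\<beta> \<in> tuples L" by auto
      have "norm (mono_val L z \<beta> *\<^sub>C m k *\<^sub>C d k \<beta>) \<le> r ^ mdeg L \<beta> * norm (m k *\<^sub>C d k \<beta>)"
        unfolding norm_scaleC[of "mono_val L z \<beta>"] by (intro mult_right_mono norm_mono_val_le z) auto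
      also have "\<dots> = q ^ mdeg L \<beta> * (norm (m k *\<^sub>C d k \<beta>) * R ^ mdeg L \<beta>)"
        using R by (simp add: q_def power_divide)
      also have "\<dots> \<le> q ^ mdeg L \<beta> * w k" by (intro mult_left_mono md_le x) (use q in auto)
      finally show "(case x of (k, \<beta>) \<Rightarrow> norm (mono_val L z \<beta> *\<^sub>C m k *\<^sub>C d k \<beta>)) \<le> (case x of (k, \<beta>) \<Rightarrow> w k * q ^ mdeg L \<beta>)"
        by (simp add: x mult.commute)
    qed auto
    then have "(\<lambda>x. norm (case x of (k, \<beta>) \<Rightarrow> mono_val L z \<beta> *\<^sub>C m k *\<^sub>C d k \<beta>)) summable_on A \<times> tuples L"
      by (simp only: prod.case_distrib[of norm])
    then have "(\<lambda>(k, \<beta>). mono_val L z \<beta> *\<^sub>C m k *\<^sub>C d k \<beta>) summable_on A \<times> tuples L"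
      by (rule abs_summable_summable)
    then have sw: "(\<Sum>\<^sub>\<infinity>k\<in>A. \<Sum>\<^sub>\<infinity>\<beta>\<in>tuples L. mono_val L z \<beta> *\<^sub>C m k *\<^sub>C d k \<beta>) = (\<Sum>\<^sub>\<infinity>\<beta>\<in>tuples L. \<Sum>\<^sub>\<infinity>k\<in>A. mono_val L z \<beta> *\<^sub>C m k *\<^sub>C d k \<beta>)"
      by (rule infsum_swap_banach[of "\<lambda>k \<beta>. mono_val L z \<beta> *\<^sub>C m k *\<^sub>C d k \<beta>" A "tuples L"])
    have "(\<Sum>\<^sub>\<infinity>\<beta>\<in>tuples L. mono_val L z \<beta> *\<^sub>C m k *\<^sub>C d k \<beta>) = m k *\<^sub>C c k z" if "k \<in> A" for k
    proof (rule infsumI)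
      have "((\<lambda>\<beta>. mono_val L z \<beta> *\<^sub>C d k \<beta>) has_sum c k z) (tuples L)"
        by (rule bspec[OF t[OF that, unfolded has_taylor_whole_space] zU])
      have eq: "(\<lambda>\<beta>. mono_val L z \<beta> *\<^sub>C m k *\<^sub>C d k \<beta>) = (\<lambda>\<beta>. m k *\<^sub>C mono_val L z \<beta> *\<^sub>C d k \<beta>)"
        by (intro ext scaleC_left_commute)
      show "((\<lambda>\<beta>. mono_val L z \<beta> *\<^sub>C m k *\<^sub>C d k \<beta>) has_sum m k *\<^sub>C c k z) (tuples L)"
        unfolding eq
        by (rule has_sum_bounded_linear[OF bounded_linear_scaleC \<open>((\<lambda>\<beta>. mono_val L z \<beta> *\<^sub>C d k \<beta>) has_sum c k z) (tuples L)\<close>])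
    qed
    then have "(\<Sum>\<^sub>\<infinity>k\<in>A. \<Sum>\<^sub>\<infinity>\<beta>\<in>tuples L. mono_val L z \<beta> *\<^sub>C m k *\<^sub>C d k \<beta>) = (\<Sum>\<^sub>\<infinity>k\<in>A. m k *\<^sub>C c k z)"
      by (rule infsum_cong)
    then have 1: "s z = (\<Sum>\<^sub>\<infinity>k\<in>A. \<Sum>\<^sub>\<infinity>\<beta>\<in>tuples L. mono_val L z \<beta> *\<^sub>C m k *\<^sub>C d k \<beta>)"
      using zU by (simp only: s_def if_True)
    have "(\<Sum>\<^sub>\<infinity>k\<in>A. mono_val L z \<beta> *\<^sub>C m k *\<^sub>C d k \<beta>) = mono_val L z \<beta> *\<^sub>C D \<beta>" if "\<beta> \<in> tuples L" for \<beta>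
      unfolding D_def
      by (rule infsumI[OF has_sum_bounded_linear[OF bounded_linear_scaleC has_sum_infsum[OF abs_summable_summable[OF md_sum[OF that]]]]])
    then show ?thesis unfolding 1 sw by (rule infsum_cong)
  qed
  have hol: "holomorphic_map L whole_space (\<lambda>z. z) ?U s"
  proof (rule holomorphic_map_local)
    fix x assume x: "x \<in> ?U"
    \<comment> \<open>Every point lies in a strictly smaller polydisc. Two more radii fit between it
      and R: one for the neighbourhood, one for the loss in differentiation.\<close>
    define r0 where "r0 = Max (insert 0 ((\<lambda>j. cmod (x j)) ` L))"
    have r0: "0 \<le> r0" "r0 < R" "\<And>j. j \<in> L \<Longrightarrow> cmod (x j) \<le> r0"
      using x L R unfolding r0_def polydisc_def by auto
    define r where "r = (r0 + R) / 2"
    define r' where "r' = (r + R) / 2"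
    have r: "r0 < r" "r < r'" "r' < R" "0 < r" using r0 R by (auto simp: r_def r'_def)
    have Ds: "(\<lambda>\<beta>. r' ^ mdeg L \<beta> * nrm whole_space (D \<beta>)) summable_on tuples L"
    proof (rule summable_on_comparison_test)
      show "(\<lambda>\<beta>. T * (r' / R) ^ mdeg L \<beta>) summable_on tuples L"
        by (intro summable_on_cmult_right summable_on_geometric_tuples L) (use r R in auto)
      show "r' ^ mdeg L \<beta> * nrm whole_space (D \<beta>) \<le> T * (r' / R) ^ mdeg L \<beta>" if "\<beta> \<in> tuples L" for \<beta>
        using mult_right_mono[OF D_le[OF that], of "(r' / R) ^ mdeg L \<beta>"] r R
        by (simp add: whole_space_def power_divide mult.commute)
    qed (use r in \<open>auto simp: whole_space_def\<close>)
    have r'0: "0 < r'" using r by simp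
    from power_series_nspace[OF seminormed_whole_space L summing_whole_space r'0 Ds]
    obtain G where G: "\<forall>z. (\<forall>j\<in>L. cmod (z j) \<le> r') \<longrightarrow> nsum whole_space (tuples L) (\<lambda>\<kappa>. mono_val L z \<kappa> *\<^sub>C D \<kappa>) (G z)"
      and q: "\<forall>r. 0 < r \<longrightarrow> r < r' \<longrightarrow> quadratic_approx L whole_space r G" by (elim exE conjE)
    define T' where "T' = {z :: 'i \<Rightarrow> complex. \<forall>j\<in>L. cmod (z j) < r}"
    have "holomorphic_map L whole_space (\<lambda>z. z) (?U \<inter> T') s"
    proof (rule holomorphic_map_quadratic[OF seminormed_whole_space L q[rule_format, OF r(4,2)]])
      show "s z = G z" if "z \<in> ?U \<inter> T'" for z
      proof -
        have z: "z \<in> tuples L" "\<And>j. j \<in> L \<Longrightarrow> cmod (z j) \<le> r'" using that r by (force simp: polydisc_def T'_def)+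
        have "((\<lambda>\<beta>. mono_val L z \<beta> *\<^sub>C D \<beta>) has_sum G z) (tuples L)"
          using G z(2) by (simp add: nsum_whole_space)
        from infsumI[OF this] show ?thesis using s_series[OF z r'0 r(3)] by simp
      qed
    next
      show "continuous_on (?U \<inter> T') (\<lambda>x. x j)" for j
        by (rule continuous_on_subset[OF continuous_on_product_coordinates subset_UNIV])
      show "cmod (z j) \<le> r" if "z \<in> ?U \<inter> T'" "j \<in> L" for z j
        using that by (simp add: T'_def less_imp_le)
    qed simp
    moreover have "open T'" unfolding T'_def by (rule open_coordinate_box[OF L])
    moreover have "x \<in> T'" using r0 r by (force simp: T'_def)
    ultimately show "\<exists>T. open T \<and> x \<in> T \<and> holomorphic_map L whole_space (\<lambda>z. z) (?U \<inter> T) s" by blast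
  qed (simp add: whole_space_def)
  have sT: "norm (s z) \<le> T" if "z \<in> ?U" for z
  proof -
    have "norm (s z) \<le> (\<Sum>\<^sub>\<infinity>k\<in>A. norm (m k *\<^sub>C c k z))" using that norm_infsum_bound[OF abs[OF that]] by (simp add: s_def)
    also have "\<dots> \<le> T" unfolding T_def by (intro infsum_mono abs w le that)
    finally show ?thesis .
  qed
  have sF: "s \<in> vecs ?F"
    unfolding bdd_holomorphic_vecs using hol sT by (auto simp: s_def whole_space_def)
  have "nsum ?F A (\<lambda>k. m k *\<^sub>C c k) s"
    unfolding nsum_def
  proof (rule conjI[OF sF], rule Lim_null_comparison)
    \<comment> \<open>The sup norm of a tail of the series is at most the tail T -
      \<open>sum w B\<close> of the weights.\<close>
    have "(sum w \<longlongrightarrow> T) (finite_subsets_at_top A)" unfolding T_def by (rule infsum_tendsto[OF w])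
    from tendsto_diff[OF tendsto_const[of T] this]
    show "((\<lambda>B. T - sum w B) \<longlongrightarrow> 0) (finite_subsets_at_top A)" by simp
    show "\<forall>\<^sub>F B in finite_subsets_at_top A. norm (nrm ?F (s - (\<Sum>k\<in>B. m k *\<^sub>C c k))) \<le> T - sum w B"
      using eventually_subset[of A]
    proof eventually_elim
      case (elim B)
      have mem: "s - (\<Sum>k\<in>B. m k *\<^sub>C c k) \<in> vecs ?F"
        using elim by (intro seminormed_diff(1)[OF S] sF conjunct1[OF seminormed_sum[OF S]] seminormed_scaleC[OF S] c) auto
      have "nrm ?F (s - (\<Sum>k\<in>B. m k *\<^sub>C c k)) \<le> T - sum w B"
      proof (rule bdd_holomorphic_nrm_le[OF U])
        fix z assume z: "z \<in> ?U"
        have AB: "(\<lambda>k. norm (m k *\<^sub>C c k z)) summable_on A - B" by (rule summable_on_subset_banach[OF abs[OF z]]) auto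
        have wAB: "w summable_on A - B" by (rule summable_on_subset_banach[OF w]) auto
        have "(s - (\<Sum>k\<in>B. m k *\<^sub>C c k)) z = infsum (\<lambda>k. m k *\<^sub>C c k z) (A - B)"
          using elim z sm[OF z] by (subst infsum_Diff) (auto simp: s_def sum_fun_apply scaleC_fun_def)
        also have "norm \<dots> \<le> (\<Sum>\<^sub>\<infinity>k\<in>A - B. norm (m k *\<^sub>C c k z))" by (rule norm_infsum_bound[OF AB])
        also have "\<dots> \<le> infsum w (A - B)" by (intro infsum_mono AB wAB le z) auto
        also have "\<dots> = T - sum w B" using elim w by (subst infsum_Diff) (auto simp: T_def)
        finally show "nrm whole_space ((s - (\<Sum>k\<in>B. m k *\<^sub>C c k)) z) \<le> T - sum w B" by (simp add: whole_space_def)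
      qed
      then show ?case using seminormed_nonneg[OF S mem] by simp
    qed
  qed
  then show "\<exists>s. nsum ?F A (\<lambda>k. m k *\<^sub>C c k) s" by blast
qed

section \<open>Convergent series are monomially summable\<close>

lemma mono_val_tuples_subset:
  assumes "finite J" "M \<subseteq> J" "\<beta> \<in> tuples M"
  shows "mono_val J z \<beta> = mono_val M z \<beta>" "mdeg J \<beta> = mdeg M \<beta>"
  using assms unfolding mono_val_def mdeg_def tuples_def
  by (auto intro!: prod.mono_neutral_right sum.mono_neutral_right)

lemma tuples_mono: "M \<subseteq> J \<Longrightarrow> tuples M \<subseteq> tuples J"
  by (auto simp: tuples_def)

lemma tuples_add: "\<kappa> \<in> tuples J \<Longrightarrow> \<beta> \<in> tuples J \<Longrightarrow> (\<lambda>i. \<kappa> i + \<beta> i :: nat) \<in> tuples J"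
  by (auto simp: tuples_def)

lemma tuples_mult: "\<kappa> \<in> tuples J \<Longrightarrow> (\<lambda>i. l * \<kappa> i :: nat) \<in> tuples J"
  by (auto simp: tuples_def)

lemma inj_on_add_tuple: "inj_on (\<lambda>\<beta> i. \<kappa> i + \<beta> i :: nat) A"
  by (auto intro!: inj_onI simp: fun_eq_iff)

lemma tuples_split_bij:
  assumes "J \<union> L = V" "J \<inter> L = {}"
  shows "bij_betw (\<lambda>(\<kappa>, \<beta>) i. \<kappa> i + \<beta> i :: nat) (tuples J \<times> tuples L) (tuples V)"
proof (rule bij_betwI)
  have nJ: "i \<notin> J" if "i \<in> L" for i using assms(2) that by blast
  show "(\<lambda>(\<kappa>, \<beta>) i. \<kappa> i + \<beta> i :: nat) \<in> tuples J \<times> tuples L \<rightarrow> tuples V"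
    using assms by (auto simp: tuples_def)
  show "(\<lambda>\<gamma>. (\<lambda>i. if i \<in> J then \<gamma> i else 0, \<lambda>i. if i \<in> L then \<gamma> i else 0)) \<in> tuples V \<rightarrow> tuples J \<times> tuples L"
    by (auto simp: tuples_def)
  show "(\<lambda>i. if i \<in> J then (case x of (\<kappa>, \<beta>) \<Rightarrow> \<lambda>i. \<kappa> i + \<beta> i) i else 0,
      \<lambda>i. if i \<in> L then (case x of (\<kappa>, \<beta>) \<Rightarrow> \<lambda>i. \<kappa> i + \<beta> i) i else 0) = x" if "x \<in> tuples J \<times> tuples L" for x :: "('a \<Rightarrow> nat) \<times> ('a \<Rightarrow> nat)"
    using that assms nJ by (auto simp: tuples_def fun_eq_iff disjoint_iff)
  show "(case (\<lambda>i. if i \<in> J then \<gamma> i else 0, \<lambda>i. if i \<in> L then \<gamma> i else 0) of (\<kappa>, \<beta>) \<Rightarrow> \<lambda>i. \<kappa> i + \<beta> i) = \<gamma>"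
    if "\<gamma> \<in> tuples V" for \<gamma> :: "'a \<Rightarrow> nat"
    using that assms by (auto simp: tuples_def fun_eq_iff)
qed

lemma mdeg_split:
  assumes "finite V" "J \<union> L = V" "J \<inter> L = {}" "\<kappa> \<in> tuples J" "\<beta> \<in> tuples L"
  shows "mdeg V (\<lambda>i. \<kappa> i + \<beta> i) = mdeg J \<kappa> + mdeg L \<beta>"
proof -
  have "J \<subseteq> V" "L \<subseteq> V" using assms(2) by blast+
  then show ?thesis
    using mono_val_tuples_subset(2)[OF assms(1) _ assms(4)] mono_val_tuples_subset(2)[OF assms(1) _ assms(5)]
    by (simp add: mdeg_add)
qed

lemma mono_val_split:
  assumes "finite V" "J \<union> L = V" "J \<inter> L = {}" "\<kappa> \<in> tuples J" "\<beta> \<in> tuples L"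
  shows "mono_val V z (\<lambda>i. \<kappa> i + \<beta> i) = mono_val J z \<kappa> * mono_val L z \<beta>"
proof -
  have "J \<subseteq> V" "L \<subseteq> V" using assms(2) by blast+
  then show ?thesis
    using mono_val_tuples_subset(1)[OF assms(1) _ assms(4)] mono_val_tuples_subset(1)[OF assms(1) _ assms(5)]
    by (simp add: mono_val_add)
qed

text \<open>The shifted family is a part of the whole one, up to the constant factor \<rho> ^
  |\<kappa>|.\<close>

lemma summable_on_shift:
  fixes N :: "('i \<Rightarrow> nat) \<Rightarrow> real"
  assumes J: "finite J" "M \<subseteq> J" and \<rho>: "0 < \<rho>" and \<kappa>: "\<kappa> \<in> tuples J"
    and s: "(\<lambda>\<kappa>. \<rho> ^ mdeg J \<kappa> * N \<kappa>) summable_on tuples J"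
  shows "(\<lambda>\<beta>. \<rho> ^ mdeg M \<beta> * N (\<lambda>i. \<kappa> i + \<beta> i)) summable_on tuples M"
proof -
  have sub: "(\<lambda>\<beta> i. \<kappa> i + \<beta> i) ` tuples M \<subseteq> tuples J"
    using tuples_mono[OF J(2)] tuples_add[OF \<kappa>] by blast
  have "(\<lambda>\<kappa>. \<rho> ^ mdeg J \<kappa> * N \<kappa>) summable_on (\<lambda>\<beta> i. \<kappa> i + \<beta> i) ` tuples M"
    by (rule summable_on_subset_banach[OF s sub])
  then have "(\<lambda>\<beta>. \<rho> ^ mdeg J (\<lambda>i. \<kappa> i + \<beta> i) * N (\<lambda>i. \<kappa> i + \<beta> i)) summable_on tuples M"
    by (subst (asm) summable_on_reindex[OF inj_on_add_tuple]) (simp add: o_def)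
  from summable_on_cmult_right[OF this, of "1 / \<rho> ^ mdeg J \<kappa>"] show ?thesis
    by (rule summable_on_cong[THEN iffD1, rotated])
      (use \<rho> mono_val_tuples_subset(2)[OF J] in \<open>simp add: mdeg_add power_add\<close>)
qed

text \<open>A convergent power series packaged as a bounded holomorphic map. The domain may be any
  set on which the coordinates are at most r, because open, closed and weighted polydiscs all
  occur.\<close>

lemma power_series_bdd_holomorphic:
  fixes c :: "('i \<Rightarrow> nat) \<Rightarrow> 'v::complex_vector"
  assumes F: "seminormed F" and M: "finite M" and sc: "summing F (tuples M) c" and r: "0 < r" "r < \<rho>"
    and s: "(\<lambda>\<kappa>. \<rho> ^ mdeg M \<kappa> * nrm F (c \<kappa>)) summable_on tuples M"
    and U: "\<forall>z\<in>U. \<forall>j\<in>M. cmod (z j) \<le> r"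
  shows "\<exists>g G. g \<in> vecs (bdd_holomorphic M U F) \<and> has_taylor M F U g c \<and>
     (\<forall>z\<in>U. nsum F (tuples M) (\<lambda>\<kappa>. mono_val M z \<kappa> *\<^sub>C c \<kappa>) (g z)) \<and> quadratic_approx M F r G \<and> (\<forall>z\<in>U. g z = G z)"
proof -
  have c: "\<And>k. k \<in> tuples M \<Longrightarrow> c k \<in> vecs F" using sc by (simp add: summing_def)
  have \<rho>: "0 < \<rho>" using r by simp
  from power_series_nspace[OF F M sc \<rho> s] obtain G where
    G: "\<forall>z. (\<forall>j\<in>M. cmod (z j) \<le> \<rho>) \<longrightarrow> nsum F (tuples M) (\<lambda>\<kappa>. mono_val M z \<kappa> *\<^sub>C c \<kappa>) (G z)"
    and q: "\<forall>r. 0 < r \<longrightarrow> r < \<rho> \<longrightarrow> quadratic_approx M F r G" by (elim exE conjE)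
  define g where "g z = (if z \<in> U then G z else 0)" for z
  have U\<rho>: "\<forall>j\<in>M. cmod (z j) \<le> \<rho>" if "z \<in> U" for z using U that r by fastforce
  have n: "nsum F (tuples M) (\<lambda>\<kappa>. mono_val M z \<kappa> *\<^sub>C c \<kappa>) (g z)" if "z \<in> U" for z
    using G[rule_format, of z] U\<rho>[OF that] that by (simp add: g_def)
  have gF: "g z \<in> vecs F" if "z \<in> U" for z using n[OF that] by (simp add: nsum_def)
  have "nrm F (g z) \<le> 1 * (\<Sum>\<^sub>\<infinity>\<kappa>\<in>tuples M. \<rho> ^ mdeg M \<kappa> * nrm F (c \<kappa>))" if "z \<in> U" for z
    by (rule nsum_weighted_bound[OF F c s _ n[OF that]])
      (use U\<rho>[OF that] norm_mono_val_le[of M z \<rho>] in auto)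
  moreover have "holomorphic_map M F (\<lambda>z. z) U g"
    by (rule holomorphic_map_quadratic[OF F M q[rule_format, OF r]])
      (use U gF in \<open>auto simp: g_def continuous_on_subset[OF continuous_on_product_coordinates subset_UNIV]\<close>)
  ultimately have "g \<in> vecs (bdd_holomorphic M U F)"
    unfolding bdd_holomorphic_vecs by (auto simp: g_def)
  moreover have "has_taylor M F U g c" using n gF by (subst has_taylor_iff_nsum) auto
  ultimately show ?thesis using n q[rule_format, OF r] by (intro exI[of _ g] exI[of _ G]) (auto simp: g_def)
qed

text \<open>The exponents \<open>\<kappa>\<close> that do not dominate \<open>N\<gamma>\<close> are uniquely \<open>l\<gamma> + \<beta>\<close> with \<open>l < N\<close> and \<open>\<beta>\<close> not
  dominating \<open>\<gamma>\<close>.\<close>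

lemma component_partial_sum:
  fixes u :: "('i \<Rightarrow> nat) \<Rightarrow> 'e::{topological_comm_monoid_add,t2_space}"
  assumes J: "J \<noteq> {}" and \<gamma>: "\<gamma> \<in> tuples J"
    and h: "\<And>l. l < N \<Longrightarrow> ((\<lambda>\<beta>. if \<not> (\<forall>j\<in>J. \<gamma> j \<le> \<beta> j) then u (\<lambda>i. l * \<gamma> i + \<beta> i) else 0) has_sum h l) (tuples J)"
  shows "(u has_sum (\<Sum>l<N. h l)) {\<kappa> \<in> tuples J. \<not> (\<forall>j\<in>J. N * \<gamma> j \<le> \<kappa> j)}"
  using h
proof (induction N)
  case 0
  then show ?case by simp
next
  case (Suc N)
  define B where "B = {\<beta> \<in> tuples J. \<not> (\<forall>j\<in>J. \<gamma> j \<le> \<beta> j)}"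
  \<comment> \<open>The shell that the N-th component adds: exponents that dominate N \<gamma> but
    not (N + 1) \<gamma>.\<close>
  define A where "A = (\<lambda>\<beta> i. N * \<gamma> i + \<beta> i) ` B"
  have "((\<lambda>\<beta>. u (\<lambda>i. N * \<gamma> i + \<beta> i)) has_sum h N) B"
    by (rule has_sum_cong_neutral[THEN iffD1, OF _ _ _ Suc.prems[OF lessI]]) (auto simp: B_def)
  then have 1: "(u has_sum h N) A"
    unfolding A_def by (subst has_sum_reindex[OF inj_on_add_tuple]) (simp add: o_def)
  have 2: "(u has_sum (\<Sum>l<N. h l)) {\<kappa> \<in> tuples J. \<not> (\<forall>j\<in>J. N * \<gamma> j \<le> \<kappa> j)}"
    using Suc by simp
  have disj: "{\<kappa> \<in> tuples J. \<not> (\<forall>j\<in>J. N * \<gamma> j \<le> \<kappa> j)} \<inter> A = {}"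
    by (auto simp: A_def)
  have un: "{\<kappa> \<in> tuples J. \<not> (\<forall>j\<in>J. N * \<gamma> j \<le> \<kappa> j)} \<union> A = {\<kappa> \<in> tuples J. \<not> (\<forall>j\<in>J. Suc N * \<gamma> j \<le> \<kappa> j)}"
  proof (intro subset_antisym subsetI)
    fix \<kappa> assume "\<kappa> \<in> {\<kappa> \<in> tuples J. \<not> (\<forall>j\<in>J. N * \<gamma> j \<le> \<kappa> j)} \<union> A"
    then show "\<kappa> \<in> {\<kappa> \<in> tuples J. \<not> (\<forall>j\<in>J. Suc N * \<gamma> j \<le> \<kappa> j)}"
      using tuples_mult[OF \<gamma>, of N] by (fastforce simp: A_def B_def intro!: tuples_add)
  next
    fix \<kappa> assume k: "\<kappa> \<in> {\<kappa> \<in> tuples J. \<not> (\<forall>j\<in>J. Suc N * \<gamma> j \<le> \<kappa> j)}"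
    show "\<kappa> \<in> {\<kappa> \<in> tuples J. \<not> (\<forall>j\<in>J. N * \<gamma> j \<le> \<kappa> j)} \<union> A"
    proof (cases "\<forall>j\<in>J. N * \<gamma> j \<le> \<kappa> j")
      case True
      define \<beta> where "\<beta> i = \<kappa> i - N * \<gamma> i" for i
      have e: "\<kappa> i = N * \<gamma> i + \<beta> i" for i
        using True \<gamma> by (cases "i \<in> J") (auto simp: \<beta>_def tuples_def)
      have "\<beta> \<in> tuples J" using k by (auto simp: \<beta>_def tuples_def)
      moreover have "\<not> (\<forall>j\<in>J. \<gamma> j \<le> \<beta> j)" using k by (auto simp: e)
      ultimately have "\<kappa> \<in> A" unfolding A_def B_def using e by (intro image_eqI[of _ _ \<beta>]) auto
      then show ?thesis by blast
    qed (use k in auto)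
  qed
  show ?case using has_sum_Un_disjoint[OF 2 1 disj] unfolding un by simp
qed

text \<open>Evaluation at x reduces the claim to the coefficient space, where the first N components
  collect the terms whose exponents do not dominate N \<gamma>. Their sum is thereby determined by
  the series itself.\<close>

lemma has_sum_bdd_component:
  fixes fh :: "('i \<Rightarrow> nat) \<Rightarrow> ('i \<Rightarrow> complex) \<Rightarrow> 'e::complex_banach"
  assumes J: "J \<noteq> {}" "finite J" and \<gamma>: "\<gamma> \<in> tuples J" and x: "x \<in> polydisc L R" and L: "finite L"
    and fh: "\<And>\<kappa>. \<kappa> \<in> tuples J \<Longrightarrow> fh \<kappa> \<in> vecs (bdd_holomorphic L (polydisc L R) whole_space)"
    and n: "\<And>l. l < N \<Longrightarrow> nsum (bdd_holomorphic L (polydisc L R) whole_space) (tuples J)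
         (\<lambda>\<beta>. mono_val J z \<beta> *\<^sub>C mono_component J \<gamma> l fh \<beta>) (g l)"
  shows "((\<lambda>\<kappa>. mono_val J z \<kappa> *\<^sub>C fh \<kappa> x) has_sum (\<Sum>l<N. mono_val J z (\<lambda>i. l * \<gamma> i) *\<^sub>C g l x)) {\<kappa> \<in> tuples J. \<not> (\<forall>j\<in>J. N * \<gamma> j \<le> \<kappa> j)}"
proof (rule component_partial_sum[OF J(1) \<gamma>])
  fix l assume l: "l < N"
  let ?F = "bdd_holomorphic L (polydisc L R) whole_space :: (('i \<Rightarrow> complex) \<Rightarrow> 'e) nspace"
  have F: "seminormed ?F" using x by (intro seminormed_bdd_holomorphic seminormed_whole_space L) auto
  have mem: "mono_component J \<gamma> l fh \<beta> \<in> vecs ?F" for \<beta>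
    unfolding mono_component_def using fh tuples_add[OF tuples_mult[OF \<gamma>]] seminormed_zero[OF F] by auto
  have "nsum whole_space (tuples J) (\<lambda>\<beta>. (mono_val J z \<beta> *\<^sub>C mono_component J \<gamma> l fh \<beta>) x) (g l x)"
    by (rule nsum_bdd_holomorphic_pointwise[OF n[OF l] x seminormed_whole_space L seminormed_scaleC[OF F mem]])
  then have "((\<lambda>\<beta>. mono_val J z \<beta> *\<^sub>C mono_component J \<gamma> l fh \<beta> x) has_sum g l x) (tuples J)"
    by (simp add: nsum_whole_space scaleC_fun_def)
  from has_sum_bounded_linear[OF bounded_linear_scaleC this, of "mono_val J z (\<lambda>i. l * \<gamma> i)"]
  show "((\<lambda>\<beta>. if \<not> (\<forall>j\<in>J. \<gamma> j \<le> \<beta> j) then mono_val J z (\<lambda>i. l * \<gamma> i + \<beta> i) *\<^sub>C fh (\<lambda>i. l * \<gamma> i + \<beta> i) x else 0)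
     has_sum mono_val J z (\<lambda>i. l * \<gamma> i) *\<^sub>C g l x) (tuples J)"
    by (rule has_sum_cong[THEN iffD1, rotated]) (auto simp: mono_component_def mono_val_add scaleC_scaleC)
qed

text \<open>Convergence at polyradius r / 2 and Abel's lemma at r / 4.\<close>

lemma convergent_series_abs_summable:
  assumes "finite V" "a \<in> convergent_series V"
  obtains \<rho> where "0 < \<rho>" "(\<lambda>\<beta>. norm (a \<beta>) * \<rho> ^ mdeg V \<beta>) summable_on tuples V"
proof -
  obtain r where r: "r > 0" "\<forall>z\<in>polydisc V r. (\<lambda>\<beta>. mono_val V z \<beta> *\<^sub>C a \<beta>) summable_on tuples V"
    using assms(2) unfolding convergent_series_def by blast
  define z where "z = (\<lambda>j. if j \<in> V then complex_of_real (r / 2) else 0)"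
  have "z \<in> polydisc V r" using r by (auto simp: polydisc_def tuples_def z_def)
  then have "(\<lambda>\<beta>. norm (a \<beta>) * (r / 4) ^ mdeg V \<beta>) summable_on tuples V"
    using r by (intro power_series_abs_summable[OF assms(1) bspec[OF r(2)], of z "r / 2"]) (auto simp: z_def)
  then show thesis using that[of "r / 4"] r by simp
qed

lemma fact_powr_bound: "(s :: real) \<ge> 0 \<Longrightarrow> C \<ge> 0 \<Longrightarrow> C \<le> C * fact N powr s"
  using mult_left_mono[OF fact_powr_ge_1[of s N], of C] by simp

text \<open>The sum of the series serves in every direction, so none is exceptional. Subtracting the
  first N components leaves the exponents that dominate N \<gamma>, hence a geometric error times
  |z^(N \<gamma>)| without factorials.\<close>

theorem convergent_partial_mono_summable:
  fixes a :: "('i \<Rightarrow> nat) \<Rightarrow> 'e::complex_banach"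
  assumes V: "finite V" and a: "a \<in> formal_series V whole_space"
    and \<rho>: "(\<lambda>\<beta>. norm (a \<beta>) * \<rho> ^ mdeg V \<beta>) summable_on tuples V" and R: "0 < R" "R < \<rho>" "R \<le> 1"
    and J: "J \<subseteq> V" "J \<noteq> {}" and \<gamma>: "\<gamma> \<in> tuples J" "\<forall>j\<in>J. 0 < \<gamma> j" and k: "0 < k"
  shows "a \<in> partial_mono_summable V J R \<gamma> k"
proof -
  define L where "L = V - J"
  have JL: "J \<union> L = V" "J \<inter> L = {}" "finite J" "finite L" using J V by (auto simp: L_def finite_subset)
  let ?U = "polydisc L R :: ('i \<Rightarrow> complex) set"
  define F where "F = (bdd_holomorphic L ?U whole_space :: (('i \<Rightarrow> complex) \<Rightarrow> 'e) nspace)"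
  have F: "seminormed F" unfolding F_def
    by (intro seminormed_bdd_holomorphic seminormed_whole_space JL polydisc_nonempty R)
  have \<rho>0: "\<rho> > 0" using R by simp
  define w where "w = (\<lambda>\<beta>. norm (a \<beta>) * \<rho> ^ mdeg V \<beta>)"
  have w: "w summable_on tuples V" using \<rho> by (simp add: w_def)
  have shift: "(\<lambda>\<beta>. \<rho> ^ mdeg L \<beta> * norm (a (\<lambda>i. \<kappa> i + \<beta> i))) summable_on tuples L" if "\<kappa> \<in> tuples J" for \<kappa>
    using summable_on_shift[OF V _ \<rho>0 _ \<rho>[unfolded mult.commute[of "norm _"]], of L \<kappa>] that tuples_mono[OF J(1)] by (auto simp: L_def)
  have "\<forall>\<kappa>\<in>tuples J. \<exists>g. g \<in> vecs F \<and> has_taylor L whole_space ?U g (\<lambda>\<beta>. a (\<lambda>i. \<kappa> i + \<beta> i))"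
  proof
    fix \<kappa> :: "'i \<Rightarrow> nat" assume \<kappa>: "\<kappa> \<in> tuples J"
    have "(\<lambda>\<beta>. \<rho> ^ mdeg L \<beta> * nrm whole_space (a (\<lambda>i. \<kappa> i + \<beta> i))) summable_on tuples L"
      using shift[OF \<kappa>] by simp
    moreover have "\<forall>z\<in>?U. \<forall>j\<in>L. cmod (z j) \<le> R" by (simp add: polydisc_def less_imp_le)
    ultimately show "\<exists>g. g \<in> vecs F \<and> has_taylor L whole_space ?U g (\<lambda>\<beta>. a (\<lambda>i. \<kappa> i + \<beta> i))"
      using power_series_bdd_holomorphic[OF seminormed_whole_space JL(4) summing_whole_space R(1,2), of "\<lambda>\<beta>. a (\<lambda>i. \<kappa> i + \<beta> i)" ?U]
      unfolding F_def by blast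
  qed
  then obtain b0 where b0: "\<forall>\<kappa>\<in>tuples J. b0 \<kappa> \<in> vecs F \<and> has_taylor L whole_space ?U (b0 \<kappa>) (\<lambda>\<beta>. a (\<lambda>i. \<kappa> i + \<beta> i))"
    by (rule bchoice[THEN exE])
  define b where "b \<kappa> = (if \<kappa> \<in> tuples J then b0 \<kappa> else 0)" for \<kappa>
  have b: "b \<kappa> \<in> vecs F" for \<kappa> using b0 seminormed_zero[OF F] by (auto simp: b_def)
  \<comment> \<open>The Taylor coefficients of all \<open>b \<kappa>\<close>, extended by 0 in the
    same way as \<open>b\<close>.\<close>
  define d where "d \<kappa> = (if \<kappa> \<in> tuples J then (\<lambda>\<beta>. a (\<lambda>i. \<kappa> i + \<beta> i)) else 0)" for \<kappa>
  have t: "has_taylor L whole_space ?U (b \<kappa>) (d \<kappa>)" for \<kappa>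
    using b0 by (auto simp: b_def d_def has_taylor_whole_space)
  have sc: "summing F (tuples M) (\<lambda>\<beta>. b (h \<beta>))" for M :: "'i set" and h
    unfolding F_def by (rule summing_bdd_holomorphic[OF JL(4) R(1) b[unfolded F_def] t])
  \<comment> \<open>The sup norm of \<open>b \<kappa>\<close> is at most the weighted sum of its
    Taylor coefficients; summing over \<kappa> regroups the absolutely convergent series
    \<open>a\<close>.\<close>
  have bs: "(\<lambda>\<kappa>. \<rho> ^ mdeg J \<kappa> * nrm F (b \<kappa>)) summable_on tuples J"
  proof -
    have "(w \<circ> (\<lambda>(\<kappa>, \<beta>) i. \<kappa> i + \<beta> i)) summable_on tuples J \<times> tuples L"
      using w bij_betw_imp_inj_on[OF tuples_split_bij[OF JL(1,2)]] bij_betw_imp_surj_on[OF tuples_split_bij[OF JL(1,2)]]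
      by (subst summable_on_reindex[symmetric]) auto
    then have "(\<lambda>(\<kappa>, \<beta>). w (\<lambda>i. \<kappa> i + \<beta> i)) summable_on tuples J \<times> tuples L" by (simp add: o_def case_prod_unfold)
    from summable_on_Sigma_banach[OF this]
    have "(\<lambda>\<kappa>. \<Sum>\<^sub>\<infinity>\<beta>\<in>tuples L. w (\<lambda>i. \<kappa> i + \<beta> i)) summable_on tuples J" .
    then show ?thesis
    proof (rule summable_on_comparison_test)
      fix \<kappa> :: "'i \<Rightarrow> nat" assume \<kappa>: "\<kappa> \<in> tuples J"
      have eq: "w (\<lambda>i. \<kappa> i + \<beta> i) = \<rho> ^ mdeg J \<kappa> * (\<rho> ^ mdeg L \<beta> * norm (a (\<lambda>i. \<kappa> i + \<beta> i)))" if "\<beta> \<in> tuples L" for \<beta>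
        by (simp add: w_def mdeg_split[OF V JL(1,2) \<kappa> that] power_add)
      have "nrm F (b \<kappa>) \<le> (\<Sum>\<^sub>\<infinity>\<beta>\<in>tuples L. \<rho> ^ mdeg L \<beta> * norm (a (\<lambda>i. \<kappa> i + \<beta> i)))"
        unfolding F_def
      proof (rule bdd_holomorphic_nrm_le[OF polydisc_nonempty[OF R(1)]])
        fix x assume x: "x \<in> ?U"
        have "nsum whole_space (tuples L) (\<lambda>\<beta>. mono_val L x \<beta> *\<^sub>C a (\<lambda>i. \<kappa> i + \<beta> i)) (b \<kappa> x)"
          using t[of \<kappa>] x \<kappa> unfolding has_taylor_whole_space nsum_whole_space by (simp add: d_def)
        from nsum_weighted_bound[OF seminormed_whole_space _ _ _ this, of "\<lambda>\<beta>. \<rho> ^ mdeg L \<beta>" 1]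
        show "nrm whole_space (b \<kappa> x) \<le> (\<Sum>\<^sub>\<infinity>\<beta>\<in>tuples L. \<rho> ^ mdeg L \<beta> * norm (a (\<lambda>i. \<kappa> i + \<beta> i)))"
          using shift[OF \<kappa>] norm_mono_val_le[of L x \<rho>] x R by (force simp: polydisc_def)
      qed
      then show "\<rho> ^ mdeg J \<kappa> * nrm F (b \<kappa>) \<le> (\<Sum>\<^sub>\<infinity>\<beta>\<in>tuples L. w (\<lambda>i. \<kappa> i + \<beta> i))"
        using \<rho>0 by (simp add: eq infsum_cmult_right' cong: infsum_cong)
    qed (use \<rho>0 seminormed_nonneg[OF F b] in auto)
  qed
  have bform: "b \<in> formal_series J F" using b by (simp add: formal_series_def) (simp add: b_def)
  have exp: "taylor_expansion V J R whole_space b a"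
    unfolding taylor_expansion_def L_def[symmetric] using b0 by (auto simp: b_def)
  have shiftb: "(\<lambda>\<beta>. \<rho> ^ mdeg M \<beta> * nrm F (b (\<lambda>i. \<kappa> i + \<beta> i))) summable_on tuples M" if "M \<subseteq> J" "\<kappa> \<in> tuples J" for M \<kappa>
    by (rule summable_on_shift[OF JL(3) that(1) \<rho>0 that(2) bs])
  \<comment> \<open>The same expansion once more, now with the exponent of the variable j fixed and
    the other variables of J expanded.\<close>
  have one: "b \<in> one_var_series J F R j" if j: "j \<in> J" for j
  proof -
    let ?O = "bdd_holomorphic (J - {j}) (polydisc (J - {j}) R) F"
    have fin: "finite (J - {j})" using JL by simp
    have "\<forall>\<kappa>\<in>tuples {j}. \<exists>g. g \<in> vecs ?O \<and> has_taylor (J - {j}) F (polydisc (J - {j}) R) g (\<lambda>\<beta>. b (\<lambda>i. \<kappa> i + \<beta> i))"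
    proof
      fix \<kappa> :: "'i \<Rightarrow> nat" assume "\<kappa> \<in> tuples {j}"
      then have \<kappa>: "\<kappa> \<in> tuples J" using tuples_mono[of "{j}" J] j by auto
      have "\<forall>z\<in>polydisc (J - {j}) R. \<forall>i\<in>J - {j}. cmod (z i) \<le> R"
        by (simp add: polydisc_def less_imp_le)
      then show "\<exists>g. g \<in> vecs ?O \<and> has_taylor (J - {j}) F (polydisc (J - {j}) R) g (\<lambda>\<beta>. b (\<lambda>i. \<kappa> i + \<beta> i))"
        using power_series_bdd_holomorphic[OF F fin sc R(1,2) shiftb[OF Diff_subset \<kappa>], of "polydisc (J - {j}) R"]
        by blast
    qed
    then obtain b' where b': "\<forall>\<kappa>\<in>tuples {j}. b' \<kappa> \<in> vecs ?O \<and> has_taylor (J - {j}) F (polydisc (J - {j}) R) (b' \<kappa>) (\<lambda>\<beta>. b (\<lambda>i. \<kappa> i + \<beta> i))"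
      by (rule bchoice[THEN exE])
    define b2 where "b2 \<kappa> = (if \<kappa> \<in> tuples {j} then b' \<kappa> else 0)" for \<kappa>
    have "b2 \<in> formal_series {j} ?O" using b' by (auto simp: formal_series_def b2_def)
    moreover have "taylor_expansion J {j} R F b2 b" using b' by (auto simp: taylor_expansion_def b2_def)
    ultimately show ?thesis using bform unfolding one_var_series_def by blast
  qed
  then have Oh: "b \<in> Ohat J F" using R unfolding Ohat_def by blast
  have dir: "mono_summable_in_dir J F \<gamma> k b \<theta>" for \<theta>
  proof -
    \<comment> \<open>Taking one factor z^\<gamma> out of a term costs \<rho> ^ |\<gamma>| in its
      weight.\<close>
    define A where "A = 1 / \<rho> ^ mdeg J \<gamma>"
    \<comment> \<open>As R \<le> 1, this is at most R ^ \<gamma> j for each j, so the weighted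
      polydisc of radius r lies in the closed polydisc of radius R.\<close>
    define r where "r = R ^ (\<Sum>j\<in>J. \<gamma> j)"
    have r: "0 < r" using R by (simp add: r_def)
    have small: "cmod (z j) \<le> R" if "cmod (z j) ^ \<gamma> j < r" "j \<in> J" for z :: "'i \<Rightarrow> complex" and j
    proof (rule ccontr)
      assume "\<not> cmod (z j) \<le> R"
      then have "R ^ \<gamma> j \<le> cmod (z j) ^ \<gamma> j" using R by (intro power_mono) auto
      moreover have "\<gamma> j \<le> (\<Sum>j\<in>J. \<gamma> j)" using that JL by (intro member_le_sum) auto
      then have "r \<le> R ^ \<gamma> j" unfolding r_def using R by (intro power_decreasing) auto
      ultimately show False using that by simp
    qed
    let ?W = "weighted_polydisc J \<gamma> r"
    \<comment> \<open>A closed polydisc that contains the points of every sector of radius r, on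
      whichever sheet.\<close>
    define PW where "PW = {z \<in> tuples J. \<forall>j\<in>J. cmod (z j) \<le> R}"
    have bs0: "(\<lambda>\<kappa>. \<rho> ^ mdeg J \<kappa> * nrm F (b \<kappa>)) summable_on tuples J" by (rule bs)
    have "\<forall>z\<in>PW. \<forall>j\<in>J. cmod (z j) \<le> R" by (simp add: PW_def)
    from power_series_bdd_holomorphic[OF F JL(3) sc[of J "\<lambda>\<kappa>. \<kappa>"] R(1,2) bs0 this]
    obtain f0 G where f0: "\<forall>z\<in>PW. nsum F (tuples J) (\<lambda>\<kappa>. mono_val J z \<kappa> *\<^sub>C b \<kappa>) (f0 z)"
      and G: "quadratic_approx J F R G" "\<forall>z\<in>PW. f0 z = G z" by (elim exE conjE)
    have compv: "mono_component J \<gamma> l b \<beta> \<in> vecs F" for l \<beta>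
      using b seminormed_zero[OF F] by (simp add: mono_component_def)
    have "\<forall>l. \<exists>g. g \<in> vecs (bdd_holomorphic J ?W F) \<and> has_taylor J F ?W g (mono_component J \<gamma> l b) \<and>
       (\<forall>z\<in>?W. nsum F (tuples J) (\<lambda>\<kappa>. mono_val J z \<kappa> *\<^sub>C mono_component J \<gamma> l b \<kappa>) (g z))"
    proof
      fix l
      define c where "c = mono_component J \<gamma> l b"
      have cb: "c \<beta> = (if \<beta> \<in> tuples J \<and> \<not> (\<forall>j\<in>J. \<gamma> j \<le> \<beta> j) then b (\<lambda>i. l * \<gamma> i + \<beta> i) else 0)" for \<beta>
        by (simp add: c_def mono_component_def)
      have sc': "summing F (tuples J) c"
        unfolding F_def
      proof (rule summing_bdd_holomorphic[OF JL(4) R(1)])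
        show "c \<beta> \<in> vecs (bdd_holomorphic L ?U whole_space)" for \<beta> using compv[of l \<beta>] by (simp add: c_def F_def)
        show "has_taylor L whole_space ?U (c \<beta>)
            (if \<beta> \<in> tuples J \<and> \<not> (\<forall>j\<in>J. \<gamma> j \<le> \<beta> j) then d (\<lambda>i. l * \<gamma> i + \<beta> i) else 0)" for \<beta>
          using t[of "\<lambda>i. l * \<gamma> i + \<beta> i"] unfolding cb by (auto simp: has_taylor_whole_space)
      qed
      \<comment> \<open>The terms of a component are those of a shift of \<open>b\<close> or
        0.\<close>
      have ss: "(\<lambda>\<kappa>. \<rho> ^ mdeg J \<kappa> * nrm F (c \<kappa>)) summable_on tuples J"
        using shiftb[OF order_refl tuples_mult[OF \<gamma>(1), of l]]
      proof (rule summable_on_comparison_test)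
        show "\<rho> ^ mdeg J \<beta> * nrm F (c \<beta>) \<le> \<rho> ^ mdeg J \<beta> * nrm F (b (\<lambda>i. l * \<gamma> i + \<beta> i))" for \<beta>
          using \<rho>0 seminormed_nonneg[OF F b] by (auto simp: cb seminormed_nrm_zero[OF F])
        show "0 \<le> \<rho> ^ mdeg J \<beta> * nrm F (c \<beta>)" for \<beta>
          using \<rho>0 seminormed_nonneg[OF F compv] by (simp add: c_def)
      qed
      have "\<forall>z\<in>?W. \<forall>j\<in>J. cmod (z j) \<le> R"
        using small by (simp add: weighted_polydisc_def)
      from power_series_bdd_holomorphic[OF F JL(3) sc' R(1,2) ss this]
      show "\<exists>g. g \<in> vecs (bdd_holomorphic J ?W F) \<and> has_taylor J F ?W g (mono_component J \<gamma> l b) \<and>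
       (\<forall>z\<in>?W. nsum F (tuples J) (\<lambda>\<kappa>. mono_val J z \<kappa> *\<^sub>C mono_component J \<gamma> l b \<kappa>) (g z))"
        unfolding c_def by blast
    qed
    then obtain g where g: "\<forall>l. g l \<in> vecs (bdd_holomorphic J ?W F) \<and> has_taylor J F ?W (g l) (mono_component J \<gamma> l b) \<and>
       (\<forall>z\<in>?W. nsum F (tuples J) (\<lambda>\<kappa>. mono_val J z \<kappa> *\<^sub>C mono_component J \<gamma> l b \<kappa>) (g l z))"
      by (rule choice[THEN exE])
    define T where "T = (\<Sum>\<^sub>\<infinity>\<kappa>\<in>tuples J. \<rho> ^ mdeg J \<kappa> * nrm F (b \<kappa>))"
    have T: "0 \<le> T" unfolding T_def using \<rho>0 seminormed_nonneg[OF F b] by (intro infsum_nonneg) auto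
    have est: "nrm F (f0 z - (\<Sum>l<N. mono_val J z (\<lambda>i. l * \<gamma> i) *\<^sub>C g l z)) \<le> T * A ^ N * cmod (mono_val J z (\<lambda>i. N * \<gamma> i))"
      if z: "z \<in> ?W" for z N
      unfolding F_def
    proof (rule bdd_holomorphic_nrm_le[OF polydisc_nonempty[OF R(1)]])
      fix x assume x: "x \<in> ?U"
      have zP: "z \<in> PW" using z small by (auto simp: PW_def weighted_polydisc_def)
      define f where "f = (\<lambda>\<kappa>. mono_val J z \<kappa> *\<^sub>C b \<kappa> x)"
      define X where "X = {\<kappa> \<in> tuples J. \<not> (\<forall>j\<in>J. N * \<gamma> j \<le> \<kappa> j)}"
      have all: "(f has_sum f0 z x) (tuples J)"
        using nsum_bdd_holomorphic_pointwise[OF f0[rule_format, OF zP, unfolded F_def] x seminormed_whole_space JL(4)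
          seminormed_scaleC[OF F b, unfolded F_def]]
        by (simp add: nsum_whole_space f_def scaleC_fun_def)
      have part: "(f has_sum (\<Sum>l<N. mono_val J z (\<lambda>i. l * \<gamma> i) *\<^sub>C g l z x)) X"
        unfolding f_def X_def
        by (rule has_sum_bdd_component[OF J(2) JL(3) \<gamma>(1) x JL(4) b[unfolded F_def]]) (use g z in \<open>simp add: F_def\<close>)
      have rest: "(f has_sum (f0 z x - (\<Sum>l<N. mono_val J z (\<lambda>i. l * \<gamma> i) *\<^sub>C g l z x))) (tuples J - X)"
        by (rule has_sum_Diff[OF all part]) (auto simp: X_def)
      have le: "norm (f \<kappa>) \<le> A ^ N * cmod (mono_val J z (\<lambda>i. N * \<gamma> i)) * (\<rho> ^ mdeg J \<kappa> * nrm F (b \<kappa>))" if \<kappa>: "\<kappa> \<in> tuples J - X" for \<kappa>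
      proof -
        define \<beta> where "\<beta> i = \<kappa> i - N * \<gamma> i" for i
        have e: "\<kappa> = (\<lambda>i. N * \<gamma> i + \<beta> i)"
        proof
          fix i
          have "N * \<gamma> i \<le> \<kappa> i" using \<kappa> \<gamma>(1) by (cases "i \<in> J") (auto simp: X_def tuples_def)
          then show "\<kappa> i = N * \<gamma> i + \<beta> i" by (simp add: \<beta>_def)
        qed
        have m: "mono_val J z \<kappa> = mono_val J z (\<lambda>i. N * \<gamma> i) * mono_val J z \<beta>"
          by (subst e) (rule mono_val_add)
        have "cmod (mono_val J z \<beta>) \<le> \<rho> ^ mdeg J \<beta>" using zP R by (intro norm_mono_val_le) (force simp: PW_def)
        also have "\<dots> = A ^ N * \<rho> ^ mdeg J \<kappa>"
          using \<rho>0 unfolding A_def by (subst e) (simp add: mdeg_add mdeg_mult power_add power_mult[symmetric] power_divide mult.commute)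
        finally have 1: "cmod (mono_val J z \<kappa>) \<le> cmod (mono_val J z (\<lambda>i. N * \<gamma> i)) * (A ^ N * \<rho> ^ mdeg J \<kappa>)"
          unfolding m norm_mult by (rule mult_left_mono) simp
        have 2: "norm (b \<kappa> x) \<le> nrm F (b \<kappa>)"
          using bdd_holomorphic_le_nrm[OF b[unfolded F_def] x, of \<kappa>] by (simp add: F_def)
        have "norm (f \<kappa>) \<le> cmod (mono_val J z (\<lambda>i. N * \<gamma> i)) * (A ^ N * \<rho> ^ mdeg J \<kappa>) * nrm F (b \<kappa>)"
          unfolding f_def norm_scaleC by (rule mult_mono[OF 1 2]) (use \<rho>0 in \<open>auto simp: A_def\<close>)
        then show ?thesis by (simp add: mult_ac)
      qed
      have sX: "(\<lambda>\<kappa>. A ^ N * cmod (mono_val J z (\<lambda>i. N * \<gamma> i)) * (\<rho> ^ mdeg J \<kappa> * nrm F (b \<kappa>))) summable_on tuples J"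
        by (rule summable_on_cmult_right[OF bs])
      have sX': "(\<lambda>\<kappa>. A ^ N * cmod (mono_val J z (\<lambda>i. N * \<gamma> i)) * (\<rho> ^ mdeg J \<kappa> * nrm F (b \<kappa>))) summable_on tuples J - X"
        by (rule summable_on_subset_banach[OF sX]) auto
      have nf: "(\<lambda>\<kappa>. norm (f \<kappa>)) summable_on tuples J - X"
        using sX' by (rule summable_on_comparison_test) (use le in auto)
      have "norm (f0 z x - (\<Sum>l<N. mono_val J z (\<lambda>i. l * \<gamma> i) *\<^sub>C g l z x)) = norm (infsum f (tuples J - X))"
        using infsumI[OF rest] by simp
      also have "\<dots> \<le> (\<Sum>\<^sub>\<infinity>\<kappa>\<in>tuples J - X. norm (f \<kappa>))" by (rule norm_infsum_bound[OF nf])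
      also have "\<dots> \<le> (\<Sum>\<^sub>\<infinity>\<kappa>\<in>tuples J - X. A ^ N * cmod (mono_val J z (\<lambda>i. N * \<gamma> i)) * (\<rho> ^ mdeg J \<kappa> * nrm F (b \<kappa>)))"
        by (rule infsum_mono[OF nf sX' le])
      also have "\<dots> \<le> (\<Sum>\<^sub>\<infinity>\<kappa>\<in>tuples J. A ^ N * cmod (mono_val J z (\<lambda>i. N * \<gamma> i)) * (\<rho> ^ mdeg J \<kappa> * nrm F (b \<kappa>)))"
        using \<rho>0 seminormed_nonneg[OF F b] by (intro infsum_mono2[OF sX' sX]) (auto simp: A_def)
      also have "\<dots> = A ^ N * cmod (mono_val J z (\<lambda>i. N * \<gamma> i)) * T" unfolding T_def by (rule infsum_cmult_right')
      finally show "nrm whole_space ((f0 z - (\<Sum>l<N. mono_val J z (\<lambda>i. l * \<gamma> i) *\<^sub>C g l z)) x) \<le> T * A ^ N * cmod (mono_val J z (\<lambda>i. N * \<gamma> i))"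
        by (simp add: sum_fun_apply scaleC_fun_def mult_ac)
    qed
    have hol: "holomorphic_map J F fst (sector J \<gamma> a0 b0 r) (\<lambda>x. f0 (fst x))" for a0 b0
    proof (rule holomorphic_map_quadratic[OF F JL(3) G(1)])
      have P: "fst x \<in> PW" if "x \<in> sector J \<gamma> a0 b0 r" for x
        using that small by (auto simp: sector_def PW_def)
      show "continuous_on (sector J \<gamma> a0 b0 r) (\<lambda>x. fst x j)" for j
        by (rule continuous_on_compose2[OF continuous_on_product_coordinates[of j] continuous_on_fst[OF continuous_on_id]]) auto
      show "cmod (fst x j) \<le> R" if "x \<in> sector J \<gamma> a0 b0 r" "j \<in> J" for x j
        using P[OF that(1)] that(2) by (auto simp: PW_def)
      show "f0 (fst x) = G (fst x)" if "x \<in> sector J \<gamma> a0 b0 r" for x using G(2) P[OF that] by blast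
      show "f0 (fst x) \<in> vecs F" if "x \<in> sector J \<gamma> a0 b0 r" for x
        using f0[rule_format, OF P[OF that]] by (simp add: nsum_def)
    qed
    have ga: "gevrey_asymp J F \<gamma> (1 / k) a0 b0 r (\<lambda>x. f0 (fst x)) b" for a0 b0
      unfolding gevrey_asymp_def
    proof (rule exI[of _ r], rule exI[of _ g], intro conjI allI impI)
      fix a' b' \<rho>' :: real assume "a0 < a' \<and> a' < b' \<and> b' < b0 \<and> 0 < \<rho>' \<and> \<rho>' < r"
      then have sub: "z \<in> ?W" if "(z, t) \<in> sector J \<gamma> a' b' \<rho>'" for z t
        using that by (auto simp: sector_def weighted_polydisc_def)
      show "\<exists>C>0. \<exists>A>0. \<forall>N. \<forall>(z, t)\<in>sector J \<gamma> a' b' \<rho>'.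
              nrm F (f0 (fst (z, t)) - (\<Sum>l<N. mono_val J z (\<lambda>i. l * \<gamma> i) *\<^sub>C g l z))
                \<le> C * A ^ N * fact N powr (1 / k) * cmod (mono_val J z (\<lambda>i. N * \<gamma> i))"
      proof (rule exI[of _ "T + 1"], rule conjI[OF _ exI[of _ A]], goal_cases)
        case 2
        show ?case
        proof (intro conjI allI)
        fix N
        have A0: "0 \<le> A ^ N" using \<rho>0 by (simp add: A_def)
        have "T * A ^ N \<le> (T + 1) * A ^ N" using A0 by (intro mult_right_mono) auto
        also have "\<dots> \<le> (T + 1) * A ^ N * fact N powr (1 / k)"
          by (rule fact_powr_bound) (use T k A0 in auto)
        finally have "T * A ^ N \<le> (T + 1) * A ^ N * fact N powr (1 / k)" .
        then show "\<forall>(z, t)\<in>sector J \<gamma> a' b' \<rho>'.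
              nrm F (f0 (fst (z, t)) - (\<Sum>l<N. mono_val J z (\<lambda>i. l * \<gamma> i) *\<^sub>C g l z))
                \<le> (T + 1) * A ^ N * fact N powr (1 / k) * cmod (mono_val J z (\<lambda>i. N * \<gamma> i))"
          using est sub by (fastforce intro: order_trans[OF est] mult_right_mono)
      qed (use \<rho>0 in \<open>auto simp: A_def\<close>)
      qed (use T in auto)
    qed (use r g in auto)
    \<comment> \<open>The opening is taken to be 2 pi / k, which exceeds the required pi /
      k.\<close>
    have "\<theta> = (\<theta> - pi / k + (\<theta> + pi / k)) / 2" "\<theta> + pi / k - (\<theta> - pi / k) > pi / k"
      using divide_pos_pos[OF pi_gt_zero k] by (simp, linarith)
    then show ?thesis unfolding mono_summable_in_dir_def using r hol ga by blast
  qed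
  have "b \<in> mono_summable J F \<gamma> k" using Oh dir by (simp add: mono_summable_def)
  then show ?thesis using a exp unfolding partial_mono_summable_def F_def L_def by blast
qed

section \<open>Gevrey bounds for monomially summable series\<close>

lemma cis_eq_imp_eq:
  assumes "cis a = cis b" "\<bar>a - b\<bar> < 2 * pi"
  shows "a = b"
proof -
  have "cis (a - b) = 1" using assms(1) by (simp add: cis_divide[symmetric])
  then have "cos (a - b) = 1" by (simp add: complex_eq_iff)
  then have "\<exists>n::int. a - b = real_of_int n * 2 * pi" by (simp only: cos_one_2pi_int)
  then obtain n :: int where n: "a - b = real_of_int n * 2 * pi" by (elim exE)
  then have "\<bar>real_of_int n\<bar> * (2 * pi) < 1 * (2 * pi)" using assms(2) by (simp add: abs_mult)
  then have "\<bar>real_of_int n\<bar> < 1" using mult_less_cancel_right_pos[of "2 * pi"] pi_gt_zero by force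
  then have "n = 0" by linarith
  then show ?thesis using n by simp
qed

text \<open>A bad \<theta>0 determines an index and an exceptional point of the circle, and there
  are finitely many such pairs. On an interval of length 1 / l this assignment is injective, but the
  interval is infinite. The factor l is the speed at which the argument of a monomial follows a
  rotation.\<close>

lemma exists_good_directions:
  assumes fin: "finite (cis ` {\<theta>. \<not> good \<theta>})" and l: "0 < l"
  shows "\<exists>\<theta>0. \<forall>i\<le>m. good (l * (\<theta>0 + real i * \<eta>))"
proof (rule ccontr)
  assume "\<not> ?thesis"
  then have "\<forall>\<theta>0. \<exists>i\<le>m. \<not> good (l * (\<theta>0 + real i * \<eta>))" by blast
  then obtain f where f: "\<And>\<theta>0. f \<theta>0 \<le> m \<and> \<not> good (l * (\<theta>0 + real (f \<theta>0) * \<eta>))" by metis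
  define g where "g \<theta>0 = (f \<theta>0, cis (l * (\<theta>0 + real (f \<theta>0) * \<eta>)))" for \<theta>0
  have "g ` {0<..<1 / l} \<subseteq> {..m} \<times> (cis ` {\<theta>. \<not> good \<theta>})" using f by (auto simp: g_def)
  then have "finite (g ` {0<..<1 / l})" by (rule finite_subset) (use fin in auto)
  moreover have "inj_on g {0<..<1 / l}"
  proof (rule inj_onI)
    fix x y assume xy: "x \<in> {0<..<1 / l}" "y \<in> {0<..<1 / l}" "g x = g y"
    then have e: "f x = f y" "cis (l * (x + real (f x) * \<eta>)) = cis (l * (y + real (f x) * \<eta>))" by (auto simp: g_def)
    have "\<bar>l * (x + real (f x) * \<eta>) - l * (y + real (f x) * \<eta>)\<bar> = l * \<bar>x - y\<bar>"
      using l by (simp add: abs_mult flip: right_diff_distrib)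
    also have "\<dots> < l * (1 / l)" using xy l by (intro mult_strict_left_mono) auto
    also have "\<dots> < 2 * pi" using l pi_gt3 by simp
    finally have "l * (x + real (f x) * \<eta>) = l * (y + real (f x) * \<eta>)" by (rule cis_eq_imp_eq[OF e(2)])
    then show "x = y" using l by simp
  qed
  ultimately have "finite {0<..<1 / l}" by (rule finite_imageD)
  then show False using infinite_Ioo[of 0 "1 / l"] l by simp
qed

text \<open>One constant \<open>C\<close> serves as both constants of the Gevrey estimate.\<close>

definition sum_data ::
  "'i set \<Rightarrow> 'v::complex_vector nspace \<Rightarrow> ('i \<Rightarrow> nat) \<Rightarrow> real \<Rightarrow> (('i \<Rightarrow> nat) \<Rightarrow> 'v) \<Rightarrow> real \<Rightarrow> real \<Rightarrow> real \<Rightarrow> real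
    \<Rightarrow> (('i \<Rightarrow> complex) \<times> real \<Rightarrow> 'v) \<Rightarrow> (nat \<Rightarrow> ('i \<Rightarrow> complex) \<Rightarrow> 'v) \<Rightarrow> bool" where
  "sum_data J F \<gamma> k b \<theta> \<delta> \<rho> C f g \<longleftrightarrow>
     holomorphic_map J F fst (sector J \<gamma> (\<theta> - pi / (2 * k) - \<delta>) (\<theta> + pi / (2 * k) + \<delta>) \<rho>) f \<and>
     (\<forall>l. \<forall>z\<in>weighted_polydisc J \<gamma> \<rho>. nsum F (tuples J) (\<lambda>\<beta>. mono_val J z \<beta> *\<^sub>C mono_component J \<gamma> l b \<beta>) (g l z)) \<and>
     (\<forall>N. \<forall>(z, t)\<in>sector J \<gamma> (\<theta> - pi / (2 * k) - \<delta>) (\<theta> + pi / (2 * k) + \<delta>) \<rho>.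
        nrm F (f (z, t) - (\<Sum>l<N. mono_val J z (\<lambda>i. l * \<gamma> i) *\<^sub>C g l z))
          \<le> C ^ Suc N * fact N powr (1 / k) * cmod (mono_val J z (\<lambda>i. N * \<gamma> i)))"

lemma sector_mono: "a \<le> a' \<Longrightarrow> b' \<le> b \<Longrightarrow> r' \<le> r \<Longrightarrow> sector J \<gamma> a' b' r' \<subseteq> sector J \<gamma> a b r"
  by (auto simp: sector_def intro: less_le_trans le_less_trans)

lemma holomorphic_map_subset:
  assumes "holomorphic_map J F \<pi> S f" "T \<subseteq> S"
  shows "holomorphic_map J F \<pi> T f"
  unfolding holomorphic_map_def
proof (intro conjI ballI)
  show "f x \<in> vecs F" if "x \<in> T" for x using assms that by (auto simp: holomorphic_map_def)
  fix x assume "x \<in> T"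
  then have "x \<in> S" using assms by blast
  from holomorphic_mapD[OF assms(1) this] obtain v where v: "\<forall>j\<in>J. v j \<in> vecs F"
    "\<forall>\<epsilon>>0. \<forall>\<^sub>F y in at x within S. nrm F (f y - f x - (\<Sum>j\<in>J. (\<pi> y j - \<pi> x j) *\<^sub>C v j)) \<le> \<epsilon> * (\<Sum>j\<in>J. cmod (\<pi> y j - \<pi> x j))"
    by (elim exE conjE)
  show "\<exists>v. (\<forall>j\<in>J. v j \<in> vecs F) \<and>
     (\<forall>\<epsilon>>0. \<forall>\<^sub>F y in at x within T. nrm F (f y - f x - (\<Sum>j\<in>J. (\<pi> y j - \<pi> x j) *\<^sub>C v j)) \<le> \<epsilon> * (\<Sum>j\<in>J. cmod (\<pi> y j - \<pi> x j)))"
  proof (intro exI[of _ v] conjI v(1) allI impI)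
    fix \<epsilon> :: real assume "\<epsilon> > 0"
    show "\<forall>\<^sub>F y in at x within T. nrm F (f y - f x - (\<Sum>j\<in>J. (\<pi> y j - \<pi> x j) *\<^sub>C v j)) \<le> \<epsilon> * (\<Sum>j\<in>J. cmod (\<pi> y j - \<pi> x j))"
      by (rule filter_leD[OF at_le[OF assms(2)] v(2)[rule_format, OF \<open>\<epsilon> > 0\<close>]])
  qed
qed

lemma sum_data_mono:
  assumes d: "sum_data J F \<gamma> k b \<theta> \<delta> \<rho> C f g" and le: "\<delta>' \<le> \<delta>" "\<rho>' \<le> \<rho>" "0 \<le> C" "C \<le> C'"
  shows "sum_data J F \<gamma> k b \<theta> \<delta>' \<rho>' C' f g"
proof -
  have sub: "sector J \<gamma> (\<theta> - pi / (2 * k) - \<delta>') (\<theta> + pi / (2 * k) + \<delta>') \<rho>'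
     \<subseteq> sector J \<gamma> (\<theta> - pi / (2 * k) - \<delta>) (\<theta> + pi / (2 * k) + \<delta>) \<rho>" (is "?S' \<subseteq> ?S")
    by (rule sector_mono) (use le in auto)
  have wp: "weighted_polydisc J \<gamma> \<rho>' \<subseteq> weighted_polydisc J \<gamma> \<rho>"
    using le by (auto simp: weighted_polydisc_def intro: less_le_trans)
  note d' = d[unfolded sum_data_def]
  show ?thesis unfolding sum_data_def
  proof (intro conjI allI ballI)
    show "holomorphic_map J F fst ?S' f" by (rule holomorphic_map_subset[OF conjunct1[OF d'] sub])
    show "nsum F (tuples J) (\<lambda>\<beta>. mono_val J z \<beta> *\<^sub>C mono_component J \<gamma> l b \<beta>) (g l z)" if "z \<in> weighted_polydisc J \<gamma> \<rho>'" for l z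
      using conjunct1[OF conjunct2[OF d']] wp that by blast
    fix N x assume x: "x \<in> ?S'"
    obtain z t where zt: "x = (z, t)" by (cases x)
    have "nrm F (f (z, t) - (\<Sum>l<N. mono_val J z (\<lambda>i. l * \<gamma> i) *\<^sub>C g l z))
       \<le> C ^ Suc N * fact N powr (1 / k) * cmod (mono_val J z (\<lambda>i. N * \<gamma> i))"
      using conjunct2[OF conjunct2[OF d'], rule_format, of x N] x sub by (auto simp: zt)
    also have "\<dots> \<le> C' ^ Suc N * fact N powr (1 / k) * cmod (mono_val J z (\<lambda>i. N * \<gamma> i))"
      using le by (intro mult_right_mono power_mono) auto
    finally show "case x of (z, t) \<Rightarrow> nrm F (f (z, t) - (\<Sum>l<N. mono_val J z (\<lambda>i. l * \<gamma> i) *\<^sub>C g l z))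
          \<le> C' ^ Suc N * fact N powr (1 / k) * cmod (mono_val J z (\<lambda>i. N * \<gamma> i))" by (simp add: zt)
  qed
qed

text \<open>Estimates are available on strictly smaller sectors, so half of the excess of the
  opening over pi / k and half of the radius are given up.\<close>

lemma sum_data_exists:
  assumes k: "0 < k" and d: "mono_summable_in_dir J F \<gamma> k b \<theta>"
  shows "\<exists>\<delta> \<rho> C f g. 0 < \<delta> \<and> 0 < \<rho> \<and> 1 \<le> C \<and> sum_data J F \<gamma> k b \<theta> \<delta> \<rho> C f g"
proof -
  from d[unfolded mono_summable_in_dir_def] obtain a0 b0 r f where
    f: "0 < r" "\<theta> = (a0 + b0) / 2" "b0 - a0 > pi / k" "holomorphic_map J F fst (sector J \<gamma> a0 b0 r) f"
    and ga: "gevrey_asymp J F \<gamma> (1 / k) a0 b0 r f b" by (elim exE conjE)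
  from ga[unfolded gevrey_asymp_def] obtain r' g where r': "0 < r'" "r' \<le> r"
    and g: "\<forall>l. g l \<in> vecs (bdd_holomorphic J (weighted_polydisc J \<gamma> r') F) \<and>
             has_taylor J F (weighted_polydisc J \<gamma> r') (g l) (mono_component J \<gamma> l b)"
    and est: "\<forall>a' b' \<rho>. a0 < a' \<and> a' < b' \<and> b' < b0 \<and> 0 < \<rho> \<and> \<rho> < r' \<longrightarrow>
           (\<exists>C>0. \<exists>A>0. \<forall>N. \<forall>(z, t)\<in>sector J \<gamma> a' b' \<rho>.
              nrm F (f (z, t) - (\<Sum>l<N. mono_val J z (\<lambda>i. l * \<gamma> i) *\<^sub>C g l z))
                \<le> C * A ^ N * fact N powr (1 / k) * cmod (mono_val J z (\<lambda>i. N * \<gamma> i)))" by (elim exE conjE)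
  define \<delta> where "\<delta> = ((b0 - a0) / 2 - pi / (2 * k)) / 2"
  have k2: "pi / (2 * k) = pi / k / 2" by simp
  have \<delta>: "0 < \<delta>" using f(3) unfolding \<delta>_def k2 by simp
  define \<rho> where "\<rho> = r' / 2"
  define a' where "a' = \<theta> - pi / (2 * k) - \<delta>"
  define b' where "b' = \<theta> + pi / (2 * k) + \<delta>"
  have p: "0 < pi / k" using k by simp
  have ab: "a0 < a'" "a' < b'" "b' < b0"
    using f(2,3) p unfolding a'_def b'_def \<delta>_def k2 by (simp_all add: field_simps)
  have \<rho>: "0 < \<rho>" "\<rho> < r'" using r' by (auto simp: \<rho>_def)
  from est[rule_format, of a' b' \<rho>] ab \<rho> obtain C A where CA: "C > 0" "A > 0"
    and e: "\<forall>N. \<forall>(z, t)\<in>sector J \<gamma> a' b' \<rho>.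
              nrm F (f (z, t) - (\<Sum>l<N. mono_val J z (\<lambda>i. l * \<gamma> i) *\<^sub>C g l z))
                \<le> C * A ^ N * fact N powr (1 / k) * cmod (mono_val J z (\<lambda>i. N * \<gamma> i))" by blast
  \<comment> \<open>A number above 1, C and A absorbs both constants in the form
    \<open>D ^ Suc N\<close>.\<close>
  define D where "D = max 1 (max C A)"
  have D: "1 \<le> D" "C \<le> D" "A \<le> D" by (auto simp: D_def)
  have wp: "weighted_polydisc J \<gamma> \<rho> \<subseteq> weighted_polydisc J \<gamma> r'"
    using \<rho> by (auto simp: weighted_polydisc_def)
  have "sum_data J F \<gamma> k b \<theta> \<delta> \<rho> D f g"
    unfolding sum_data_def a'_def[symmetric] b'_def[symmetric]
  proof (intro conjI allI ballI)
    show "holomorphic_map J F fst (sector J \<gamma> a' b' \<rho>) f"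
      by (rule holomorphic_map_subset[OF f(4)], rule sector_mono) (use ab \<rho> r' in auto)
    fix l z assume z: "z \<in> weighted_polydisc J \<gamma> \<rho>"
    have ht: "has_taylor J F (weighted_polydisc J \<gamma> r') (g l) (mono_component J \<gamma> l b)" using g by blast
    have gv: "\<forall>z\<in>weighted_polydisc J \<gamma> r'. g l z \<in> vecs F"
      using g bdd_holomorphic_value[of "g l" J "weighted_polydisc J \<gamma> r'" F] by blast
    show "nsum F (tuples J) (\<lambda>\<beta>. mono_val J z \<beta> *\<^sub>C mono_component J \<gamma> l b \<beta>) (g l z)"
      using ht gv z wp has_taylor_iff_nsum[of "weighted_polydisc J \<gamma> r'" "g l" F J "mono_component J \<gamma> l b"] by blast
  next
    fix N x assume x: "x \<in> sector J \<gamma> a' b' \<rho>"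
    obtain z t where zt: "x = (z, t)" by (cases x)
    have "nrm F (f (z, t) - (\<Sum>l<N. mono_val J z (\<lambda>i. l * \<gamma> i) *\<^sub>C g l z))
       \<le> C * A ^ N * fact N powr (1 / k) * cmod (mono_val J z (\<lambda>i. N * \<gamma> i))"
      using bspec[OF spec[OF e], OF x] by (simp add: zt)
    also have "C * A ^ N \<le> D ^ Suc N"
      unfolding power_Suc using CA D by (intro mult_mono power_mono) auto
    finally show "case x of (z, t) \<Rightarrow> nrm F (f (z, t) - (\<Sum>l<N. mono_val J z (\<lambda>i. l * \<gamma> i) *\<^sub>C g l z))
          \<le> D ^ Suc N * fact N powr (1 / k) * cmod (mono_val J z (\<lambda>i. N * \<gamma> i))"
      by (simp add: zt mult_right_mono)
  qed
  then show ?thesis using \<delta> \<rho>(1) D(1) by blast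
qed

text \<open>Minima of openings and radii, maxima of constants over finitely many directions.\<close>

lemma sum_data_uniform:
  assumes k: "0 < k" and fin: "finite \<Theta>" and d: "\<forall>\<theta>\<in>\<Theta>. mono_summable_in_dir J F \<gamma> k b \<theta>"
  shows "\<exists>\<delta> \<rho> C. 0 < \<delta> \<and> 0 < \<rho> \<and> 1 \<le> C \<and> (\<forall>\<theta>\<in>\<Theta>. \<exists>f g. sum_data J F \<gamma> k b \<theta> \<delta> \<rho> C f g)"
  using fin d
proof (induction \<Theta> rule: finite_induct)
  case empty
  then show ?case by (auto intro: exI[of _ 1])
next
  case (insert \<theta> \<Theta>)
  then obtain \<delta> \<rho> C where 1: "0 < \<delta>" "0 < \<rho>" "1 \<le> C" "\<forall>\<theta>\<in>\<Theta>. \<exists>f g. sum_data J F \<gamma> k b \<theta> \<delta> \<rho> C f g" by auto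
  from sum_data_exists[OF k, of J F \<gamma> b \<theta>] insert.prems obtain \<delta>' \<rho>' C' f' g' where
    2: "0 < \<delta>'" "0 < \<rho>'" "1 \<le> C'" "sum_data J F \<gamma> k b \<theta> \<delta>' \<rho>' C' f' g'" by auto
  show ?case
  proof (rule exI[of _ "min \<delta> \<delta>'"], rule exI[of _ "min \<rho> \<rho>'"], rule exI[of _ "max C C'"], intro conjI ballI)
    fix \<theta>' assume t: "\<theta>' \<in> insert \<theta> \<Theta>"
    show "\<exists>f g. sum_data J F \<gamma> k b \<theta>' (min \<delta> \<delta>') (min \<rho> \<rho>') (max C C') f g"
    proof (cases "\<theta>' = \<theta>")
      case True
      have "sum_data J F \<gamma> k b \<theta> (min \<delta> \<delta>') (min \<rho> \<rho>') (max C C') f' g'"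
        by (rule sum_data_mono[OF 2(4)]) (use 2 in auto)
      then show ?thesis using True by blast
    next
      case False
      then obtain f g where "sum_data J F \<gamma> k b \<theta>' \<delta> \<rho> C f g" using t 1(4) by blast
      then have "sum_data J F \<gamma> k b \<theta>' (min \<delta> \<delta>') (min \<rho> \<rho>') (max C C') f g"
        by (rule sum_data_mono) (use 1 in auto)
      then show ?thesis by blast
    qed
  qed (use 1 2 in auto)
qed

text \<open>The index l of the component in which the exponent \<kappa> occurs.\<close>

definition level :: "'i set \<Rightarrow> ('i \<Rightarrow> nat) \<Rightarrow> ('i \<Rightarrow> nat) \<Rightarrow> nat" where
  "level J \<gamma> \<kappa> = Min ((\<lambda>j. \<kappa> j div \<gamma> j) ` J)"

lemma le_level_iff:
  assumes "finite J" "J \<noteq> {}" "\<forall>j\<in>J. 0 < \<gamma> j"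
  shows "N \<le> level J \<gamma> \<kappa> \<longleftrightarrow> (\<forall>j\<in>J. N * \<gamma> j \<le> \<kappa> j)"
  unfolding level_def using assms by (simp add: less_eq_div_iff_mult_less_eq)

lemma level_decomposition:
  assumes J: "finite J" "J \<noteq> {}" "\<forall>j\<in>J. 0 < \<gamma> j" and \<gamma>: "\<gamma> \<in> tuples J" and \<kappa>: "\<kappa> \<in> tuples J"
  obtains \<beta> where "\<beta> \<in> tuples J" "\<not> (\<forall>j\<in>J. \<gamma> j \<le> \<beta> j)" "\<kappa> = (\<lambda>i. level J \<gamma> \<kappa> * \<gamma> i + \<beta> i)"
proof -
  define l where "l = level J \<gamma> \<kappa>"
  have le: "\<forall>j\<in>J. l * \<gamma> j \<le> \<kappa> j" using le_level_iff[OF J, of l \<kappa>] by (simp add: l_def)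
  have nle: "\<not> (\<forall>j\<in>J. Suc l * \<gamma> j \<le> \<kappa> j)" using le_level_iff[OF J, of "Suc l" \<kappa>] by (simp add: l_def)
  define \<beta> where "\<beta> i = \<kappa> i - l * \<gamma> i" for i
  have e: "\<kappa> i = l * \<gamma> i + \<beta> i" for i
    using le \<gamma> by (cases "i \<in> J") (auto simp: \<beta>_def tuples_def)
  have "\<beta> \<in> tuples J" using \<kappa> by (auto simp: \<beta>_def tuples_def)
  moreover have "\<not> (\<forall>j\<in>J. \<gamma> j \<le> \<beta> j)" using nle by (auto simp: e)
  ultimately show thesis using that[of \<beta>] e by (auto simp: l_def)
qed

lemma level_mdeg:
  assumes J: "finite J" "J \<noteq> {}" "\<forall>j\<in>J. 0 < \<gamma> j"
  shows "level J \<gamma> \<kappa> \<le> mdeg J \<kappa>"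
proof -
  obtain j where j: "j \<in> J" using J by blast
  have "level J \<gamma> \<kappa> * 1 \<le> level J \<gamma> \<kappa> * \<gamma> j" using J j by (intro mult_le_mono2) auto
  also have "\<dots> \<le> \<kappa> j" using le_level_iff[OF J, of "level J \<gamma> \<kappa>" \<kappa>] j by simp
  also have "\<dots> \<le> mdeg J \<kappa>" unfolding mdeg_def using J j by (intro member_le_sum) auto
  finally show ?thesis by simp
qed

text \<open>Every argument lies in the sector of one of finitely many good directions; this yields bounds
  for the components on whole polydiscs and hence, by Cauchy's estimate, for the coefficients.\<close>

lemma mono_summable_gevrey_bound:
  fixes b :: "('i \<Rightarrow> nat) \<Rightarrow> ('i \<Rightarrow> complex) \<Rightarrow> 'e::complex_banach"
  assumes J: "finite J" "J \<noteq> {}" "\<forall>j\<in>J. 0 < \<gamma> j" and \<gamma>: "\<gamma> \<in> tuples J" and k: "0 < k"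
    and L: "finite L" and R: "0 < R"
    and bs: "b \<in> mono_summable J (bdd_holomorphic L (polydisc L R) whole_space) \<gamma> k"
    and bv: "\<And>\<kappa>. \<kappa> \<in> tuples J \<Longrightarrow> b \<kappa> \<in> vecs (bdd_holomorphic L (polydisc L R) whole_space)"
  shows "\<exists>D\<ge>1. \<exists>B\<ge>1. \<forall>\<kappa>\<in>tuples J. nrm (bdd_holomorphic L (polydisc L R) whole_space) (b \<kappa>)
     \<le> D * B ^ mdeg J \<kappa> * fact (level J \<gamma> \<kappa>) powr (1 / k)"
proof -
  define F where "F = (bdd_holomorphic L (polydisc L R) whole_space :: (('i \<Rightarrow> complex) \<Rightarrow> 'e) nspace)"
  have F: "seminormed F" unfolding F_def
    by (intro seminormed_bdd_holomorphic seminormed_whole_space L polydisc_nonempty R)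
  have bF: "b \<kappa> \<in> vecs F" if "\<kappa> \<in> tuples J" for \<kappa> using bv[OF that] by (simp add: F_def)
  have compF: "mono_component J \<gamma> l b \<beta> \<in> vecs F" for l \<beta>
    using bF tuples_add[OF tuples_mult[OF \<gamma>]] seminormed_zero[OF F] by (auto simp: mono_component_def)
  \<comment> \<open>The half-opening pi / (2 k). Sectors of this half-opening around directions
    \<eta> apart reach every argument.\<close>
  define \<eta> where "\<eta> = pi / (2 * k)"
  have \<eta>: "0 < \<eta>" using k by (simp add: \<eta>_def)
  define m where "m = nat \<lceil>2 * pi / \<eta>\<rceil>"
  have m: "2 * pi \<le> m * \<eta>"
  proof -
    have "2 * pi / \<eta> \<le> real m" unfolding m_def by linarith
    then show ?thesis using \<eta> by (simp add: field_simps)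
  qed
  have fin: "finite (cis ` {\<theta>. \<not> mono_summable_in_dir J F \<gamma> k b \<theta>})"
    using bs unfolding mono_summable_def F_def by blast
  from exists_good_directions[OF fin, of 1 m \<eta>] obtain \<theta>0 where
    \<theta>0: "\<forall>i\<le>m. mono_summable_in_dir J F \<gamma> k b (\<theta>0 + real i * \<eta>)" by auto
  from sum_data_uniform[OF k, of "(\<lambda>i. \<theta>0 + real i * \<eta>) ` {..m}" J F \<gamma> b] \<theta>0
  obtain \<delta> \<rho> C where \<delta>: "0 < \<delta>" and \<rho>: "0 < \<rho>" and C: "1 \<le> C"
    and data: "\<forall>i\<le>m. \<exists>f g. sum_data J F \<gamma> k b (\<theta>0 + real i * \<eta>) \<delta> \<rho> C f g" by auto
  define s where "s = 1 / k"
  have s: "0 < s" using k by (simp add: s_def)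
  define E where "E = C * 2 powr s"
  have E: "1 \<le> E" using C s by (simp add: E_def) (metis mult_mono' ge_one_powr_ge_zero less_imp_le mult_1 one_le_numeral zero_le_one)
  have gbound: "\<exists>y. nsum F (tuples J) (\<lambda>\<beta>. mono_val J z \<beta> *\<^sub>C mono_component J \<gamma> l b \<beta>) y \<and> nrm F y \<le> 2 * C\<^sup>2 * E ^ l * fact l powr s"
    if z: "z \<in> tuples J" "\<forall>j\<in>J. 0 < cmod (z j) \<and> cmod (z j) \<le> 1 \<and> cmod (z j) ^ \<gamma> j < \<rho>" for z l
  proof -
    define t0 where "t0 = Arg2pi (mono_val J z \<gamma> / cis \<theta>0)"
    have t0: "0 \<le> t0" "t0 < 2 * pi" unfolding t0_def by (auto simp: Arg2pi_lt_2pi Arg2pi_ge_0)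
    have arg: "is_Arg (mono_val J z \<gamma>) (\<theta>0 + t0)"
    proof -
      have "mono_val J z \<gamma> / cis \<theta>0 = cmod (mono_val J z \<gamma> / cis \<theta>0) * exp (\<i> * t0)"
        unfolding t0_def by (rule Arg2pi_eq)
      then have "mono_val J z \<gamma> = cis \<theta>0 * (cmod (mono_val J z \<gamma>) * exp (\<i> * t0))"
        by (simp add: norm_divide field_simps)
      moreover have "exp (\<i> * complex_of_real (\<theta>0 + t0)) = cis \<theta>0 * exp (\<i> * t0)"
        by (simp add: cis_conv_exp exp_add[symmetric] algebra_simps)
      ultimately show ?thesis unfolding is_Arg_def by (metis mult.left_commute)
    qed
    \<comment> \<open>The last of the chosen directions that does not exceed the argument; the
      difference is below \<eta>.\<close>
    define i where "i = nat \<lfloor>t0 / \<eta>\<rfloor>"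
    have i: "real i * \<eta> \<le> t0" "t0 < (real i + 1) * \<eta>"
    proof -
      have "real i \<le> t0 / \<eta>" "t0 / \<eta> < real i + 1"
        using t0 \<eta> unfolding i_def by (auto intro: of_nat_floor)
      then show "real i * \<eta> \<le> t0" "t0 < (real i + 1) * \<eta>" using \<eta> by (auto simp: field_simps)
    qed
    have "real i * \<eta> < real m * \<eta>" using i t0 m by linarith
    then have im: "i \<le> m" using \<eta> by simp
    from data[rule_format, OF im] obtain f g where d: "sum_data J F \<gamma> k b (\<theta>0 + real i * \<eta>) \<delta> \<rho> C f g" by (elim exE)
    let ?S = "sector J \<gamma> (\<theta>0 + real i * \<eta> - pi / (2 * k) - \<delta>) (\<theta>0 + real i * \<eta> + pi / (2 * k) + \<delta>) \<rho>"
    have zS: "(z, \<theta>0 + t0) \<in> ?S"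
      using z arg i \<delta> unfolding \<eta>_def[symmetric] by (auto simp: sector_def algebra_simps)
    have zW: "z \<in> weighted_polydisc J \<gamma> \<rho>" using z by (auto simp: weighted_polydisc_def)
    note d' = d[unfolded sum_data_def]
    have n: "nsum F (tuples J) (\<lambda>\<beta>. mono_val J z \<beta> *\<^sub>C mono_component J \<gamma> l b \<beta>) (g l z)" for l
      using conjunct1[OF conjunct2[OF d']] zW by blast
    define T where "T N = f (z, \<theta>0 + t0) - (\<Sum>l<N. mono_val J z (\<lambda>i. l * \<gamma> i) *\<^sub>C g l z)" for N
    have gF: "g l z \<in> vecs F" for l using n by (simp add: nsum_def)
    have fF: "f (z, \<theta>0 + t0) \<in> vecs F" using conjunct1[OF d'] zS by (auto simp: holomorphic_map_def)
    have TF: "T N \<in> vecs F" for N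
      unfolding T_def by (intro seminormed_diff(1)[OF F] fF conjunct1[OF seminormed_sum[OF F]] seminormed_scaleC[OF F] gF)
    have Tb: "nrm F (T N) \<le> C ^ Suc N * fact N powr s * cmod (mono_val J z \<gamma>) ^ N" for N
      using conjunct2[OF conjunct2[OF d'], rule_format, OF zS, of N] by (simp add: T_def s_def mono_val_mult norm_power)
    define \<mu> where "\<mu> = cmod (mono_val J z \<gamma>)"
    have \<mu>: "0 < \<mu>" "\<mu> \<le> 1"
    proof -
      show "0 < \<mu>" using z by (auto simp: \<mu>_def norm_mono_val intro!: prod_pos)
      show "\<mu> \<le> 1" using norm_mono_val_le[of J z 1 \<gamma>] z by (simp add: \<mu>_def)
    qed
    \<comment> \<open>Consecutive remainders differ by a single term. Both are small of order l in
      z^\<gamma>, so division by |z^\<gamma>| ^ l bounds the component itself.\<close>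
    have "mono_val J z (\<lambda>i. l * \<gamma> i) *\<^sub>C g l z = T l - T (Suc l)" by (simp add: T_def)
    then have "\<mu> ^ l * nrm F (g l z) = nrm F (T l - T (Suc l))"
      using seminormed_nrm_scaleC[OF F gF, of "mono_val J z (\<lambda>i. l * \<gamma> i)" l] by (simp add: mono_val_mult norm_power \<mu>_def)
    also have "\<dots> \<le> nrm F (T l) + nrm F (T (Suc l))" by (rule seminormed_diff(2)[OF F TF TF])
    also have "\<dots> \<le> C ^ Suc l * fact l powr s * \<mu> ^ l + C ^ Suc (Suc l) * fact (Suc l) powr s * \<mu> ^ Suc l"
      using Tb[of l] Tb[of "Suc l"] by (intro add_mono) (simp_all add: \<mu>_def)
    also have "\<dots> \<le> C ^ Suc (Suc l) * (2 powr s) ^ l * fact l powr s * \<mu> ^ l + C ^ Suc (Suc l) * (2 powr s) ^ l * fact l powr s * \<mu> ^ l"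
    proof (rule add_mono)
      have "1 \<le> (2 powr s) ^ l" using s by (intro one_le_power ge_one_powr_ge_zero) auto
      then have "C ^ Suc l * 1 \<le> C ^ Suc (Suc l) * (2 powr s) ^ l" using C by (intro mult_mono power_increasing) auto
      then show "C ^ Suc l * fact l powr s * \<mu> ^ l \<le> C ^ Suc (Suc l) * (2 powr s) ^ l * fact l powr s * \<mu> ^ l"
        using \<mu> by (intro mult_right_mono) auto
      \<comment> \<open>The factor (l + 1) powr s of the next factorial is made geometric.\<close>
      have "real (Suc l) \<le> 2 ^ l" using Suc_leI[OF less_exp[of l]] by (metis of_nat_le_iff of_nat_numeral of_nat_power)
      then have "real (Suc l) powr s \<le> (2 ^ l) powr s" using s by (intro powr_mono2) auto
      also have "\<dots> = (2 powr s) ^ l" by (simp add: powr_powr mult.commute flip: powr_realpow)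
      finally have "fact (Suc l) powr s \<le> (2 powr s) ^ l * (fact l powr s :: real)"
        by (simp add: powr_mult mult_right_mono)
      moreover have "\<mu> ^ Suc l \<le> \<mu> ^ l" using \<mu> by (intro power_decreasing) auto
      ultimately have "fact (Suc l) powr s * \<mu> ^ Suc l \<le> (2 powr s) ^ l * fact l powr s * \<mu> ^ l"
        using \<mu> by (intro mult_mono) auto
      then have "C ^ Suc (Suc l) * (fact (Suc l) powr s * \<mu> ^ Suc l) \<le> C ^ Suc (Suc l) * ((2 powr s) ^ l * fact l powr s * \<mu> ^ l)"
        by (rule mult_left_mono) (use C in auto)
      then show "C ^ Suc (Suc l) * fact (Suc l) powr s * \<mu> ^ Suc l \<le> C ^ Suc (Suc l) * (2 powr s) ^ l * fact l powr s * \<mu> ^ l"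
        by (simp only: mult.assoc)
    qed
    also have "\<dots> = \<mu> ^ l * (2 * C\<^sup>2 * E ^ l * fact l powr s)"
      by (simp add: E_def power_mult_distrib power2_eq_square algebra_simps)
    finally have "nrm F (g l z) \<le> 2 * C\<^sup>2 * E ^ l * fact l powr s" using \<mu> by simp
    then show ?thesis using n by blast
  qed
  \<comment> \<open>Cauchy's estimate is taken at radius \<sigma>, absolute convergence is read off
    at radius 2 \<sigma>; both lie in the domain of the sums.\<close>
  define \<sigma> where "\<sigma> = min 1 \<rho> / 4"
  have \<sigma>: "0 < \<sigma>" "2 * \<sigma> < 1" "2 * \<sigma> < \<rho>" using \<rho> by (auto simp: \<sigma>_def min_def)
  have pw: "r ^ \<gamma> j < \<rho>" if "0 < r" "r \<le> 2 * \<sigma>" "j \<in> J" for r j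
  proof -
    have "r ^ \<gamma> j \<le> r ^ 1" using that \<sigma> J by (intro power_decreasing) (auto simp: Suc_leI)
    then show ?thesis using that \<sigma> by simp
  qed
  have cb: "nrm F (mono_component J \<gamma> l b \<beta>) * \<sigma> ^ mdeg J \<beta> \<le> 2 * C\<^sup>2 * E ^ l * fact l powr s" if \<beta>: "\<beta> \<in> tuples J" for l \<beta>
  proof -
    have "nrm F (mono_component J \<gamma> l b \<beta>) \<le> 2 * C\<^sup>2 * E ^ l * fact l powr s / \<sigma> ^ mdeg J \<beta>"
      unfolding F_def
    proof (rule bdd_holomorphic_nrm_le[OF polydisc_nonempty[OF R]])
      fix x assume x: "x \<in> polydisc L R"
      have hs: "\<exists>y. ((\<lambda>\<beta>. mono_val J z \<beta> *\<^sub>C mono_component J \<gamma> l b \<beta> x) has_sum y) (tuples J) \<and> norm y \<le> 2 * C\<^sup>2 * E ^ l * fact l powr s"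
        if z: "z \<in> tuples J" "\<forall>j\<in>J. cmod (z j) = r" and r: "0 < r" "r \<le> 2 * \<sigma>" for z r
      proof -
        have "\<forall>j\<in>J. 0 < cmod (z j) \<and> cmod (z j) \<le> 1 \<and> cmod (z j) ^ \<gamma> j < \<rho>"
          using z r \<sigma> pw by auto
        from gbound[OF z(1) this] obtain y where y: "nsum F (tuples J) (\<lambda>\<beta>. mono_val J z \<beta> *\<^sub>C mono_component J \<gamma> l b \<beta>) y"
          "nrm F y \<le> 2 * C\<^sup>2 * E ^ l * fact l powr s" by blast
        have "((\<lambda>\<beta>. mono_val J z \<beta> *\<^sub>C mono_component J \<gamma> l b \<beta> x) has_sum y x) (tuples J)"
          using nsum_bdd_holomorphic_pointwise[OF y(1)[unfolded F_def] x seminormed_whole_space L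
              seminormed_scaleC[OF F compF, unfolded F_def]]
          by (simp add: nsum_whole_space scaleC_fun_def)
        moreover have "y \<in> vecs F" using y by (simp add: nsum_def)
        then have "norm (y x) \<le> nrm F y"
          using bdd_holomorphic_le_nrm[of y L "polydisc L R" whole_space x] x by (simp add: F_def)
        ultimately show ?thesis using y(2) order_trans by blast
      qed
      have "norm (mono_component J \<gamma> l b \<beta> x) * \<sigma> ^ mdeg J \<beta> \<le> 2 * C\<^sup>2 * E ^ l * fact l powr s"
      proof (rule cauchy_coefficient_bound[OF J(1) \<beta>])
        define z where "z = (\<lambda>j. if j \<in> J then complex_of_real (2 * \<sigma>) else 0)"
        have "(\<lambda>\<beta>. mono_val J z \<beta> *\<^sub>C mono_component J \<gamma> l b \<beta> x) summable_on tuples J"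
          using hs[of z "2 * \<sigma>"] \<sigma> by (auto simp: z_def tuples_def summable_on_def)
        then show "(\<lambda>\<beta>. norm (mono_component J \<gamma> l b \<beta> x) * \<sigma> ^ mdeg J \<beta>) summable_on tuples J"
          by (rule power_series_abs_summable[OF J(1), where R = "2 * \<sigma>"]) (use \<sigma> in \<open>auto simp: z_def\<close>)
        fix z :: "'i \<Rightarrow> complex" assume z: "z \<in> tuples J" "\<And>j. j \<in> J \<Longrightarrow> cmod (z j) = \<sigma>"
        then obtain y where "((\<lambda>\<beta>. mono_val J z \<beta> *\<^sub>C mono_component J \<gamma> l b \<beta> x) has_sum y) (tuples J)" "norm y \<le> 2 * C\<^sup>2 * E ^ l * fact l powr s"
          using hs[of z \<sigma>] \<sigma> by auto
        then show "norm (\<Sum>\<^sub>\<infinity>\<beta>\<in>tuples J. mono_val J z \<beta> *\<^sub>C mono_component J \<gamma> l b \<beta> x) \<le> 2 * C\<^sup>2 * E ^ l * fact l powr s"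
          by (simp add: infsumI)
      qed (use \<sigma> in auto)
      then show "nrm whole_space (mono_component J \<gamma> l b \<beta> x) \<le> 2 * C\<^sup>2 * E ^ l * fact l powr s / \<sigma> ^ mdeg J \<beta>"
        using \<sigma> by (simp add: field_simps)
    qed
    then show ?thesis using \<sigma> by (simp add: field_simps)
  qed
  have main: "nrm F (b \<kappa>) \<le> 2 * C\<^sup>2 * (E / \<sigma>) ^ mdeg J \<kappa> * fact (level J \<gamma> \<kappa>) powr s" if \<kappa>: "\<kappa> \<in> tuples J" for \<kappa>
  proof -
    obtain \<beta> where \<beta>: "\<beta> \<in> tuples J" "\<not> (\<forall>j\<in>J. \<gamma> j \<le> \<beta> j)" "\<kappa> = (\<lambda>i. level J \<gamma> \<kappa> * \<gamma> i + \<beta> i)"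
      by (rule level_decomposition[OF J \<gamma> \<kappa>], rule that)
    define l where "l = level J \<gamma> \<kappa>"
    have bk: "mono_component J \<gamma> l b \<beta> = b \<kappa>" using \<beta> by (simp add: mono_component_def l_def)
    have deg: "mdeg J \<beta> \<le> mdeg J \<kappa>" by (subst \<beta>(3)) (simp add: mdeg_add)
    have "nrm F (b \<kappa>) \<le> 2 * C\<^sup>2 * E ^ l * fact l powr s * (1 / \<sigma>) ^ mdeg J \<beta>"
      using cb[OF \<beta>(1), of l] \<sigma> by (simp add: bk field_simps power_divide)
    also have "\<dots> \<le> 2 * C\<^sup>2 * E ^ mdeg J \<kappa> * fact l powr s * (1 / \<sigma>) ^ mdeg J \<kappa>"
      using E C \<sigma> deg level_mdeg[OF J, of \<kappa>]
      by (intro mult_mono mult_right_mono mult_left_mono power_increasing) (auto simp: l_def)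
    also have "\<dots> = 2 * C\<^sup>2 * (E / \<sigma>) ^ mdeg J \<kappa> * fact l powr s" by (simp add: power_divide)
    finally show ?thesis by (simp add: l_def)
  qed
  have "1 \<le> 2 * C\<^sup>2" using C by (simp add: power2_eq_square) (metis mult_mono' mult_2 add_increasing2 mult_1 zero_le_one order_trans)
  moreover have "1 \<le> E / \<sigma>" using E \<sigma> by simp
  ultimately show ?thesis using main unfolding F_def s_def by blast
qed

section \<open>Reduction to one variable\<close>

definition wdeg :: "('i \<Rightarrow> nat) \<Rightarrow> 'i set \<Rightarrow> ('i \<Rightarrow> nat) \<Rightarrow> nat" where
  "wdeg w V \<nu> = (\<Sum>j\<in>V. w j * \<nu> j)"

definition layer :: "('i \<Rightarrow> nat) \<Rightarrow> 'i set \<Rightarrow> (('i \<Rightarrow> nat) \<Rightarrow> 'e::complex_vector) \<Rightarrow> nat \<Rightarrow> ('i \<Rightarrow> complex) \<Rightarrow> 'e" where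
  "layer w V a n z = (\<Sum>\<nu> | \<nu> \<in> tuples V \<and> wdeg w V \<nu> = n. mono_val V z \<nu> *\<^sub>C a \<nu>)"

section \<open>Weighted degree and the Gevrey order of the layers\<close>

lemma finite_tuples_le:
  assumes "finite V"
  shows "finite {\<nu> \<in> tuples V. \<forall>j\<in>V. \<nu> j \<le> (n::nat)}"
proof -
  have "finite {\<nu>. \<forall>j. (j \<in> V \<longrightarrow> \<nu> j \<in> {..n}) \<and> (j \<notin> V \<longrightarrow> \<nu> j = 0)}"
    by (rule finite_set_of_finite_funs[OF assms]) simp
  then show ?thesis by (rule finite_subset[rotated]) (auto simp: tuples_def)
qed

lemma finite_wdeg_less:
  assumes V: "finite V" and w: "\<forall>j\<in>V. 0 < w j"
  shows "finite {\<nu> \<in> tuples V. wdeg w V \<nu> < n}"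
proof -
  have "\<nu> j \<le> n" if "wdeg w V \<nu> < n" "j \<in> V" for \<nu> j
  proof -
    have "1 * \<nu> j \<le> w j * \<nu> j" using w that by (intro mult_le_mono1) auto
    also have "\<dots> \<le> wdeg w V \<nu>" unfolding wdeg_def using V that by (intro member_le_sum) auto
    finally show ?thesis using that by simp
  qed
  then have "{\<nu> \<in> tuples V. wdeg w V \<nu> < n} \<subseteq> {\<nu> \<in> tuples V. \<forall>j\<in>V. \<nu> j \<le> n}" by auto
  then show ?thesis by (rule finite_subset) (rule finite_tuples_le[OF V])
qed

lemma finite_wdeg_eq:
  assumes "finite V" "\<forall>j\<in>V. 0 < w j"
  shows "finite {\<nu>. \<nu> \<in> tuples V \<and> wdeg w V \<nu> = n}"
  by (rule finite_subset[OF _ finite_wdeg_less[OF assms, of "Suc n"]]) auto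

lemma sum_layers:
  assumes V: "finite V" "\<forall>j\<in>V. 0 < w j"
  shows "(\<Sum>n<N. layer w V a n z) = (\<Sum>\<nu> | \<nu> \<in> tuples V \<and> wdeg w V \<nu> < N. mono_val V z \<nu> *\<^sub>C a \<nu>)"
proof (induction N)
  case (Suc N)
  have "{\<nu>. \<nu> \<in> tuples V \<and> wdeg w V \<nu> < Suc N} = {\<nu>. \<nu> \<in> tuples V \<and> wdeg w V \<nu> < N} \<union> {\<nu>. \<nu> \<in> tuples V \<and> wdeg w V \<nu> = N}"
    by auto
  then show ?case using Suc finite_wdeg_less[OF V, of N] finite_wdeg_eq[OF V, of N]
    by (simp add: layer_def) (subst sum.union_disjoint, auto)
qed simp

lemma mono_val_quasihomogeneous:
  "mono_val V (\<lambda>j. y j * q ^ w j) \<nu> = mono_val V y \<nu> * q ^ wdeg w V \<nu>"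
proof (cases "finite V")
  case True
  then show ?thesis
    by (simp add: mono_val_def wdeg_def power_mult_distrib prod.distrib power_sum power_mult)
qed (simp add: mono_val_def wdeg_def)

lemma layer_quasihomogeneous: "layer w V a n (\<lambda>j. y j * q ^ w j) = q ^ n *\<^sub>C layer w V a n y"
  unfolding layer_def scaleC_sum_right mono_val_quasihomogeneous
  by (intro sum.cong) (auto simp: scaleC_scaleC mult.commute)

lemma level_cong: "(\<And>j. j \<in> J \<Longrightarrow> \<kappa> j = \<kappa>' j) \<Longrightarrow> level J \<gamma> \<kappa> = level J \<gamma> \<kappa>'"
  unfolding level_def by (rule arg_cong[where f = Min], rule image_cong) auto

text \<open>Each unit of level contains a copy of \<gamma>. Factorial growth in the level thus turns
  into factorial growth of a smaller order in the weighted degree.\<close>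

lemma level_wdeg:
  assumes V: "finite V" "J \<subseteq> V" and J: "J \<noteq> {}" "\<forall>j\<in>J. 0 < \<gamma> j"
  shows "level J \<gamma> \<nu> * wdeg w J \<gamma> \<le> wdeg w V \<nu>"
proof -
  have f: "finite J" using V by (rule finite_subset[rotated])
  have "level J \<gamma> \<nu> * wdeg w J \<gamma> = (\<Sum>j\<in>J. w j * (level J \<gamma> \<nu> * \<gamma> j))"
    by (simp add: wdeg_def sum_distrib_left mult_ac)
  also have "\<dots> \<le> (\<Sum>j\<in>J. w j * \<nu> j)"
    using le_level_iff[OF f J, of "level J \<gamma> \<nu>" \<nu>] by (intro sum_mono mult_le_mono2) simp
  also have "\<dots> \<le> wdeg w V \<nu>" unfolding wdeg_def using V by (intro sum_mono2) auto
  finally show ?thesis .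
qed

text \<open>The quotient is a multinomial coefficient.\<close>

lemma fact_power_le: "(fact l ^ m :: nat) \<le> fact (l * m)"
proof (induction m)
  case (Suc m)
  have "(fact l ^ Suc m :: nat) \<le> fact l * fact (l * m)" using Suc by simp
  also have "\<dots> \<le> fact (l + l * m)" by (intro dvd_imp_le fact_fact_dvd_fact) simp
  finally show ?case by simp
qed simp

text \<open>Order 1 / k in l is order 1 / (k m) in any n \<ge> l m. With m =
  \<open>wdeg w J \<gamma>\<close> this is the origin of the products that are compared
  later.\<close>

lemma fact_powr_level:
  fixes k :: real
  assumes "l * m \<le> n" "0 < m" "0 < k"
  shows "(fact l :: real) powr (1 / k) \<le> fact n powr (1 / (k * m))"
proof -
  have "(fact l ^ m :: nat) \<le> fact n" using fact_power_le[of l m] fact_mono_nat[OF assms(1)] by (rule order_trans)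
  then have "real (fact l ^ m) \<le> real (fact n)" by (simp only: of_nat_le_iff)
  then have "((fact l :: real) ^ m) powr (1 / (k * m)) \<le> fact n powr (1 / (k * m))"
    using assms by (intro powr_mono2) auto
  moreover have "((fact l :: real) ^ m) powr (1 / (k * m)) = fact l powr (1 / k)"
    using assms by (simp add: powr_powr flip: powr_realpow)
  ultimately show ?thesis by simp
qed

text \<open>The Gevrey bound for the coefficients in the variables of J, followed by Cauchy's
  estimate in the remaining variables, which do not affect the level.\<close>

lemma partial_mono_summable_gevrey_bound:
  fixes a :: "('i \<Rightarrow> nat) \<Rightarrow> 'e::complex_banach" and k :: real
  assumes V: "finite V" "J \<subseteq> V" and J: "J \<noteq> {}" "\<forall>j\<in>J. 0 < \<gamma> j" and \<gamma>: "\<gamma> \<in> tuples J" and k: "0 < k" and R: "0 < R"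
    and b: "b \<in> mono_summable J (bdd_holomorphic (V - J) (polydisc (V - J) R) whole_space) \<gamma> k"
      "\<And>\<kappa>. \<kappa> \<in> tuples J \<Longrightarrow> b \<kappa> \<in> vecs (bdd_holomorphic (V - J) (polydisc (V - J) R) whole_space)"
    and t: "taylor_expansion V J R whole_space b a"
  shows "\<exists>D\<ge>1. \<exists>B\<ge>1. \<forall>\<nu>\<in>tuples V. norm (a \<nu>) \<le> D * B ^ mdeg V \<nu> * fact (level J \<gamma> \<nu>) powr (1 / k)"
proof -
  define L where "L = V - J"
  have f: "finite J" "finite L" using V finite_subset by (auto simp: L_def)
  have VJL: "J \<union> L = V" "J \<inter> L = {}" using V by (auto simp: L_def)
  have "\<exists>D\<ge>1. \<exists>B\<ge>1. \<forall>\<kappa>\<in>tuples J. nrm (bdd_holomorphic L (polydisc L R) whole_space) (b \<kappa>) \<le> D * B ^ mdeg J \<kappa> * fact (level J \<gamma> \<kappa>) powr (1 / k)"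
    by (rule mono_summable_gevrey_bound[OF f(1) J \<gamma> k f(2) R]) (use b in \<open>simp_all add: L_def\<close>)
  then obtain D B where DB: "D \<ge> 1" "B \<ge> 1"
    and bnd: "\<forall>\<kappa>\<in>tuples J. nrm (bdd_holomorphic L (polydisc L R) whole_space) (b \<kappa>) \<le> D * B ^ mdeg J \<kappa> * fact (level J \<gamma> \<kappa>) powr (1 / k)"
    by (elim exE conjE)
  define B' where "B' = max B (1 / R)"
  have B': "1 \<le> B'" "B \<le> B'" "1 / R \<le> B'" using DB by (auto simp: B'_def)
  have "norm (a \<nu>) \<le> D * B' ^ mdeg V \<nu> * fact (level J \<gamma> \<nu>) powr (1 / k)" if \<nu>: "\<nu> \<in> tuples V" for \<nu>
  proof -
    have "\<nu> \<in> (\<lambda>(\<kappa>, \<beta>) i. \<kappa> i + \<beta> i) ` (tuples J \<times> tuples L)"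
      using \<nu> tuples_split_bij[OF VJL] by (simp add: bij_betw_def)
    then obtain \<kappa> \<beta> where \<kappa>: "\<kappa> \<in> tuples J" and \<beta>: "\<beta> \<in> tuples L" and e: "\<nu> = (\<lambda>i. \<kappa> i + \<beta> i)"
      by (elim imageE) auto
    have lev: "level J \<gamma> \<nu> = level J \<gamma> \<kappa>"
      by (rule level_cong) (use \<beta> in \<open>auto simp: e tuples_def L_def\<close>)
    let ?M = "D * B ^ mdeg J \<kappa> * fact (level J \<gamma> \<kappa>) powr (1 / k)"
    have "norm (a (\<lambda>i. \<kappa> i + \<beta> i)) * R ^ mdeg L \<beta> \<le> ?M"
    proof (rule taylor_coefficient_bound[OF f(2) R _ _ \<beta>, of "b \<kappa>" "\<lambda>\<beta>. a (\<lambda>i. \<kappa> i + \<beta> i)"])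
      show "has_taylor L whole_space (polydisc L R) (b \<kappa>) (\<lambda>\<beta>. a (\<lambda>i. \<kappa> i + \<beta> i))"
        using t \<kappa> by (simp add: taylor_expansion_def L_def)
      show "norm (b \<kappa> z) \<le> ?M" if "z \<in> polydisc L R" for z
        using bdd_holomorphic_le_nrm[OF b(2)[OF \<kappa>, folded L_def] that] bnd \<kappa> by fastforce
    qed
    then have "norm (a \<nu>) \<le> ?M * (1 / R) ^ mdeg L \<beta>" using R by (simp add: e field_simps power_divide)
    also have "\<dots> \<le> D * B' ^ mdeg J \<kappa> * fact (level J \<gamma> \<kappa>) powr (1 / k) * B' ^ mdeg L \<beta>"
      using DB B' R by (intro mult_mono power_mono mult_right_mono mult_left_mono) auto
    also have "\<dots> = D * B' ^ mdeg V \<nu> * fact (level J \<gamma> \<nu>) powr (1 / k)"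
      using mdeg_split[OF V(1) VJL \<kappa> \<beta>] by (simp add: lev[unfolded e] e power_add)
    finally show ?thesis .
  qed
  then show ?thesis using DB(1) B'(1) by blast
qed

lemma geometric_tuples:
  fixes B \<rho> :: real
  assumes V: "finite V" and "0 \<le> B" "0 \<le> \<rho>" "B * \<rho> \<le> 1 / 2"
  shows "(\<lambda>\<nu>. (B * \<rho>) ^ mdeg V \<nu>) summable_on tuples V"
  by (rule summable_on_geometric_tuples[OF V]) (use assms in auto)

text \<open>On a torus with B \<rho> \<le> 1 / 2 all layers are dominated by one geometric series; n
  enters through the factorial alone.\<close>

lemma layer_bound:
  fixes a :: "('i \<Rightarrow> nat) \<Rightarrow> 'e::complex_banach" and k :: real
  assumes V: "finite V" "J \<subseteq> V" and J: "J \<noteq> {}" "\<forall>j\<in>J. 0 < \<gamma> j" and k: "0 < k" and w: "\<forall>j\<in>V. 0 < w j"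
    and bnd: "\<forall>\<nu>\<in>tuples V. norm (a \<nu>) \<le> D * B ^ mdeg V \<nu> * fact (level J \<gamma> \<nu>) powr (1 / k)"
    and D: "0 \<le> D" "0 \<le> B" and \<rho>: "0 \<le> \<rho>" "B * \<rho> \<le> 1 / 2" and y: "\<forall>j\<in>V. cmod (y j) = \<rho>" and L: "0 < wdeg w J \<gamma>"
  shows "norm (layer w V a n y) \<le> D * (\<Sum>\<^sub>\<infinity>\<nu>\<in>tuples V. (B * \<rho>) ^ mdeg V \<nu>) * fact n powr (1 / (k * wdeg w J \<gamma>))"
proof -
  let ?X = "{\<nu>. \<nu> \<in> tuples V \<and> wdeg w V \<nu> = n}" and ?f = "fact n powr (1 / (k * wdeg w J \<gamma>)) :: real"
  have s: "(\<lambda>\<nu>. (B * \<rho>) ^ mdeg V \<nu>) summable_on tuples V" by (rule geometric_tuples[OF V(1) D(2) \<rho>])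
  have "norm (layer w V a n y) \<le> (\<Sum>\<nu>\<in>?X. norm (mono_val V y \<nu> *\<^sub>C a \<nu>))"
    unfolding layer_def by (rule norm_sum)
  also have "\<dots> \<le> (\<Sum>\<nu>\<in>?X. D * ?f * (B * \<rho>) ^ mdeg V \<nu>)"
  proof (rule sum_mono)
    fix \<nu> assume \<nu>: "\<nu> \<in> ?X"
    have "fact (level J \<gamma> \<nu>) powr (1 / k) \<le> ?f"
      by (rule fact_powr_level[OF _ L k]) (use level_wdeg[OF V J, of \<nu> w] \<nu> in auto)
    then have "D * B ^ mdeg V \<nu> * fact (level J \<gamma> \<nu>) powr (1 / k) \<le> D * B ^ mdeg V \<nu> * ?f"
      by (rule mult_left_mono) (use D in auto)
    then have "norm (a \<nu>) \<le> D * B ^ mdeg V \<nu> * ?f"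
      using bnd \<nu> order_trans by blast
    then have "norm (mono_val V y \<nu> *\<^sub>C a \<nu>) \<le> \<rho> ^ mdeg V \<nu> * (D * B ^ mdeg V \<nu> * ?f)"
      using norm_mono_val_eq[of V y \<rho> \<nu>] y \<rho> by (simp add: norm_scaleC mult_left_mono)
    then show "norm (mono_val V y \<nu> *\<^sub>C a \<nu>) \<le> D * ?f * (B * \<rho>) ^ mdeg V \<nu>"
      by (simp add: power_mult_distrib mult_ac)
  qed
  also have "\<dots> = D * ?f * (\<Sum>\<nu>\<in>?X. (B * \<rho>) ^ mdeg V \<nu>)" by (rule sum_distrib_left[symmetric])
  also have "\<dots> \<le> D * ?f * (\<Sum>\<^sub>\<infinity>\<nu>\<in>tuples V. (B * \<rho>) ^ mdeg V \<nu>)"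
    by (rule mult_left_mono, rule finite_sum_le_infsum[OF s finite_wdeg_eq[OF V(1) w]]) (use D \<rho> in auto)
  finally show ?thesis using D by (simp add: mult_ac)
qed

text \<open>The chain rule. One error comes from f and is weighted by the speed of the curve, the
  other comes from the curve and is weighted by the size of the partial derivatives; each receives
  half of \<epsilon>.\<close>

lemma holomorphic_map_along_curve:
  fixes f :: "'x::topological_space \<Rightarrow> 'v::complex_vector"
  assumes F: "seminormed F" and J: "finite J" and f: "holomorphic_map J F \<pi> S f"
    and W: "open W" "v0 \<in> W" and c: "continuous_on W c" "\<forall>v\<in>W. c v \<in> S"
    and d: "\<forall>j\<in>J. ((\<lambda>v. \<pi> (c v) j) has_field_derivative d j) (at v0)"
  shows "\<exists>u\<in>vecs F. \<forall>\<epsilon>>0. \<forall>\<^sub>F v in at v0. nrm F (f (c v) - f (c v0) - (v - v0) *\<^sub>C u) \<le> \<epsilon> * cmod (v - v0)"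
proof -
  have cS: "c v0 \<in> S" using W c by blast
  from holomorphic_mapD[OF f cS] obtain e where e: "\<forall>j\<in>J. e j \<in> vecs F"
    and E: "\<forall>\<epsilon>>0. \<forall>\<^sub>F y in at (c v0) within S. nrm F (f y - f (c v0) - (\<Sum>j\<in>J. (\<pi> y j - \<pi> (c v0) j) *\<^sub>C e j)) \<le> \<epsilon> * (\<Sum>j\<in>J. cmod (\<pi> y j - \<pi> (c v0) j))"
    by (elim exE conjE)
  have fv: "f y \<in> vecs F" if "y \<in> S" for y using f that by (simp add: holomorphic_map_def)
  define u where "u = (\<Sum>j\<in>J. d j *\<^sub>C e j)"
  have u: "u \<in> vecs F" unfolding u_def by (rule conjunct1[OF seminormed_sum[OF F]]) (use e seminormed_scaleC[OF F] in auto)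
  have cc: "filterlim c (nhds (c v0)) (at v0)"
    using c(1) W by (simp add: continuous_on_eq_continuous_at isCont_def)
  have inW: "\<forall>\<^sub>F v in at v0. v \<in> W" by (rule eventually_at_in_open'[OF W])
  show ?thesis
  proof (intro bexI[OF _ u] allI impI)
    fix \<epsilon> :: real assume \<epsilon>: "\<epsilon> > 0"
    \<comment> \<open>Near v0 the coordinate with index j moves at most |d j| + 1 times as fast as
      v.\<close>
    define Q where "Q = (\<Sum>j\<in>J. cmod (d j) + 1)"
    define N where "N = (\<Sum>j\<in>J. nrm F (e j))"
    have Q: "0 \<le> Q" unfolding Q_def by (intro sum_nonneg) auto
    have N: "0 \<le> N" unfolding N_def using e seminormed_nonneg[OF F] by (intro sum_nonneg) auto
    define \<epsilon>1 where "\<epsilon>1 = \<epsilon> / 2 / (1 + Q)"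
    define \<epsilon>2 where "\<epsilon>2 = min 1 (\<epsilon> / 2 / (1 + N))"
    have \<epsilon>1: "0 < \<epsilon>1" "\<epsilon>1 * Q \<le> \<epsilon> / 2" using \<epsilon> Q by (auto simp: \<epsilon>1_def field_simps)
    have "\<epsilon> / 2 / (1 + N) * N \<le> \<epsilon> / 2" using \<epsilon> N by (simp add: field_simps)
    moreover have "\<epsilon>2 * N \<le> \<epsilon> / 2 / (1 + N) * N" using N by (intro mult_right_mono) (auto simp: \<epsilon>2_def)
    ultimately have \<epsilon>2N: "\<epsilon>2 * N \<le> \<epsilon> / 2" by linarith
    have \<epsilon>2: "0 < \<epsilon>2" "\<epsilon>2 \<le> 1" using \<epsilon> N by (auto simp: \<epsilon>2_def)
    have 1: "\<forall>\<^sub>F v in at v0. nrm F (f (c v) - f (c v0) - (\<Sum>j\<in>J. (\<pi> (c v) j - \<pi> (c v0) j) *\<^sub>C e j)) \<le> \<epsilon>1 * (\<Sum>j\<in>J. cmod (\<pi> (c v) j - \<pi> (c v0) j))"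
    proof -
      have "\<forall>\<^sub>F y in nhds (c v0). y \<noteq> c v0 \<longrightarrow> y \<in> S \<longrightarrow> nrm F (f y - f (c v0) - (\<Sum>j\<in>J. (\<pi> y j - \<pi> (c v0) j) *\<^sub>C e j)) \<le> \<epsilon>1 * (\<Sum>j\<in>J. cmod (\<pi> y j - \<pi> (c v0) j))"
        using E \<epsilon>1(1) by (simp add: eventually_at_filter)
      from eventually_compose_filterlim[OF this cc] inW show ?thesis
      proof eventually_elim
        \<comment> \<open>The curve may return to \<open>c v0\<close>, where the punctured filter
          gives no information; but then both sides vanish.\<close>
        case (elim v)
        then show ?case using c(2) seminormed_nrm_zero[OF F] by (cases "c v = c v0") auto
      qed
    qed
    have 2: "\<forall>\<^sub>F v in at v0. \<forall>j\<in>J. cmod (\<pi> (c v) j - \<pi> (c v0) j - (v - v0) * d j) \<le> \<epsilon>2 * cmod (v - v0)"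
    proof (rule eventually_ball_finite[OF J], rule ballI)
      fix j assume j: "j \<in> J"
      have "((\<lambda>v. (\<pi> (c v) j - \<pi> (c v0) j) / (v - v0)) \<longlongrightarrow> d j) (at v0)"
        using d j by (simp add: has_field_derivative_iff)
      from tendstoD[OF this \<epsilon>2(1)]
      have "\<forall>\<^sub>F v in at v0. dist ((\<pi> (c v) j - \<pi> (c v0) j) / (v - v0)) (d j) < \<epsilon>2" .
      moreover have "\<forall>\<^sub>F v in at v0. v \<noteq> v0" by (simp add: eventually_at_filter)
      ultimately show "\<forall>\<^sub>F v in at v0. cmod (\<pi> (c v) j - \<pi> (c v0) j - (v - v0) * d j) \<le> \<epsilon>2 * cmod (v - v0)"
      proof eventually_elim
        case (elim v)
        have "\<pi> (c v) j - \<pi> (c v0) j - (v - v0) * d j = ((\<pi> (c v) j - \<pi> (c v0) j) / (v - v0) - d j) * (v - v0)"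
          using elim by (simp add: field_simps)
        then have "cmod (\<pi> (c v) j - \<pi> (c v0) j - (v - v0) * d j) = dist ((\<pi> (c v) j - \<pi> (c v0) j) / (v - v0)) (d j) * cmod (v - v0)"
          by (simp only: norm_mult dist_norm)
        also have "\<dots> \<le> \<epsilon>2 * cmod (v - v0)" using elim by (intro mult_right_mono) auto
        finally show ?case .
      qed
    qed
    from 1 2 inW show "\<forall>\<^sub>F v in at v0. nrm F (f (c v) - f (c v0) - (v - v0) *\<^sub>C u) \<le> \<epsilon> * cmod (v - v0)"
    proof eventually_elim
      case (elim v)
      let ?\<pi> = "\<lambda>j. \<pi> (c v) j - \<pi> (c v0) j"
      let ?A = "f (c v) - f (c v0) - (\<Sum>j\<in>J. ?\<pi> j *\<^sub>C e j)" and ?B = "\<Sum>j\<in>J. (?\<pi> j - (v - v0) * d j) *\<^sub>C e j"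
      have le: "cmod (?\<pi> j) \<le> (cmod (d j) + 1) * cmod (v - v0)" if j: "j \<in> J" for j
      proof -
        have "cmod (?\<pi> j) \<le> cmod ((v - v0) * d j) + cmod (?\<pi> j - (v - v0) * d j)"
          by (metis add.commute diff_add_cancel norm_triangle_ineq)
        also have "\<dots> \<le> cmod (v - v0) * cmod (d j) + 1 * cmod (v - v0)"
          unfolding norm_mult using bspec[OF elim(2) j] mult_right_mono[OF \<epsilon>2(2) norm_ge_zero[of "v - v0"]] by linarith
        finally show ?thesis by (simp add: algebra_simps)
      qed
      have AF: "?A \<in> vecs F"
        using elim(3) c(2) cS e by (intro seminormed_diff(1)[OF F] fv conjunct1[OF seminormed_sum[OF F]] seminormed_scaleC[OF F]) auto
      have tF: "(?\<pi> j - (v - v0) * d j) *\<^sub>C e j \<in> vecs F" if "j \<in> J" for j using e that by (intro seminormed_scaleC[OF F]) auto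
      have B: "?B \<in> vecs F \<and> nrm F ?B \<le> (\<Sum>j\<in>J. nrm F ((?\<pi> j - (v - v0) * d j) *\<^sub>C e j))"
        by (rule seminormed_sum[OF F tF])
      have "f (c v) - f (c v0) - (v - v0) *\<^sub>C u = ?A + ?B"
        by (simp add: u_def scaleC_sum_right scaleC_diff_left scaleC_scaleC sum_subtractf)
      then have "nrm F (f (c v) - f (c v0) - (v - v0) *\<^sub>C u) \<le> nrm F ?A + nrm F ?B"
        using seminormed_triangle[OF F AF conjunct1[OF B]] by (simp only:)
      also have "nrm F ?A \<le> \<epsilon>1 * (\<Sum>j\<in>J. (cmod (d j) + 1) * cmod (v - v0))"
        by (rule order_trans[OF elim(1)], intro mult_left_mono sum_mono le) (use \<epsilon>1 in auto)
      also have "\<dots> = \<epsilon>1 * Q * cmod (v - v0)" by (simp add: Q_def sum_distrib_right mult.assoc)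
      also have "nrm F ?B \<le> (\<Sum>j\<in>J. \<epsilon>2 * cmod (v - v0) * nrm F (e j))"
      proof (rule order_trans[OF conjunct2[OF B]], rule sum_mono)
        fix j assume j: "j \<in> J"
        then have ej: "e j \<in> vecs F" using e by blast
        show "nrm F ((?\<pi> j - (v - v0) * d j) *\<^sub>C e j) \<le> \<epsilon>2 * cmod (v - v0) * nrm F (e j)"
          unfolding seminormed_nrm_scaleC[OF F ej] using elim(2) j seminormed_nonneg[OF F ej] by (intro mult_right_mono) auto
      qed
      also have "\<dots> = \<epsilon>2 * N * cmod (v - v0)" by (simp add: N_def sum_distrib_left sum_distrib_right mult_ac)
      finally have "nrm F (f (c v) - f (c v0) - (v - v0) *\<^sub>C u) \<le> (\<epsilon>1 * Q + \<epsilon>2 * N) * cmod (v - v0)"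
        by (simp add: algebra_simps)
      also have "\<dots> \<le> \<epsilon> * cmod (v - v0)" using \<epsilon>1 \<epsilon>2N by (intro mult_right_mono) auto
      finally show ?case .
    qed
  qed
qed

lemma linear_contractionD:
  assumes "linear_contraction \<Lambda>"
  shows "\<Lambda> (x + y) = \<Lambda> x + \<Lambda> y" "\<Lambda> (x - y) = \<Lambda> x - \<Lambda> y" "\<Lambda> (c *\<^sub>C x) = c * \<Lambda> x" "cmod (\<Lambda> x) \<le> norm x"
    "\<Lambda> (sum f A) = (\<Sum>i\<in>A. \<Lambda> (f i))"
proof -
  show add: "\<Lambda> (x + y) = \<Lambda> x + \<Lambda> y" for x y using assms by (simp add: linear_contraction_def)
  show sc: "\<Lambda> (c *\<^sub>C x) = c * \<Lambda> x" for c x using assms by (simp add: linear_contraction_def)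
  show "cmod (\<Lambda> x) \<le> norm x" using assms by (simp add: linear_contraction_def)
  show "\<Lambda> (x - y) = \<Lambda> x - \<Lambda> y" using add[of "x - y" y] by simp
  have z: "\<Lambda> 0 = 0" using add[of 0 0] by simp
  show "\<Lambda> (sum f A) = (\<Sum>i\<in>A. \<Lambda> (f i))"
    by (induction A rule: infinite_finite_induct) (simp_all add: z add)
qed

text \<open>The value of f is itself a map, evaluated at a moving point. The increment splits into
  the remainder of f in the sup norm, v - v0 times the increment of the derivative u along
  \<open>xc\<close>, and the increment of the fixed map \<open>f (zc v0, tc v0)\<close> along
  \<open>xc\<close>.\<close>

lemma holomorphic_along_curves:
  fixes f :: "('i \<Rightarrow> complex) \<times> real \<Rightarrow> ('i \<Rightarrow> complex) \<Rightarrow> 'e::complex_banach"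
  assumes J: "finite J" and L: "finite L" and R: "0 < R"
    and f: "holomorphic_map J (bdd_holomorphic L (polydisc L R) whole_space) fst S f"
    and W: "open W" and zc: "\<forall>j. (\<lambda>v. zc v j) holomorphic_on W" and xc: "\<forall>j. (\<lambda>v. xc v j) holomorphic_on W"
    and tc: "continuous_on W tc" and S: "\<forall>v\<in>W. (zc v, tc v) \<in> S" and U: "\<forall>v\<in>W. xc v \<in> polydisc L R"
    and \<Lambda>: "linear_contraction \<Lambda>"
  shows "(\<lambda>v. \<Lambda> (f (zc v, tc v) (xc v))) holomorphic_on W"
proof -
  let ?U = "polydisc L R"
  define F where "F = (bdd_holomorphic L ?U whole_space :: (('i \<Rightarrow> complex) \<Rightarrow> 'e) nspace)"
  have F: "seminormed F" unfolding F_def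
    by (intro seminormed_bdd_holomorphic seminormed_whole_space L polydisc_nonempty R)
  let ?c = "\<lambda>v. (zc v, tc v)"
  have cont: "continuous_on W ?c" "continuous_on W xc"
    using zc xc holomorphic_on_imp_continuous_on
    by (auto intro!: continuous_on_Pair tc continuous_on_coordinatewise_then_product)
  have der: "\<forall>j\<in>M. ((\<lambda>v. y v j) has_field_derivative deriv (\<lambda>v. y v j) v0) (at v0)"
    if "\<forall>j. (\<lambda>v. y v j) holomorphic_on W" "v0 \<in> W" for y :: "complex \<Rightarrow> 'i \<Rightarrow> complex" and v0 M
    using that holomorphic_derivI[OF _ W] by blast
  have fF: "f (?c v) \<in> vecs F" if "v \<in> W" for v
    using f S that by (auto simp: holomorphic_map_def F_def)
  have inner: "\<exists>u. \<forall>\<epsilon>>0. \<forall>\<^sub>F v in at v0. norm (g (xc v) - g (xc v0) - (v - v0) *\<^sub>C u) \<le> \<epsilon> * cmod (v - v0)"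
    if g: "g \<in> vecs F" and v0: "v0 \<in> W" for g v0
  proof -
    have "holomorphic_map L whole_space (\<lambda>z. z) ?U g" using g by (simp add: F_def bdd_holomorphic_vecs)
    moreover have "\<forall>j\<in>L. ((\<lambda>v. xc v j) has_field_derivative deriv (\<lambda>v. xc v j) v0) (at v0)" by (rule der[OF xc v0])
    ultimately have "\<exists>u\<in>vecs whole_space. \<forall>\<epsilon>>0. \<forall>\<^sub>F v in at v0. nrm whole_space (g (xc v) - g (xc v0) - (v - v0) *\<^sub>C u) \<le> \<epsilon> * cmod (v - v0)"
      by (rule holomorphic_map_along_curve[OF seminormed_whole_space L, where \<pi> = "\<lambda>z. z", OF _ W v0 cont(2) U])
    then show ?thesis by auto
  qed
  have "((\<lambda>v. \<Lambda> (f (?c v) (xc v))) has_field_derivative 0) (at v0) \<or> (\<exists>D. ((\<lambda>v. \<Lambda> (f (?c v) (xc v))) has_field_derivative D) (at v0))" if v0: "v0 \<in> W" for v0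
  proof (rule disjI2)
    have "\<forall>j\<in>J. ((\<lambda>v. fst (?c v) j) has_field_derivative deriv (\<lambda>v. zc v j) v0) (at v0)" using der[OF zc v0] by simp
    from holomorphic_map_along_curve[OF F J f[folded F_def], where c = ?c, OF W v0 cont(1) S this]
    obtain u where u: "u \<in> vecs F" "\<forall>\<epsilon>>0. \<forall>\<^sub>F v in at v0. nrm F (f (?c v) - f (?c v0) - (v - v0) *\<^sub>C u) \<le> \<epsilon> * cmod (v - v0)" by blast
    obtain u1 where u1: "\<forall>\<epsilon>>0. \<forall>\<^sub>F v in at v0. norm (f (?c v0) (xc v) - f (?c v0) (xc v0) - (v - v0) *\<^sub>C u1) \<le> \<epsilon> * cmod (v - v0)"
      using inner[OF fF[OF v0] v0] by blast
    obtain u2 where u2: "\<forall>\<epsilon>>0. \<forall>\<^sub>F v in at v0. norm (u (xc v) - u (xc v0) - (v - v0) *\<^sub>C u2) \<le> \<epsilon> * cmod (v - v0)"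
      using inner[OF u(1) v0] by blast
    let ?D = "\<Lambda> (u (xc v0)) + \<Lambda> u1"
    have "((\<lambda>v. (\<Lambda> (f (?c v) (xc v)) - \<Lambda> (f (?c v0) (xc v0))) / (v - v0)) \<longlongrightarrow> ?D) (at v0)"
    proof (rule tendstoI)
      fix \<epsilon> :: real assume \<epsilon>: "0 < \<epsilon>"
      have inW: "\<forall>\<^sub>F v in at v0. v \<in> W" by (rule eventually_at_in_open'[OF W v0])
      have ne: "\<forall>\<^sub>F v in at v0. v \<noteq> v0" by (simp add: eventually_at_filter)
      \<comment> \<open>Makes the increment of u along \<open>xc\<close> at most \<epsilon> / 4; as
        an element of \<open>F\<close>, u is differentiable along this curve.\<close>
      have near: "\<forall>\<^sub>F v in at v0. dist v v0 < \<epsilon> / 4 / (1 + norm u2)"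
      proof -
        have "0 < \<epsilon> / 4 / (1 + norm u2)" using \<epsilon> by (intro divide_pos_pos add_pos_nonneg) auto
        then show ?thesis unfolding eventually_at by blast
      qed
      have "\<epsilon> / 4 > 0" using \<epsilon> by simp
      from u(2)[rule_format, OF this] u1[rule_format, OF this] u2[rule_format, OF zero_less_one] inW ne near
      show "\<forall>\<^sub>F v in at v0. dist ((\<Lambda> (f (?c v) (xc v)) - \<Lambda> (f (?c v0) (xc v0))) / (v - v0)) ?D < \<epsilon>"
      proof eventually_elim
        case (elim v)
        let ?h = "v - v0"
        let ?A = "f (?c v) - f (?c v0) - ?h *\<^sub>C u"
        have AF: "?A \<in> vecs F"
          using fF[OF elim(4)] fF[OF v0] u(1) by (intro seminormed_diff(1)[OF F] seminormed_scaleC[OF F])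
        have "norm (?A (xc v)) \<le> nrm F ?A"
          using bdd_holomorphic_le_nrm[OF AF[unfolded F_def], of "xc v"] U elim(4) by (simp add: F_def)
        then have A: "norm (?A (xc v)) \<le> \<epsilon> / 4 * cmod ?h" using elim(1) by linarith
        let ?B = "f (?c v0) (xc v) - f (?c v0) (xc v0) - ?h *\<^sub>C u1"
        let ?C = "u (xc v) - u (xc v0)"
        have "norm ?C \<le> norm (?C - ?h *\<^sub>C u2) + norm (?h *\<^sub>C u2)" by (metis diff_add_cancel norm_triangle_ineq)
        also have "\<dots> \<le> cmod ?h * (1 + norm u2)" using elim(3) by (simp add: norm_scaleC algebra_simps)
        also have "\<dots> < \<epsilon> / 4" using elim(6) by (simp add: dist_norm pos_less_divide_eq add_pos_nonneg algebra_simps)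
        finally have C: "norm ?C \<le> \<epsilon> / 4" by simp
        have e: "\<Lambda> (f (?c v) (xc v)) - \<Lambda> (f (?c v0) (xc v0)) - ?h * ?D = \<Lambda> (?A (xc v)) + ?h * \<Lambda> ?C + \<Lambda> ?B"
          by (simp add: linear_contractionD[OF \<Lambda>] scaleC_fun_def algebra_simps)
        have "cmod (\<Lambda> (f (?c v) (xc v)) - \<Lambda> (f (?c v0) (xc v0)) - ?h * ?D) \<le> cmod (\<Lambda> (?A (xc v))) + cmod ?h * cmod (\<Lambda> ?C) + cmod (\<Lambda> ?B)"
          unfolding e by (rule order_trans[OF norm_triangle_ineq], rule add_right_mono, rule order_trans[OF norm_triangle_ineq]) (simp add: norm_mult)
        also have "\<dots> \<le> \<epsilon> / 4 * cmod ?h + cmod ?h * (\<epsilon> / 4) + \<epsilon> / 4 * cmod ?h"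
          by (intro add_mono mult_left_mono order_trans[OF linear_contractionD(4)[OF \<Lambda>]] A C elim(2) norm_ge_zero)
        also have "\<dots> < \<epsilon> * cmod ?h" using elim(5) \<epsilon> by simp
        finally have lt: "cmod (\<Lambda> (f (?c v) (xc v)) - \<Lambda> (f (?c v0) (xc v0)) - ?h * ?D) < \<epsilon> * cmod ?h" .
        have "dist ((\<Lambda> (f (?c v) (xc v)) - \<Lambda> (f (?c v0) (xc v0))) / ?h) ?D = cmod ((\<Lambda> (f (?c v) (xc v)) - \<Lambda> (f (?c v0) (xc v0)) - ?h * ?D) / ?h)"
          using elim(5) by (simp add: dist_norm diff_divide_distrib)
        also have "\<dots> < \<epsilon>" using lt elim(5) by (simp add: norm_divide field_simps)
        finally show ?case .
      qed
    qed
    then show "\<exists>D. ((\<lambda>v. \<Lambda> (f (?c v) (xc v))) has_field_derivative D) (at v0)" by (auto simp: has_field_derivative_iff)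
  qed
  then show ?thesis unfolding holomorphic_on_open[OF W] by blast
qed

text \<open>If |arg v| is at least pi / 2 + \<epsilon>, then v has nonpositive scalar product with
  every x of the cone, whose half-aperture is \<epsilon>.\<close>

lemma wide_sector_Ln:
  assumes \<epsilon>: "0 < \<epsilon>" "\<epsilon> < pi / 2" and v: "v \<in> wide_sector (tan \<epsilon>)"
  shows "\<bar>Im (Ln v)\<bar> < pi / 2 + \<epsilon>"
proof (rule ccontr)
  assume "\<not> ?thesis"
  then have big: "pi / 2 + \<epsilon> \<le> \<bar>Im (Ln v)\<bar>" by simp
  from v obtain x where v1: "1 < cmod v" and x: "\<bar>Im x\<bar> < tan \<epsilon> * Re x" "0 < Re (v * cnj x)"
    unfolding wide_sector_def acone_def by auto
  have v0: "v \<noteq> 0" using v1 by auto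
  have t: "0 < tan \<epsilon>" using \<epsilon> by (rule tan_gt_zero)
  have rx: "0 < Re x" using x(1) t by (metis abs_ge_zero le_less_trans zero_less_mult_pos)
  define \<psi> where "\<psi> = \<bar>Im (Ln v)\<bar> - pi / 2"
  have \<psi>: "\<epsilon> \<le> \<psi>" "\<psi> \<le> pi / 2"
    using big mpi_less_Im_Ln[OF v0] Im_Ln_le_pi[OF v0] by (auto simp: \<psi>_def)
  have c: "0 < cos \<epsilon>" using \<epsilon> by (intro cos_gt_zero) auto
  have cs: "cos (Im (Ln v)) = - sin \<psi>" "\<bar>sin (Im (Ln v))\<bar> = cos \<psi>"
  proof -
    have "cos (Im (Ln v)) = cos \<bar>Im (Ln v)\<bar>" by simp
    also have "\<dots> = cos (\<psi> + pi / 2)" by (simp add: \<psi>_def)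
    also have "\<dots> = - sin \<psi>" by (simp add: cos_add)
    finally show "cos (Im (Ln v)) = - sin \<psi>" .
    have "\<bar>sin (Im (Ln v))\<bar> = \<bar>sin \<bar>Im (Ln v)\<bar>\<bar>" by (simp add: abs_if)
    also have "\<dots> = \<bar>sin (\<psi> + pi / 2)\<bar>" by (simp add: \<psi>_def)
    also have "\<dots> = cos \<psi>" using \<psi> \<epsilon> cos_ge_zero[of \<psi>] by (simp add: sin_add)
    finally show "\<bar>sin (Im (Ln v))\<bar> = cos \<psi>" .
  qed
  have ve: "v = of_real (cmod v) * cis (Im (Ln v))"
    using exp_Ln[OF v0] exp_eq_polar[of "Ln v"] v0 by (simp add: norm_exp_eq_Re[symmetric] del: norm_exp_eq_Re)
  have "Re (v * cnj x) = cmod v * (cos (Im (Ln v)) * Re x + sin (Im (Ln v)) * Im x)"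
    by (subst ve) (simp add: algebra_simps)
  also have "\<dots> \<le> cmod v * (- sin \<psi> * Re x + cos \<psi> * (tan \<epsilon> * Re x))"
  proof (intro mult_left_mono add_mono)
    have "sin (Im (Ln v)) * Im x \<le> \<bar>sin (Im (Ln v))\<bar> * \<bar>Im x\<bar>" by (simp add: abs_mult[symmetric])
    also have "\<dots> \<le> cos \<psi> * (tan \<epsilon> * Re x)" unfolding cs using x(1) cs(2) by (intro mult_left_mono) auto
    finally show "sin (Im (Ln v)) * Im x \<le> cos \<psi> * (tan \<epsilon> * Re x)" .
  qed (auto simp: cs)
  also have "\<dots> = cmod v * Re x / cos \<epsilon> * sin (\<epsilon> - \<psi>)"
    using c by (simp add: tan_def sin_diff field_simps)
  also have "\<dots> \<le> 0"
  proof -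
    have "0 \<le> sin (\<psi> - \<epsilon>)" using \<psi> \<epsilon> by (intro sin_ge_zero) auto
    then have "sin (\<epsilon> - \<psi>) \<le> 0" using sin_minus[of "\<psi> - \<epsilon>"] by simp
    then show ?thesis using c rx by (intro mult_nonneg_nonpos) auto
  qed
  finally show False using x(2) by simp
qed

lemma mono_val_zero_outside:
  "mono_val J (\<lambda>j. if j \<in> J then x j else 0) \<nu> = mono_val J x \<nu>"
  by (rule mono_val_cong) auto

text \<open>On the curve \<open>v \<mapsto> (y\<^sub>j q(v) ^ w\<^sub>j)\<close> the layer of weighted degree \<open>n\<close> becomes the \<open>n\<close>th term of a
  Puiseux series in \<open>1/v\<close>, and the sum of \<open>b\<close> becomes a function with that series as its Gevrey
  asymptotic expansion.\<close>

lemma sum_along_curve: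
  fixes a :: "('i \<Rightarrow> nat) \<Rightarrow> 'e::complex_banach" and w :: "'i \<Rightarrow> nat" and k \<theta> \<delta> \<epsilon> \<rho> :: real
  assumes V: "finite V" "J \<subseteq> V" and J: "J \<noteq> {}" "\<forall>j\<in>J. 0 < \<gamma> j" and \<gamma>: "\<gamma> \<in> tuples J" and k: "0 < k" and R: "0 < R"
    and w: "\<forall>j\<in>V. 0 < w j"
    and b: "\<And>\<kappa>. \<kappa> \<in> tuples J \<Longrightarrow> b \<kappa> \<in> vecs (bdd_holomorphic (V - J) (polydisc (V - J) R) whole_space)"
    and t: "taylor_expansion V J R whole_space b a"
    and bnd: "\<forall>\<nu>\<in>tuples V. norm (a \<nu>) \<le> D * B ^ mdeg V \<nu> * fact (level J \<gamma> \<nu>) powr (1 / k)"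
    and D: "0 \<le> D" "0 \<le> B"
    and \<rho>: "0 < \<rho>" "\<rho> \<le> 1" "\<rho> < R" "\<rho> < \<rho>0" "B * \<rho> \<le> 1 / 2"
    and sum: "sum_data J (bdd_holomorphic (V - J) (polydisc (V - J) R) whole_space) \<gamma> k b (wdeg w J \<gamma> * \<theta>) \<delta> \<rho>0 C f g"
    and C: "1 \<le> C" and \<epsilon>: "0 < \<epsilon>" "\<epsilon> < pi / 2" "\<epsilon> \<le> k * \<delta>"
    and y: "\<forall>j\<in>V. cmod (y j) = \<rho>" "is_Arg (mono_val J y \<gamma>) 0"
    and \<Lambda>: "linear_contraction \<Lambda>"
  defines "K \<equiv> k * wdeg w J \<gamma>"
  shows "\<exists>h. h holomorphic_on wide_sector (tan \<epsilon>) \<and> (\<forall>M. \<forall>v\<in>wide_sector (tan \<epsilon>).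
     cmod (h v - (\<Sum>n<M * wdeg w J \<gamma>. \<Lambda> (layer w V a n y) * cis (n * \<theta>) * v powr - of_real (n / K)))
       \<le> (C + D * (\<Sum>\<^sub>\<infinity>\<nu>\<in>tuples V. (B * \<rho>) ^ mdeg V \<nu>)) * C ^ M * fact M powr (wdeg w J \<gamma> / K) * cmod v powr - (M * wdeg w J \<gamma> / K))"
proof -
  define L where "L = V - J"
  define Lw where "Lw = wdeg w J \<gamma>"
  define F where "F = (bdd_holomorphic L (polydisc L R) whole_space :: (('i \<Rightarrow> complex) \<Rightarrow> 'e) nspace)"
  define W where "W = wide_sector (tan \<epsilon>)"
  define T where "T = (\<Sum>\<^sub>\<infinity>\<nu>\<in>tuples V. (B * \<rho>) ^ mdeg V \<nu>)"
  have f: "finite J" "finite L" using V finite_subset by (auto simp: L_def)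
  have VJL: "J \<union> L = V" "J \<inter> L = {}" using V by (auto simp: L_def)
  have Lw: "0 < Lw"
  proof -
    obtain j where j: "j \<in> J" using J by blast
    have "0 < w j * \<gamma> j" using w J(2) j subsetD[OF V(2) j] by simp
    also have "\<dots> \<le> Lw" unfolding Lw_def wdeg_def using f j by (intro member_le_sum) auto
    finally show ?thesis .
  qed
  have K: "K = k * Lw" "0 < K" using k Lw by (auto simp: K_def Lw_def)
  have F: "seminormed F" unfolding F_def
    by (intro seminormed_bdd_holomorphic seminormed_whole_space f polydisc_nonempty R)
  note sd = sum[unfolded sum_data_def, folded L_def, folded F_def]
  let ?S = "sector J \<gamma> (wdeg w J \<gamma> * \<theta> - pi / (2 * k) - \<delta>) (wdeg w J \<gamma> * \<theta> + pi / (2 * k) + \<delta>) \<rho>0"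
  have tan: "0 < tan \<epsilon>" using \<epsilon> by (intro tan_gt_zero)
  have openW: "open W" unfolding W_def by (rule open_wide_sector)
  have nonpos: "v \<notin> \<real>\<^sub>\<le>\<^sub>0" "v \<noteq> 0" "1 < cmod v" if "v \<in> W" for v
    using wide_sector_nonpos[of v "tan \<epsilon>"] tan that by (auto simp: W_def wide_sector_def)
  define q where "q v = cis \<theta> * exp (- Ln v / K)" for v
  define \<xi> where "\<xi> v j = y j * q v ^ w j" for v j
  define zc where "zc v = (\<lambda>j. if j \<in> J then \<xi> v j else 0)" for v
  define xc where "xc v = (\<lambda>j. if j \<in> L then \<xi> v j else 0)" for v
  \<comment> \<open>A continuous argument of the monomial along the curve. Since Lw / K = 1 / k, the
    bound pi / 2 + \<epsilon> for |arg v| becomes pi / (2 k) + \<epsilon> / k here, and \<epsilon>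
    \<le> k \<delta> keeps the curve in the sector.\<close>
  define tc where "tc v = Lw * \<theta> - Lw * (Im (Ln v) / K)" for v
  have q_pow: "q v ^ n = cis (n * \<theta>) * v powr - of_real (n / K)" if "v \<in> W" for v n
    using nonpos[OF that] by (simp add: q_def power_mult_distrib Complex.DeMoivre powr_def exp_of_nat_mult[symmetric] mult_ac)
  have norm_q: "cmod (q v) = cmod v powr - (1 / K)" if "v \<in> W" for v
    using nonpos[OF that] by (simp add: q_def norm_mult powr_def)
  have q1: "cmod (q v) \<le> 1" "0 < cmod (q v)" if "v \<in> W" for v
  proof -
    have "1 \<le> cmod v powr (1 / K)" using nonpos[OF that] K(2) by (intro ge_one_powr_ge_zero) auto
    then show "cmod (q v) \<le> 1" "0 < cmod (q v)"
      using nonpos[OF that] by (simp_all add: norm_q[OF that] powr_minus inverse_le_1_iff)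
  qed
  have norm_\<xi>: "0 < cmod (\<xi> v j)" "cmod (\<xi> v j) \<le> \<rho>" if "v \<in> W" "j \<in> V" for v j
  proof -
    have "cmod (q v) ^ w j \<le> 1" using q1[OF that(1)] by (intro power_le_one) auto
    then show "cmod (\<xi> v j) \<le> \<rho>" using y that \<rho> by (simp add: \<xi>_def norm_mult norm_power mult_left_le)
    show "0 < cmod (\<xi> v j)" using y that \<rho> q1(2)[OF that(1)] by (simp add: \<xi>_def norm_mult norm_power)
  qed
  have mono_\<xi>: "mono_val V (\<xi> v) \<nu> = mono_val V y \<nu> * q v ^ wdeg w V \<nu>" for v V \<nu>
    unfolding \<xi>_def by (rule mono_val_quasihomogeneous)
  have holq: "q holomorphic_on W"
    unfolding q_def using nonpos K by (intro holomorphic_intros) auto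
  have hol: "(\<lambda>v. zc v j) holomorphic_on W" "(\<lambda>v. xc v j) holomorphic_on W" for j
    unfolding zc_def xc_def \<xi>_def using holq by (cases "j \<in> J"; cases "j \<in> L"; auto intro!: holomorphic_intros)+
  have tcont: "continuous_on W tc"
    unfolding tc_def using nonpos K(2) by (intro continuous_intros) auto
  have S: "(zc v, tc v) \<in> ?S" if v: "v \<in> W" for v
  proof -
    have "mono_val J (zc v) \<gamma> = mono_val J y \<gamma> * q v ^ Lw"
      unfolding zc_def mono_val_zero_outside mono_\<xi> Lw_def ..
    also have "q v = cmod (q v) * exp (\<i> * (\<theta> - Im (Ln v) / K))"
    proof -
      have e: "exp (- Ln v / K) = of_real (exp (- Re (Ln v) / K)) * cis (- Im (Ln v) / K)"
        using exp_eq_polar[of "- Ln v / K"] by simp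
      have "cmod (q v) = exp (- Re (Ln v) / K)" unfolding q_def e by (simp add: norm_mult)
      then have "q v = cmod (q v) * (cis \<theta> * cis (- Im (Ln v) / K))" unfolding q_def e by (simp add: mult_ac)
      then show ?thesis by (simp add: cis_conv_exp exp_add[symmetric] right_diff_distrib)
    qed
    also have "(cmod (q v) * exp (\<i> * (\<theta> - Im (Ln v) / K))) ^ Lw = cmod (q v) ^ Lw * exp (\<i> * tc v)"
      by (simp add: power_mult_distrib exp_of_nat_mult[symmetric] tc_def algebra_simps)
    finally have m: "mono_val J (zc v) \<gamma> = mono_val J y \<gamma> * (cmod (q v) ^ Lw * exp (\<i> * tc v))" .
    have "mono_val J y \<gamma> = cmod (mono_val J y \<gamma>)" using y(2) by (simp add: is_Arg_def)
    then have "is_Arg (mono_val J (zc v) \<gamma>) (tc v)"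
      unfolding is_Arg_def m by (simp add: norm_mult norm_power)
    moreover have "Lw * \<theta> - pi / (2 * k) - \<delta> < tc v" "tc v < Lw * \<theta> + pi / (2 * k) + \<delta>"
    proof -
      have "\<bar>Im (Ln v)\<bar> < pi / 2 + \<epsilon>" using wide_sector_Ln[OF \<epsilon>(1,2)] v by (simp add: W_def)
      then have "\<bar>Im (Ln v)\<bar> / k < (pi / 2 + \<epsilon>) / k" using k by (rule divide_strict_right_mono)
      moreover have "(pi / 2 + \<epsilon>) / k \<le> pi / (2 * k) + \<delta>" using k \<epsilon>(3) by (simp add: field_simps)
      moreover have "\<bar>Im (Ln v) / k\<bar> = \<bar>Im (Ln v)\<bar> / k" using k by simp
      moreover have "Lw * (Im (Ln v) / K) = Im (Ln v) / k" using K Lw by simp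
      ultimately show "Lw * \<theta> - pi / (2 * k) - \<delta> < tc v" "tc v < Lw * \<theta> + pi / (2 * k) + \<delta>"
        unfolding tc_def by linarith+
    qed
    moreover have "cmod (\<xi> v j) ^ \<gamma> j < \<rho>0" "0 < cmod (\<xi> v j) ^ \<gamma> j" if j: "j \<in> J" for j
    proof -
      have n: "0 < cmod (\<xi> v j)" "cmod (\<xi> v j) \<le> \<rho>" using norm_\<xi>[OF v, of j] j V by auto
      then have "cmod (\<xi> v j) ^ \<gamma> j \<le> cmod (\<xi> v j) ^ 1"
        using J(2) j \<rho> by (intro power_decreasing) (auto simp: Suc_leI)
      then show "cmod (\<xi> v j) ^ \<gamma> j < \<rho>0" "0 < cmod (\<xi> v j) ^ \<gamma> j" using n \<rho> by auto
    qed
    ultimately show ?thesis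
      unfolding sector_def Lw_def[symmetric] by (auto simp: zc_def tuples_def)
  qed
  have U: "xc v \<in> polydisc L R" if "v \<in> W" for v
    using norm_\<xi>(2)[OF that] \<rho> VJL by (force simp: polydisc_def xc_def tuples_def)
  define h where "h v = \<Lambda> (f (zc v, tc v) (xc v))" for v
  have hol_h: "h holomorphic_on W"
    unfolding h_def
    by (rule holomorphic_along_curves[OF f R conjunct1[OF sd, unfolded F_def] openW _ _ tcont _ _ \<Lambda>]) (use hol S U in auto)
  have sT: "(\<lambda>\<nu>. (B * \<rho>) ^ mdeg V \<nu>) summable_on tuples V" by (rule geometric_tuples[OF V(1) D(2)]) (use \<rho> in auto)
  have T0: "0 \<le> T" unfolding T_def using D \<rho> by (intro infsum_nonneg) auto
  have est: "cmod (h v - (\<Sum>n<M * Lw. \<Lambda> (layer w V a n y) * cis (n * \<theta>) * v powr - of_real (n / K)))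
       \<le> (C + D * T) * C ^ M * fact M powr (Lw / K) * cmod v powr - (M * Lw / K)" if v: "v \<in> W" for v M
  proof -
    \<comment> \<open>The first M components sum the terms over \<open>Y\<close>, with
      \<open>X\<close> its trace in the variables of J; the Puiseux sum runs over \<open>Z\<close>.
      The set \<open>Z\<close> is contained in \<open>Y\<close>, and what separates them has level
      below M but weighted degree at least M Lw.\<close>
    define X where "X = {\<kappa> \<in> tuples J. \<not> (\<forall>j\<in>J. M * \<gamma> j \<le> \<kappa> j)}"
    define Y where "Y = {\<nu> \<in> tuples V. level J \<gamma> \<nu> < M}"
    define Z where "Z = {\<nu> \<in> tuples V. wdeg w V \<nu> < M * Lw}"
    define G where "G = (\<Sum>l<M. mono_val J (zc v) (\<lambda>i. l * \<gamma> i) *\<^sub>C g l (zc v))"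
    define u where "u \<nu> = mono_val V (\<xi> v) \<nu> *\<^sub>C a \<nu>" for \<nu>
    have fM: "1 \<le> (fact M powr (1 / k) :: real)" by (rule fact_powr_ge_1) (use k in simp)
    have XL: "X = {\<kappa> \<in> tuples J. level J \<gamma> \<kappa> < M}"
      using le_level_iff[OF f(1) J, of M] by (auto simp: X_def not_le[symmetric])
    have zW: "zc v \<in> weighted_polydisc J \<gamma> \<rho>0" using S[OF v] by (auto simp: sector_def weighted_polydisc_def)
    have n: "nsum F (tuples J) (\<lambda>\<beta>. mono_val J (zc v) \<beta> *\<^sub>C mono_component J \<gamma> l b \<beta>) (g l (zc v))" for l
      using conjunct1[OF conjunct2[OF sd]] zW by blast
    have part: "((\<lambda>\<kappa>. mono_val J (zc v) \<kappa> *\<^sub>C b \<kappa> (xc v)) has_sum (\<Sum>l<M. mono_val J (zc v) (\<lambda>i. l * \<gamma> i) *\<^sub>C g l (zc v) (xc v))) X"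
      unfolding X_def
      by (rule has_sum_bdd_component[OF J(1) f(1) \<gamma> U[OF v] f(2)]) (use b n in \<open>auto simp: F_def L_def\<close>)
    \<comment> \<open>On \<open>Y\<close> the factorial of the level is bounded by that of M,
      uniformly in \<nu>.\<close>
    have le_u: "norm (u \<nu>) \<le> D * fact M powr (1 / k) * (cmod (q v) ^ wdeg w V \<nu> * (B * \<rho>) ^ mdeg V \<nu>)" if \<nu>: "\<nu> \<in> Y" for \<nu>
    proof -
      have "fact (level J \<gamma> \<nu>) powr (1 / k) \<le> (fact M powr (1 / k) :: real)"
        using \<nu> k by (intro powr_mono2 fact_mono) (auto simp: Y_def)
      then have "D * B ^ mdeg V \<nu> * fact (level J \<gamma> \<nu>) powr (1 / k) \<le> D * B ^ mdeg V \<nu> * fact M powr (1 / k)"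
        by (rule mult_left_mono) (use D in auto)
      moreover have "norm (a \<nu>) \<le> D * B ^ mdeg V \<nu> * fact (level J \<gamma> \<nu>) powr (1 / k)"
        using bnd \<nu> by (auto simp: Y_def)
      ultimately have 1: "norm (a \<nu>) \<le> D * B ^ mdeg V \<nu> * fact M powr (1 / k)" by linarith
      have "cmod (mono_val V (\<xi> v) \<nu>) = \<rho> ^ mdeg V \<nu> * cmod (q v) ^ wdeg w V \<nu>"
        using norm_mono_val_eq[of V y \<rho> \<nu>] y by (simp add: mono_\<xi> norm_mult norm_power)
      then have "norm (u \<nu>) \<le> \<rho> ^ mdeg V \<nu> * cmod (q v) ^ wdeg w V \<nu> * (D * B ^ mdeg V \<nu> * fact M powr (1 / k))"
        using 1 \<rho> unfolding u_def norm_scaleC by (simp add: mult_left_mono)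
      then show ?thesis by (simp add: power_mult_distrib mult_ac)
    qed
    have s1: "(\<lambda>\<nu>. D * fact M powr (1 / k) * c * (B * \<rho>) ^ mdeg V \<nu>) summable_on A" if "A \<subseteq> tuples V" for A c
      by (rule summable_on_subset_banach[OF summable_on_cmult_right[OF sT] that])
    have absu: "(\<lambda>\<nu>. norm (u \<nu>)) summable_on Y"
    proof (rule summable_on_comparison_test[OF s1[of Y 1]])
      show "norm (u \<nu>) \<le> D * fact M powr (1 / k) * 1 * (B * \<rho>) ^ mdeg V \<nu>" if "\<nu> \<in> Y" for \<nu>
      proof -
        have "cmod (q v) ^ wdeg w V \<nu> \<le> 1" using q1[OF v] by (intro power_le_one) auto
        then have "cmod (q v) ^ wdeg w V \<nu> * (B * \<rho>) ^ mdeg V \<nu> \<le> 1 * (B * \<rho>) ^ mdeg V \<nu>"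
          using D \<rho> by (intro mult_right_mono) auto
        then have "D * fact M powr (1 / k) * (cmod (q v) ^ wdeg w V \<nu> * (B * \<rho>) ^ mdeg V \<nu>) \<le> D * fact M powr (1 / k) * (1 * (B * \<rho>) ^ mdeg V \<nu>)"
          using D by (intro mult_left_mono) auto
        then show ?thesis using le_u[OF that] by simp
      qed
    qed (auto simp: Y_def)
    have su: "u summable_on Y" by (rule abs_summable_summable[OF absu])
    \<comment> \<open>Entries outside J do not affect the level, so \<open>Y\<close> is a
      product.\<close>
    have bij: "bij_betw (\<lambda>(\<kappa>, \<beta>) i. \<kappa> i + \<beta> i) (X \<times> tuples L) Y"
    proof (rule bij_betw_subset[OF tuples_split_bij[OF VJL]])
      have lev: "level J \<gamma> (\<lambda>i. \<kappa> i + \<beta> i) = level J \<gamma> \<kappa>" if "\<beta> \<in> tuples L" for \<kappa> \<beta>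
        by (rule level_cong) (use that in \<open>auto simp: tuples_def L_def\<close>)
      show "X \<times> tuples L \<subseteq> tuples J \<times> tuples L" by (auto simp: X_def)
      show "(\<lambda>(\<kappa>, \<beta>) i. \<kappa> i + \<beta> i) ` (X \<times> tuples L) = Y"
      proof (intro equalityI subsetI)
        fix \<nu> assume "\<nu> \<in> Y"
        then have "\<nu> \<in> (\<lambda>(\<kappa>, \<beta>) i. \<kappa> i + \<beta> i) ` (tuples J \<times> tuples L)" and l: "level J \<gamma> \<nu> < M"
          using tuples_split_bij[OF VJL] by (auto simp: bij_betw_def Y_def)
        then obtain \<kappa> \<beta> where \<kappa>: "\<kappa> \<in> tuples J" "\<beta> \<in> tuples L" "\<nu> = (\<lambda>i. \<kappa> i + \<beta> i)" by (elim imageE) auto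
        then have "(\<kappa>, \<beta>) \<in> X \<times> tuples L" using l lev by (simp add: XL)
        then show "\<nu> \<in> (\<lambda>(\<kappa>, \<beta>) i. \<kappa> i + \<beta> i) ` (X \<times> tuples L)" using \<kappa>(3) by (intro image_eqI[of _ _ "(\<kappa>, \<beta>)"]) auto
      next
        fix \<nu> assume "\<nu> \<in> (\<lambda>(\<kappa>, \<beta>) i. \<kappa> i + \<beta> i) ` (X \<times> tuples L)"
        then obtain \<kappa> \<beta> where \<kappa>: "\<kappa> \<in> X" "\<beta> \<in> tuples L" "\<nu> = (\<lambda>i. \<kappa> i + \<beta> i)" by (elim imageE) auto
        have "(\<lambda>(\<kappa>, \<beta>) i. \<kappa> i + \<beta> i :: nat) ` (tuples J \<times> tuples L) = tuples V"
          using tuples_split_bij[OF VJL] by (simp add: bij_betw_def)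
        then have "\<nu> \<in> tuples V" using \<kappa> by (auto simp: XL)
        then show "\<nu> \<in> Y" using \<kappa> lev by (simp add: Y_def XL)
      qed
    qed
    have hsY: "(u has_sum infsum u Y) Y" using su by (rule has_sum_infsum)
    then have hsS: "((\<lambda>p. u (\<lambda>i. fst p i + snd p i)) has_sum infsum u Y) (X \<times> tuples L)"
      using has_sum_reindex_bij_betw[OF bij, of u "infsum u Y"] by (simp add: case_prod_unfold)
    have inner: "((\<lambda>\<beta>. u (\<lambda>i. \<kappa> i + \<beta> i)) has_sum mono_val J (zc v) \<kappa> *\<^sub>C b \<kappa> (xc v)) (tuples L)" if \<kappa>: "\<kappa> \<in> X" for \<kappa>
    proof -
      have \<kappa>J: "\<kappa> \<in> tuples J" using \<kappa> by (simp add: X_def)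
      have "((\<lambda>\<beta>. mono_val L (xc v) \<beta> *\<^sub>C a (\<lambda>i. \<kappa> i + \<beta> i)) has_sum b \<kappa> (xc v)) (tuples L)"
        using t \<kappa>J U[OF v] by (simp add: taylor_expansion_def has_taylor_whole_space L_def)
      from has_sum_bounded_linear[OF bounded_linear_scaleC this, of "mono_val J (zc v) \<kappa>"]
      have "((\<lambda>\<beta>. mono_val J (zc v) \<kappa> *\<^sub>C mono_val L (xc v) \<beta> *\<^sub>C a (\<lambda>i. \<kappa> i + \<beta> i)) has_sum mono_val J (zc v) \<kappa> *\<^sub>C b \<kappa> (xc v)) (tuples L)" .
      moreover have "mono_val J (zc v) \<kappa> *\<^sub>C mono_val L (xc v) \<beta> *\<^sub>C a (\<lambda>i. \<kappa> i + \<beta> i) = u (\<lambda>i. \<kappa> i + \<beta> i)" if "\<beta> \<in> tuples L" for \<beta>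
        using mono_val_split[OF V(1) VJL \<kappa>J that, of "\<xi> v"]
        by (simp add: u_def zc_def xc_def mono_val_zero_outside scaleC_scaleC)
      ultimately show ?thesis by (simp cong: has_sum_cong)
    qed
    have "((\<lambda>\<kappa>. mono_val J (zc v) \<kappa> *\<^sub>C b \<kappa> (xc v)) has_sum infsum u Y) X"
      by (rule has_sum_SigmaD[OF hsS]) (use inner in auto)
    \<comment> \<open>The expansion of the coefficients in the remaining variables and the component
      sum in those of J together give the series over \<open>Y\<close>.\<close>
    then have GY: "G (xc v) = infsum u Y"
      using has_sum_unique[OF _ part] by (simp add: G_def sum_fun_apply scaleC_fun_def)
    have ZY: "Z \<subseteq> Y"
    proof
      fix \<nu> assume \<nu>: "\<nu> \<in> Z"
      then have "wdeg w V \<nu> < M * Lw" by (simp add: Z_def)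
      then have "level J \<gamma> \<nu> * Lw < M * Lw" using level_wdeg[OF V J, of \<nu> w, folded Lw_def] by linarith
      then show "\<nu> \<in> Y" using \<nu> by (auto simp: Y_def Z_def)
    qed
    have fZ: "finite Z" unfolding Z_def by (rule finite_wdeg_less[OF V(1) w])
    have sumZ: "sum u Z = (\<Sum>n<M * Lw. layer w V a n (\<xi> v))"
      unfolding sum_layers[OF V(1) w] u_def Z_def ..
    have \<Lambda>Z: "\<Lambda> (sum u Z) = (\<Sum>n<M * Lw. \<Lambda> (layer w V a n y) * cis (n * \<theta>) * v powr - of_real (n / K))"
      unfolding sumZ linear_contractionD(5)[OF \<Lambda>]
    proof (rule sum.cong[OF refl])
      fix n
      have "layer w V a n (\<xi> v) = q v ^ n *\<^sub>C layer w V a n y" unfolding \<xi>_def by (rule layer_quasihomogeneous)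
      then show "\<Lambda> (layer w V a n (\<xi> v)) = \<Lambda> (layer w V a n y) * cis (n * \<theta>) * v powr - of_real (n / K)"
        by (simp only: linear_contractionD(3)[OF \<Lambda>] q_pow[OF v]) (simp only: mult_ac)
    qed
    define P where "P = fact M powr (1 / k) * cmod (q v) ^ (M * Lw)"
    have P0: "0 \<le> P" by (simp add: P_def)
    \<comment> \<open>Each exponent of \<open>Y - Z\<close> contributes at least M Lw factors of q,
      and |q| \<le> 1.\<close>
    have rest: "norm (infsum u Y - sum u Z) \<le> D * T * P"
    proof -
      have d: "(u has_sum (infsum u Y - sum u Z)) (Y - Z)"
        by (rule has_sum_Diff[OF hsY has_sum_finite[OF fZ] ZY])
      have au: "(\<lambda>\<nu>. norm (u \<nu>)) summable_on Y - Z" by (rule summable_on_subset_banach[OF absu]) auto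
      have le: "norm (u \<nu>) \<le> D * fact M powr (1 / k) * cmod (q v) ^ (M * Lw) * (B * \<rho>) ^ mdeg V \<nu>" if \<nu>: "\<nu> \<in> Y - Z" for \<nu>
      proof -
        have "M * Lw \<le> wdeg w V \<nu>" using \<nu> by (auto simp: Y_def Z_def)
        then have "cmod (q v) ^ wdeg w V \<nu> \<le> cmod (q v) ^ (M * Lw)" using q1[OF v] by (intro power_decreasing) auto
        then have "cmod (q v) ^ wdeg w V \<nu> * (B * \<rho>) ^ mdeg V \<nu> \<le> cmod (q v) ^ (M * Lw) * (B * \<rho>) ^ mdeg V \<nu>"
          using D \<rho> by (intro mult_right_mono) auto
        then have "D * fact M powr (1 / k) * (cmod (q v) ^ wdeg w V \<nu> * (B * \<rho>) ^ mdeg V \<nu>) \<le> D * fact M powr (1 / k) * (cmod (q v) ^ (M * Lw) * (B * \<rho>) ^ mdeg V \<nu>)"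
          using D by (intro mult_left_mono) auto
        then show ?thesis using le_u[of \<nu>] \<nu> by (simp add: mult.assoc)
      qed
      have "norm (infsum u Y - sum u Z) = norm (infsum u (Y - Z))" using infsumI[OF d] by simp
      also have "\<dots> \<le> (\<Sum>\<^sub>\<infinity>\<nu>\<in>Y - Z. norm (u \<nu>))" by (rule norm_infsum_bound[OF au])
      also have "\<dots> \<le> (\<Sum>\<^sub>\<infinity>\<nu>\<in>Y - Z. D * fact M powr (1 / k) * cmod (q v) ^ (M * Lw) * (B * \<rho>) ^ mdeg V \<nu>)"
        by (rule infsum_mono[OF au s1 le]) (auto simp: Y_def)
      also have "\<dots> \<le> (\<Sum>\<^sub>\<infinity>\<nu>\<in>tuples V. D * fact M powr (1 / k) * cmod (q v) ^ (M * Lw) * (B * \<rho>) ^ mdeg V \<nu>)"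
        using D \<rho> by (intro infsum_mono2[OF s1 s1]) (auto simp: Y_def)
      also have "\<dots> = D * fact M powr (1 / k) * cmod (q v) ^ (M * Lw) * T" unfolding T_def by (rule infsum_cmult_right')
      finally show ?thesis by (simp add: P_def mult_ac)
    qed
    \<comment> \<open>The Gevrey estimate of the given sum, in which the monomial with exponent M
      \<gamma> has modulus at most |q| ^ (M Lw).\<close>
    have main: "norm (f (zc v, tc v) (xc v) - G (xc v)) \<le> C ^ Suc M * P"
    proof -
      have gF: "g l (zc v) \<in> vecs F" for l using n by (simp add: nsum_def)
      have fF: "f (zc v, tc v) \<in> vecs F" using conjunct1[OF sd] S[OF v] by (auto simp: holomorphic_map_def)
      have AF: "f (zc v, tc v) - G \<in> vecs F"
        unfolding G_def by (intro seminormed_diff(1)[OF F] fF conjunct1[OF seminormed_sum[OF F]] seminormed_scaleC[OF F] gF)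
      have "nrm F (f (zc v, tc v) - G) \<le> C ^ Suc M * fact M powr (1 / k) * cmod (mono_val J (zc v) (\<lambda>i. M * \<gamma> i))"
        using conjunct2[OF conjunct2[OF sd], rule_format, OF S[OF v], of M] by (simp add: G_def)
      moreover have "norm ((f (zc v, tc v) - G) (xc v)) \<le> nrm F (f (zc v, tc v) - G)"
        using bdd_holomorphic_le_nrm[OF AF[unfolded F_def] U[OF v]] by (simp add: F_def)
      moreover have "cmod (mono_val J (zc v) (\<lambda>i. M * \<gamma> i)) \<le> cmod (q v) ^ (M * Lw)"
      proof -
        have "cmod (mono_val J y \<gamma>) \<le> 1"
          using norm_mono_val_le[of J y \<rho> \<gamma>] y V \<rho> power_le_one[of \<rho> "mdeg J \<gamma>"] by force
        then have "cmod (mono_val J y \<gamma>) ^ M * cmod (q v) ^ (Lw * M) \<le> 1 * cmod (q v) ^ (Lw * M)"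
          by (intro mult_right_mono power_le_one) auto
        then show ?thesis
          by (simp add: mono_val_mult zc_def mono_val_zero_outside mono_\<xi> Lw_def norm_mult norm_power power_mult_distrib power_mult[symmetric] mult.commute)
      qed
      then have "C ^ Suc M * fact M powr (1 / k) * cmod (mono_val J (zc v) (\<lambda>i. M * \<gamma> i)) \<le> C ^ Suc M * fact M powr (1 / k) * cmod (q v) ^ (M * Lw)"
        by (rule mult_left_mono) (use C in auto)
      ultimately show ?thesis by (simp add: P_def mult.assoc)
    qed
    have "h v - \<Lambda> (sum u Z) = \<Lambda> ((f (zc v, tc v) (xc v) - G (xc v)) + (infsum u Y - sum u Z))"
      unfolding GY by (simp add: h_def linear_contractionD[OF \<Lambda>])
    then have "cmod (h v - \<Lambda> (sum u Z)) \<le> norm ((f (zc v, tc v) (xc v) - G (xc v)) + (infsum u Y - sum u Z))"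
      using linear_contractionD(4)[OF \<Lambda>] by simp
    also have "\<dots> \<le> C ^ Suc M * P + D * T * P" by (rule order_trans[OF norm_triangle_ineq add_mono[OF main rest]])
    \<comment> \<open>As C \<ge> 1, both errors acquire the common factor C ^ M.\<close>
    also have "\<dots> \<le> C ^ Suc M * P + D * T * (C ^ M * P)"
    proof -
      have "1 * P \<le> C ^ M * P" using C P0 by (intro mult_right_mono one_le_power) auto
      then show ?thesis using D T0 by (intro add_left_mono mult_left_mono) auto
    qed
    also have "\<dots> = (C + D * T) * C ^ M * P" by (simp add: algebra_simps)
    also have "P = fact M powr (Lw / K) * cmod v powr - (M * Lw / K)"
    proof -
      have "cmod (q v) ^ (M * Lw) = cmod v powr - (M * Lw / K)"
        using nonpos(2)[OF v] norm_q[OF v] by (simp add: powr_powr flip: powr_realpow)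
      moreover have "1 / k = Lw / K" using K Lw by simp
      ultimately show ?thesis by (simp only: P_def)
    qed
    finally show ?thesis unfolding \<Lambda>Z by (simp only: mult.assoc)
  qed
  show ?thesis
    using hol_h est unfolding W_def Lw_def T_def by blast
qed

section \<open>Series that belong to two spaces\<close>

lemma mono_summable_vecs:
  assumes "b \<in> mono_summable J F \<gamma> k" "J \<noteq> {}" "\<kappa> \<in> tuples J"
  shows "b \<kappa> \<in> vecs F"
  using assms by (auto simp: mono_summable_def Ohat_def one_var_series_def formal_series_def)

lemma wdeg_pos:
  assumes "finite J" "J \<noteq> {}" "\<forall>j\<in>J. 0 < w j" "\<forall>j\<in>J. 0 < \<gamma> j"
  shows "0 < wdeg w J \<gamma>"
  unfolding wdeg_def using assms by (intro sum_pos) auto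

lemma wdeg_le_mdeg:
  assumes "finite V"
  shows "wdeg w V \<nu> \<le> sum w V * mdeg V \<nu>"
  unfolding wdeg_def mdeg_def sum_distrib_left
  by (intro sum_mono mult_le_mono1 member_le_sum) (use assms in auto)

lemma geometric_bound_convergent_series:
  fixes a :: "('i \<Rightarrow> nat) \<Rightarrow> 'e::complex_banach"
  assumes V: "finite V" and a: "a \<in> formal_series V whole_space" and Q: "0 < Q"
    and bnd: "\<And>\<nu>. \<nu> \<in> tuples V \<Longrightarrow> norm (a \<nu>) \<le> C * Q ^ mdeg V \<nu>"
  shows "a \<in> convergent_series V"
proof -
  have "(\<lambda>\<nu>. mono_val V z \<nu> *\<^sub>C a \<nu>) summable_on tuples V" if z: "z \<in> polydisc V (1 / (2 * Q))" for z
  proof (rule abs_summable_summable, rule summable_on_comparison_test)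
    show "(\<lambda>\<nu>. C * (1 / 2) ^ mdeg V \<nu>) summable_on tuples V"
      by (intro summable_on_cmult_right summable_on_geometric_tuples[OF V]) auto
    fix \<nu> :: "'i \<Rightarrow> nat" assume \<nu>: "\<nu> \<in> tuples V"
    have "cmod (mono_val V z \<nu>) \<le> (1 / (2 * Q)) ^ mdeg V \<nu>"
      by (rule norm_mono_val_le) (use z in \<open>auto simp: polydisc_def intro: less_imp_le\<close>)
    then have "norm (mono_val V z \<nu> *\<^sub>C a \<nu>) \<le> (1 / (2 * Q)) ^ mdeg V \<nu> * (C * Q ^ mdeg V \<nu>)"
      unfolding norm_scaleC by (rule mult_mono[OF _ bnd[OF \<nu>]]) (use Q in auto)
    also have "\<dots> = C * (1 / 2) ^ mdeg V \<nu>" using Q by (simp add: power_divide power_mult_distrib)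
    finally show "norm (mono_val V z \<nu> *\<^sub>C a \<nu>) \<le> C * (1 / 2) ^ mdeg V \<nu>" .
  qed auto
  moreover have "0 < 1 / (2 * Q)" using Q by simp
  ultimately show ?thesis using a unfolding convergent_series_def by blast
qed

text \<open>The space with the smaller product supplies the sums, the other one the growth of the
  layers. All constants come from finitely many directions and two coefficient bounds, hence they
  hold for every point of the torus and every functional.\<close>

lemma partial_mono_summable_inter_weighted:
  fixes a :: "('i \<Rightarrow> nat) \<Rightarrow> 'e::complex_banach" and k k' :: real and w :: "'i \<Rightarrow> nat"
  assumes V: "finite V" and J: "J \<subseteq> V" "J \<noteq> {}" and \<gamma>: "\<gamma> \<in> tuples J" "\<forall>j\<in>J. 0 < \<gamma> j" and k: "0 < k"
    and I: "I \<subseteq> V" "I \<noteq> {}" and \<gamma>': "\<gamma>' \<in> tuples I" "\<forall>i\<in>I. 0 < \<gamma>' i" and k': "0 < k'"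
    and R: "0 < R" "0 < R'" and w: "\<forall>j\<in>V. 0 < w j"
    and a: "a \<in> partial_mono_summable V J R \<gamma> k" "a \<in> partial_mono_summable V I R' \<gamma>' k'"
    and lt: "k * wdeg w J \<gamma> < k' * wdeg w I \<gamma>'"
  shows "a \<in> convergent_series V"
proof -
  define F where "F = (bdd_holomorphic (V - J) (polydisc (V - J) R) whole_space :: (('i \<Rightarrow> complex) \<Rightarrow> 'e) nspace)"
  have af: "a \<in> formal_series V whole_space" using a(1) by (simp add: partial_mono_summable_def)
  obtain b where b: "b \<in> mono_summable J F \<gamma> k" and tb: "taylor_expansion V J R whole_space b a"
    using a(1) unfolding partial_mono_summable_def F_def by blast
  obtain b' where b': "b' \<in> mono_summable I (bdd_holomorphic (V - I) (polydisc (V - I) R') whole_space) \<gamma>' k'"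
    and tb': "taylor_expansion V I R' whole_space b' a"
    using a(2) unfolding partial_mono_summable_def by blast
  have bv: "\<And>\<kappa>. \<kappa> \<in> tuples J \<Longrightarrow> b \<kappa> \<in> vecs F" by (rule mono_summable_vecs[OF b J(2)])
  have b'v: "\<And>\<kappa>. \<kappa> \<in> tuples I \<Longrightarrow> b' \<kappa> \<in> vecs (bdd_holomorphic (V - I) (polydisc (V - I) R') whole_space)"
    by (rule mono_summable_vecs[OF b' I(2)])
  obtain D B where D: "1 \<le> D" "1 \<le> B" and bnd: "\<forall>\<nu>\<in>tuples V. norm (a \<nu>) \<le> D * B ^ mdeg V \<nu> * fact (level J \<gamma> \<nu>) powr (1 / k)"
  proof -
    have "\<exists>D\<ge>1. \<exists>B\<ge>1. \<forall>\<nu>\<in>tuples V. norm (a \<nu>) \<le> D * B ^ mdeg V \<nu> * fact (level J \<gamma> \<nu>) powr (1 / k)"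
      by (rule partial_mono_summable_gevrey_bound[OF V J \<gamma>(2,1) k R(1) b[unfolded F_def] _ tb]) (rule bv[unfolded F_def])
    then show thesis using that by (elim exE conjE)
  qed
  obtain D' B' where D': "1 \<le> D'" "1 \<le> B'" and bnd': "\<forall>\<nu>\<in>tuples V. norm (a \<nu>) \<le> D' * B' ^ mdeg V \<nu> * fact (level I \<gamma>' \<nu>) powr (1 / k')"
  proof -
    have "\<exists>D\<ge>1. \<exists>B\<ge>1. \<forall>\<nu>\<in>tuples V. norm (a \<nu>) \<le> D * B ^ mdeg V \<nu> * fact (level I \<gamma>' \<nu>) powr (1 / k')"
      by (rule partial_mono_summable_gevrey_bound[OF V I \<gamma>'(2,1) k' R(2) b' _ tb']) (rule b'v)
    then show thesis using that by (elim exE conjE)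
  qed
  define Lw where "Lw = wdeg w J \<gamma>"
  define K where "K = k * Lw"
  define K2 where "K2 = k' * wdeg w I \<gamma>'"
  have fJ: "finite J" "finite I" using V J I finite_subset by blast+
  have Lw: "0 < Lw" unfolding Lw_def by (rule wdeg_pos[OF fJ(1) J(2) _ \<gamma>(2)]) (use w J in blast)
  have Lw': "0 < wdeg w I \<gamma>'" by (rule wdeg_pos[OF fJ(2) I(2) _ \<gamma>'(2)]) (use w I in blast)
  have K: "0 < K" "K < K2" using k Lw lt by (auto simp: K_def K2_def Lw_def)
  \<comment> \<open>Half of the critical angle pi (1 / K - 1 / K2).\<close>
  define \<eta> where "\<eta> = pi * (1 / K - 1 / K2) / 2"
  have dK: "0 < 1 / K - 1 / K2" using K by (simp add: field_simps)
  have \<eta>: "0 < \<eta>" "\<eta> / (1 / K - 1 / K2) < pi"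
    unfolding \<eta>_def using dK pi_gt_zero by (simp_all add: pos_divide_less_eq)
  define m where "m = nat \<lceil>2 * pi / \<eta>\<rceil>"
  have m: "2 * pi \<le> m * \<eta>"
  proof -
    have "2 * pi / \<eta> \<le> real m" unfolding m_def by linarith
    then show ?thesis using \<eta> by (simp add: field_simps)
  qed
  have fin: "finite (cis ` {\<theta>. \<not> mono_summable_in_dir J F \<gamma> k b \<theta>})"
    using b unfolding mono_summable_def by blast
  have Lw0: "0 < real Lw" using Lw by simp
  from exists_good_directions[OF fin Lw0, of m \<eta>] obtain \<theta>0 where
    \<theta>0: "\<forall>i\<le>m. mono_summable_in_dir J F \<gamma> k b (Lw * (\<theta>0 + real i * \<eta>))" by (elim exE)
  from sum_data_uniform[OF k, of "(\<lambda>i. Lw * (\<theta>0 + real i * \<eta>)) ` {..m}" J F \<gamma> b] \<theta>0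
  obtain \<delta> \<rho>0 C where \<delta>: "0 < \<delta>" and \<rho>0: "0 < \<rho>0" and C: "1 \<le> C"
    and data: "\<forall>i\<le>m. \<exists>f g. sum_data J F \<gamma> k b (Lw * (\<theta>0 + real i * \<eta>)) \<delta> \<rho>0 C f g" by auto
  \<comment> \<open>The half-opening beyond pi / 2 that is available in the variable v, kept below
    pi / 2 by the cap.\<close>
  define \<epsilon> where "\<epsilon> = min (k * \<delta>) (pi / 4)"
  have \<epsilon>: "0 < \<epsilon>" "\<epsilon> < pi / 2" "\<epsilon> \<le> k * \<delta>"
    using mult_pos_pos[OF k \<delta>] pi_gt_zero unfolding \<epsilon>_def by linarith+
  \<comment> \<open>Small against the radii \<open>R\<close> and \<open>\<rho>0\<close>, so that the
    curves stay in the domains, and against both geometric constants, so that the layers are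
    controlled.\<close>
  define \<rho> where "\<rho> = Min {1, R / 2, \<rho>0 / 2, 1 / (2 * B), 1 / (2 * B')}"
  have "\<rho> \<in> {1, R / 2, \<rho>0 / 2, 1 / (2 * B), 1 / (2 * B')}" unfolding \<rho>_def by (rule Min_in) auto
  then have \<rho>: "0 < \<rho>" using R \<rho>0 D D' by auto
  have le: "\<rho> \<le> 1" "\<rho> \<le> R / 2" "\<rho> \<le> \<rho>0 / 2" "\<rho> \<le> 1 / (2 * B)" "\<rho> \<le> 1 / (2 * B')"
    unfolding \<rho>_def by (rule Min_le; simp)+
  have \<rho>2: "\<rho> < R" "\<rho> < \<rho>0" "B * \<rho> \<le> 1 / 2" "B' * \<rho> \<le> 1 / 2"
    using le R \<rho>0 D D' by (auto simp: field_simps)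
  define T where "T = (\<Sum>\<^sub>\<infinity>\<nu>\<in>tuples V. (B * \<rho>) ^ mdeg V \<nu>)"
  define T' where "T' = (\<Sum>\<^sub>\<infinity>\<nu>\<in>tuples V. (B' * \<rho>) ^ mdeg V \<nu>)"
  have T: "0 \<le> T" "0 \<le> T'" unfolding T_def T'_def using D D' \<rho> by (auto intro!: infsum_nonneg)
  define M where "M = max (D' * T') (C + D * T)"
  have M: "0 < M" "D' * T' \<le> M" "C + D * T \<le> M"
  proof -
    have "0 \<le> D * T" using D T by simp
    then show "0 < M" using C by (auto simp: M_def less_max_iff_disj)
  qed (auto simp: M_def)
  have C0: "0 < C" using C by simp
  have tan: "0 < tan \<epsilon>" using \<epsilon> by (intro tan_gt_zero)
  have "\<exists>C'>0. \<exists>A'>0. \<forall>p. (\<forall>n. cmod (p n) \<le> M * C ^ n * fact n powr (1 / K2)) \<longrightarrow>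
     (\<forall>i\<le>m. \<exists>h. h holomorphic_on wide_sector (tan \<epsilon>) \<and> (\<forall>N. \<forall>v\<in>wide_sector (tan \<epsilon>).
        cmod (h v - (\<Sum>n<N * Lw. p n * cis (n * (\<theta>0 + i * \<eta>)) * v powr - of_real (n / K))) \<le> M * C ^ N * fact N powr (Lw / K) * cmod v powr - (N * Lw / K))) \<longrightarrow>
     (\<forall>n. cmod (p n) \<le> C' * A' ^ n)"
    by (rule scalar_tauberian[OF K Lw tan M(1) C0 \<eta> m])
  then obtain C' A' where C': "0 < C'" "0 < A'" and taub: "\<forall>p. (\<forall>n. cmod (p n) \<le> M * C ^ n * fact n powr (1 / K2)) \<longrightarrow>
     (\<forall>i\<le>m. \<exists>h. h holomorphic_on wide_sector (tan \<epsilon>) \<and> (\<forall>N. \<forall>v\<in>wide_sector (tan \<epsilon>).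
        cmod (h v - (\<Sum>n<N * Lw. p n * cis (n * (\<theta>0 + i * \<eta>)) * v powr - of_real (n / K))) \<le> M * C ^ N * fact N powr (Lw / K) * cmod v powr - (N * Lw / K))) \<longrightarrow>
     (\<forall>n. cmod (p n) \<le> C' * A' ^ n)" by (elim exE conjE)
  \<comment> \<open>Points of the torus at which the monomial is positive: the argument along the
    curve then depends on v alone, and one set of directions serves all these points.\<close>
  have normalised: "norm (layer w V a n y) \<le> C' * A' ^ n"
    if y: "\<forall>j\<in>V. cmod (y j) = \<rho>" "is_Arg (mono_val J y \<gamma>) 0" for y n
  proof -
    \<comment> \<open>This functional varies with y and n; the Tauberian constants do not.\<close>
    obtain \<Lambda> where \<Lambda>: "linear_contraction \<Lambda>" "\<Lambda> (layer w V a n y) = of_real (norm (layer w V a n y))"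
      by (rule norming_functional)
    have "\<forall>n. cmod (\<Lambda> (layer w V a n y)) \<le> M * C ^ n * fact n powr (1 / K2)"
    proof
      fix n
      have "cmod (\<Lambda> (layer w V a n y)) \<le> norm (layer w V a n y)" by (rule linear_contractionD(4)[OF \<Lambda>(1)])
      also have "\<dots> \<le> D' * T' * fact n powr (1 / K2)" unfolding T'_def K2_def
        by (rule layer_bound[OF V I \<gamma>'(2) k' w bnd' _ _ _ \<rho>2(4) y(1) Lw']) (use D' \<rho> in auto)
      also have "\<dots> \<le> M * C ^ n * fact n powr (1 / K2)"
      proof (rule mult_right_mono)
        have "D' * T' * 1 \<le> M * C ^ n" using M C by (intro mult_mono) auto
        then show "D' * T' \<le> M * C ^ n" by simp
      qed simp
      finally show "cmod (\<Lambda> (layer w V a n y)) \<le> M * C ^ n * fact n powr (1 / K2)" .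
    qed
    moreover have "\<forall>i\<le>m. \<exists>h. h holomorphic_on wide_sector (tan \<epsilon>) \<and> (\<forall>N. \<forall>v\<in>wide_sector (tan \<epsilon>).
        cmod (h v - (\<Sum>n<N * Lw. \<Lambda> (layer w V a n y) * cis (n * (\<theta>0 + i * \<eta>)) * v powr - of_real (n / K))) \<le> M * C ^ N * fact N powr (Lw / K) * cmod v powr - (N * Lw / K))"
    proof (intro allI impI)
      fix i assume "i \<le> m"
      then obtain f g where sd: "sum_data J F \<gamma> k b (Lw * (\<theta>0 + real i * \<eta>)) \<delta> \<rho>0 C f g" using data by blast
      have "\<exists>h. h holomorphic_on wide_sector (tan \<epsilon>) \<and> (\<forall>N. \<forall>v\<in>wide_sector (tan \<epsilon>).
         cmod (h v - (\<Sum>n<N * wdeg w J \<gamma>. \<Lambda> (layer w V a n y) * cis (n * (\<theta>0 + real i * \<eta>)) * v powr - of_real (n / (k * wdeg w J \<gamma>))))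
         \<le> (C + D * (\<Sum>\<^sub>\<infinity>\<nu>\<in>tuples V. (B * \<rho>) ^ mdeg V \<nu>)) * C ^ N * fact N powr (wdeg w J \<gamma> / (k * wdeg w J \<gamma>)) * cmod v powr - (N * wdeg w J \<gamma> / (k * wdeg w J \<gamma>)))"
        by (rule sum_along_curve[OF V J \<gamma>(2,1) k R(1) w bv[unfolded F_def] tb bnd _ _ \<rho> le(1) \<rho>2(1-3) sd[unfolded F_def Lw_def] C \<epsilon> y \<Lambda>(1)])
          (use D in auto)
      then obtain h where h: "h holomorphic_on wide_sector (tan \<epsilon>)" and hb: "\<forall>N. \<forall>v\<in>wide_sector (tan \<epsilon>).
        cmod (h v - (\<Sum>n<N * Lw. \<Lambda> (layer w V a n y) * cis (n * (\<theta>0 + i * \<eta>)) * v powr - of_real (n / K))) \<le> (C + D * T) * C ^ N * fact N powr (Lw / K) * cmod v powr - (N * Lw / K)"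
        unfolding Lw_def[symmetric] K_def[symmetric] T_def[symmetric] by (elim exE conjE)
      have "\<forall>N. \<forall>v\<in>wide_sector (tan \<epsilon>).
        cmod (h v - (\<Sum>n<N * Lw. \<Lambda> (layer w V a n y) * cis (n * (\<theta>0 + i * \<eta>)) * v powr - of_real (n / K))) \<le> M * C ^ N * fact N powr (Lw / K) * cmod v powr - (N * Lw / K)"
      proof (intro allI ballI, rule order_trans, rule hb[rule_format], assumption)
        show "(C + D * T) * C ^ N * fact N powr (Lw / K) * cmod v powr - (N * Lw / K) \<le> M * C ^ N * fact N powr (Lw / K) * cmod v powr - (N * Lw / K)" for N v
          using C by (intro mult_right_mono M(3)) auto
      qed
      then show "\<exists>h. h holomorphic_on wide_sector (tan \<epsilon>) \<and> (\<forall>N. \<forall>v\<in>wide_sector (tan \<epsilon>).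
        cmod (h v - (\<Sum>n<N * Lw. \<Lambda> (layer w V a n y) * cis (n * (\<theta>0 + i * \<eta>)) * v powr - of_real (n / K))) \<le> M * C ^ N * fact N powr (Lw / K) * cmod v powr - (N * Lw / K))"
        using h by blast
    qed
    ultimately have "\<forall>n. cmod (\<Lambda> (layer w V a n y)) \<le> C' * A' ^ n"
      by (rule mp[OF mp[OF spec[OF taub, of "\<lambda>n. \<Lambda> (layer w V a n y)"]]])
    then have "cmod (\<Lambda> (layer w V a n y)) \<le> C' * A' ^ n" by blast
    then show ?thesis by (simp add: \<Lambda>(2))
  qed
  have torus: "norm (layer w V a n y) \<le> C' * A' ^ n" if y: "\<forall>j\<in>V. cmod (y j) = \<rho>" for y n
  proof -
    \<comment> \<open>A quasihomogeneous rotation makes the monomial positive and multiplies each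
      layer by a number of modulus 1.\<close>
    define q where "q = cis (- Arg (mono_val J y \<gamma>) / Lw)"
    have "q ^ Lw = cis (- Arg (mono_val J y \<gamma>))" using Lw by (simp add: q_def Complex.DeMoivre)
    moreover have "mono_val J y \<gamma> = cmod (mono_val J y \<gamma>) * cis (Arg (mono_val J y \<gamma>))"
      using rcis_cmod_Arg[of "mono_val J y \<gamma>"] by (simp add: rcis_def)
    ultimately have "mono_val J y \<gamma> * q ^ Lw = cmod (mono_val J y \<gamma>)"
      by (metis cis_mult cis_zero add.right_inverse mult.assoc mult.right_neutral)
    then have "mono_val J (\<lambda>j. y j * q ^ w j) \<gamma> = cmod (mono_val J y \<gamma>)"
      by (simp add: mono_val_quasihomogeneous Lw_def)
    then have "is_Arg (mono_val J (\<lambda>j. y j * q ^ w j) \<gamma>) 0" by (simp add: is_Arg_def)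
    moreover have "\<forall>j\<in>V. cmod (y j * q ^ w j) = \<rho>" using y by (simp add: norm_mult norm_power q_def)
    ultimately have "norm (layer w V a n (\<lambda>j. y j * q ^ w j)) \<le> C' * A' ^ n" by (intro normalised)
    then show ?thesis by (simp add: layer_quasihomogeneous norm_scaleC norm_power q_def)
  qed
  \<comment> \<open>At least 1, so that the weighted degree may be replaced by the larger number
    \<open>sum w V\<close> times the degree.\<close>
  define A where "A = max 1 A'"
  have A: "1 \<le> A" "A' \<le> A" by (auto simp: A_def)
  show ?thesis
  proof (rule geometric_bound_convergent_series[OF V af])
    show "0 < A ^ sum w V / \<rho>" using A \<rho> by auto
    fix \<nu> :: "'i \<Rightarrow> nat" assume \<nu>: "\<nu> \<in> tuples V"
    let ?n = "wdeg w V \<nu>"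
    \<comment> \<open>A layer is a polynomial, so its values on the torus bound each of its
      coefficients.\<close>
    have "norm (a \<nu>) * \<rho> ^ mdeg V \<nu> \<le> C' * A' ^ ?n"
    proof (rule polynomial_coefficient_bound[OF V finite_wdeg_eq[OF V w, of ?n]])
      show "norm (\<Sum>\<beta> | \<beta> \<in> tuples V \<and> wdeg w V \<beta> = ?n. mono_val V z \<beta> *\<^sub>C a \<beta>) \<le> C' * A' ^ ?n"
        if "\<And>j. j \<in> V \<Longrightarrow> cmod (z j) = \<rho>" for z
        using torus[of z ?n] that unfolding layer_def by blast
    qed (use \<nu> \<rho> in auto)
    also have "\<dots> \<le> C' * A ^ (sum w V * mdeg V \<nu>)"
    proof (rule mult_left_mono)
      have "A' ^ ?n \<le> A ^ ?n" using A C' by (intro power_mono) auto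
      also have "\<dots> \<le> A ^ (sum w V * mdeg V \<nu>)" using A wdeg_le_mdeg[OF V] by (intro power_increasing) auto
      finally show "A' ^ ?n \<le> A ^ (sum w V * mdeg V \<nu>)" .
    qed (use C' in auto)
    finally show "norm (a \<nu>) \<le> C' * (A ^ sum w V / \<rho>) ^ mdeg V \<nu>"
      using \<rho> by (simp add: power_divide power_mult field_simps)
  qed
qed

text \<open>If equal weights give 0, doubling the weight of j changes the sum by u j.\<close>

lemma exists_separating_weight:
  fixes u :: "'i \<Rightarrow> real"
  assumes V: "finite V" "j \<in> V" "u j \<noteq> 0"
  shows "\<exists>w :: 'i \<Rightarrow> nat. (\<forall>i. (0::nat) < w i) \<and> (\<Sum>i\<in>V. w i * u i) \<noteq> 0"
proof (cases "(\<Sum>i\<in>V. u i) = 0")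
  case True
  have "(\<Sum>i\<in>V. real (if i = j then 2 else 1) * u i) = (\<Sum>i\<in>V. u i + (if i = j then u i else 0))"
    by (intro sum.cong) auto
  also have "\<dots> = u j" using V True by (simp add: sum.distrib)
  finally show ?thesis using V(3) by (intro exI[of _ "\<lambda>i. if i = j then 2 else 1"]) auto
next
  case False
  then show ?thesis by (intro exI[of _ "\<lambda>i. 1"]) auto
qed

text \<open>The exponents are 0 outside their index sets and positive on them. Equality of k
  \<gamma> and k' \<gamma>' on all of \<open>V\<close> would therefore force J = I as well.\<close>

theorem partial_mono_summable_inter:
  fixes a :: "('i \<Rightarrow> nat) \<Rightarrow> 'e::complex_banach" and k k' :: real
  assumes V: "finite V" and J: "J \<subseteq> V" "J \<noteq> {}" and \<gamma>: "\<gamma> \<in> tuples J" "\<forall>j\<in>J. 0 < \<gamma> j" and k: "0 < k"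
    and I: "I \<subseteq> V" "I \<noteq> {}" and \<gamma>': "\<gamma>' \<in> tuples I" "\<forall>i\<in>I. 0 < \<gamma>' i" and k': "0 < k'"
    and R: "0 < R" "0 < R'"
    and a: "a \<in> partial_mono_summable V J R \<gamma> k" "a \<in> partial_mono_summable V I R' \<gamma>' k'"
    and ne: "\<not> (J = I \<and> (\<forall>j\<in>J. k * \<gamma> j = k' * \<gamma>' j))"
  shows "a \<in> convergent_series V"
proof -
  have "\<exists>j\<in>V. k * \<gamma> j - k' * \<gamma>' j \<noteq> 0"
  proof (rule ccontr)
    assume "\<not> ?thesis"
    then have e: "k * \<gamma> j = k' * \<gamma>' j" if "j \<in> V" for j using that by auto
    have "j \<in> J \<longleftrightarrow> j \<in> I" for j
    proof
      assume j: "j \<in> J"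
      then have "0 < k' * \<gamma>' j" using e[of j] k \<gamma>(2) J by (auto simp flip: e)
      then show "j \<in> I" using \<gamma>'(1) by (auto simp: tuples_def)
    next
      assume j: "j \<in> I"
      then have "0 < k * \<gamma> j" using e[of j] k' \<gamma>'(2) I by auto
      then show "j \<in> J" using \<gamma>(1) by (auto simp: tuples_def)
    qed
    then show False using ne e J by blast
  qed
  then obtain j where j: "j \<in> V" "k * \<gamma> j - k' * \<gamma>' j \<noteq> 0" by (elim bexE)
  from exists_separating_weight[where u = "\<lambda>j. k * \<gamma> j - k' * \<gamma>' j", OF V j]
  obtain w :: "'i \<Rightarrow> nat" where w: "\<forall>i. 0 < w i" and s: "(\<Sum>i\<in>V. w i * (k * \<gamma> i - k' * \<gamma>' i)) \<noteq> 0" by (elim exE conjE)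
  have ext: "c * wdeg w A \<beta> = (\<Sum>i\<in>V. w i * (c * \<beta> i))" if "A \<subseteq> V" "\<beta> \<in> tuples A" for c :: real and A \<beta>
  proof -
    have "wdeg w A \<beta> = wdeg w V \<beta>"
      unfolding wdeg_def using V that by (intro sum.mono_neutral_left) (auto simp: tuples_def)
    then show ?thesis by (simp add: wdeg_def sum_distrib_left mult_ac)
  qed
  have "k * wdeg w J \<gamma> - k' * wdeg w I \<gamma>' = (\<Sum>i\<in>V. w i * (k * \<gamma> i - k' * \<gamma>' i))"
    unfolding ext[OF J(1) \<gamma>(1)] ext[OF I(1) \<gamma>'(1)] by (simp add: sum_subtractf right_diff_distrib)
  then have "k * wdeg w J \<gamma> < k' * wdeg w I \<gamma>' \<or> k' * wdeg w I \<gamma>' < k * wdeg w J \<gamma>" using s by linarith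
  \<comment> \<open>Whichever product is smaller takes the part of \<open>K\<close>.\<close>
  then show ?thesis
    using partial_mono_summable_inter_weighted[OF V J \<gamma> k I \<gamma>' k' R _ a]
      partial_mono_summable_inter_weighted[OF V I \<gamma>' k' J \<gamma> k R(2,1) _ a(2,1)] w by blast
qed

section \<open>Proportional exponents\<close>

text \<open>The projections agree along \<phi>, so only the sheet coordinate changes; the derivative
  is carried over and continuity of \<phi> transports the limit.\<close>

lemma holomorphic_map_reparametrise:
  assumes F: "seminormed F" and f: "holomorphic_map J F \<pi> S f"
    and \<phi>: "continuous_on S' \<phi>" "\<forall>x\<in>S'. \<phi> x \<in> S" "\<forall>x\<in>S'. \<pi>' x = \<pi> (\<phi> x)"
  shows "holomorphic_map J F \<pi>' S' (\<lambda>x. f (\<phi> x))"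
  unfolding holomorphic_map_def
proof (intro conjI ballI)
  show "f (\<phi> x) \<in> vecs F" if "x \<in> S'" for x using f \<phi> that by (auto simp: holomorphic_map_def)
  fix x assume x: "x \<in> S'"
  then have "\<phi> x \<in> S" using \<phi> by blast
  from holomorphic_mapD[OF f this] obtain v where v: "\<forall>j\<in>J. v j \<in> vecs F"
    and E: "\<forall>\<epsilon>>0. \<forall>\<^sub>F y in at (\<phi> x) within S. nrm F (f y - f (\<phi> x) - (\<Sum>j\<in>J. (\<pi> y j - \<pi> (\<phi> x) j) *\<^sub>C v j)) \<le> \<epsilon> * (\<Sum>j\<in>J. cmod (\<pi> y j - \<pi> (\<phi> x) j))"
    by (elim exE conjE)
  have lim: "filterlim \<phi> (nhds (\<phi> x)) (at x within S')" using \<phi>(1) x by (simp add: continuous_on_def)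
  have inS: "\<forall>\<^sub>F y in at x within S'. y \<in> S'" by (simp add: eventually_at_filter)
  show "\<exists>v. (\<forall>j\<in>J. v j \<in> vecs F) \<and> (\<forall>\<epsilon>>0. \<forall>\<^sub>F y in at x within S'.
     nrm F (f (\<phi> y) - f (\<phi> x) - (\<Sum>j\<in>J. (\<pi>' y j - \<pi>' x j) *\<^sub>C v j)) \<le> \<epsilon> * (\<Sum>j\<in>J. cmod (\<pi>' y j - \<pi>' x j)))"
  proof (rule exI[of _ v], intro conjI v allI impI)
    fix \<epsilon> :: real assume "0 < \<epsilon>"
    then have "\<forall>\<^sub>F y in nhds (\<phi> x). y \<noteq> \<phi> x \<longrightarrow> y \<in> S \<longrightarrow> nrm F (f y - f (\<phi> x) - (\<Sum>j\<in>J. (\<pi> y j - \<pi> (\<phi> x) j) *\<^sub>C v j)) \<le> \<epsilon> * (\<Sum>j\<in>J. cmod (\<pi> y j - \<pi> (\<phi> x) j))"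
      using E by (simp add: eventually_at_filter)
    from eventually_compose_filterlim[OF this lim] inS
    show "\<forall>\<^sub>F y in at x within S'. nrm F (f (\<phi> y) - f (\<phi> x) - (\<Sum>j\<in>J. (\<pi>' y j - \<pi>' x j) *\<^sub>C v j)) \<le> \<epsilon> * (\<Sum>j\<in>J. cmod (\<pi>' y j - \<pi>' x j))"
    proof eventually_elim
      case (elim y)
      then show ?case using \<phi>(2,3) x seminormed_nrm_zero[OF F] by (cases "\<phi> y = \<phi> x") auto
    qed
  qed
qed

lemma holomorphic_map_cong:
  assumes "holomorphic_map J F \<pi> S f" "\<And>x. x \<in> S \<Longrightarrow> g x = f x"
  shows "holomorphic_map J F \<pi> S g"
proof -
  have "(\<forall>\<^sub>F y in at x within S. nrm F (g y - g x - (\<Sum>j\<in>J. (\<pi> y j - \<pi> x j) *\<^sub>C v j)) \<le> \<epsilon> * (\<Sum>j\<in>J. cmod (\<pi> y j - \<pi> x j)))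
    \<longleftrightarrow> (\<forall>\<^sub>F y in at x within S. nrm F (f y - f x - (\<Sum>j\<in>J. (\<pi> y j - \<pi> x j) *\<^sub>C v j)) \<le> \<epsilon> * (\<Sum>j\<in>J. cmod (\<pi> y j - \<pi> x j)))"
    if "x \<in> S" for x v \<epsilon>
    by (rule eventually_cong[of "\<lambda>y. y \<in> S"]) (use assms(2) that in \<open>auto simp: eventually_at_filter\<close>)
  then show ?thesis using assms unfolding holomorphic_map_def by simp
qed

text \<open>Constants that are uniform on a whole sector serve for all smaller ones.\<close>

lemma mono_summable_in_dirI:
  fixes \<delta> \<rho> C A :: real
  assumes pos: "0 < k" "0 < \<delta>" "0 < \<rho>" "0 < C" "0 < A"
    and hol: "holomorphic_map J F fst (sector J \<gamma> (\<theta> - pi / (2 * k) - \<delta>) (\<theta> + pi / (2 * k) + \<delta>) \<rho>) f"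
    and g: "\<forall>l. g l \<in> vecs (bdd_holomorphic J (weighted_polydisc J \<gamma> \<rho>) F) \<and>
             has_taylor J F (weighted_polydisc J \<gamma> \<rho>) (g l) (mono_component J \<gamma> l b)"
    and est: "\<And>N z t. (z, t) \<in> sector J \<gamma> (\<theta> - pi / (2 * k) - \<delta>) (\<theta> + pi / (2 * k) + \<delta>) \<rho> \<Longrightarrow>
        nrm F (f (z, t) - (\<Sum>l<N. mono_val J z (\<lambda>i. l * \<gamma> i) *\<^sub>C g l z))
          \<le> C * A ^ N * fact N powr (1 / k) * cmod (mono_val J z (\<lambda>i. N * \<gamma> i))"
  shows "mono_summable_in_dir J F \<gamma> k b \<theta>"
proof -
  let ?a = "\<theta> - pi / (2 * k) - \<delta>" and ?b = "\<theta> + pi / (2 * k) + \<delta>"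
  have k2: "pi / (2 * k) = pi / k / 2" by simp
  have "gevrey_asymp J F \<gamma> (1 / k) ?a ?b \<rho> f b"
    unfolding gevrey_asymp_def
  proof (rule exI[of _ \<rho>], rule exI[of _ g], intro conjI allI impI)
    fix a' b' \<rho>' assume r: "?a < a' \<and> a' < b' \<and> b' < ?b \<and> 0 < \<rho>' \<and> \<rho>' < \<rho>"
    have sub: "sector J \<gamma> a' b' \<rho>' \<subseteq> sector J \<gamma> ?a ?b \<rho>" by (rule sector_mono) (use r in auto)
    have "\<forall>N. \<forall>(z, t)\<in>sector J \<gamma> a' b' \<rho>'. nrm F (f (z, t) - (\<Sum>l<N. mono_val J z (\<lambda>i. l * \<gamma> i) *\<^sub>C g l z))
          \<le> C * A ^ N * fact N powr (1 / k) * cmod (mono_val J z (\<lambda>i. N * \<gamma> i))"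
      using est sub by blast
    then show "\<exists>C>0. \<exists>A>0. \<forall>N. \<forall>(z, t)\<in>sector J \<gamma> a' b' \<rho>'. nrm F (f (z, t) - (\<Sum>l<N. mono_val J z (\<lambda>i. l * \<gamma> i) *\<^sub>C g l z))
          \<le> C * A ^ N * fact N powr (1 / k) * cmod (mono_val J z (\<lambda>i. N * \<gamma> i))"
      using pos by blast
  qed (use pos g in auto)
  moreover have "\<theta> = (?a + ?b) / 2" by simp
  moreover have "?b - ?a > pi / k" using pos unfolding k2 by simp
  ultimately show ?thesis unfolding mono_summable_in_dir_def using pos(3) hol by blast
qed

lemma canonical_components:
  fixes b :: "('i \<Rightarrow> nat) \<Rightarrow> ('i \<Rightarrow> complex) \<Rightarrow> 'e::complex_banach" and Cl :: "nat \<Rightarrow> real"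
  assumes J: "finite J" and L: "finite L" and R: "0 < R"
  defines "F \<equiv> bdd_holomorphic L (polydisc L R) whole_space"
  assumes \<gamma>: "\<gamma> \<in> tuples J" and bv: "\<And>\<kappa>. \<kappa> \<in> tuples J \<Longrightarrow> b \<kappa> \<in> vecs F"
    and tay: "\<And>\<kappa>. \<kappa> \<in> tuples J \<Longrightarrow> has_taylor L whole_space (polydisc L R) (b \<kappa>) (d \<kappa>)"
    and Q: "1 \<le> Q" and bnd: "\<And>l \<beta>. \<beta> \<in> tuples J \<Longrightarrow> nrm F (mono_component J \<gamma> l b \<beta>) \<le> Cl l * Q ^ mdeg J \<beta>"
  shows "\<exists>\<rho>0 T. 0 < \<rho>0 \<and> \<rho>0 \<le> 1 \<and> 0 \<le> T \<and> (\<forall>\<rho>. 0 < \<rho> \<longrightarrow> \<rho> \<le> \<rho>0 \<longrightarrow> (\<exists>g. \<forall>l.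
     g l \<in> vecs (bdd_holomorphic J (weighted_polydisc J \<gamma> \<rho>) F) \<and>
     has_taylor J F (weighted_polydisc J \<gamma> \<rho>) (g l) (mono_component J \<gamma> l b) \<and>
     (\<forall>z\<in>weighted_polydisc J \<gamma> \<rho>. nsum F (tuples J) (\<lambda>\<beta>. mono_val J z \<beta> *\<^sub>C mono_component J \<gamma> l b \<beta>) (g l z) \<and> nrm F (g l z) \<le> T * Cl l)))"
proof -
  have F: "seminormed F" unfolding F_def
    by (intro seminormed_bdd_holomorphic seminormed_whole_space L polydisc_nonempty R)
  have cv: "mono_component J \<gamma> l b \<beta> \<in> vecs F" for l \<beta>
    using bv tuples_add[OF tuples_mult[OF \<gamma>]] seminormed_zero[OF F] by (auto simp: mono_component_def)
  \<comment> \<open>Strictly inside the radius 1 / (2 Q), at which the coefficient bounds leave the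
    ratio 1 / 2.\<close>
  define r where "r = 1 / (4 * Q)"
  have r: "0 < r" "r < 1 / (2 * Q)" "r \<le> 1" using Q by (auto simp: r_def field_simps)
  define T where "T = (\<Sum>\<^sub>\<infinity>\<beta>\<in>tuples J. (1 / 2 :: real) ^ mdeg J \<beta>)"
  have T: "0 \<le> T" unfolding T_def by (intro infsum_nonneg) auto
  have geo: "(\<lambda>\<beta>. (1 / 2 :: real) ^ mdeg J \<beta>) summable_on tuples J"
    by (rule summable_on_geometric_tuples[OF J]) auto
  have le: "(1 / (2 * Q)) ^ mdeg J \<beta> * nrm F (mono_component J \<gamma> l b \<beta>) \<le> Cl l * (1 / 2) ^ mdeg J \<beta>" if "\<beta> \<in> tuples J" for \<beta> l
  proof -
    have "(1 / (2 * Q)) ^ mdeg J \<beta> * nrm F (mono_component J \<gamma> l b \<beta>) \<le> (1 / (2 * Q)) ^ mdeg J \<beta> * (Cl l * Q ^ mdeg J \<beta>)"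
      by (rule mult_left_mono[OF bnd[OF that]]) (use Q in auto)
    also have "\<dots> = Cl l * (1 / 2) ^ mdeg J \<beta>" using Q by (simp add: power_divide power_mult_distrib)
    finally show ?thesis .
  qed
  have s: "(\<lambda>\<beta>. (1 / (2 * Q)) ^ mdeg J \<beta> * nrm F (mono_component J \<gamma> l b \<beta>)) summable_on tuples J" for l
    by (rule summable_on_comparison_test[OF summable_on_cmult_right[OF geo, of "Cl l"] le])
      (use Q seminormed_nonneg[OF F cv] in auto)
  have sle: "(\<Sum>\<^sub>\<infinity>\<beta>\<in>tuples J. (1 / (2 * Q)) ^ mdeg J \<beta> * nrm F (mono_component J \<gamma> l b \<beta>)) \<le> T * Cl l" for l
  proof -
    have "(\<Sum>\<^sub>\<infinity>\<beta>\<in>tuples J. (1 / (2 * Q)) ^ mdeg J \<beta> * nrm F (mono_component J \<gamma> l b \<beta>)) \<le> (\<Sum>\<^sub>\<infinity>\<beta>\<in>tuples J. Cl l * (1 / 2) ^ mdeg J \<beta>)"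
      by (rule infsum_mono[OF s summable_on_cmult_right[OF geo] le])
    also have "\<dots> = T * Cl l" unfolding T_def by (simp add: infsum_cmult_right' mult.commute)
    finally show ?thesis .
  qed
  have sc: "summing F (tuples J) (mono_component J \<gamma> l b)" for l
    unfolding F_def
  proof (rule summing_bdd_holomorphic[OF L R])
    show "mono_component J \<gamma> l b \<beta> \<in> vecs (bdd_holomorphic L (polydisc L R) whole_space)" for \<beta>
      using cv[of l \<beta>] by (simp add: F_def)
    show "has_taylor L whole_space (polydisc L R) (mono_component J \<gamma> l b \<beta>)
       (if \<not> (\<forall>j\<in>J. \<gamma> j \<le> \<beta> j) then d (\<lambda>i. l * \<gamma> i + \<beta> i) else (\<lambda>_. 0))" if "\<beta> \<in> tuples J" for \<beta>
      using tay[OF tuples_add[OF tuples_mult[OF \<gamma>] that, of l]] that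
      by (simp add: mono_component_def) (simp add: has_taylor_whole_space)
  qed
  show ?thesis
  \<comment> \<open>As r \<le> 1, coordinates with |z j| ^ \<gamma> j below this radius satisfy |z
    j| \<le> r.\<close>
  proof (rule exI[of _ "r ^ mdeg J \<gamma>"], rule exI[of _ T], intro conjI allI impI T)
    show "0 < r ^ mdeg J \<gamma>" "r ^ mdeg J \<gamma> \<le> 1" using r by (auto intro: power_le_one)
    fix \<rho> assume \<rho>: "0 < \<rho>" "\<rho> \<le> r ^ mdeg J \<gamma>"
    let ?W = "weighted_polydisc J \<gamma> \<rho>"
    have W: "\<forall>z\<in>?W. \<forall>j\<in>J. cmod (z j) \<le> r"
    proof (intro ballI)
      fix z j assume z: "z \<in> ?W" and j: "j \<in> J"
      have "\<gamma> j \<le> mdeg J \<gamma>" unfolding mdeg_def using J j by (intro member_le_sum) auto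
      then have "r ^ mdeg J \<gamma> \<le> r ^ \<gamma> j" using r by (intro power_decreasing) auto
      moreover have "cmod (z j) ^ \<gamma> j < \<rho>" using z j by (simp add: weighted_polydisc_def)
      ultimately have "cmod (z j) ^ \<gamma> j < r ^ \<gamma> j" using \<rho> by linarith
      then show "cmod (z j) \<le> r" using r power_less_imp_less_base[of "cmod (z j)" "\<gamma> j" r] by simp
    qed
    have "\<exists>g. g \<in> vecs (bdd_holomorphic J ?W F) \<and> has_taylor J F ?W g (mono_component J \<gamma> l b) \<and>
     (\<forall>z\<in>?W. nsum F (tuples J) (\<lambda>\<beta>. mono_val J z \<beta> *\<^sub>C mono_component J \<gamma> l b \<beta>) (g z) \<and> nrm F (g z) \<le> T * Cl l)" for l
    proof -
      from power_series_bdd_holomorphic[OF F J sc r(1,2) s W, of l] obtain g where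
        g: "g \<in> vecs (bdd_holomorphic J ?W F)" "has_taylor J F ?W g (mono_component J \<gamma> l b)"
        "\<forall>z\<in>?W. nsum F (tuples J) (\<lambda>\<beta>. mono_val J z \<beta> *\<^sub>C mono_component J \<gamma> l b \<beta>) (g z)" by (elim exE conjE)
      have "nrm F (g z) \<le> T * Cl l" if z: "z \<in> ?W" for z
      proof -
        have "nrm F (g z) \<le> 1 * (\<Sum>\<^sub>\<infinity>\<beta>\<in>tuples J. (1 / (2 * Q)) ^ mdeg J \<beta> * nrm F (mono_component J \<gamma> l b \<beta>))"
        proof (rule nsum_weighted_bound[OF F cv s _ g(3)[rule_format, OF z]])
          have "cmod (mono_val J z \<beta>) \<le> (1 / (2 * Q)) ^ mdeg J \<beta>" for \<beta>
            by (rule norm_mono_val_le) (use W z r in force)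
          then show "cmod (mono_val J z \<beta>) \<le> 1 * (1 / (2 * Q)) ^ mdeg J \<beta>" for \<beta> by simp
        qed
        then show ?thesis using sle[of l] by simp
      qed
      then show ?thesis using g by blast
    qed
    then have "\<forall>l. \<exists>g. g \<in> vecs (bdd_holomorphic J ?W F) \<and> has_taylor J F ?W g (mono_component J \<gamma> l b) \<and>
     (\<forall>z\<in>?W. nsum F (tuples J) (\<lambda>\<beta>. mono_val J z \<beta> *\<^sub>C mono_component J \<gamma> l b \<beta>) (g z) \<and> nrm F (g z) \<le> T * Cl l)" by blast
    then show "\<exists>g. \<forall>l. g l \<in> vecs (bdd_holomorphic J ?W F) \<and> has_taylor J F ?W (g l) (mono_component J \<gamma> l b) \<and>
     (\<forall>z\<in>?W. nsum F (tuples J) (\<lambda>\<beta>. mono_val J z \<beta> *\<^sub>C mono_component J \<gamma> l b \<beta>) (g l z) \<and> nrm F (g l z) \<le> T * Cl l)"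
      by (rule choice)
  qed
qed

text \<open>Both sides sum the terms of \<open>b\<close> whose exponents are not above \<open>N M \<gamma>\<close>.\<close>

lemma component_sums_agree:
  fixes b :: "('i \<Rightarrow> nat) \<Rightarrow> ('i \<Rightarrow> complex) \<Rightarrow> 'e::complex_banach"
  assumes J: "J \<noteq> {}" "finite J" and \<gamma>: "\<gamma> \<in> tuples J" and L: "finite L" and R: "0 < R"
  defines "F \<equiv> bdd_holomorphic L (polydisc L R) whole_space"
  assumes bv: "\<And>\<kappa>. \<kappa> \<in> tuples J \<Longrightarrow> b \<kappa> \<in> vecs F"
    and g: "\<And>l. nsum F (tuples J) (\<lambda>\<beta>. mono_val J z \<beta> *\<^sub>C mono_component J \<gamma> l b \<beta>) (g l)"
    and g': "\<And>l. nsum F (tuples J) (\<lambda>\<beta>. mono_val J z \<beta> *\<^sub>C mono_component J (\<lambda>i. N * \<gamma> i) l b \<beta>) (g' l)"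
  shows "(\<Sum>l<M. mono_val J z (\<lambda>i. l * (N * \<gamma> i)) *\<^sub>C g' l) = (\<Sum>l<N * M. mono_val J z (\<lambda>i. l * \<gamma> i) *\<^sub>C g l)" (is "?A = ?B")
proof
  fix x
  have F: "seminormed F" unfolding F_def
    by (intro seminormed_bdd_holomorphic seminormed_whole_space L polydisc_nonempty R)
  have AB: "?A \<in> vecs F" "?B \<in> vecs F"
    using g g' by (auto simp: nsum_def intro!: conjunct1[OF seminormed_sum[OF F]] seminormed_scaleC[OF F])
  show "?A x = ?B x"
  proof (cases "x \<in> polydisc L R")
    case True
    have 1: "((\<lambda>\<kappa>. mono_val J z \<kappa> *\<^sub>C b \<kappa> x) has_sum (\<Sum>l<M. mono_val J z (\<lambda>i. l * (N * \<gamma> i)) *\<^sub>C g' l x)) {\<kappa> \<in> tuples J. \<not> (\<forall>j\<in>J. M * (N * \<gamma> j) \<le> \<kappa> j)}"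
      by (rule has_sum_bdd_component[OF J tuples_mult[OF \<gamma>] True L bv[unfolded F_def] g'[unfolded F_def]])
    have 2: "((\<lambda>\<kappa>. mono_val J z \<kappa> *\<^sub>C b \<kappa> x) has_sum (\<Sum>l<N * M. mono_val J z (\<lambda>i. l * \<gamma> i) *\<^sub>C g l x)) {\<kappa> \<in> tuples J. \<not> (\<forall>j\<in>J. (N * M) * \<gamma> j \<le> \<kappa> j)}"
      by (rule has_sum_bdd_component[OF J \<gamma> True L bv[unfolded F_def] g[unfolded F_def]])
    have e: "M * (N * \<gamma> j) = (N * M) * \<gamma> j" for j by (simp only: mult_ac)
    show ?thesis using has_sum_unique[OF 1[unfolded e] 2] by (simp add: sum_fun_apply scaleC_fun_def)
  next
    case False
    then show ?thesis using AB by (simp add: F_def bdd_holomorphic_vecs)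
  qed
qed

section \<open>Passing from an exponent to its multiples\<close>

lemma fact_add_le: "(fact (n + m) :: nat) \<le> fact n * (n + m) ^ m"
proof (induction m)
  case (Suc m)
  have "(fact (n + Suc m) :: nat) = (n + Suc m) * fact (n + m)" by simp
  also have "\<dots> \<le> (n + Suc m) * (fact n * (n + m) ^ m)" by (rule mult_le_mono2[OF Suc])
  also have "\<dots> \<le> (n + Suc m) * (fact n * (n + Suc m) ^ m)"
    by (intro mult_le_mono2 power_mono) auto
  finally show ?case by (simp only: power_Suc mult_ac)
qed simp

text \<open>Induction on M: a block of N new factors, each at most N (M + 1). Order 1 / k in N M
  thereby becomes order N / k in M.\<close>

lemma fact_mult_le: "(fact (N * M) :: nat) \<le> (N ^ N) ^ M * fact M ^ N"
proof (induction M)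
  case (Suc M)
  have "(fact (N * Suc M) :: nat) = fact (N * M + N)" by (simp add: add.commute)
  also have "\<dots> \<le> fact (N * M) * (N * M + N) ^ N" by (rule fact_add_le)
  also have "\<dots> \<le> ((N ^ N) ^ M * fact M ^ N) * (N * M + N) ^ N" by (rule mult_le_mono1[OF Suc])
  also have "(N * M + N) ^ N = N ^ N * Suc M ^ N" by (simp add: add.commute flip: power_mult_distrib)
  finally show ?case by (simp only: power_Suc fact_Suc power_mult_distrib of_nat_id mult_ac)
qed simp

lemma is_Arg_iff_cis: "is_Arg z t \<longleftrightarrow> z = cmod z * cis t"
  by (simp add: is_Arg_def cis_conv_exp)

text \<open>N times an argument of w differs from t by a multiple of 2 pi; the remainder of that
  multiple modulo N selects i.\<close>

lemma is_Arg_root: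
  assumes "is_Arg (w ^ N) t" "w \<noteq> 0" "0 < N"
  shows "\<exists>i<N. is_Arg w ((t + 2 * pi * real i) / N)"
proof -
  define a where "a = Arg w"
  have wa: "w = cmod w * cis a" using rcis_cmod_Arg[of w] by (simp add: a_def rcis_def)
  have "w ^ N = cmod w ^ N * cis (N * a)" by (subst wa) (simp add: power_mult_distrib Complex.DeMoivre)
  moreover have "w ^ N = cmod w ^ N * cis t" using assms(1) by (simp add: is_Arg_iff_cis norm_power)
  ultimately have "cis (N * a) = cis t" using assms(2) by simp
  then have "cis (N * a - t) = 1" by (simp add: cis_divide[symmetric])
  then have "cos (N * a - t) = 1" by (simp add: complex_eq_iff)
  then have "\<exists>n::int. N * a - t = real_of_int n * 2 * pi" by (simp only: cos_one_2pi_int)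
  then obtain n :: int where n: "N * a - t = real_of_int n * 2 * pi" by (elim exE)
  define i where "i = nat (n mod int N)"
  have i: "i < N" "int i = n mod int N" using assms(3) by (auto simp: i_def nat_less_iff)
  have "n = int N * (n div int N) + int i" using i(2) by simp
  then have n': "real_of_int n = real N * real_of_int (n div int N) + real i"
    by (metis of_int_add of_int_mult of_int_of_nat_eq)
  have "(t + 2 * pi * real i) / N = a + 2 * pi * real_of_int (- (n div int N))"
    using n assms(3) unfolding n' by (simp add: field_simps)
  moreover have "cis (2 * pi * real_of_int m) = 1" for m
    by (simp add: complex_eq_iff sin_int_2pin cos_int_2pin)
  ultimately have "cis ((t + 2 * pi * real i) / N) = cis a" by (simp only: cis_mult[symmetric]) simp
  then show ?thesis using wa i(1) unfolding is_Arg_iff_cis by metis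
qed

text \<open>Two candidates with indices below N differ by less than 2 pi, so if they give the same
  point of the circle they coincide.\<close>

lemma is_Arg_root_unique:
  fixes N :: nat
  assumes "is_Arg w ((t + 2 * pi * real i) / N)" "is_Arg w ((t + 2 * pi * real j) / N)" "w \<noteq> 0" "i < N" "j < N"
  shows "i = j"
proof -
  have "cis ((t + 2 * pi * real i) / N) = cis ((t + 2 * pi * real j) / N)"
    using assms(1-3) unfolding is_Arg_iff_cis by (metis mult_cancel_left norm_eq_zero of_real_eq_0_iff)
  moreover have "\<bar>(t + 2 * pi * real i) / N - (t + 2 * pi * real j) / N\<bar> < 2 * pi"
  proof -
    have "(t + 2 * pi * real i) / N - (t + 2 * pi * real j) / N = 2 * pi * ((real i - real j) / N)"
      by (simp add: diff_divide_distrib[symmetric] algebra_simps)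
    moreover have "\<bar>real i - real j\<bar> < real N" using assms(4,5) by linarith
    then have "\<bar>(real i - real j) / N\<bar> < 1" by (simp add: abs_divide)
    then have "2 * pi * \<bar>(real i - real j) / N\<bar> < 2 * pi * 1" by (intro mult_strict_left_mono) auto
    ultimately show ?thesis by (simp add: abs_mult)
  qed
  ultimately have "(t + 2 * pi * real i) / N = (t + 2 * pi * real j) / N" by (rule cis_eq_imp_eq)
  then show ?thesis using assms(4) by simp
qed

lemma continuous_mono_val: "continuous_on UNIV (\<lambda>z :: 'i \<Rightarrow> complex. mono_val J z \<beta>)"
  unfolding mono_val_def by (intro continuous_intros continuous_on_product_coordinates)

text \<open>Finitely many such sets will partition a sector. Being closed, each of them is then open
  in the sector too, so the choice of the root is locally constant.\<close>

lemma closed_is_Arg: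
  assumes N: "N \<noteq> 0"
  shows "closed {x :: ('i \<Rightarrow> complex) \<times> real. is_Arg (mono_val J (fst x) \<beta>) ((snd x + c) / N)}"
proof -
  have 1: "continuous_on UNIV (\<lambda>x :: ('i \<Rightarrow> complex) \<times> real. mono_val J (fst x) \<beta>)"
    by (rule continuous_on_compose2[OF continuous_mono_val continuous_on_fst[OF continuous_on_id]]) auto
  show ?thesis unfolding is_Arg_def
    by (rule closed_Collect_eq[OF 1]) (intro continuous_intros 1, use N in auto)
qed

lemma cmod_power_multiple_less:
  fixes \<rho> :: real and n N :: nat
  assumes "0 < cmod x ^ (N * n)" "cmod x ^ (N * n) < r" "r \<le> \<rho> ^ N" "0 < N" "0 < n" "0 < \<rho>"
  shows "0 < cmod x ^ n" "cmod x ^ n < \<rho>"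
proof -
  have "(cmod x ^ n) ^ N < \<rho> ^ N" using assms by (simp add: power_mult[symmetric] mult.commute)
  then show "cmod x ^ n < \<rho>" by (rule power_less_imp_less_base) (use assms in auto)
  have "x \<noteq> 0" using assms(1,4,5) by (intro notI) (simp add: power_0_left)
  then show "0 < cmod x ^ n" by simp
qed

text \<open>A point of a sector for N \<gamma> carries an argument t of the N-th power of the
  monomial, and exactly one of the numbers (t + 2 pi i) / N with i < N is an argument of the
  monomial itself. It selects one of the N given sums, and the selection is locally
  constant.\<close>

lemma mono_summable_in_dir_multiple:
  fixes b :: "('i \<Rightarrow> nat) \<Rightarrow> ('i \<Rightarrow> complex) \<Rightarrow> 'e::complex_banach" and k \<theta> :: real and N :: nat
  assumes J: "finite J" "J \<noteq> {}" "\<forall>j\<in>J. 0 < \<gamma> j" and \<gamma>: "\<gamma> \<in> tuples J" and L: "finite L" and R: "0 < R"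
    and k: "0 < k" and N: "0 < N"
  defines "F \<equiv> bdd_holomorphic L (polydisc L R) whole_space"
  assumes bv: "\<And>\<kappa>. \<kappa> \<in> tuples J \<Longrightarrow> b \<kappa> \<in> vecs F"
    and tay: "\<And>\<kappa>. \<kappa> \<in> tuples J \<Longrightarrow> has_taylor L whole_space (polydisc L R) (b \<kappa>) (d \<kappa>)"
    and DB: "1 \<le> D" "1 \<le> B" and bnd: "\<forall>\<kappa>\<in>tuples J. nrm F (b \<kappa>) \<le> D * B ^ mdeg J \<kappa> * fact (level J \<gamma> \<kappa>) powr (1 / k)"
    and dir: "\<forall>i<N. mono_summable_in_dir J F \<gamma> k b ((\<theta> + 2 * pi * real i) / N)"
  shows "mono_summable_in_dir J F (\<lambda>i. N * \<gamma> i) (k / N) b \<theta>"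
proof -
  have F: "seminormed F" unfolding F_def
    by (intro seminormed_bdd_holomorphic seminormed_whole_space L polydisc_nonempty R)
  define \<Theta> where "\<Theta> i = (\<theta> + 2 * pi * real i) / N" for i
  from sum_data_uniform[OF k, of "\<Theta> ` {..<N}" J F \<gamma> b] dir
  obtain \<delta> \<rho> C where \<delta>: "0 < \<delta>" and \<rho>: "0 < \<rho>" and C: "1 \<le> C"
    and data: "\<forall>i\<in>{..<N}. \<exists>f. \<exists>g. sum_data J F \<gamma> k b (\<Theta> i) \<delta> \<rho> C f g" by (auto simp: \<Theta>_def)
  from bchoice[OF data] obtain f where data: "\<forall>i\<in>{..<N}. \<exists>g. sum_data J F \<gamma> k b (\<Theta> i) \<delta> \<rho> C (f i) g" by (elim exE)
  from bchoice[OF data] obtain g where data: "\<forall>i\<in>{..<N}. sum_data J F \<gamma> k b (\<Theta> i) \<delta> \<rho> C (f i) (g i)" by (elim exE)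
  let ?\<gamma> = "\<lambda>i. N * \<gamma> i"
  \<comment> \<open>An exponent in the l-th component for N \<gamma> has level below N (l + 1) with
    respect to \<gamma>.\<close>
  define Cl where "Cl l = D * B ^ (l * (N * mdeg J \<gamma>)) * fact (N * Suc l) powr (1 / k)" for l
  have comp: "nrm F (mono_component J ?\<gamma> l b \<beta>) \<le> Cl l * B ^ mdeg J \<beta>" if \<beta>: "\<beta> \<in> tuples J" for l \<beta>
  proof (cases "\<forall>j\<in>J. N * \<gamma> j \<le> \<beta> j")
    case True
    then have "mono_component J ?\<gamma> l b \<beta> = 0" by (simp add: mono_component_def)
    then show ?thesis using DB by (simp add: seminormed_nrm_zero[OF F] Cl_def)
  next
    case False
    let ?\<kappa> = "\<lambda>i. l * (N * \<gamma> i) + \<beta> i"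
    have e: "mono_component J ?\<gamma> l b \<beta> = b ?\<kappa>" using False \<beta> by (simp add: mono_component_def)
    have "?\<kappa> \<in> tuples J" by (intro tuples_add tuples_mult \<gamma> \<beta>)
    then have "nrm F (b ?\<kappa>) \<le> D * B ^ mdeg J ?\<kappa> * fact (level J \<gamma> ?\<kappa>) powr (1 / k)" using bnd by blast
    also have "\<dots> \<le> D * B ^ mdeg J ?\<kappa> * fact (N * Suc l) powr (1 / k)"
    proof -
      \<comment> \<open>Otherwise \<beta> would dominate N \<gamma>.\<close>
      have "\<not> N * Suc l \<le> level J \<gamma> ?\<kappa>"
      proof
        assume "N * Suc l \<le> level J \<gamma> ?\<kappa>"
        then have "\<forall>j\<in>J. N * Suc l * \<gamma> j \<le> l * (N * \<gamma> j) + \<beta> j" by (rule iffD1[OF le_level_iff[OF J, of "N * Suc l" ?\<kappa>]])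
        then show False using False by (auto simp: algebra_simps)
      qed
      then have "(fact (level J \<gamma> ?\<kappa>) :: real) \<le> fact (N * Suc l)" by (intro fact_mono) simp
      then have "fact (level J \<gamma> ?\<kappa>) powr (1 / k) \<le> (fact (N * Suc l) :: real) powr (1 / k)"
        using k by (intro powr_mono2) auto
      then show ?thesis using DB by (intro mult_left_mono) auto
    qed
    also have "\<dots> = Cl l * B ^ mdeg J \<beta>"
      by (simp only: Cl_def mdeg_add mdeg_mult power_add mult_ac)
    finally show ?thesis unfolding e .
  qed
  have "\<exists>\<rho>0 T. 0 < \<rho>0 \<and> \<rho>0 \<le> 1 \<and> 0 \<le> T \<and> (\<forall>\<rho>. 0 < \<rho> \<longrightarrow> \<rho> \<le> \<rho>0 \<longrightarrow> (\<exists>g. \<forall>l.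
     g l \<in> vecs (bdd_holomorphic J (weighted_polydisc J ?\<gamma> \<rho>) F) \<and>
     has_taylor J F (weighted_polydisc J ?\<gamma> \<rho>) (g l) (mono_component J ?\<gamma> l b) \<and>
     (\<forall>z\<in>weighted_polydisc J ?\<gamma> \<rho>. nsum F (tuples J) (\<lambda>\<beta>. mono_val J z \<beta> *\<^sub>C mono_component J ?\<gamma> l b \<beta>) (g l z) \<and> nrm F (g l z) \<le> T * Cl l)))"
    unfolding F_def
    by (rule canonical_components[OF J(1) L R tuples_mult[OF \<gamma>] bv[unfolded F_def] tay DB(2) comp[unfolded F_def]])
  then obtain \<rho>0 T where \<rho>0: "0 < \<rho>0" "\<rho>0 \<le> 1" and canon: "\<forall>\<rho>. 0 < \<rho> \<longrightarrow> \<rho> \<le> \<rho>0 \<longrightarrow> (\<exists>g. \<forall>l.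
     g l \<in> vecs (bdd_holomorphic J (weighted_polydisc J ?\<gamma> \<rho>) F) \<and>
     has_taylor J F (weighted_polydisc J ?\<gamma> \<rho>) (g l) (mono_component J ?\<gamma> l b) \<and>
     (\<forall>z\<in>weighted_polydisc J ?\<gamma> \<rho>. nsum F (tuples J) (\<lambda>\<beta>. mono_val J z \<beta> *\<^sub>C mono_component J ?\<gamma> l b \<beta>) (g l z) \<and> nrm F (g l z) \<le> T * Cl l))"
    by (elim exE conjE)
  \<comment> \<open>The bound \<rho> for |z j| ^ \<gamma> j amounts to \<rho> ^ N for the exponent N
    \<gamma>.\<close>
  define r where "r = min \<rho>0 (\<rho> ^ N)"
  have r: "0 < r" "r \<le> \<rho>0" "r \<le> \<rho> ^ N" using \<rho>0 \<rho> by (auto simp: r_def)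
  let ?W = "weighted_polydisc J ?\<gamma> r"
  from mp[OF mp[OF spec[OF canon, of r] r(1)] r(2)] obtain g' where g': "\<forall>l. g' l \<in> vecs (bdd_holomorphic J ?W F) \<and> has_taylor J F ?W (g' l) (mono_component J ?\<gamma> l b) \<and>
     (\<forall>z\<in>?W. nsum F (tuples J) (\<lambda>\<beta>. mono_val J z \<beta> *\<^sub>C mono_component J ?\<gamma> l b \<beta>) (g' l z) \<and> nrm F (g' l z) \<le> T * Cl l)" by (elim exE)
  let ?S = "sector J ?\<gamma> (\<theta> - pi / (2 * (k / N)) - N * \<delta>) (\<theta> + pi / (2 * (k / N)) + N * \<delta>) r"
  let ?Si = "\<lambda>i. sector J \<gamma> (\<Theta> i - pi / (2 * k) - \<delta>) (\<Theta> i + pi / (2 * k) + \<delta>) \<rho>"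
  define C' where "C' i = {x :: ('i \<Rightarrow> complex) \<times> real. is_Arg (mono_val J (fst x) \<gamma>) ((snd x + 2 * pi * real i) / N)}" for i
  define \<phi> where "\<phi> i x = (fst x, (snd x + 2 * pi * real i) / N)" for i and x :: "('i \<Rightarrow> complex) \<times> real"
  define sel where "sel x = (SOME i. i < N \<and> x \<in> C' i)" for x
  define h where "h x = f (sel x) (\<phi> (sel x) x)" for x
  have closedC: "closed (C' i)" for i unfolding C'_def by (rule closed_is_Arg) (use N in auto)
  have pw: "0 < cmod (fst x j) ^ \<gamma> j \<and> cmod (fst x j) ^ \<gamma> j < \<rho>" if "x \<in> ?S" "j \<in> J" for x j
    using cmod_power_multiple_less[of "fst x j" N "\<gamma> j" r \<rho>] that r N J(3) \<rho> by (auto simp: sector_def)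
  have nz: "mono_val J (fst x) \<gamma> \<noteq> 0" if "x \<in> ?S" for x
  proof -
    have "fst x j ^ \<gamma> j \<noteq> 0" if "j \<in> J" for j
      using pw[OF \<open>x \<in> ?S\<close> that] by (metis norm_power norm_zero less_irrefl)
    then show ?thesis unfolding mono_val_def using J(1) by (simp add: prod_zero_iff)
  qed
  have selx: "sel x < N \<and> x \<in> C' (sel x)" if x: "x \<in> ?S" for x
  proof -
    have "is_Arg (mono_val J (fst x) \<gamma> ^ N) (snd x)"
      using x by (auto simp: sector_def mono_val_mult)
    from is_Arg_root[OF this nz[OF x] N] have "\<exists>i. i < N \<and> x \<in> C' i" by (simp add: C'_def)
    then show ?thesis unfolding sel_def by (rule someI_ex)
  qed
  have uniq: "i = j" if "x \<in> ?S" "i < N" "x \<in> C' i" "j < N" "x \<in> C' j" for x i j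
    using is_Arg_root_unique[OF _ _ nz[OF that(1)] that(2,4)] that(3,5) by (simp add: C'_def)
  have \<phi>S: "\<phi> i x \<in> ?Si i" if x: "x \<in> ?S" and i: "x \<in> C' i" for x i
  proof -
    have "\<theta> - N * (pi / (2 * k)) - N * \<delta> < snd x" "snd x < \<theta> + N * (pi / (2 * k)) + N * \<delta>"
      using x by (auto simp: sector_def field_simps)
    then have "(\<theta> - N * (pi / (2 * k)) - N * \<delta> + 2 * pi * real i) / N < (snd x + 2 * pi * real i) / N"
      "(snd x + 2 * pi * real i) / N < (\<theta> + N * (pi / (2 * k)) + N * \<delta> + 2 * pi * real i) / N"
      using N by (intro divide_strict_right_mono; simp)+
    moreover have "(\<theta> - N * (pi / (2 * k)) - N * \<delta> + 2 * pi * real i) / N = \<Theta> i - pi / (2 * k) - \<delta>"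
      "(\<theta> + N * (pi / (2 * k)) + N * \<delta> + 2 * pi * real i) / N = \<Theta> i + pi / (2 * k) + \<delta>"
      using N by (simp_all add: \<Theta>_def add_divide_distrib diff_divide_distrib)
    ultimately have "\<Theta> i - pi / (2 * k) - \<delta> < (snd x + 2 * pi * real i) / N" "(snd x + 2 * pi * real i) / N < \<Theta> i + pi / (2 * k) + \<delta>"
      by simp_all
    then show ?thesis using x i pw[OF x] by (auto simp: \<phi>_def sector_def C'_def)
  qed
  have hF: "h x \<in> vecs F" if x: "x \<in> ?S" for x
  proof -
    have "holomorphic_map J F fst (?Si (sel x)) (f (sel x))" using data selx[OF x] by (simp add: sum_data_def)
    then show ?thesis using \<phi>S[OF x] selx[OF x] by (simp add: h_def holomorphic_map_def)
  qed
  have hol: "holomorphic_map J F fst ?S h"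
  proof (rule holomorphic_map_local[OF hF])
    fix x assume x: "x \<in> ?S"
    define i where "i = sel x"
    have i: "i < N" "x \<in> C' i" using selx[OF x] by (auto simp: i_def)
    \<comment> \<open>The complement of the other sheets: it is open and meets the sector in the
      sheet of x.\<close>
    define T where "T = - (\<Union>j\<in>{..<N} - {i}. C' j)"
    have "open T" unfolding T_def using closedC by (intro open_Compl closed_UN) auto
    moreover have "x \<in> T" using uniq[OF x i] by (auto simp: T_def)
    moreover have "holomorphic_map J F fst (?S \<inter> T) h"
    proof (rule holomorphic_map_cong)
      have sel_i: "sel y = i" if "y \<in> ?S \<inter> T" for y
        using selx[of y] that by (auto simp: T_def)
      show "h y = f i (\<phi> i y)" if "y \<in> ?S \<inter> T" for y by (simp add: h_def sel_i[OF that])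
      show "holomorphic_map J F fst (?S \<inter> T) (\<lambda>y. f i (\<phi> i y))"
      proof (rule holomorphic_map_reparametrise[OF F])
        show "holomorphic_map J F fst (?Si i) (f i)" using data i by (simp add: sum_data_def)
        show "continuous_on (?S \<inter> T) (\<phi> i)" unfolding \<phi>_def by (intro continuous_intros) (use N in auto)
        show "\<forall>y\<in>?S \<inter> T. \<phi> i y \<in> ?Si i"
        proof
          fix y assume y: "y \<in> ?S \<inter> T"
          then show "\<phi> i y \<in> ?Si i" using \<phi>S[of y i] selx[of y] sel_i[OF y] by auto
        qed
      qed (simp add: \<phi>_def)
    qed
    ultimately show "\<exists>T. open T \<and> x \<in> T \<and> holomorphic_map J F fst (?S \<inter> T) h" by blast
  qed
  define A where "A = C ^ N * (real (N ^ N)) powr (1 / k)"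
  show ?thesis
  proof (rule mono_summable_in_dirI[where \<delta> = "N * \<delta>" and \<rho> = r and C = C and A = A and f = h and g = g'])
    show "0 < k / N" "0 < N * \<delta>" "0 < r" "0 < C" "0 < A" using k N \<delta> r C by (auto simp: A_def)
    show "holomorphic_map J F fst ?S h" by (rule hol)
    show "\<forall>l. g' l \<in> vecs (bdd_holomorphic J ?W F) \<and> has_taylor J F ?W (g' l) (mono_component J ?\<gamma> l b)" using g' by blast
    fix M z t assume x: "(z, t) \<in> ?S"
    define i where "i = sel (z, t)"
    have i: "i < N" "(z, t) \<in> C' i" using selx[OF x] by (auto simp: i_def)
    note d = bspec[OF data, unfolded sum_data_def, of i]
    have zW: "z \<in> weighted_polydisc J \<gamma> \<rho>" "z \<in> ?W"
      using pw[OF x] x by (auto simp: weighted_polydisc_def sector_def)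
    have n: "nsum F (tuples J) (\<lambda>\<beta>. mono_val J z \<beta> *\<^sub>C mono_component J \<gamma> l b \<beta>) (g i l z)" for l
      using d i zW by blast
    have n': "nsum F (tuples J) (\<lambda>\<beta>. mono_val J z \<beta> *\<^sub>C mono_component J ?\<gamma> l b \<beta>) (g' l z)" for l
      using g' zW by blast
    \<comment> \<open>M components for N \<gamma> comprise N M components for \<gamma>, so the
      estimate of order N M of the selected sum applies.\<close>
    have s: "(\<Sum>l<M. mono_val J z (\<lambda>i. l * (N * \<gamma> i)) *\<^sub>C g' l z) = (\<Sum>l<N * M. mono_val J z (\<lambda>i. l * \<gamma> i) *\<^sub>C g i l z)"
      by (rule component_sums_agree[OF J(2,1) \<gamma> L R bv[unfolded F_def] n[unfolded F_def] n'[unfolded F_def]])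
    obtain t' where t': "\<phi> i (z, t) = (z, t')" by (simp add: \<phi>_def)
    have "(z, t') \<in> ?Si i" using \<phi>S[OF x i(2)] by (simp add: t')
    then have "nrm F (f i (z, t') - (\<Sum>l<N * M. mono_val J z (\<lambda>i. l * \<gamma> i) *\<^sub>C g i l z))
          \<le> C ^ Suc (N * M) * fact (N * M) powr (1 / k) * cmod (mono_val J z (\<lambda>i. N * M * \<gamma> i))"
      using d i by blast
    also have "\<dots> \<le> C ^ Suc (N * M) * (((real (N ^ N)) powr (1 / k)) ^ M * fact M powr (1 / (k / N))) * cmod (mono_val J z (\<lambda>i. N * M * \<gamma> i))"
    proof (intro mult_right_mono mult_left_mono)
      have "real (fact (N * M)) \<le> real ((N ^ N) ^ M * fact M ^ N)" by (simp only: of_nat_le_iff fact_mult_le)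
      then have "(fact (N * M) :: real) powr (1 / k) \<le> (real (N ^ N) ^ M * fact M ^ N) powr (1 / k)"
        using k by (intro powr_mono2) auto
      also have "\<dots> = ((real (N ^ N)) powr (1 / k)) ^ M * fact M powr (1 / (k / N))"
      proof -
        have p: "(x ^ n) powr c = x powr (n * c)" if "0 < x" for x c :: real and n
          using that by (simp add: powr_powr flip: powr_realpow)
        have q: "(x powr c) ^ n = x powr (n * c)" if "0 < x" for x c :: real and n
          using that by (simp add: powr_powr mult.commute flip: powr_realpow)
        have "0 < real (N ^ N)" using N by simp
        then show ?thesis using N by (simp add: powr_mult p q mult.commute)
      qed
      finally show "(fact (N * M) :: real) powr (1 / k) \<le> ((real (N ^ N)) powr (1 / k)) ^ M * fact M powr (1 / (k / N))" .
    qed (use C in auto)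
    also have "\<dots> = C * A ^ M * fact M powr (1 / (k / N)) * cmod (mono_val J z (\<lambda>i. M * (N * \<gamma> i)))"
    proof -
      have "(\<lambda>i. N * M * \<gamma> i) = (\<lambda>i. M * (N * \<gamma> i))" by (simp add: fun_eq_iff mult_ac)
      moreover have "C ^ (N * M) = (C ^ N) ^ M" by (rule power_mult)
      ultimately show ?thesis by (simp add: A_def power_mult_distrib mult_ac)
    qed
    finally show "nrm F (h (z, t) - (\<Sum>l<M. mono_val J z (\<lambda>i. l * (N * \<gamma> i)) *\<^sub>C g' l z))
       \<le> C * A ^ M * fact M powr (1 / (k / N)) * cmod (mono_val J z (\<lambda>i. M * (N * \<gamma> i)))"
      by (simp add: s h_def i_def[symmetric] t')
  qed
qed

text \<open>Multiplying the argument by N leads from a sector for \<gamma> to one for N \<gamma>, so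
  a single sum suffices. Its estimates concern truncations at multiples of N; a general order m is
  rounded up, and the at most N additional components are bounded through the coefficients.\<close>

lemma mono_summable_in_dir_divide:
  fixes b :: "('i \<Rightarrow> nat) \<Rightarrow> ('i \<Rightarrow> complex) \<Rightarrow> 'e::complex_banach" and k \<theta> :: real and N :: nat
  assumes J: "finite J" "J \<noteq> {}" "\<forall>j\<in>J. 0 < \<gamma> j" and \<gamma>: "\<gamma> \<in> tuples J" and L: "finite L" and R: "0 < R"
    and k: "0 < k" and N: "0 < N"
  defines "F \<equiv> bdd_holomorphic L (polydisc L R) whole_space"
  assumes bv: "\<And>\<kappa>. \<kappa> \<in> tuples J \<Longrightarrow> b \<kappa> \<in> vecs F"
    and tay: "\<And>\<kappa>. \<kappa> \<in> tuples J \<Longrightarrow> has_taylor L whole_space (polydisc L R) (b \<kappa>) (d \<kappa>)"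
    and DB: "1 \<le> D" "1 \<le> B"
    and bnd: "\<forall>\<kappa>\<in>tuples J. nrm F (b \<kappa>) \<le> D * B ^ mdeg J \<kappa> * fact (level J (\<lambda>i. N * \<gamma> i) \<kappa>) powr (1 / (k / N))"
    and dir: "mono_summable_in_dir J F (\<lambda>i. N * \<gamma> i) (k / N) b (N * \<theta>)"
  shows "mono_summable_in_dir J F \<gamma> k b \<theta>"
proof -
  have F: "seminormed F" unfolding F_def
    by (intro seminormed_bdd_holomorphic seminormed_whole_space L polydisc_nonempty R)
  let ?\<gamma> = "\<lambda>i. N * \<gamma> i"
  have kN: "0 < k / N" using k N by simp
  have J': "\<forall>j\<in>J. 0 < N * \<gamma> j" using J N by simp
  from sum_data_exists[OF kN dir] obtain \<delta> \<rho> C f g where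
    \<delta>: "0 < \<delta>" and \<rho>: "0 < \<rho>" and C: "1 \<le> C" and data: "sum_data J F ?\<gamma> (k / N) b (N * \<theta>) \<delta> \<rho> C f g" by (elim exE conjE)
  note data = data[unfolded sum_data_def]
  have factlev: "fact M powr (1 / (k / N)) \<le> (fact n powr (1 / k) :: real)" if "M * N \<le> n" for M n
    using fact_powr_level[OF that N kN] N by simp
  \<comment> \<open>N times the level for N \<gamma> is at most l, so order N / k in that level is
    order 1 / k in l.\<close>
  define Cl where "Cl l = D * B ^ (l * mdeg J \<gamma>) * fact l powr (1 / k)" for l
  have comp: "nrm F (mono_component J \<gamma> l b \<beta>) \<le> Cl l * B ^ mdeg J \<beta>" if \<beta>: "\<beta> \<in> tuples J" for l \<beta>
  proof (cases "\<forall>j\<in>J. \<gamma> j \<le> \<beta> j")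
    case True
    then have "mono_component J \<gamma> l b \<beta> = 0" by (simp add: mono_component_def)
    then show ?thesis using DB by (simp add: seminormed_nrm_zero[OF F] Cl_def)
  next
    case False
    let ?\<kappa> = "\<lambda>i. l * \<gamma> i + \<beta> i"
    have e: "mono_component J \<gamma> l b \<beta> = b ?\<kappa>" using False \<beta> by (simp add: mono_component_def)
    have "?\<kappa> \<in> tuples J" by (intro tuples_add tuples_mult \<gamma> \<beta>)
    then have "nrm F (b ?\<kappa>) \<le> D * B ^ mdeg J ?\<kappa> * fact (level J ?\<gamma> ?\<kappa>) powr (1 / (k / N))" using bnd by blast
    also have "\<dots> \<le> D * B ^ mdeg J ?\<kappa> * fact l powr (1 / k)"
    proof (intro mult_left_mono factlev)
      let ?l = "level J ?\<gamma> ?\<kappa>"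
      have "\<forall>j\<in>J. ?l * (N * \<gamma> j) \<le> l * \<gamma> j + \<beta> j" using le_level_iff[OF J(1,2) J', of ?l ?\<kappa>] by simp
      then have 1: "\<forall>j\<in>J. ?l * N * \<gamma> j \<le> l * \<gamma> j + \<beta> j" by (simp only: mult.assoc)
      show "?l * N \<le> l"
      proof (rule ccontr)
        assume "\<not> ?l * N \<le> l"
        then have "Suc l \<le> ?l * N" by simp
        then have "Suc l * \<gamma> j \<le> l * \<gamma> j + \<beta> j" if "j \<in> J" for j
          using 1 that mult_le_mono1[of "Suc l" "?l * N" "\<gamma> j"] by (meson order_trans)
        then show False using False by auto
      qed
    qed (use DB in auto)
    also have "\<dots> = Cl l * B ^ mdeg J \<beta>"
      by (simp only: Cl_def mdeg_add mdeg_mult power_add mult_ac)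
    finally show ?thesis unfolding e .
  qed
  have "\<exists>\<rho>0 T. 0 < \<rho>0 \<and> \<rho>0 \<le> 1 \<and> 0 \<le> T \<and> (\<forall>\<rho>. 0 < \<rho> \<longrightarrow> \<rho> \<le> \<rho>0 \<longrightarrow> (\<exists>g. \<forall>l.
     g l \<in> vecs (bdd_holomorphic J (weighted_polydisc J \<gamma> \<rho>) F) \<and>
     has_taylor J F (weighted_polydisc J \<gamma> \<rho>) (g l) (mono_component J \<gamma> l b) \<and>
     (\<forall>z\<in>weighted_polydisc J \<gamma> \<rho>. nsum F (tuples J) (\<lambda>\<beta>. mono_val J z \<beta> *\<^sub>C mono_component J \<gamma> l b \<beta>) (g l z) \<and> nrm F (g l z) \<le> T * Cl l)))"
    unfolding F_def
    by (rule canonical_components[OF J(1) L R \<gamma> bv[unfolded F_def] tay DB(2) comp[unfolded F_def]])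
  then obtain \<rho>0 T where \<rho>0: "0 < \<rho>0" "\<rho>0 \<le> 1" and T: "0 \<le> T" and canon: "\<forall>\<rho>. 0 < \<rho> \<longrightarrow> \<rho> \<le> \<rho>0 \<longrightarrow> (\<exists>g. \<forall>l.
     g l \<in> vecs (bdd_holomorphic J (weighted_polydisc J \<gamma> \<rho>) F) \<and>
     has_taylor J F (weighted_polydisc J \<gamma> \<rho>) (g l) (mono_component J \<gamma> l b) \<and>
     (\<forall>z\<in>weighted_polydisc J \<gamma> \<rho>. nsum F (tuples J) (\<lambda>\<beta>. mono_val J z \<beta> *\<^sub>C mono_component J \<gamma> l b \<beta>) (g l z) \<and> nrm F (g l z) \<le> T * Cl l))"
    by (elim exE conjE)
  define r where "r = min \<rho>0 \<rho>"
  have r: "0 < r" "r \<le> \<rho>0" "r \<le> \<rho>" using \<rho>0 \<rho> by (auto simp: r_def)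
  let ?W = "weighted_polydisc J \<gamma> r"
  from mp[OF mp[OF spec[OF canon, of r] r(1)] r(2)] obtain g' where g': "\<forall>l. g' l \<in> vecs (bdd_holomorphic J ?W F) \<and> has_taylor J F ?W (g' l) (mono_component J \<gamma> l b) \<and>
     (\<forall>z\<in>?W. nsum F (tuples J) (\<lambda>\<beta>. mono_val J z \<beta> *\<^sub>C mono_component J \<gamma> l b \<beta>) (g' l z) \<and> nrm F (g' l z) \<le> T * Cl l)"
    by (elim exE)
  let ?S = "sector J \<gamma> (\<theta> - pi / (2 * k) - \<delta> / N) (\<theta> + pi / (2 * k) + \<delta> / N) r"
  let ?S' = "sector J ?\<gamma> (N * \<theta> - pi / (2 * (k / N)) - \<delta>) (N * \<theta> + pi / (2 * (k / N)) + \<delta>) \<rho>"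
  \<comment> \<open>Numbers below r \<le> 1 do not grow when raised to the power N.\<close>
  have pw: "cmod (z j) ^ (N * \<gamma> j) < \<rho>" if "cmod (z j) ^ \<gamma> j < r" for z :: "'i \<Rightarrow> complex" and j
  proof -
    have "(cmod (z j) ^ \<gamma> j) ^ N \<le> (cmod (z j) ^ \<gamma> j) ^ 1"
      using that r \<rho>0 N by (intro power_decreasing) auto
    then show ?thesis using that r by (simp add: power_mult[symmetric] mult.commute)
  qed
  define \<phi> where "\<phi> x = (fst x, real N * snd x)" for x :: "('i \<Rightarrow> complex) \<times> real"
  have \<phi>S: "\<phi> x \<in> ?S'" if x: "x \<in> ?S" for x
  proof -
    have "is_Arg (mono_val J (fst x) \<gamma>) (snd x)" using x by (auto simp: sector_def)
    then have "mono_val J (fst x) \<gamma> = cmod (mono_val J (fst x) \<gamma>) * cis (snd x)" by (simp add: is_Arg_iff_cis)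
    then have "mono_val J (fst x) \<gamma> ^ N = (cmod (mono_val J (fst x) \<gamma>) * cis (snd x)) ^ N" by simp
    then have "is_Arg (mono_val J (fst x) ?\<gamma>) (N * snd x)"
      by (simp add: is_Arg_iff_cis mono_val_mult norm_mult norm_power power_mult_distrib Complex.DeMoivre)
    moreover have "N * (\<theta> - pi / (2 * k) - \<delta> / N) < N * snd x" "N * snd x < N * (\<theta> + pi / (2 * k) + \<delta> / N)"
      using x N by (auto simp: sector_def)
    moreover have "N * (\<theta> - pi / (2 * k) - \<delta> / N) = N * \<theta> - pi / (2 * (k / N)) - \<delta>"
      "N * (\<theta> + pi / (2 * k) + \<delta> / N) = N * \<theta> + pi / (2 * (k / N)) + \<delta>"
      using N by (simp_all add: field_simps)
    ultimately have "is_Arg (mono_val J (fst x) ?\<gamma>) (N * snd x)" "N * \<theta> - pi / (2 * (k / N)) - \<delta> < N * snd x"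
      "N * snd x < N * \<theta> + pi / (2 * (k / N)) + \<delta>" by (simp_all only:)
    moreover have "0 < cmod (fst x j) ^ (N * \<gamma> j)" if "j \<in> J" for j
    proof -
      have "0 < cmod (fst x j) ^ \<gamma> j" "0 < \<gamma> j" using x that J(3) by (auto simp: sector_def)
      then have "fst x j \<noteq> 0" by (intro notI) (simp add: power_0_left)
      then show ?thesis by simp
    qed
    ultimately show ?thesis using x pw by (auto simp: sector_def \<phi>_def)
  qed
  \<comment> \<open>A common base for the remainder of the given sum and for the additional
    components.\<close>
  define H where "H = max C (B ^ mdeg J \<gamma>)"
  have H: "1 \<le> H" "C \<le> H" "B ^ mdeg J \<gamma> \<le> H" using C by (auto simp: H_def)
  define s where "s = 1 / k"
  have s: "0 < s" using k by (simp add: s_def)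
  define C1 where "C1 = (C + N * T * D) * H ^ N * (2 powr s) ^ N * fact N powr s"
  define A1 where "A1 = H * 2 powr s"
  have C1: "0 < C + N * T * D" using C T DB by (intro add_pos_nonneg mult_nonneg_nonneg) auto
  show ?thesis
  proof (rule mono_summable_in_dirI[where \<delta> = "\<delta> / N" and \<rho> = r and C = C1 and A = A1 and f = "\<lambda>x. f (\<phi> x)" and g = g'])
    show "0 < k" "0 < \<delta> / N" "0 < r" "0 < C1" "0 < A1" using k N \<delta> r H C1 by (auto simp: A1_def C1_def)
    show "\<forall>l. g' l \<in> vecs (bdd_holomorphic J ?W F) \<and> has_taylor J F ?W (g' l) (mono_component J \<gamma> l b)" using g' by blast
    show "holomorphic_map J F fst ?S (\<lambda>x. f (\<phi> x))"
    proof (rule holomorphic_map_reparametrise[OF F conjunct1[OF data]])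
      show "continuous_on ?S \<phi>" unfolding \<phi>_def by (intro continuous_intros)
      show "\<forall>x\<in>?S. \<phi> x \<in> ?S'" using \<phi>S by blast
    qed (simp add: \<phi>_def)
    fix m z t assume x: "(z, t) \<in> ?S"
    have x': "(z, N * t) \<in> ?S'" using \<phi>S[OF x] by (simp add: \<phi>_def)
    have zW: "z \<in> ?W" "z \<in> weighted_polydisc J ?\<gamma> \<rho>" using x pw by (auto simp: weighted_polydisc_def sector_def)
    define \<mu> where "\<mu> = cmod (mono_val J z \<gamma>)"
    have \<mu>: "0 \<le> \<mu>" "\<mu> \<le> 1"
    proof -
      show "\<mu> \<le> 1" unfolding \<mu>_def norm_mono_val
        using zW(1) r \<rho>0 by (intro prod_le_1) (force simp: weighted_polydisc_def)
    qed (simp add: \<mu>_def)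
    have mono: "cmod (mono_val J z (\<lambda>i. l * \<gamma> i)) = \<mu> ^ l" for l by (simp add: mono_val_mult norm_power \<mu>_def)
    \<comment> \<open>Rounding up, so that m \<le> N M \<le> m + N.\<close>
    define M where "M = Suc (m div N)"
    have M: "m \<le> N * M" "N * M \<le> m + N" "M \<le> m + N"
    proof -
      have "m = N * (m div N) + m mod N" "m mod N < N" using N by auto
      then show "m \<le> N * M" "N * M \<le> m + N" unfolding M_def by (simp; linarith)+
      have "m div N \<le> m" by simp
      then show "M \<le> m + N" using N unfolding M_def by linarith
    qed
    have n: "nsum F (tuples J) (\<lambda>\<beta>. mono_val J z \<beta> *\<^sub>C mono_component J ?\<gamma> l b \<beta>) (g l z)" for l
      using data zW by blast
    have n': "nsum F (tuples J) (\<lambda>\<beta>. mono_val J z \<beta> *\<^sub>C mono_component J \<gamma> l b \<beta>) (g' l z)" for l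
      using g' zW by blast
    have g'F: "g' l z \<in> vecs F" for l using n' by (simp add: nsum_def)
    have gF: "g l z \<in> vecs F" for l using n by (simp add: nsum_def)
    have fF: "f (z, N * t) \<in> vecs F" using conjunct1[OF data] x' by (auto simp: holomorphic_map_def)
    have agree: "(\<Sum>l<M. mono_val J z (\<lambda>i. l * (N * \<gamma> i)) *\<^sub>C g l z) = (\<Sum>l<N * M. mono_val J z (\<lambda>i. l * \<gamma> i) *\<^sub>C g' l z)"
      by (rule component_sums_agree[OF J(2,1) \<gamma> L R bv[unfolded F_def] n'[unfolded F_def] n[unfolded F_def]])
    define P where "P = f (z, N * t) - (\<Sum>l<M. mono_val J z (\<lambda>i. l * (N * \<gamma> i)) *\<^sub>C g l z)"
    \<comment> \<open>The components between m and N M, at most N in number.\<close>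
    define Q where "Q = (\<Sum>l\<in>{m..<N * M}. mono_val J z (\<lambda>i. l * \<gamma> i) *\<^sub>C g' l z)"
    define \<Phi> where "\<Phi> = (fact (m + N) powr s :: real)"
    have \<Phi>0: "0 \<le> \<Phi>" by (simp add: \<Phi>_def)
    have PF: "P \<in> vecs F" unfolding P_def
      by (intro seminormed_diff(1)[OF F] fF conjunct1[OF seminormed_sum[OF F]] seminormed_scaleC[OF F] gF)
    have P: "nrm F P \<le> C * H ^ (m + N) * \<Phi> * \<mu> ^ m"
    proof -
      have "nrm F P \<le> C ^ Suc M * fact M powr (1 / (k / N)) * cmod (mono_val J z (\<lambda>i. M * (N * \<gamma> i)))"
        using conjunct2[OF conjunct2[OF data], rule_format, OF x', of M] by (simp add: P_def)
      also have "(\<lambda>i. M * (N * \<gamma> i)) = (\<lambda>i. (N * M) * \<gamma> i)" by (simp add: fun_eq_iff mult_ac)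
      also have "cmod (mono_val J z (\<lambda>i. (N * M) * \<gamma> i)) = \<mu> ^ (N * M)" by (rule mono)
      also have "C ^ Suc M * fact M powr (1 / (k / N)) * \<mu> ^ (N * M) \<le> (C * H ^ (m + N)) * \<Phi> * \<mu> ^ m"
      proof (intro mult_mono)
        have "C ^ M \<le> H ^ M" using C H by (intro power_mono) auto
        also have "\<dots> \<le> H ^ (m + N)" using H M by (intro power_increasing) auto
        finally show "C ^ Suc M \<le> C * H ^ (m + N)" using C by simp
        show "fact M powr (1 / (k / N)) \<le> \<Phi>" unfolding \<Phi>_def s_def by (rule factlev) (use M in \<open>simp add: mult.commute\<close>)
        show "\<mu> ^ (N * M) \<le> \<mu> ^ m" using \<mu> M by (intro power_decreasing) auto
      qed (use C H \<mu> \<Phi>0 in auto)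
      finally show ?thesis .
    qed
    have Q: "Q \<in> vecs F \<and> nrm F Q \<le> (\<Sum>l\<in>{m..<N * M}. nrm F (mono_val J z (\<lambda>i. l * \<gamma> i) *\<^sub>C g' l z))"
      unfolding Q_def by (intro seminormed_sum[OF F] seminormed_scaleC[OF F] g'F)
    have "(\<Sum>l\<in>{m..<N * M}. nrm F (mono_val J z (\<lambda>i. l * \<gamma> i) *\<^sub>C g' l z)) \<le> (\<Sum>l\<in>{m..<N * M}. T * D * H ^ (m + N) * \<Phi> * \<mu> ^ m)"
    proof (rule sum_mono)
      fix l assume l: "l \<in> {m..<N * M}"
      then have l': "m \<le> l" "l \<le> m + N" using M by auto
      have "nrm F (g' l z) \<le> T * Cl l" using g' zW by blast
      also have "\<dots> \<le> T * (D * H ^ (m + N) * \<Phi>)"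
      proof (intro mult_left_mono T)
        have "B ^ (l * mdeg J \<gamma>) = (B ^ mdeg J \<gamma>) ^ l" by (simp add: power_mult[symmetric] mult.commute)
        also have "\<dots> \<le> H ^ l" using DB H by (intro power_mono) auto
        also have "\<dots> \<le> H ^ (m + N)" using H l' by (intro power_increasing) auto
        finally have "B ^ (l * mdeg J \<gamma>) \<le> H ^ (m + N)" .
        moreover have "(fact l :: real) \<le> fact (m + N)" using l' by (intro fact_mono) auto
        then have "fact l powr s \<le> \<Phi>" unfolding \<Phi>_def using s by (intro powr_mono2) auto
        ultimately show "Cl l \<le> D * H ^ (m + N) * \<Phi>" unfolding Cl_def s_def[symmetric] using DB H \<Phi>0 by (intro mult_mono) auto
      qed
      finally have "\<mu> ^ l * nrm F (g' l z) \<le> \<mu> ^ m * (T * (D * H ^ (m + N) * \<Phi>))"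
        using \<mu> l' seminormed_nonneg[OF F g'F] by (intro mult_mono power_decreasing) auto
      then show "nrm F (mono_val J z (\<lambda>i. l * \<gamma> i) *\<^sub>C g' l z) \<le> T * D * H ^ (m + N) * \<Phi> * \<mu> ^ m"
        unfolding seminormed_nrm_scaleC[OF F g'F] mono by (simp only: mult_ac)
    qed
    also have "\<dots> = real (N * M - m) * (T * D * H ^ (m + N) * \<Phi> * \<mu> ^ m)" by simp
    also have "\<dots> \<le> real N * (T * D * H ^ (m + N) * \<Phi> * \<mu> ^ m)"
    proof (rule mult_right_mono)
      have "N * M - m \<le> N" using M(2) by simp
      then show "real (N * M - m) \<le> real N" by (simp only: of_nat_le_iff)
    qed (use T DB H \<Phi>0 \<mu> in auto)
    finally have Qb: "nrm F Q \<le> real N * (T * D * H ^ (m + N) * \<Phi> * \<mu> ^ m)" using Q by linarith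
    have split: "{..<N * M} = {..<m} \<union> {m..<N * M}" using M(1) by (simp add: ivl_disj_un)
    have "(\<Sum>l<N * M. mono_val J z (\<lambda>i. l * \<gamma> i) *\<^sub>C g' l z) = (\<Sum>l<m. mono_val J z (\<lambda>i. l * \<gamma> i) *\<^sub>C g' l z) + Q"
      unfolding Q_def split by (rule sum.union_disjoint) auto
    then have "f (\<phi> (z, t)) - (\<Sum>l<m. mono_val J z (\<lambda>i. l * \<gamma> i) *\<^sub>C g' l z) = P + Q"
      by (simp add: P_def agree \<phi>_def)
    then have "nrm F (f (\<phi> (z, t)) - (\<Sum>l<m. mono_val J z (\<lambda>i. l * \<gamma> i) *\<^sub>C g' l z)) \<le> nrm F P + nrm F Q"
      using seminormed_triangle[OF F PF conjunct1[OF Q]] by (simp only:)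
    also have "\<dots> \<le> C * H ^ (m + N) * \<Phi> * \<mu> ^ m + real N * (T * D * H ^ (m + N) * \<Phi> * \<mu> ^ m)" by (rule add_mono[OF P Qb])
    also have "\<dots> = (C + N * T * D) * H ^ (m + N) * \<mu> ^ m * \<Phi>" by (simp add: algebra_simps)
    also have "\<dots> \<le> (C + N * T * D) * H ^ (m + N) * \<mu> ^ m * ((2 powr s) ^ (m + N) * fact m powr s * fact N powr s)"
    proof (rule mult_left_mono)
      \<comment> \<open>Detaches the fixed factor fact N from fact (m + N) at a geometric
        cost.\<close>
      have "(m + N) choose m \<le> 2 ^ (m + N)" by (rule binomial_le_pow2)
      then have "fact m * fact N * ((m + N) choose m) \<le> fact m * fact N * (2 ^ (m + N) :: nat)" by (rule mult_le_mono2)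
      moreover have "fact m * fact N * ((m + N) choose m) = (fact (m + N) :: nat)"
        using binomial_fact_lemma[of m "m + N"] by simp
      ultimately have "(fact (m + N) :: nat) \<le> fact m * fact N * 2 ^ (m + N)" by simp
      then have "real (fact (m + N)) \<le> real (fact m * fact N * 2 ^ (m + N))" by (simp only: of_nat_le_iff)
      then have "\<Phi> \<le> (fact m * fact N * 2 ^ (m + N)) powr s" unfolding \<Phi>_def using s by (intro powr_mono2) auto
      also have "\<dots> = (2 powr s) ^ (m + N) * fact m powr s * fact N powr s"
      proof -
        have "(2 ^ (m + N)) powr s = (2 powr s) ^ (m + N)" by (simp add: powr_powr mult.commute flip: powr_realpow)
        then show ?thesis by (simp add: powr_mult)
      qed
      finally show "\<Phi> \<le> (2 powr s) ^ (m + N) * fact m powr s * fact N powr s" .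
    qed (use C1 H \<mu> in auto)
    also have "\<dots> = C1 * A1 ^ m * fact m powr (1 / k) * cmod (mono_val J z (\<lambda>i. m * \<gamma> i))"
      unfolding mono s_def[symmetric] C1_def A1_def by (simp only: power_add power_mult_distrib mult_ac)
    finally show "nrm F (f (\<phi> (z, t)) - (\<Sum>l<m. mono_val J z (\<lambda>i. l * \<gamma> i) *\<^sub>C g' l z))
          \<le> C1 * A1 ^ m * fact m powr (1 / k) * cmod (mono_val J z (\<lambda>i. m * \<gamma> i))" .
  qed
qed

text \<open>Exceptional points of the circle for N \<gamma> are among the N-th powers of those for
  \<gamma>, and those for \<gamma> are among the N-th roots of those for N \<gamma>; both operations
  preserve finiteness.\<close>

theorem mono_summable_multiple:
  fixes b :: "('i \<Rightarrow> nat) \<Rightarrow> ('i \<Rightarrow> complex) \<Rightarrow> 'e::complex_banach" and k :: real and N :: nat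
  assumes J: "finite J" "J \<noteq> {}" "\<forall>j\<in>J. 0 < \<gamma> j" and \<gamma>: "\<gamma> \<in> tuples J" and L: "finite L" and R: "0 < R"
    and k: "0 < k" and N: "0 < N"
  defines "F \<equiv> bdd_holomorphic L (polydisc L R) whole_space"
  assumes tay: "\<And>\<kappa>. \<kappa> \<in> tuples J \<Longrightarrow> has_taylor L whole_space (polydisc L R) (b \<kappa>) (d \<kappa>)"
  shows "b \<in> mono_summable J F (\<lambda>i. N * \<gamma> i) (k / N) \<longleftrightarrow> b \<in> mono_summable J F \<gamma> k"
proof
  have kN: "0 < k / N" using k N by simp
  have J': "\<forall>j\<in>J. 0 < N * \<gamma> j" using J N by simp
  {
    assume b: "b \<in> mono_summable J F \<gamma> k"
    have Oh: "b \<in> Ohat J F" and fin: "finite (cis ` {\<theta>. \<not> mono_summable_in_dir J F \<gamma> k b \<theta>})"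
      using b by (simp_all only: mono_summable_def mem_Collect_eq)
    have bv: "\<And>\<kappa>. \<kappa> \<in> tuples J \<Longrightarrow> b \<kappa> \<in> vecs F" by (rule mono_summable_vecs[OF b J(2)])
    have "\<exists>D\<ge>1. \<exists>B\<ge>1. \<forall>\<kappa>\<in>tuples J. nrm F (b \<kappa>) \<le> D * B ^ mdeg J \<kappa> * fact (level J \<gamma> \<kappa>) powr (1 / k)"
      unfolding F_def by (rule mono_summable_gevrey_bound[OF J \<gamma> k L R b[unfolded F_def] bv[unfolded F_def]])
    then obtain D B where DB: "1 \<le> D" "1 \<le> B" "\<forall>\<kappa>\<in>tuples J. nrm F (b \<kappa>) \<le> D * B ^ mdeg J \<kappa> * fact (level J \<gamma> \<kappa>) powr (1 / k)"
      by (elim exE conjE)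
    have imp: "mono_summable_in_dir J F (\<lambda>i. N * \<gamma> i) (k / N) b \<theta>"
      if "\<forall>i<N. mono_summable_in_dir J F \<gamma> k b ((\<theta> + 2 * pi * real i) / N)" for \<theta>
      unfolding F_def
      by (rule mono_summable_in_dir_multiple[OF J \<gamma> L R k N bv[unfolded F_def] tay DB[unfolded F_def] that[unfolded F_def]])
    have "cis ` {\<theta>. \<not> mono_summable_in_dir J F (\<lambda>i. N * \<gamma> i) (k / N) b \<theta>} \<subseteq> (\<lambda>u. u ^ N) ` cis ` {\<theta>. \<not> mono_summable_in_dir J F \<gamma> k b \<theta>}"
    proof (rule image_subsetI)
      fix \<theta> assume "\<theta> \<in> {\<theta>. \<not> mono_summable_in_dir J F (\<lambda>i. N * \<gamma> i) (k / N) b \<theta>}"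
      then obtain i where i: "\<not> mono_summable_in_dir J F \<gamma> k b ((\<theta> + 2 * pi * real i) / N)" using imp by blast
      have "cis ((\<theta> + 2 * pi * real i) / N) ^ N = cis (\<theta> + 2 * pi * real i)"
        using N by (simp add: Complex.DeMoivre)
      also have "\<dots> = cis \<theta>"
        using cis_multiple_2pi[of "real i"] by (simp add: cis_mult[symmetric])
      finally have "cis \<theta> = cis ((\<theta> + 2 * pi * real i) / N) ^ N" by simp
      then show "cis \<theta> \<in> (\<lambda>u. u ^ N) ` cis ` {\<theta>. \<not> mono_summable_in_dir J F \<gamma> k b \<theta>}" using i by blast
    qed
    then have "finite (cis ` {\<theta>. \<not> mono_summable_in_dir J F (\<lambda>i. N * \<gamma> i) (k / N) b \<theta>})"
      by (rule finite_subset) (rule finite_imageI[OF fin])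
    then show "b \<in> mono_summable J F (\<lambda>i. N * \<gamma> i) (k / N)" using Oh by (simp only: mono_summable_def mem_Collect_eq simp_thms)
  next
    assume b: "b \<in> mono_summable J F (\<lambda>i. N * \<gamma> i) (k / N)"
    have Oh: "b \<in> Ohat J F" and fin: "finite (cis ` {\<theta>. \<not> mono_summable_in_dir J F (\<lambda>i. N * \<gamma> i) (k / N) b \<theta>})"
      using b by (simp_all only: mono_summable_def mem_Collect_eq)
    have bv: "\<And>\<kappa>. \<kappa> \<in> tuples J \<Longrightarrow> b \<kappa> \<in> vecs F" by (rule mono_summable_vecs[OF b J(2)])
    have "\<exists>D\<ge>1. \<exists>B\<ge>1. \<forall>\<kappa>\<in>tuples J. nrm F (b \<kappa>) \<le> D * B ^ mdeg J \<kappa> * fact (level J (\<lambda>i. N * \<gamma> i) \<kappa>) powr (1 / (k / N))"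
      unfolding F_def by (rule mono_summable_gevrey_bound[OF J(1,2) J' tuples_mult[OF \<gamma>] kN L R b[unfolded F_def] bv[unfolded F_def]])
    then obtain D B where DB: "1 \<le> D" "1 \<le> B" "\<forall>\<kappa>\<in>tuples J. nrm F (b \<kappa>) \<le> D * B ^ mdeg J \<kappa> * fact (level J (\<lambda>i. N * \<gamma> i) \<kappa>) powr (1 / (k / N))"
      by (elim exE conjE)
    have imp: "mono_summable_in_dir J F \<gamma> k b \<theta>"
      if "mono_summable_in_dir J F (\<lambda>i. N * \<gamma> i) (k / N) b (real N * \<theta>)" for \<theta>
      unfolding F_def
      by (rule mono_summable_in_dir_divide[OF J \<gamma> L R k N bv[unfolded F_def] tay DB[unfolded F_def] that[unfolded F_def]])
    let ?B = "cis ` {\<theta>. \<not> mono_summable_in_dir J F (\<lambda>i. N * \<gamma> i) (k / N) b \<theta>}"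
    have "cis ` {\<theta>. \<not> mono_summable_in_dir J F \<gamma> k b \<theta>} \<subseteq> (\<Union>v\<in>?B. {u. u ^ N = v})"
    proof (rule image_subsetI)
      fix \<theta> assume "\<theta> \<in> {\<theta>. \<not> mono_summable_in_dir J F \<gamma> k b \<theta>}"
      then have "cis (N * \<theta>) \<in> ?B" using imp by blast
      then show "cis \<theta> \<in> (\<Union>v\<in>?B. {u. u ^ N = v})" by (rule UN_I) (simp add: Complex.DeMoivre)
    qed
    moreover have "finite (\<Union>v\<in>?B. {u. u ^ N = v})" by (rule finite_UN_I[OF fin]) (rule finite_nth_roots[OF N])
    ultimately have "finite (cis ` {\<theta>. \<not> mono_summable_in_dir J F \<gamma> k b \<theta>})" by (rule finite_subset)
    then show "b \<in> mono_summable J F \<gamma> k" using Oh by (simp only: mono_summable_def mem_Collect_eq simp_thms)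
  }
qed

text \<open>At one index j0 the two exponents are divided by their gcd. The quotients q and q' are
  coprime with k q = k' q', and by cross multiplication q divides \<alpha> at every index. Both
  spaces equal the one for the exponent \<delta> = \<alpha> / q and the level k q.\<close>

theorem partial_mono_summable_proportional:
  fixes k k' :: real
  assumes V: "finite V" and J: "J \<subseteq> V" "J \<noteq> {}" and \<alpha>: "\<alpha> \<in> tuples J" "\<forall>j\<in>J. 0 < \<alpha> j" and k: "0 < k"
    and \<alpha>': "\<alpha>' \<in> tuples J" "\<forall>j\<in>J. 0 < \<alpha>' j" and k': "0 < k'" and R: "0 < R"
    and eq: "\<forall>j\<in>J. k * real (\<alpha> j) = k' * real (\<alpha>' j)"
  shows "(partial_mono_summable V J R \<alpha> k :: (('i \<Rightarrow> nat) \<Rightarrow> 'e::complex_banach) set) = partial_mono_summable V J R \<alpha>' k'"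
proof -
  have f: "finite J" "finite (V - J)" using V J finite_subset by auto
  obtain j0 where j0: "j0 \<in> J" using J by blast
  define G where "G = gcd (\<alpha> j0) (\<alpha>' j0)"
  define q where "q = \<alpha> j0 div G"
  define q' where "q' = \<alpha>' j0 div G"
  have g0: "0 < G" using \<alpha> j0 by (simp add: G_def)
  have cop: "coprime q q'" unfolding q_def q'_def G_def using \<alpha> j0 by (intro div_gcd_coprime) auto
  have qe: "\<alpha> j0 = q * G" "\<alpha>' j0 = q' * G" by (simp_all add: q_def q'_def G_def)
  have q: "0 < q" "0 < q'" using qe \<alpha> \<alpha>' j0 by (metis mult_is_0 neq0_conv)+
  have kq: "k * q = k' * q'"
  proof -
    have "k * (real q * real G) = k' * (real q' * real G)"
      using eq j0 qe by (metis of_nat_mult)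
    then show ?thesis using g0 by simp
  qed
  \<comment> \<open>The proportionality freed of the real numbers k and k', so that divisibility can
    be used.\<close>
  have cross: "\<alpha> j * q' = \<alpha>' j * q" if "j \<in> J" for j
  proof -
    have "k' * (k * real (\<alpha> j)) * real q' = k' * (k' * real (\<alpha>' j)) * real q'" using eq that by simp
    also have "\<dots> = k' * real (\<alpha>' j) * (k' * real q')" by simp
    also have "\<dots> = k' * real (\<alpha>' j) * (k * real q)" by (simp only: kq)
    finally have "real (\<alpha> j) * real q' = real (\<alpha>' j) * real q" using k k' by simp
    then show ?thesis by (metis of_nat_eq_iff of_nat_mult)
  qed
  \<comment> \<open>The common tuple; the division is exact because q is coprime to q'.\<close>
  define \<delta> where "\<delta> j = \<alpha> j div q" for j
  have \<delta>e: "\<alpha> j = q * \<delta> j" "\<alpha>' j = q' * \<delta> j" for j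
  proof -
    have "\<alpha> j = q * \<delta> j \<and> \<alpha>' j = q' * \<delta> j"
    proof (cases "j \<in> J")
      case True
      have "q dvd \<alpha> j * q'" using cross[OF True] by simp
      then have "q dvd \<alpha> j" using cop by (simp add: coprime_dvd_mult_left_iff)
      then have 1: "\<alpha> j = q * \<delta> j" by (simp add: \<delta>_def)
      have "\<alpha>' j * q = (q * \<delta> j) * q'" unfolding 1[symmetric] by (rule cross[OF True, symmetric])
      then have "\<alpha>' j * q = (q' * \<delta> j) * q" by (simp only: mult_ac)
      then have "\<alpha>' j = q' * \<delta> j" using q(1) by (metis mult_cancel2 neq0_conv)
      then show ?thesis using 1 by blast
    next
      case False
      then show ?thesis using \<alpha> \<alpha>' by (simp add: tuples_def \<delta>_def)
    qed
    then show "\<alpha> j = q * \<delta> j" "\<alpha>' j = q' * \<delta> j" by auto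
  qed
  have \<delta>: "\<delta> \<in> tuples J" "\<forall>j\<in>J. 0 < \<delta> j"
  proof -
    show "\<delta> \<in> tuples J" using \<alpha> by (simp add: tuples_def \<delta>_def)
    show "\<forall>j\<in>J. 0 < \<delta> j" using \<alpha>(2) \<delta>e(1) by (metis mult_is_0 neq0_conv)
  qed
  \<comment> \<open>The level that belongs to \<delta>; it also equals k' q'.\<close>
  define \<kappa> where "\<kappa> = k * q"
  have \<kappa>: "0 < \<kappa>" "k = \<kappa> / q" "k' = \<kappa> / q'" 
  proof -
    show "0 < \<kappa>" "k = \<kappa> / q" using k q by (simp_all add: \<kappa>_def)
    show "k' = \<kappa> / q'" unfolding \<kappa>_def kq using q by simp
  qed
  have ae: "\<alpha> = (\<lambda>i. q * \<delta> i)" "\<alpha>' = (\<lambda>i. q' * \<delta> i)" using \<delta>e by auto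
  let ?F = "bdd_holomorphic (V - J) (polydisc (V - J) R) whole_space :: (('i \<Rightarrow> complex) \<Rightarrow> 'e) nspace"
  have iff: "b \<in> mono_summable J ?F \<alpha> k \<longleftrightarrow> b \<in> mono_summable J ?F \<alpha>' k'"
    if "taylor_expansion V J R whole_space b a" for a b
  proof -
    have t: "has_taylor (V - J) whole_space (polydisc (V - J) R) (b \<kappa>) (\<lambda>\<beta>. a (\<lambda>i. \<kappa> i + \<beta> i))" if "\<kappa> \<in> tuples J" for \<kappa>
      using \<open>taylor_expansion V J R whole_space b a\<close> that by (simp add: taylor_expansion_def)
    have "b \<in> mono_summable J ?F (\<lambda>i. N * \<delta> i) (\<kappa> / N) \<longleftrightarrow> b \<in> mono_summable J ?F \<delta> \<kappa>" if "0 < N" for N :: nat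
      by (rule mono_summable_multiple[OF f(1) J(2) \<delta>(2,1) f(2) R \<kappa>(1) that]) (rule t)
    from this[OF q(1)] this[OF q(2)] show ?thesis unfolding ae \<kappa>(2,3) by simp
  qed
  show ?thesis unfolding partial_mono_summable_def using iff by blast
qed

theorem theorem5p8:
  fixes d :: nat and I J :: "nat set" and \<alpha> \<alpha>' :: "nat \<Rightarrow> nat" and k k' :: real
  assumes "1 \<le> d"
    and "J \<subseteq> {1..d}" "J \<noteq> {}" "I \<subseteq> {1..d}" "I \<noteq> {}"
    and "\<alpha> \<in> tuples J" "\<forall>j\<in>J. 0 < \<alpha> j"
    and "\<alpha>' \<in> tuples I" "\<forall>i\<in>I. 0 < \<alpha>' i"
    and "0 < k" "0 < k'"
  shows
    "if J = I \<and> (\<forall>j\<in>J. k * real (\<alpha> j) = k' * real (\<alpha>' j))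
     then \<forall>R>0. (partial_mono_summable {1..d} J R \<alpha> k :: ((nat \<Rightarrow> nat) \<Rightarrow> 'e::complex_banach) set)
                = partial_mono_summable {1..d} I R \<alpha>' k'
     else (\<Union>R\<in>{0<..}. partial_mono_summable {1..d} J R \<alpha> k \<inter> partial_mono_summable {1..d} I R \<alpha>' k')
          = (convergent_series {1..d} :: ((nat \<Rightarrow> nat) \<Rightarrow> 'e) set)"
proof (cases "J = I \<and> (\<forall>j\<in>J. k * real (\<alpha> j) = k' * real (\<alpha>' j))")
  case True
  have "\<alpha>' \<in> tuples J" "\<forall>j\<in>J. 0 < \<alpha>' j" using True assms(8,9) by auto
  from partial_mono_summable_proportional[OF finite_atLeastAtMost assms(2,3,6,7,10) this assms(11)] True
  show ?thesis by auto
next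
  case False
  have "(\<Union>R\<in>{0<..}. partial_mono_summable {1..d} J R \<alpha> k \<inter> partial_mono_summable {1..d} I R \<alpha>' k')
          = (convergent_series {1..d} :: ((nat \<Rightarrow> nat) \<Rightarrow> 'e) set)"
  proof (intro equalityI subsetI)
    fix a :: "(nat \<Rightarrow> nat) \<Rightarrow> 'e"
    assume "a \<in> (\<Union>R\<in>{0<..}. partial_mono_summable {1..d} J R \<alpha> k \<inter> partial_mono_summable {1..d} I R \<alpha>' k')"
    then obtain R where R: "0 < R" "a \<in> partial_mono_summable {1..d} J R \<alpha> k" "a \<in> partial_mono_summable {1..d} I R \<alpha>' k'"
      by auto
    show "a \<in> convergent_series {1..d}"
      by (rule partial_mono_summable_inter[OF finite_atLeastAtMost assms(2,3,6,7,10,4,5,8,9,11) R(1,1,2,3) False])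
  next
    fix a :: "(nat \<Rightarrow> nat) \<Rightarrow> 'e"
    assume a: "a \<in> convergent_series {1..d}"
    then have f: "a \<in> formal_series {1..d} whole_space" by (simp add: convergent_series_def)
    obtain \<rho> where \<rho>: "0 < \<rho>" "(\<lambda>\<beta>. norm (a \<beta>) * \<rho> ^ mdeg {1..d} \<beta>) summable_on tuples {1..d}"
      by (rule convergent_series_abs_summable[OF finite_atLeastAtMost a])
    \<comment> \<open>Below \<rho> and at most 1, so that the same radius serves both index
      sets.\<close>
    define R where "R = min 1 (\<rho> / 2)"
    have R: "0 < R" "R < \<rho>" "R \<le> 1" using \<rho> by (auto simp: R_def)
    have "a \<in> partial_mono_summable {1..d} J R \<alpha> k"
      by (rule convergent_partial_mono_summable[OF finite_atLeastAtMost f \<rho>(2) R assms(2,3,6,7,10)])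
    moreover have "a \<in> partial_mono_summable {1..d} I R \<alpha>' k'"
      by (rule convergent_partial_mono_summable[OF finite_atLeastAtMost f \<rho>(2) R assms(4,5,8,9,11)])
    ultimately show "a \<in> (\<Union>R\<in>{0<..}. partial_mono_summable {1..d} J R \<alpha> k \<inter> partial_mono_summable {1..d} I R \<alpha>' k')"
      using R(1) by blast
  qed
  then show ?thesis by (simp only: if_not_P[OF False])
qed

end
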